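(* Let $V=V_1\oplus\cdots\oplus V_d$ be the vector representation of dimension $dN$ of $U_q(\mathfrak{gl}_N^{\oplus d})$. There is a surjective morphism of algebras $$\Psi\colon\mathrm{BT}^{\mathrm{H}}_n\to\operatorname{End}_{U_q(\mathfrak{gl}_N^{\oplus d})\rtimes\mathfrak{S}_d}(V^{\otimes n}),$$ given by $\tilde s_i\mapsto\sigma_i$, $\tilde E_i\mapsto\varepsilon_i$ ($1\le i\le n-1$). It is an isomorphism if and only if $n\leq d$ and $n\leq N$.
   Context: $q$ is an indeterminate, $\Bbbk=\mathbb{C}(q)$, $d\ge1$, $n\ge1$, $N>1$. $U_q(\mathfrak{gl}_N^{\oplus d})\cong U_q(\mathfrak{gl}_N)^{\boxtimes d}$ (componentwise structure). $V_b$ is a copy of the $N$-dimensional vector representation on which the $b$-th factor acts, the other factors acting through their counits. $\mathfrak{S}_d$ acts on $U_q(\mathfrak{gl}_N)^{\boxtimes d}$ by permuting tensor factors, $\sigma\cdot(x_1\otimes\cdots\otimes x_d)=x_{\sigma^{-1}(1)}\otimes\cdots\otimes x_{\sigma^{-1}(d)}$, and $U_q(\mathfrak{gl}_N^{\oplus d})\rtimes\mathfrak{S}_d$ is the smash product. $\mathfrak{S}_d$ acts on $V$ by permuting the $d$ summands ($V_b\to V_{\sigma(b)}$ by the identity) and diagonally on $V^{\otimes n}$. $\check R$ is the action of the $R$-matrix (composed with the flip) on the tensor square of the vector representation of $U_q(\mathfrak{gl}_N)$, normalized so that $\check R^2=(q-q^{-1})\check R+1$, with eigenvalue $q$ on the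 $q$-symmetric square and $-q^{-1}$ on the $q$-antisymmetric square. On $V^{\otimes n}$, $\sigma_i$ acts on factors $i,i+1$ by $v\otimes w\mapsto w\otimes v$ if $v\in V_b,w\in V_c$, $b\ne c$, and by $\check R$ on $V_b\otimes V_b$; $\varepsilon_i$ acts on factors $i,i+1$ as the identity on $V_b\otimes V_b$ and as $0$ on $V_b\otimes V_c$, $b\neq c$. The tied braid algebra $\mathrm{TB}_n$ is the $\Bbbk$-algebra with invertible generators $\tilde s_1,\dots,\tilde s_{n-1}$ satisfying the braid relations ($\tilde s_i\tilde s_j=\tilde s_j\tilde s_i$ if $|i-j|>1$, $\tilde s_i\tilde s_j\tilde s_i=\tilde s_j\tilde s_i\tilde s_j$ if $|i-j|=1$), and generators $\tilde E_1,\dots,\tilde E_{n-1}$ with relations: $\tilde E_i\tilde E_j=\tilde E_j\tilde E_i$; $\tilde E_i^2=\tilde E_i$; $\tilde s_i\tilde E_i=\tilde E_i\tilde s_i$; $\tilde s_i\tilde E_j=\tilde E_j\tilde s_i$ for $|i-j|>1$; and, for $|i-j|=1$: $\tilde E_i\tilde s_j\tilde s_i=\tilde s_j\tilde s_i\tilde E_j$, $\tilde E_i\tilde s_j\tilde s_i^{-1}=\tilde s_j\tilde s_i^{-1}\tilde E_j$, $\tilde E_i\tilde E_j\tilde s_i=\tilde E_j\tilde s_i\tilde E_j=\tilde s_i\tilde E_j\tilde E_i$. The Hecke algebra of braids and ties $\mathrm{BT}^{\mathrm H}_n$ is the quotient of $\mathrm{TB}_n$ by $\tilde s_i^2=(q-q^{-1})\tilde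 s_i\tilde E_i+1$ for all $i$. *)

theory Defs
  imports
    "HOL-Computational_Algebra.Polynomial"
    "HOL-Computational_Algebra.Fraction_Field"
    "HOL-Algebra.QuotRing"
    "HOL-Algebra.Module"
    "HOL-Algebra.Sym_Groups"
begin

section \<open>Associative unital algebras over a field\<close>

text \<open>
  The records of \<^theory>\<open>HOL-Algebra.Module\<close> carry a ring together with a scalar
  multiplication, and serve here as (not necessarily commutative) algebras over the field given
  by a type \<^typ>\<open>'k::field\<close>.
\<close>

definition alg_hom ::
  "('k, 'a) module \<Rightarrow> ('k, 'b) module \<Rightarrow> ('a \<Rightarrow> 'b) set" where
  "alg_hom A B =
     {h \<in> ring_hom A B. \<forall>c. \<forall>x\<in>carrier A. h (c \<odot>\<^bsub>A\<^esub> x) = c \<odot>\<^bsub>B\<^esub> h x}"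

definition alg_iso ::
  "('k, 'a) module \<Rightarrow> ('k, 'b) module \<Rightarrow> ('a \<Rightarrow> 'b) set" where
  "alg_iso A B = {h \<in> alg_hom A B. bij_betw h (carrier A) (carrier B)}"


subsection \<open>Coordinate vectors and endomorphism algebras\<close>

definition vec :: "'i set \<Rightarrow> ('i \<Rightarrow> 'k::field) set" where
  "vec I = {x. \<forall>i. i \<notin> I \<longrightarrow> x i = 0}"

definition bv :: "'i \<Rightarrow> 'i \<Rightarrow> 'k::field" where
  "bv i = (\<lambda>j. if j = i then 1 else 0)"

text \<open>
  The linear operator sending \<^term>\<open>bv i\<close> to \<^term>\<open>\<phi> i\<close> for \<^term>\<open>i \<in> I\<close>. Operators are
  extensional, so that equality of operators is equality on \<^term>\<open>vec I\<close>.
\<close>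

definition lin_op :: "'i set \<Rightarrow> ('i \<Rightarrow> 'i \<Rightarrow> 'k::field) \<Rightarrow> ('i \<Rightarrow> 'k) \<Rightarrow> ('i \<Rightarrow> 'k)" where
  "lin_op I \<phi> = (\<lambda>x\<in>vec I. \<lambda>j. \<Sum>i\<in>I. x i * \<phi> i j)"

definition endo :: "'i set \<Rightarrow> ('k::field, ('i \<Rightarrow> 'k) \<Rightarrow> ('i \<Rightarrow> 'k)) module" where
  "endo I =
     \<lparr> carrier = {f \<in> vec I \<rightarrow>\<^sub>E vec I.
         (\<forall>x\<in>vec I. \<forall>y\<in>vec I. f (\<lambda>i. x i + y i) = (\<lambda>i. f x i + f y i)) \<and>
         (\<forall>c. \<forall>x\<in>vec I. f (\<lambda>i. c * x i) = (\<lambda>i. c * f x i))},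
       mult = (\<lambda>f g. compose (vec I) f g),
       one = (\<lambda>x\<in>vec I. x),
       zero = (\<lambda>x\<in>vec I. \<lambda>i. 0),
       add = (\<lambda>f g. \<lambda>x\<in>vec I. \<lambda>i. f x i + g x i),
       smult = (\<lambda>c f. \<lambda>x\<in>vec I. \<lambda>i. c * f x i) \<rparr>"

text \<open>
  For an algebra \<open>A\<close> acting on \<^term>\<open>vec I\<close> through \<open>\<rho>\<close>, the algebra of
  \<open>A\<close>-module endomorphisms.
\<close>

definition endo_over ::
  "'i set \<Rightarrow> ('k::field, 'a) module \<Rightarrow> ('a \<Rightarrow> ('i \<Rightarrow> 'k) \<Rightarrow> ('i \<Rightarrow> 'k))
     \<Rightarrow> ('k, ('i \<Rightarrow> 'k) \<Rightarrow> ('i \<Rightarrow> 'k)) module" where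
  "endo_over I A \<rho> = (endo I)
     \<lparr> carrier := {f \<in> carrier (endo I). \<forall>a\<in>carrier A. \<forall>x\<in>vec I. f (\<rho> a x) = \<rho> a (f x)} \<rparr>"


subsection \<open>Algebras given by generators and relations\<close>

text \<open>
  Elements of the free algebra on \<open>X\<close> are finitely supported functions on the words over
  \<open>X\<close>; the word \<open>w\<close> is \<^term>\<open>bv w\<close>.
\<close>

definition free_alg :: "'g set \<Rightarrow> ('k::field, 'g list \<Rightarrow> 'k) module" where
  "free_alg X =
     \<lparr> carrier = {x. finite {w. x w \<noteq> 0} \<and> {w. x w \<noteq> 0} \<subseteq> lists X},
       mult = (\<lambda>x y w. \<Sum>k\<le>length w. x (take k w) * y (drop k w)),
       one = bv [],
       zero = (\<lambda>w. 0),
       add = (\<lambda>x y w. x w + y w),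
       smult = (\<lambda>c x w. c * x w) \<rparr>"

definition alg_quot :: "('k, 'a) module \<Rightarrow> 'a set \<Rightarrow> ('k, 'a set) module" where
  "alg_quot A I =
     ring.extend (A Quot I) (module.fields (\<lambda>c X. \<Union>x\<in>X. I +>\<^bsub>A\<^esub> (c \<odot>\<^bsub>A\<^esub> x)))"

text \<open>
  A relation is an equation between two linear combinations of words, each written as a list of
  coefficients and words.
\<close>

type_synonym ('k, 'g) lincomb = "('k \<times> 'g list) list"

definition lc :: "('k::field, 'g) lincomb \<Rightarrow> 'g list \<Rightarrow> 'k" where
  "lc ps = (\<lambda>w. \<Sum>(c, u)\<leftarrow>ps. c * bv u w)"

definition weq ::
  "'g list \<Rightarrow> 'g list \<Rightarrow> ('k::field, 'g) lincomb \<times> ('k, 'g) lincomb" where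
  "weq u v = ([(1, u)], [(1, v)])"

definition rel_ideal ::
  "'g set \<Rightarrow> (('k::field, 'g) lincomb \<times> ('k, 'g) lincomb) set \<Rightarrow> ('g list \<Rightarrow> 'k) set" where
  "rel_ideal X R = Idl\<^bsub>free_alg X\<^esub> {\<lambda>w. lc l w - lc r w | l r. (l, r) \<in> R}"

definition pres_alg ::
  "'g set \<Rightarrow> (('k::field, 'g) lincomb \<times> ('k, 'g) lincomb) set
     \<Rightarrow> ('k, ('g list \<Rightarrow> 'k) set) module" where
  "pres_alg X R = alg_quot (free_alg X) (rel_ideal X R)"

definition pres_gen ::
  "'g set \<Rightarrow> (('k::field, 'g) lincomb \<times> ('k, 'g) lincomb) set
     \<Rightarrow> 'g \<Rightarrow> ('g list \<Rightarrow> 'k) set" where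
  "pres_gen X R g = rel_ideal X R +>\<^bsub>free_alg X\<^esub> bv [g]"

text \<open>
  The morphism out of a presented algebra determined by images \<open>\<rho> g\<close> in \<open>B\<close>
  of the generators; \<^const>\<open>the_elem\<close> picks out the common value on the members of a
  residue class, as in the first isomorphism theorem of \<^theory>\<open>HOL-Algebra.QuotRing\<close>.
\<close>

definition word_ev :: "('k::field, 'b) module \<Rightarrow> ('g \<Rightarrow> 'b) \<Rightarrow> 'g list \<Rightarrow> 'b" where
  "word_ev B \<rho> w = foldr (\<lambda>g b. \<rho> g \<otimes>\<^bsub>B\<^esub> b) w \<one>\<^bsub>B\<^esub>"

definition free_ev :: "('k::field, 'b) module \<Rightarrow> ('g \<Rightarrow> 'b) \<Rightarrow> ('g list \<Rightarrow> 'k) \<Rightarrow> 'b" where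
  "free_ev B \<rho> x = (\<Oplus>\<^bsub>B\<^esub>w\<in>{w. x w \<noteq> 0}. x w \<odot>\<^bsub>B\<^esub> word_ev B \<rho> w)"

definition pres_ev ::
  "('k::field, 'b) module \<Rightarrow> ('g \<Rightarrow> 'b) \<Rightarrow> ('g list \<Rightarrow> 'k) set \<Rightarrow> 'b" where
  "pres_ev B \<rho> X = the_elem (free_ev B \<rho> ` X)"


subsection \<open>Smash products\<close>

text \<open>
  For a finite group \<open>G\<close> acting on \<open>A\<close> by algebra automorphisms
  \<open>act \<tau>\<close>, the element \<open>\<Sum>\<tau>. a\<^sub>\<tau> \<tau>\<close> of the smash product is the function
  \<open>\<tau> \<mapsto> a\<^sub>\<tau>\<close>, and \<open>(a \<rho>) (b \<tau>) = a (act \<rho> b) (\<rho> \<tau>)\<close>.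
\<close>

definition smash ::
  "('k, 'a) module \<Rightarrow> 'g monoid \<Rightarrow> ('g \<Rightarrow> 'a \<Rightarrow> 'a) \<Rightarrow> ('k, 'g \<Rightarrow> 'a) module" where
  "smash A G act =
     \<lparr> carrier = carrier G \<rightarrow>\<^sub>E carrier A,
       mult = (\<lambda>f g. \<lambda>\<tau>\<in>carrier G.
         \<Oplus>\<^bsub>A\<^esub>\<rho>\<in>carrier G. f \<rho> \<otimes>\<^bsub>A\<^esub> act \<rho> (g (inv\<^bsub>G\<^esub> \<rho> \<otimes>\<^bsub>G\<^esub> \<tau>))),
       one = (\<lambda>\<tau>\<in>carrier G. if \<tau> = \<one>\<^bsub>G\<^esub> then \<one>\<^bsub>A\<^esub> else \<zero>\<^bsub>A\<^esub>),
       zero = (\<lambda>\<tau>\<in>carrier G. \<zero>\<^bsub>A\<^esub>),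
       add = (\<lambda>f g. \<lambda>\<tau>\<in>carrier G. f \<tau> \<oplus>\<^bsub>A\<^esub> g \<tau>),
       smult = (\<lambda>c f. \<lambda>\<tau>\<in>carrier G. c \<odot>\<^bsub>A\<^esub> f \<tau>) \<rparr>"


section \<open>The quantum group\<close>

type_synonym Cq = "complex poly fract"

definition q :: Cq where
  "q = Fract [:0, 1:] 1"

text \<open>
  Generators of \<open>U\<^sub>q(gl\<^sub>N\<^sup>\<oplus>\<^sup>d)\<close>: the first argument is the index
  \<open>b \<in> {1..d}\<close> of the summand, \<open>UK b j\<close> stands for \<open>q\<close> to the power
  \<open>\<epsilon>\<^sub>j\<close>, and \<open>UL b j\<close> is its inverse.
\<close>

datatype ugen = UE nat nat | UF nat nat | UK nat nat | UL nat nat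

primrec summand :: "ugen \<Rightarrow> nat" where
  "summand (UE b i) = b"
| "summand (UF b i) = b"
| "summand (UK b j) = b"
| "summand (UL b j) = b"

definition ugens :: "nat \<Rightarrow> nat \<Rightarrow> ugen set" where
  "ugens d N =
     {UE b i | b i. b \<in> {1..d} \<and> i \<in> {1..<N}} \<union> {UF b i | b i. b \<in> {1..d} \<and> i \<in> {1..<N}} \<union>
     {UK b j | b j. b \<in> {1..d} \<and> j \<in> {1..N}} \<union> {UL b j | b j. b \<in> {1..d} \<and> j \<in> {1..N}}"

text \<open>The pairing of \<open>\<epsilon>\<^sub>j\<close> with the simple root \<open>\<epsilon>\<^sub>i - \<epsilon>\<^sub>i\<^sub>+\<^sub>1\<close>.\<close>

definition wt :: "nat \<Rightarrow> nat \<Rightarrow> int" where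
  "wt j i = of_bool (j = i) - of_bool (j = i + 1)"

definition gl_rels :: "nat \<Rightarrow> nat \<Rightarrow> ((Cq, ugen) lincomb \<times> (Cq, ugen) lincomb) set" where
  "gl_rels N b =
     {weq [UK b j, UL b j] [] | j. j \<in> {1..N}} \<union>
     {weq [UL b j, UK b j] [] | j. j \<in> {1..N}} \<union>
     {weq [UK b j, UK b k] [UK b k, UK b j] | j k. j \<in> {1..N} \<and> k \<in> {1..N}} \<union>
     {([(1, [UK b j, UE b i])], [(q powi wt j i, [UE b i, UK b j])])
        | j i. j \<in> {1..N} \<and> i \<in> {1..<N}} \<union>
     {([(1, [UK b j, UF b i])], [(q powi (- wt j i), [UF b i, UK b j])])
        | j i. j \<in> {1..N} \<and> i \<in> {1..<N}} \<union>
     {([(1, [UE b i, UF b i]), (-1, [UF b i, UE b i])],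
       [(1 / (q - inverse q), [UK b i, UL b (i + 1)]),
        (- 1 / (q - inverse q), [UL b i, UK b (i + 1)])])
        | i. i \<in> {1..<N}} \<union>
     {weq [UE b i, UF b k] [UF b k, UE b i] | i k. i \<in> {1..<N} \<and> k \<in> {1..<N} \<and> i \<noteq> k} \<union>
     {weq [X b i, X b k] [X b k, X b i] | X i k.
        X \<in> {UE, UF} \<and> i \<in> {1..<N} \<and> k \<in> {1..<N} \<and> \<bar>int i - int k\<bar> > 1} \<union>
     {([(1, [X b i, X b i, X b k]), (1, [X b k, X b i, X b i])],
       [(q + inverse q, [X b i, X b k, X b i])]) | X i k.
        X \<in> {UE, UF} \<and> i \<in> {1..<N} \<and> k \<in> {1..<N} \<and> \<bar>int i - int k\<bar> = 1}"

definition u_rels :: "nat \<Rightarrow> nat \<Rightarrow> ((Cq, ugen) lincomb \<times> (Cq, ugen) lincomb) set" where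
  "u_rels d N =
     (\<Union>b\<in>{1..d}. gl_rels N b) \<union>
     {weq [g, h] [h, g] | g h. g \<in> ugens d N \<and> h \<in> ugens d N \<and> summand g \<noteq> summand h}"

definition Uq :: "nat \<Rightarrow> nat \<Rightarrow> (Cq, (ugen list \<Rightarrow> Cq) set) module" where
  "Uq d N = pres_alg (ugens d N) (u_rels d N)"

text \<open>
  The Hopf structure used: writing \<open>K = UK b i UL b (i + 1)\<close>, the coproduct sends
  \<open>E \<mapsto> E \<otimes> K + 1 \<otimes> E\<close> and
  \<open>F \<mapsto> F \<otimes> 1 + K\<^sup>-\<^sup>1 \<otimes> F\<close>, and \<open>UK\<close>, \<open>UL\<close> are
  group-like. The coproduct of a generator is the sum of the pure tensors of words listed below.
\<close>

primrec comult :: "ugen \<Rightarrow> (ugen list \<times> ugen list) list" where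
  "comult (UE b i) = [([UE b i], [UK b i, UL b (i + 1)]), ([], [UE b i])]"
| "comult (UF b i) = [([UF b i], []), ([UL b i, UK b (i + 1)], [UF b i])]"
| "comult (UK b j) = [([UK b j], [UK b j])]"
| "comult (UL b j) = [([UL b j], [UL b j])]"

primrec counit :: "ugen \<Rightarrow> Cq" where
  "counit (UE b i) = 0"
| "counit (UF b i) = 0"
| "counit (UK b j) = 1"
| "counit (UL b j) = 1"

text \<open>The action of \<open>\<SS>\<^sub>d\<close> by permutation of the summands.\<close>

primrec gen_perm :: "(nat \<Rightarrow> nat) \<Rightarrow> ugen \<Rightarrow> ugen" where
  "gen_perm \<tau> (UE b i) = UE (\<tau> b) i"
| "gen_perm \<tau> (UF b i) = UF (\<tau> b) i"
| "gen_perm \<tau> (UK b j) = UK (\<tau> b) j"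
| "gen_perm \<tau> (UL b j) = UL (\<tau> b) j"

definition Uq_perm ::
  "nat \<Rightarrow> nat \<Rightarrow> (nat \<Rightarrow> nat) \<Rightarrow> (ugen list \<Rightarrow> Cq) set \<Rightarrow> (ugen list \<Rightarrow> Cq) set" where
  "Uq_perm d N \<tau> =
     pres_ev (Uq d N) (\<lambda>g. pres_gen (ugens d N) (u_rels d N) (gen_perm \<tau> g))"

definition UqS :: "nat \<Rightarrow> nat \<Rightarrow> (Cq, (nat \<Rightarrow> nat) \<Rightarrow> (ugen list \<Rightarrow> Cq) set) module" where
  "UqS d N = smash (Uq d N) (sym_group d) (Uq_perm d N)"


section \<open>The tensor powers of the vector representation\<close>

text \<open>
  The basis vector \<open>(b, i)\<close> of \<open>V\<close> is the \<open>i\<close>-th standard basis vector of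
  \<open>V\<^sub>b\<close>, and the \<open>n\<close>-th tensor power of \<open>V\<close> is
  \<open>vec (tidx d N n)\<close>, with \<open>bv w\<close> the pure tensor of the basis vectors listed in
  \<open>w\<close>.
\<close>

type_synonym tens = "(nat \<times> nat) list \<Rightarrow> Cq"

definition vidx :: "nat \<Rightarrow> nat \<Rightarrow> (nat \<times> nat) set" where
  "vidx d N = {1..d} \<times> {1..N}"

definition tidx :: "nat \<Rightarrow> nat \<Rightarrow> nat \<Rightarrow> (nat \<times> nat) list set" where
  "tidx d N n = {w. length w = n \<and> set w \<subseteq> vidx d N}"

primrec vec_rep_basis :: "ugen \<Rightarrow> nat \<times> nat \<Rightarrow> nat \<times> nat \<Rightarrow> Cq" where
  "vec_rep_basis (UE b i) v = (if v = (b, i + 1) then bv (b, i) else (\<lambda>_. 0))"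
| "vec_rep_basis (UF b i) v = (if v = (b, i) then bv (b, i + 1) else (\<lambda>_. 0))"
| "vec_rep_basis (UK b j) v = (\<lambda>u. (if v = (b, j) then q else 1) * bv v u)"
| "vec_rep_basis (UL b j) v = (\<lambda>u. (if v = (b, j) then inverse q else 1) * bv v u)"

definition vec_rep ::
  "nat \<Rightarrow> nat \<Rightarrow> ugen \<Rightarrow> (nat \<times> nat \<Rightarrow> Cq) \<Rightarrow> (nat \<times> nat \<Rightarrow> Cq)" where
  "vec_rep d N g = lin_op (vidx d N) (vec_rep_basis g)"

text \<open>\<open>x \<otimes> y\<close> for \<open>x\<close> in \<open>V\<close> and \<open>y\<close> in a tensor power of \<open>V\<close>.\<close>

definition tensor :: "(nat \<times> nat \<Rightarrow> Cq) \<Rightarrow> tens \<Rightarrow> tens" where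
  "tensor x y = (\<lambda>w. case w of [] \<Rightarrow> 0 | v # u \<Rightarrow> x v * y u)"

text \<open>
  The action of the generators on tensor powers: the trivial module for \<open>n = 0\<close>, and
  the tensor product of \<open>V\<close> with the \<open>n\<close>-th tensor power for \<open>n + 1\<close>.
\<close>

primrec tens_rep :: "nat \<Rightarrow> nat \<Rightarrow> nat \<Rightarrow> ugen \<Rightarrow> tens \<Rightarrow> tens" where
  "tens_rep d N 0 = (\<lambda>g. lin_op (tidx d N 0) (\<lambda>w u. counit g * bv w u))"
| "tens_rep d N (Suc n) = (\<lambda>g. lin_op (tidx d N (Suc n)) (\<lambda>w u.
     \<Sum>(g1, g2)\<leftarrow>comult g.
       tensor (word_ev (endo (vidx d N)) (vec_rep d N) g1 (bv (hd w)))
              (word_ev (endo (tidx d N n)) (tens_rep d N n) g2 (bv (tl w))) u))"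

definition Uq_rep ::
  "nat \<Rightarrow> nat \<Rightarrow> nat \<Rightarrow> (ugen list \<Rightarrow> Cq) set \<Rightarrow> tens \<Rightarrow> tens" where
  "Uq_rep d N n = pres_ev (endo (tidx d N n)) (tens_rep d N n)"

definition perm_rep :: "nat \<Rightarrow> nat \<Rightarrow> nat \<Rightarrow> (nat \<Rightarrow> nat) \<Rightarrow> tens \<Rightarrow> tens" where
  "perm_rep d N n \<tau> = lin_op (tidx d N n) (\<lambda>w. bv (map (\<lambda>(b, i). (\<tau> b, i)) w))"

definition UqS_rep ::
  "nat \<Rightarrow> nat \<Rightarrow> nat \<Rightarrow> ((nat \<Rightarrow> nat) \<Rightarrow> (ugen list \<Rightarrow> Cq) set) \<Rightarrow> tens \<Rightarrow> tens" where
  "UqS_rep d N n f =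
     (\<Oplus>\<^bsub>endo (tidx d N n)\<^esub>\<tau>\<in>carrier (sym_group d).
        Uq_rep d N n (f \<tau>) \<otimes>\<^bsub>endo (tidx d N n)\<^esub> perm_rep d N n \<tau>)"

definition EndUqS :: "nat \<Rightarrow> nat \<Rightarrow> nat \<Rightarrow> (Cq, tens \<Rightarrow> tens) module" where
  "EndUqS d N n = endo_over (tidx d N n) (UqS d N) (UqS_rep d N n)"


subsection \<open>The operators on neighbouring tensor factors\<close>

text \<open>
  The operator acting on the tensor factors \<open>i, i + 1\<close> (positions \<open>i - 1, i\<close> of the
  index list) by \<open>\<phi>\<close>, where \<open>\<phi> v w\<close> is the image of
  \<open>v \<otimes> w\<close>.
\<close>

definition local_op ::
  "nat \<Rightarrow> nat \<Rightarrow> nat \<Rightarrow> nat \<Rightarrow> (nat \<times> nat \<Rightarrow> nat \<times> nat \<Rightarrow> tens) \<Rightarrow> tens \<Rightarrow> tens" where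
  "local_op d N n i \<phi> = lin_op (tidx d N n) (\<lambda>w u.
     if length u = length w \<and> take (i - 1) u = take (i - 1) w \<and> drop (i + 1) u = drop (i + 1) w
     then \<phi> (w ! (i - 1)) (w ! i) [u ! (i - 1), u ! i] else 0)"

text \<open>
  The action on \<open>V\<^sub>b \<otimes> V\<^sub>b\<close> of the \<open>R\<close>-matrix of
  \<open>U\<^sub>q(gl\<^sub>N)\<close> followed by the flip. For the coproduct above,
  \<open>q\<^sup>-\<^sup>1 v\<^sub>i \<otimes> v\<^sub>j + v\<^sub>j \<otimes> v\<^sub>i\<close> (\<open>i < j\<close>) and
  \<open>v\<^sub>i \<otimes> v\<^sub>i\<close> span the \<open>q\<close>-symmetric square, on which it is
  \<open>q\<close>, and \<open>v\<^sub>j \<otimes> v\<^sub>i - q v\<^sub>i \<otimes> v\<^sub>j\<close> (\<open>i < j\<close>) span the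
  \<open>q\<close>-antisymmetric square, on which it is \<open>- q\<^sup>-\<^sup>1\<close>.
\<close>

definition R_check :: "nat \<Rightarrow> nat \<Rightarrow> nat \<Rightarrow> tens" where
  "R_check b i j = (\<lambda>u.
     if i = j then q * bv [(b, i), (b, i)] u
     else if i < j then bv [(b, j), (b, i)] u
     else bv [(b, j), (b, i)] u + (q - inverse q) * bv [(b, i), (b, j)] u)"

definition sigma_op :: "nat \<Rightarrow> nat \<Rightarrow> nat \<Rightarrow> nat \<Rightarrow> tens \<Rightarrow> tens" where
  "sigma_op d N n i = local_op d N n i (\<lambda>(b, k) (c, l).
     if b = c then R_check b k l else bv [(c, l), (b, k)])"

definition eps_op :: "nat \<Rightarrow> nat \<Rightarrow> nat \<Rightarrow> nat \<Rightarrow> tens \<Rightarrow> tens" where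
  "eps_op d N n i = local_op d N n i (\<lambda>(b, k) (c, l).
     if b = c then bv [(b, k), (c, l)] else (\<lambda>_. 0))"


section \<open>The Hecke algebra of braids and ties\<close>

text \<open>\<open>BS' i\<close> is the inverse of \<open>BS i\<close>.\<close>

datatype btgen = BS nat | BS' nat | BE nat

definition btgens :: "nat \<Rightarrow> btgen set" where
  "btgens n = BS ` {1..<n} \<union> BS' ` {1..<n} \<union> BE ` {1..<n}"

definition tb_rels :: "nat \<Rightarrow> ((Cq, btgen) lincomb \<times> (Cq, btgen) lincomb) set" where
  "tb_rels n =
     {r. \<exists>i\<in>{1..<n}. r \<in>
        {weq [BS i, BS' i] [], weq [BS' i, BS i] [],
         weq [BE i, BE i] [BE i], weq [BS i, BE i] [BE i, BS i]}} \<union>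
     {r. \<exists>i\<in>{1..<n}. \<exists>j\<in>{1..<n}. r = weq [BE i, BE j] [BE j, BE i]} \<union>
     {r. \<exists>i\<in>{1..<n}. \<exists>j\<in>{1..<n}. \<bar>int i - int j\<bar> > 1 \<and> r \<in>
        {weq [BS i, BS j] [BS j, BS i], weq [BS i, BE j] [BE j, BS i]}} \<union>
     {r. \<exists>i\<in>{1..<n}. \<exists>j\<in>{1..<n}. \<bar>int i - int j\<bar> = 1 \<and> r \<in>
        {weq [BS i, BS j, BS i] [BS j, BS i, BS j],
         weq [BE i, BS j, BS i] [BS j, BS i, BE j],
         weq [BE i, BS j, BS' i] [BS j, BS' i, BE j],
         weq [BE i, BE j, BS i] [BE j, BS i, BE j],
         weq [BE j, BS i, BE j] [BS i, BE j, BE i]}}"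

definition bth_rels :: "nat \<Rightarrow> ((Cq, btgen) lincomb \<times> (Cq, btgen) lincomb) set" where
  "bth_rels n = tb_rels n \<union>
     {([(1, [BS i, BS i])], [(q - inverse q, [BS i, BE i]), (1, [])]) | i. i \<in> {1..<n}}"

definition BTH :: "nat \<Rightarrow> (Cq, (btgen list \<Rightarrow> Cq) set) module" where
  "BTH n = pres_alg (btgens n) (bth_rels n)"

definition bth_s :: "nat \<Rightarrow> nat \<Rightarrow> (btgen list \<Rightarrow> Cq) set" where
  "bth_s n i = pres_gen (btgens n) (bth_rels n) (BS i)"

definition bth_E :: "nat \<Rightarrow> nat \<Rightarrow> (btgen list \<Rightarrow> Cq) set" where
  "bth_E n i = pres_gen (btgens n) (bth_rels n) (BE i)"

end

theory Submission
  imports Defs "HOL-Computational_Algebra.Formal_Power_Series"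
begin

text \<open>
  The image of the braids and ties algebra commutes with the quantum group and with the
  permutations of the summands. For surjectivity one specialises at \<open>q = 1\<close>: the residues of the
  commutant commute with the classical Lie algebra, hence by classical Schur-Weyl duality and
  averaging over the permutations of the summands they are residues of elements of the image, and
  a Nakayama argument lifts this to generic \<open>q\<close>. For injectivity the algebra is spanned by products
  of a normal word in the braid generators and an idempotent tying the blocks of a set partition;
  if \<open>n \<le> d\<close> and \<open>n \<le> N\<close>, these products are separated by the vectors
  \<open>(c\<^sub>1, 1) \<otimes> \<dots> \<otimes> (c\<^sub>n, n)\<close>. If \<open>n > d\<close>, the projection to words of distinct colours is in the
  kernel, and if \<open>n > N\<close>, the \<open>q\<close>-antisymmetriser on words of one colour is.
\<close>

section \<open>Algebras and presentations\<close>

text \<open>The presentation gives no lower bound on the size of the algebra, so no dimensions are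
  compared. For surjectivity it is enough that the residues at \<open>q = 1\<close> of the commutant
  occur as residues of the image: a nonzero difference could be divided by powers of
  \<open>q - 1\<close> until its residue is nonzero, and that is then excluded. The double commutant
  statement at \<open>q = 1\<close> is obtained by averaging a linear projection onto the span of
  place permutations and colour idempotents, as in Maschke's theorem. For injectivity the letters of
  the test words increase, so that a normal word merely permutes places and the correction term of
  the R-matrix never appears. An element of the kernel is seen to be nonzero by letting the same
  element of the free algebra act for other values of \<open>d\<close> and \<open>N\<close>; this is
  why operators are tracked uniformly in both. Operators are defined as total functions on all
  words, by recursion on the first letter, and restricted to the tensor power only afterwards: each
  relation then becomes an identity provable by induction on words.\<close>

locale kalg = ring A for A :: "('k::field, 'a) module" (structure) +
  assumes smult_closed [simp, intro]: "x \<in> carrier A \<Longrightarrow> c \<odot> x \<in> carrier A"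
    and smult_r_distr: "x \<in> carrier A \<Longrightarrow> y \<in> carrier A \<Longrightarrow> c \<odot> (x \<oplus> y) = c \<odot> x \<oplus> c \<odot> y"
    and smult_l_distr: "x \<in> carrier A \<Longrightarrow> (c + c') \<odot> x = c \<odot> x \<oplus> c' \<odot> x"
    and smult_assoc: "x \<in> carrier A \<Longrightarrow> (c * c') \<odot> x = c \<odot> (c' \<odot> x)"
    and smult_one [simp]: "x \<in> carrier A \<Longrightarrow> 1 \<odot> x = x"
    and smult_mult_l: "x \<in> carrier A \<Longrightarrow> y \<in> carrier A \<Longrightarrow> (c \<odot> x) \<otimes> y = c \<odot> (x \<otimes> y)"
    and smult_mult_r: "x \<in> carrier A \<Longrightarrow> y \<in> carrier A \<Longrightarrow> x \<otimes> (c \<odot> y) = c \<odot> (x \<otimes> y)"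
begin

lemma smult_zero_l [simp]:
  assumes "x \<in> carrier A" shows "0 \<odot> x = \<zero>"
proof -
  have "0 \<odot> x \<oplus> 0 \<odot> x = 0 \<odot> x \<oplus> \<zero>"
    using smult_l_distr[OF assms, of 0 0] assms by simp
  then show ?thesis using assms by (simp add: add.l_cancel_one)
qed

lemma smult_zero_r [simp]: "c \<odot> \<zero> = \<zero>"
proof -
  have "c \<odot> \<zero> \<oplus> c \<odot> \<zero> = c \<odot> \<zero> \<oplus> \<zero>"
    using smult_r_distr[of \<zero> \<zero> c] by simp
  then show ?thesis by (simp add: add.l_cancel_one)
qed

lemma smult_minus_one:
  assumes "x \<in> carrier A" shows "(- 1) \<odot> x = \<ominus> x"
proof -
  have "(-1) \<odot> x \<oplus> x = \<zero>"
    using smult_l_distr[OF assms, of "-1" 1] assms by simp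
  then show ?thesis using assms by (simp add: minus_equality)
qed

lemma finsum_smult:
  assumes "finite S" "f \<in> S \<rightarrow> carrier A"
  shows "(\<Oplus>w\<in>S. c \<odot> f w) = c \<odot> (\<Oplus>w\<in>S. f w)"
  using assms by (induction S rule: finite_induct) (auto simp: smult_r_distr Pi_iff)

lemma word_ev_closed [simp, intro]:
  assumes "\<And>g. g \<in> X \<Longrightarrow> \<rho> g \<in> carrier A" "set w \<subseteq> X"
  shows "word_ev A \<rho> w \<in> carrier A"
  using assms(2) unfolding word_ev_def by (induction w) (auto simp: assms(1))

lemma word_ev_Nil [simp]: "word_ev A \<rho> [] = \<one>"
  and word_ev_Cons [simp]: "word_ev A \<rho> (g # w) = \<rho> g \<otimes> word_ev A \<rho> w"
  by (simp_all add: word_ev_def)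

lemma word_ev_append:
  assumes "\<And>g. g \<in> X \<Longrightarrow> \<rho> g \<in> carrier A" "set v \<subseteq> X" "set w \<subseteq> X"
  shows "word_ev A \<rho> (v @ w) = word_ev A \<rho> v \<otimes> word_ev A \<rho> w"
  using assms(2) word_ev_closed[of X \<rho>] assms(1,3)
  by (induction v) (auto simp: m_assoc)

end

lemma alg_hom_smult:
  "h \<in> alg_hom A B \<Longrightarrow> x \<in> carrier A \<Longrightarrow> h (c \<odot>\<^bsub>A\<^esub> x) = c \<odot>\<^bsub>B\<^esub> h x"
  by (simp add: alg_hom_def)

lemma alg_hom_ring_hom: "h \<in> alg_hom A B \<Longrightarrow> h \<in> ring_hom A B"
  by (simp add: alg_hom_def)

subsection \<open>Free algebras\<close>

lemma free_alg_simps [simp]: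
  "zero (free_alg X) = (\<lambda>w. 0)" "one (free_alg X) = bv []"
  "add (free_alg X) x y = (\<lambda>w. x w + y w)" "smult (free_alg X) c x = (\<lambda>w. c * x w)"
  by (simp_all add: free_alg_def)

lemma free_alg_carrier:
  "x \<in> carrier (free_alg X) \<longleftrightarrow> finite {w. x w \<noteq> 0} \<and> (\<forall>w. x w \<noteq> 0 \<longrightarrow> set w \<subseteq> X)"
  by (auto simp: free_alg_def lists_eq_set)

lemma free_alg_mult:
  "mult (free_alg X) x y w = (\<Sum>k=0..length w. x (take k w) * y (drop k w))"
  by (simp add: free_alg_def atLeast0AtMost)

lemma bv_free_alg [simp, intro]: "set w \<subseteq> X \<Longrightarrow> bv w \<in> carrier (free_alg X)"
  by (auto simp: free_alg_carrier bv_def split: if_splits)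

lemma free_alg_mult_closed:
  assumes "x \<in> carrier (free_alg X)" "y \<in> carrier (free_alg X)"
  shows "x \<otimes>\<^bsub>free_alg X\<^esub> y \<in> carrier (free_alg X)"
proof -
  let ?S = "(\<lambda>(u, v). u @ v) ` ({w. x w \<noteq> 0} \<times> {w. y w \<noteq> 0})"
  have sub: "{w. (x \<otimes>\<^bsub>free_alg X\<^esub> y) w \<noteq> 0} \<subseteq> ?S"
  proof
    fix w assume "w \<in> {w. (x \<otimes>\<^bsub>free_alg X\<^esub> y) w \<noteq> 0}"
    then obtain k where "x (take k w) * y (drop k w) \<noteq> 0"
      by (auto simp: free_alg_mult elim: sum.not_neutral_contains_not_neutral)
    then show "w \<in> ?S"
      by (intro image_eqI[of _ _ "(take k w, drop k w)"]) auto
  qed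
  moreover have "finite ?S" using assms by (auto simp: free_alg_carrier)
  ultimately have "finite {w. (x \<otimes>\<^bsub>free_alg X\<^esub> y) w \<noteq> 0}" by (rule finite_subset)
  moreover have "set w \<subseteq> X" if "(x \<otimes>\<^bsub>free_alg X\<^esub> y) w \<noteq> 0" for w
    using that sub assms by (fastforce simp: free_alg_carrier)
  ultimately show ?thesis by (auto simp: free_alg_carrier)
qed

text \<open>Both bracketings sum over the ways of cutting \<open>w\<close> into three pieces, as in
  the Cauchy product of power series; \<open>fps_mult_assoc_lemma\<close> is that
  reindexing.\<close>

lemma free_alg_mult_assoc:
  "mult (free_alg X) (mult (free_alg X) x y) z = mult (free_alg X) x (mult (free_alg X) y z)"
proof
  fix w :: "'a list"
  let ?n = "length w"
  define f where "f i m r = x (take i w) * y (take m (drop i w)) * z (drop (i + m) w)" for i m and r :: nat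
  have "mult (free_alg X) (mult (free_alg X) x y) z w
      = (\<Sum>k=0..?n. \<Sum>i=0..k. f i (k - i) (?n - k))"
    by (auto simp: free_alg_mult sum_distrib_right f_def min_def drop_take intro!: sum.cong split: if_splits)
  also have "\<dots> = (\<Sum>k=0..?n. \<Sum>i=0..?n - k. f k i (?n - k - i))"
    by (rule fps_mult_assoc_lemma)
  also have "\<dots> = mult (free_alg X) x (mult (free_alg X) y z) w"
    by (auto simp: free_alg_mult sum_distrib_left f_def mult.assoc add.commute intro!: sum.cong)
  finally show "mult (free_alg X) (mult (free_alg X) x y) z w
      = mult (free_alg X) x (mult (free_alg X) y z) w" .
qed

lemma free_alg_bv_Nil_mult: "mult (free_alg X) (bv []) x = x"
proof
  fix w
  have "mult (free_alg X) (bv []) x w = (\<Sum>k=0..length w. if k = 0 then x w else 0)"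
    unfolding free_alg_mult by (rule sum.cong) (auto simp: bv_def)
  then show "mult (free_alg X) (bv []) x w = x w" by simp
qed

lemma free_alg_mult_bv_Nil: "mult (free_alg X) x (bv []) = x"
proof
  fix w
  have "mult (free_alg X) x (bv []) w = (\<Sum>k=0..length w. if k = length w then x w else 0)"
    unfolding free_alg_mult by (rule sum.cong) (auto simp: bv_def)
  then show "mult (free_alg X) x (bv []) w = x w" by simp
qed

lemma free_alg_bv_mult: "mult (free_alg X) (bv u) (bv v) = bv (u @ v)"
proof
  fix w
  have "mult (free_alg X) (bv u) (bv v) w
      = (\<Sum>k=0..length w. if k = length u then (if w = u @ v then 1 else 0) else 0)"
    unfolding free_alg_mult
  proof (rule sum.cong)
    fix k assume k: "k \<in> {0..length w}"
    have "k = length u \<and> w = u @ v" if "take k w = u" "drop k w = v"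
      using that k append_take_drop_id[of k w] by (metis atLeastAtMost_iff length_take min_absorb2)
    moreover have "take k w = u \<and> drop k w = v" if "k = length u \<and> w = u @ v"
      using that by simp
    ultimately have iff: "take k w = u \<and> drop k w = v \<longleftrightarrow> k = length u \<and> w = u @ v"
      by blast
    have "bv u (take k w) * bv v (drop k w) = (if take k w = u \<and> drop k w = v then 1 else 0)"
      by (simp add: bv_def)
    then show "bv u (take k w) * bv v (drop k w)
        = (if k = length u then (if w = u @ v then 1 else 0) else 0)"
      unfolding iff by (metis (full_types))
  qed simp
  then show "mult (free_alg X) (bv u) (bv v) w = bv (u @ v) w" by (auto simp: bv_def)
qed

lemma free_alg_kalg:
  fixes X :: "'b set"
  shows "kalg (free_alg X :: ('a::field, 'b list \<Rightarrow> 'a) module)"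
proof -
  let ?F = "free_alg X :: ('a, 'b list \<Rightarrow> 'a) module"
  have add_closed: "(\<lambda>w. x w + y w) \<in> carrier (free_alg X)"
    if "x \<in> carrier (free_alg X)" "y \<in> carrier (free_alg X)" for x y :: "'b list \<Rightarrow> 'a"
  proof -
    have "{w. x w + y w \<noteq> 0} \<subseteq> {w. x w \<noteq> 0} \<union> {w. y w \<noteq> 0}" by auto
    then have "finite {w. x w + y w \<noteq> 0}"
      using that by (auto simp: free_alg_carrier intro: finite_subset)
    moreover have "set w \<subseteq> X" if "x w + y w \<noteq> 0" for w
      using that \<open>x \<in> _\<close> \<open>y \<in> _\<close> unfolding free_alg_carrier by (metis add_0)
    ultimately show ?thesis by (auto simp: free_alg_carrier)
  qed
  have smult_closed: "(\<lambda>w. c * x w) \<in> carrier (free_alg X)"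
    if "x \<in> carrier (free_alg X)" for x :: "'b list \<Rightarrow> 'a" and c
    using that by (auto simp: free_alg_carrier)
  have "ring ?F"
  proof (rule ringI)
    show "abelian_group ?F"
    proof (rule abelian_groupI)
      fix x :: "'b list \<Rightarrow> 'a" assume "x \<in> carrier ?F"
      then show "\<exists>y\<in>carrier ?F. y \<oplus>\<^bsub>?F\<^esub> x = \<zero>\<^bsub>?F\<^esub>"
        using smult_closed[of x "-1"] by (intro bexI[of _ "\<lambda>w. -1 * x w"]) auto
    qed (auto simp: add_closed add.assoc add.commute, auto simp: free_alg_carrier)
    show "Group.monoid ?F"
      by (rule monoidI)
        (auto simp: free_alg_mult_closed free_alg_mult_assoc free_alg_bv_Nil_mult free_alg_mult_bv_Nil)
  qed (auto simp: free_alg_mult fun_eq_iff algebra_simps sum.distrib)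
  then show ?thesis
    by (intro kalg.intro kalg_axioms.intro)
      (auto simp: smult_closed free_alg_mult fun_eq_iff algebra_simps sum_distrib_left)
qed

text \<open>Builds an element one monomial at a time, so that statements linear in \<open>x\<close>
  need only be checked on words.\<close>

lemma free_alg_induct [consumes 1, case_names zero add]:
  assumes "x \<in> carrier (free_alg X)"
    and "P (\<lambda>w. 0)"
    and "\<And>x c w. x \<in> carrier (free_alg X) \<Longrightarrow> set w \<subseteq> X \<Longrightarrow> P x \<Longrightarrow> P (\<lambda>u. x u + c * bv w u)"
  shows "P x"
proof -
  have "finite {w. x w \<noteq> 0}" using assms(1) by (auto simp: free_alg_carrier)
  then show ?thesis using assms(1)
  proof (induction "{w. x w \<noteq> 0}" arbitrary: x rule: finite_induct)
    case empty
    then have "x = (\<lambda>w. 0)" by auto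
    then show ?case using assms(2) by simp
  next
    case (insert w S)
    define y where "y = x(w := 0)"
    have S: "S = {w. y w \<noteq> 0}" using insert.hyps by (auto simp: y_def)
    have "finite {w. y w \<noteq> 0}" using insert.hyps(1) S by simp
    then have y: "y \<in> carrier (free_alg X)"
      using insert.prems by (auto simp: free_alg_carrier y_def)
    have "set w \<subseteq> X" using insert.hyps(4) insert.prems by (auto simp: free_alg_carrier)
    moreover have "x = (\<lambda>u. y u + x w * bv w u)" by (auto simp: y_def bv_def)
    ultimately show ?case using assms(3)[OF y _ insert.hyps(3)[OF S y], of w "x w"] by simp
  qed
qed

context kalg
begin

context
  fixes X :: "'g set" and \<rho> :: "'g \<Rightarrow> 'a"
  assumes \<rho>: "\<And>g. g \<in> X \<Longrightarrow> \<rho> g \<in> carrier A"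
begin

text \<open>\<open>free_ev\<close> sums over the support, which varies with the element. Over a
  common finite set of words the sums for several elements can be added term by term.\<close>

lemma free_ev_superset:
  assumes "x \<in> carrier (free_alg X)" "finite S" "{w. x w \<noteq> 0} \<subseteq> S" "S \<subseteq> lists X"
  shows "free_ev A \<rho> x = (\<Oplus>w\<in>S. x w \<odot> word_ev A \<rho> w)"
  unfolding free_ev_def
proof (rule add.finprod_mono_neutral_cong_left)
  show "(\<lambda>w. x w \<odot> word_ev A \<rho> w) \<in> S \<rightarrow> carrier A"
    using assms(4) \<rho> by (auto intro!: smult_closed word_ev_closed[of X])
qed (use assms \<rho> in \<open>auto intro!: smult_zero_l word_ev_closed[of X]\<close>)

lemma free_ev_closed:
  assumes "x \<in> carrier (free_alg X)" shows "free_ev A \<rho> x \<in> carrier A"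
  unfolding free_ev_def
  using assms \<rho> by (intro finsum_closed) (auto simp: free_alg_carrier intro!: word_ev_closed[of X])

lemma free_ev_add:
  assumes x: "x \<in> carrier (free_alg X)" and y: "y \<in> carrier (free_alg X)"
  shows "free_ev A \<rho> (\<lambda>w. x w + y w) = free_ev A \<rho> x \<oplus> free_ev A \<rho> y"
proof -
  interpret F: kalg "free_alg X :: ('k, _) module" by (rule free_alg_kalg)
  let ?S = "{w. x w \<noteq> 0} \<union> {w. y w \<noteq> 0}"
  have S: "finite ?S" "?S \<subseteq> lists X" using x y by (auto simp: free_alg_carrier)
  have xy: "(\<lambda>w. x w + y w) \<in> carrier (free_alg X)" using F.add.m_closed[OF x y] by simp
  have cl: "(\<lambda>w. z w \<odot> word_ev A \<rho> w) \<in> ?S \<rightarrow> carrier A" for z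
    using S(2) \<rho> by (auto intro!: smult_closed word_ev_closed[of X])
  have "free_ev A \<rho> (\<lambda>w. x w + y w) = (\<Oplus>w\<in>?S. (x w + y w) \<odot> word_ev A \<rho> w)"
    by (rule free_ev_superset[OF xy S(1) _ S(2)]) auto
  also have "\<dots> = (\<Oplus>w\<in>?S. x w \<odot> word_ev A \<rho> w \<oplus> y w \<odot> word_ev A \<rho> w)"
  proof (rule finsum_cong')
    fix w assume "w \<in> ?S"
    then have "set w \<subseteq> X" using S(2) by auto
    then show "(x w + y w) \<odot> word_ev A \<rho> w = x w \<odot> word_ev A \<rho> w \<oplus> y w \<odot> word_ev A \<rho> w"
      using \<rho> by (intro smult_l_distr word_ev_closed[of X]) auto
  qed (use cl in \<open>auto simp: Pi_iff\<close>)
  also have "\<dots> = free_ev A \<rho> x \<oplus> free_ev A \<rho> y"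
    using S by (subst finsum_addf[OF cl cl])
      (auto simp: free_ev_superset[OF x S(1) _ S(2)] free_ev_superset[OF y S(1) _ S(2)])
  finally show ?thesis .
qed

lemma free_ev_smult:
  assumes x: "x \<in> carrier (free_alg X)"
  shows "free_ev A \<rho> (\<lambda>w. c * x w) = c \<odot> free_ev A \<rho> x"
proof -
  interpret F: kalg "free_alg X :: ('k, _) module" by (rule free_alg_kalg)
  let ?S = "{w. x w \<noteq> 0}"
  have S: "finite ?S" "?S \<subseteq> lists X" using x by (auto simp: free_alg_carrier)
  have cx: "(\<lambda>w. c * x w) \<in> carrier (free_alg X)" using F.smult_closed[OF x] by simp
  have cl: "(\<lambda>w. z w \<odot> word_ev A \<rho> w) \<in> ?S \<rightarrow> carrier A" for z
    using S(2) \<rho> by (auto intro!: smult_closed word_ev_closed[of X])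
  have "free_ev A \<rho> (\<lambda>w. c * x w) = (\<Oplus>w\<in>?S. (c * x w) \<odot> word_ev A \<rho> w)"
    by (rule free_ev_superset[OF cx S(1) _ S(2)]) auto
  also have "\<dots> = (\<Oplus>w\<in>?S. c \<odot> (x w \<odot> word_ev A \<rho> w))"
  proof (rule finsum_cong')
    fix w assume "w \<in> ?S"
    then have "set w \<subseteq> X" using S(2) by auto
    then show "(c * x w) \<odot> word_ev A \<rho> w = c \<odot> (x w \<odot> word_ev A \<rho> w)"
      using \<rho> by (intro smult_assoc word_ev_closed[of X]) auto
  qed (use cl in \<open>auto simp: Pi_iff\<close>)
  also have "\<dots> = c \<odot> free_ev A \<rho> x"
    by (subst finsum_smult[OF S(1) cl]) (simp add: free_ev_def)
  finally show ?thesis .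
qed

lemma free_ev_bv:
  assumes "set w \<subseteq> X" shows "free_ev A \<rho> (bv w) = word_ev A \<rho> w"
proof -
  have "free_ev A \<rho> (bv w) = (\<Oplus>v\<in>{w}. bv w v \<odot> word_ev A \<rho> v)"
    by (rule free_ev_superset[OF bv_free_alg[OF assms]]) (use assms in \<open>auto simp: bv_def split: if_splits\<close>)
  also have "\<dots> = word_ev A \<rho> w" using assms \<rho> by (simp add: bv_def word_ev_closed[of X])
  finally show ?thesis .
qed

lemma free_ev_zero: "free_ev A \<rho> (\<lambda>w. 0) = \<zero>"
  by (simp add: free_ev_def)

lemma free_ev_mult:
  assumes x: "x \<in> carrier (free_alg X)" and y: "y \<in> carrier (free_alg X)"
  shows "free_ev A \<rho> (x \<otimes>\<^bsub>free_alg X\<^esub> y) = free_ev A \<rho> x \<otimes> free_ev A \<rho> y"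
proof -
  interpret F: kalg "free_alg X :: ('k, _) module" by (rule free_alg_kalg)
  note cl = \<rho> word_ev_closed[of X \<rho>] free_ev_closed
  have fadd: "free_ev A \<rho> (x \<oplus>\<^bsub>free_alg X\<^esub> y) = free_ev A \<rho> x \<oplus> free_ev A \<rho> y"
    if "x \<in> carrier (free_alg X)" "y \<in> carrier (free_alg X)" for x y
    using free_ev_add[OF that] by simp
  have fsm: "free_ev A \<rho> (c \<odot>\<^bsub>free_alg X\<^esub> x) = c \<odot> free_ev A \<rho> x"
    if "x \<in> carrier (free_alg X)" for x c
    using free_ev_smult[OF that] by simp
  have zero: "(\<lambda>w. 0 :: 'k) = \<zero>\<^bsub>free_alg X\<^esub>" by simp
  have form: "(\<lambda>u. x u + c * bv w u) = x \<oplus>\<^bsub>free_alg X\<^esub> (c \<odot>\<^bsub>free_alg X\<^esub> bv w)" for x w and c :: 'k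
    by simp
  have fz: "free_ev A \<rho> \<zero>\<^bsub>free_alg X\<^esub> = \<zero>" using free_ev_zero by simp
  have bvc: "bv w \<in> carrier (free_alg X)" if "set w \<subseteq> X" for w using that by simp
  \<comment> \<open>A single word on the left comes first, because there multiplication by a word is
    concatenation; linearity in the left factor does the rest.\<close>
  have 1: "free_ev A \<rho> (bv v \<otimes>\<^bsub>free_alg X\<^esub> y) = word_ev A \<rho> v \<otimes> free_ev A \<rho> y"
    if v: "set v \<subseteq> X" for v
    using y
  proof (induction rule: free_alg_induct)
    case zero
    have "bv v \<otimes>\<^bsub>free_alg X\<^esub> (\<lambda>w. 0) = (\<lambda>w. 0 :: 'k)"
      using F.r_null[OF bvc[OF v]] by simp
    then show ?case using v cl by (simp add: free_ev_zero)
  next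
    case (add y c w)
    have "bv v \<otimes>\<^bsub>free_alg X\<^esub> (y \<oplus>\<^bsub>free_alg X\<^esub> (c \<odot>\<^bsub>free_alg X\<^esub> bv w))
        = (bv v \<otimes>\<^bsub>free_alg X\<^esub> y) \<oplus>\<^bsub>free_alg X\<^esub> (c \<odot>\<^bsub>free_alg X\<^esub> bv (v @ w))"
      by (simp only: F.r_distr[OF add(1) F.smult_closed[OF bvc[OF add(2)]] bvc[OF v]]
          F.smult_mult_r[OF bvc[OF v] bvc[OF add(2)]] free_alg_bv_mult)
    then show ?case unfolding form
      using add bvc[OF v] bvc[OF add(2)] v cl bvc[of "v @ w"]
      by (simp add: fadd fsm free_ev_bv word_ev_append[of X] r_distr smult_mult_r del: free_alg_simps)
  qed
  show ?thesis using x
  proof (induction rule: free_alg_induct)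
    case zero
    have "(\<lambda>w. 0 :: 'k) \<otimes>\<^bsub>free_alg X\<^esub> y = (\<lambda>w. 0)"
      using F.l_null[OF y] by simp
    then show ?case using y cl by (simp add: free_ev_zero)
  next
    case (add x c w)
    have "(x \<oplus>\<^bsub>free_alg X\<^esub> (c \<odot>\<^bsub>free_alg X\<^esub> bv w)) \<otimes>\<^bsub>free_alg X\<^esub> y
        = (x \<otimes>\<^bsub>free_alg X\<^esub> y) \<oplus>\<^bsub>free_alg X\<^esub> (c \<odot>\<^bsub>free_alg X\<^esub> (bv w \<otimes>\<^bsub>free_alg X\<^esub> y))"
      by (simp only: F.l_distr[OF add(1) F.smult_closed[OF bvc[OF add(2)]] y]
          F.smult_mult_l[OF bvc[OF add(2)] y])
    then show ?case unfolding form
      using add bvc[OF add(2)] y cl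
      by (simp add: fadd fsm free_ev_bv 1 l_distr smult_mult_l del: free_alg_simps)
  qed
qed

lemma free_ev_hom: "free_ev A \<rho> \<in> alg_hom (free_alg X) A"
  unfolding alg_hom_def
  by (auto intro!: ring_hom_memI free_ev_closed free_ev_mult simp: free_ev_add free_ev_smult free_ev_bv[of "[]", simplified])

end

end


subsection \<open>Quotients and presented algebras\<close>

lemma alg_quot_simps [simp]:
  "carrier (alg_quot A I) = carrier (A Quot I)"
  "mult (alg_quot A I) = mult (A Quot I)"
  "one (alg_quot A I) = one (A Quot I)"
  "zero (alg_quot A I) = zero (A Quot I)"
  "add (alg_quot A I) = add (A Quot I)"
  "smult (alg_quot A I) c X = (\<Union>x\<in>X. I +>\<^bsub>A\<^esub> (c \<odot>\<^bsub>A\<^esub> x))"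
  by (simp_all add: alg_quot_def ring.defs module.defs)

context kalg
begin

context
  fixes I assumes I: "ideal I A"
begin

interpretation ideal I A by (rule I)

lemma Quot_cases:
  assumes "X \<in> carrier (A Quot I)"
  obtains x where "x \<in> carrier A" "X = I +> x"
  using assms by (auto simp: FactRing_def A_RCOSETS_def')

lemma coset_in_Quot [simp, intro]: "x \<in> carrier A \<Longrightarrow> I +> x \<in> carrier (A Quot I)"
  by (auto simp: FactRing_def A_RCOSETS_def')

lemma coset_add: "x \<in> carrier A \<Longrightarrow> y \<in> carrier A \<Longrightarrow>
    (I +> x) \<oplus>\<^bsub>A Quot I\<^esub> (I +> y) = I +> (x \<oplus> y)"
  using rcos_ring_hom by (simp add: ring_hom_add)

lemma coset_mult: "x \<in> carrier A \<Longrightarrow> y \<in> carrier A \<Longrightarrow>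
    (I +> x) \<otimes>\<^bsub>A Quot I\<^esub> (I +> y) = I +> (x \<otimes> y)"
  using rcos_ring_hom by (simp add: ring_hom_mult)

lemma coset_eq_iff: "x \<in> carrier A \<Longrightarrow> y \<in> carrier A \<Longrightarrow> I +> x = I +> y \<longleftrightarrow> x \<ominus> y \<in> I"
  using quotient_eq_iff_same_a_r_cos[OF I] by blast

text \<open>Scaling by \<open>c\<close> is multiplication by the element
  \<open>c \<odot> \<one>\<close>, so a ring ideal is also a subspace. This is what makes the scalar
  multiplication of cosets well defined.\<close>

lemma ideal_smult: assumes "x \<in> I" shows "c \<odot> x \<in> I"
proof -
  have x: "x \<in> carrier A" using assms by (rule a_Hcarr)
  have "c \<odot> x = (c \<odot> \<one>) \<otimes> x" using x by (simp add: smult_mult_l)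
  then show ?thesis using I_l_closed[OF assms, of "c \<odot> \<one>"] by simp
qed

lemma coset_mem:
  assumes "x \<in> carrier A" "y \<in> I +> x"
  shows "y \<in> carrier A" "I +> y = I +> x"
proof -
  show y: "y \<in> carrier A" using assms a_r_coset_subset_G a_subset by blast
  show "I +> y = I +> x" by (rule a_repr_independence[OF assms(2,1) a_subgroup, symmetric])
qed

lemma coset_smult:
  assumes x: "x \<in> carrier A"
  shows "c \<odot>\<^bsub>alg_quot A I\<^esub> (I +> x) = I +> (c \<odot> x)"
proof -
  have "I +> (c \<odot> y) = I +> (c \<odot> x)" if "y \<in> I +> x" for y
  proof -
    have y: "y \<in> carrier A" "y \<ominus> x \<in> I"
      using coset_mem[OF x that] x by (auto simp flip: coset_eq_iff)
    have "c \<odot> y \<ominus> c \<odot> x = c \<odot> (y \<ominus> x)"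
      using x y(1)
      by (simp add: minus_eq smult_r_distr flip: smult_minus_one)
        (simp add: smult_r_distr mult.commute flip: smult_assoc)
    then show ?thesis using x y by (simp add: coset_eq_iff ideal_smult)
  qed
  moreover have "I +> x \<noteq> {}" using x a_rcos_self by blast
  ultimately show ?thesis by auto
qed

lemma alg_quot_kalg: "kalg (alg_quot A I)"
proof -
  have "ring (alg_quot A I)"
  proof -
    interpret Q: ring "A Quot I" by (rule quotient_is_ring)
    have "abelian_group (alg_quot A I)"
      by (rule abelian_groupI) (auto simp: Q.a_ac intro: Q.l_neg Q.add.inv_closed)
    moreover have "Group.monoid (alg_quot A I)"
      by (rule monoidI) (auto simp: Q.m_assoc)
    ultimately show ?thesis
      by (rule ringI) (auto simp: Q.l_distr Q.r_distr)
  qed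
  then show ?thesis
    by (intro kalg.intro kalg_axioms.intro)
      (auto elim!: Quot_cases simp: coset_smult coset_add coset_mult smult_closed smult_r_distr
        smult_l_distr smult_assoc smult_mult_l smult_mult_r simp del: alg_quot_simps(6))
qed

lemma coset_hom: "(+>) I \<in> alg_hom A (alg_quot A I)"
  unfolding alg_hom_def
  using rcos_ring_hom by (auto simp: coset_smult ring_hom_def simp del: alg_quot_simps(6))

end

lemma alg_hom_ring_hom_ring:
  assumes "kalg B" "h \<in> alg_hom A B"
  shows "ring_hom_ring A B h"
  using assms ring_axioms by (auto intro!: ring_hom_ringI2 simp: kalg_def alg_hom_def)

end

definition wf_rels :: "'g set \<Rightarrow> (('k::field, 'g) lincomb \<times> ('k, 'g) lincomb) set \<Rightarrow> bool" where
  "wf_rels X R \<longleftrightarrow> (\<forall>(l, r)\<in>R. \<forall>(c, u)\<in>set l \<union> set r. set u \<subseteq> X)"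

definition lc_ev :: "('k::field, 'b) module \<Rightarrow> ('g \<Rightarrow> 'b) \<Rightarrow> ('k, 'g) lincomb \<Rightarrow> 'b" where
  "lc_ev B \<rho> l = foldr (\<lambda>(c, u) b. (c \<odot>\<^bsub>B\<^esub> word_ev B \<rho> u) \<oplus>\<^bsub>B\<^esub> b) l \<zero>\<^bsub>B\<^esub>"

definition sat_rels ::
  "('k::field, 'b) module \<Rightarrow> ('g \<Rightarrow> 'b) \<Rightarrow> (('k, 'g) lincomb \<times> ('k, 'g) lincomb) set \<Rightarrow> bool" where
  "sat_rels B \<rho> R \<longleftrightarrow> (\<forall>(l, r)\<in>R. lc_ev B \<rho> l = lc_ev B \<rho> r)"

lemma lc_ev_simps [simp]:
  "lc_ev B \<rho> [] = \<zero>\<^bsub>B\<^esub>"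
  "lc_ev B \<rho> ((c, u) # l) = (c \<odot>\<^bsub>B\<^esub> word_ev B \<rho> u) \<oplus>\<^bsub>B\<^esub> lc_ev B \<rho> l"
  by (simp_all add: lc_ev_def)

lemma lc_Nil: "lc [] = (\<lambda>w. 0)" by (simp add: lc_def)

lemma lc_Cons: "lc ((c, u) # l) = (\<lambda>w. c * bv u w + lc l w)" by (simp add: lc_def)

lemma lc_free_alg:
  assumes "\<forall>(c, u)\<in>set l. set u \<subseteq> X"
  shows "lc l \<in> carrier (free_alg X)"
proof -
  interpret F: kalg "free_alg X" by (rule free_alg_kalg)
  show ?thesis using assms
  proof (induction l)
    case Nil
    then show ?case using F.zero_closed by (simp add: lc_Nil)
  next
    case (Cons a l)
    obtain c u where a: "a = (c, u)" by (cases a)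
    have "(c \<odot>\<^bsub>free_alg X\<^esub> bv u) \<oplus>\<^bsub>free_alg X\<^esub> lc l \<in> carrier (free_alg X)"
      using Cons a by (intro F.add.m_closed F.smult_closed) auto
    then show ?case by (simp add: a lc_Cons)
  qed
qed

context kalg
begin

context
  fixes X :: "'g set" and \<rho> :: "'g \<Rightarrow> 'a"
  assumes \<rho>: "\<And>g. g \<in> X \<Longrightarrow> \<rho> g \<in> carrier A"
begin

lemma lc_ev_closed:
  assumes "\<forall>(c, u)\<in>set l. set u \<subseteq> X"
  shows "lc_ev A \<rho> l \<in> carrier A"
  using assms \<rho> by (induction l) (auto intro!: add.m_closed smult_closed word_ev_closed[of X])

lemma free_ev_lc:
  assumes "\<forall>(c, u)\<in>set l. set u \<subseteq> X"
  shows "free_ev A \<rho> (lc l) = lc_ev A \<rho> l"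
  using assms
proof (induction l)
  case Nil
  then show ?case by (simp add: lc_Nil free_ev_def)
next
  case (Cons a l)
  interpret F: kalg "free_alg X :: ('k, _) module" by (rule free_alg_kalg)
  obtain c u where a: "a = (c, u)" by (cases a)
  have u: "set u \<subseteq> X" and l: "\<forall>(c, u)\<in>set l. set u \<subseteq> X" using Cons.prems a by auto
  have "(\<lambda>w. c * bv u w) \<in> carrier (free_alg X)"
    using F.smult_closed[OF bv_free_alg[OF u]] by simp
  then show ?case
    unfolding a lc_Cons
    by (subst free_ev_add[of X]) (use \<rho> u l Cons.IH in \<open>auto simp: lc_free_alg
        free_ev_smult[of X] free_ev_bv[of X]\<close>)
qed

context
  fixes R :: "(('k, 'g) lincomb \<times> ('k, 'g) lincomb) set"
  assumes wf: "wf_rels X R"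
begin

lemma rel_elems: "{\<lambda>w. lc l w - lc r w | l r. (l, r) \<in> R} \<subseteq> carrier (free_alg X)"
proof -
  interpret F: kalg "free_alg X :: ('k, _) module" by (rule free_alg_kalg)
  have "(\<lambda>w. lc l w - lc r w) \<in> carrier (free_alg X)" if "(l, r) \<in> R" for l r
  proof -
    have "\<forall>(c, u)\<in>set l. set u \<subseteq> X" "\<forall>(c, u)\<in>set r. set u \<subseteq> X"
      using wf that unfolding wf_rels_def by fast+
    then have "lc l \<oplus>\<^bsub>free_alg X\<^esub> ((-1) \<odot>\<^bsub>free_alg X\<^esub> lc r) \<in> carrier (free_alg X)"
      by (intro F.add.m_closed F.smult_closed lc_free_alg) auto
    then show ?thesis by simp
  qed
  then show ?thesis by auto
qed

lemma rel_ideal_ideal: "ideal (rel_ideal X R) (free_alg X)"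
proof -
  interpret F: kalg "free_alg X :: ('k, _) module" by (rule free_alg_kalg)
  show ?thesis unfolding rel_ideal_def by (rule F.genideal_ideal[OF rel_elems])
qed

lemma rel_ideal_ev:
  assumes "sat_rels A \<rho> R" "x \<in> rel_ideal X R"
  shows "free_ev A \<rho> x = \<zero>"
proof -
  interpret F: kalg "free_alg X :: ('k, _) module" by (rule free_alg_kalg)
  interpret h: ring_hom_ring "free_alg X" A "free_ev A \<rho>"
    by (rule F.alg_hom_ring_hom_ring[OF kalg_axioms free_ev_hom[OF \<rho>]])
  have "{\<lambda>w. lc l w - lc r w | l r. (l, r) \<in> R} \<subseteq> a_kernel (free_alg X) A (free_ev A \<rho>)"
  proof clarify
    fix l r assume lr: "(l, r) \<in> R"
    have w: "\<forall>(c, u)\<in>set l. set u \<subseteq> X" "\<forall>(c, u)\<in>set r. set u \<subseteq> X"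
      using wf lr unfolding wf_rels_def by fast+
    have e: "(\<lambda>w. lc l w - lc r w) = (\<lambda>w. lc l w + - 1 * lc r w)" by simp
    have m: "(\<lambda>w. -1 * lc r w) \<in> carrier (free_alg X)"
      using F.smult_closed[OF lc_free_alg[OF w(2)], of "-1"] by simp
    have "free_ev A \<rho> (\<lambda>w. lc l w - lc r w)
        = free_ev A \<rho> (lc l) \<oplus> free_ev A \<rho> (\<lambda>w. -1 * lc r w)"
      unfolding e by (rule free_ev_add[OF \<rho> lc_free_alg[OF w(1)] m])
    also have "\<dots> = lc_ev A \<rho> l \<oplus> (-1) \<odot> lc_ev A \<rho> r"
      by (simp only: free_ev_smult[OF \<rho> lc_free_alg[OF w(2)]] free_ev_lc[OF w(1)] free_ev_lc[OF w(2)])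
    also have "\<dots> = \<zero>"
      using assms(1) lr lc_ev_closed[OF w(1)] unfolding sat_rels_def
      by (auto simp: smult_minus_one r_neg)
    finally show "(\<lambda>w. lc l w - lc r w) \<in> a_kernel (free_alg X) A (free_ev A \<rho>)"
      using rel_elems lr unfolding a_kernel_def' by blast
  qed
  then have "rel_ideal X R \<subseteq> a_kernel (free_alg X) A (free_ev A \<rho>)"
    unfolding rel_ideal_def by (rule F.genideal_minimal[OF h.kernel_is_ideal])
  then show ?thesis using assms(2) unfolding a_kernel_def' by blast
qed

text \<open>\<open>free_ev\<close> kills the ideal, hence is constant on each coset; the image of a
  coset is a singleton and \<open>the_elem\<close> in \<open>pres_ev\<close> returns its only
  member.\<close>

lemma pres_ev_coset:
  assumes "sat_rels A \<rho> R" "x \<in> carrier (free_alg X)"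
  shows "pres_ev A \<rho> (rel_ideal X R +>\<^bsub>free_alg X\<^esub> x) = free_ev A \<rho> x"
proof -
  interpret F: kalg "free_alg X :: ('k, _) module" by (rule free_alg_kalg)
  interpret h: ring_hom_ring "free_alg X" A "free_ev A \<rho>"
    by (rule F.alg_hom_ring_hom_ring[OF kalg_axioms free_ev_hom[OF \<rho>]])
  have "free_ev A \<rho> y = free_ev A \<rho> x" if y: "y \<in> rel_ideal X R +>\<^bsub>free_alg X\<^esub> x" for y
  proof -
    obtain i where i: "i \<in> rel_ideal X R" "y = i \<oplus>\<^bsub>free_alg X\<^esub> x"
      using y by (auto simp: a_r_coset_def')
    have ic: "i \<in> carrier (free_alg X)"
      using ideal.Icarr[OF rel_ideal_ideal i(1)] .
    show ?thesis
      unfolding i(2) h.hom_add[OF ic assms(2)] rel_ideal_ev[OF assms(1) i(1)]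
      using h.hom_closed[OF assms(2)] by simp
  qed
  moreover have "x \<in> rel_ideal X R +>\<^bsub>free_alg X\<^esub> x"
    using additive_subgroup.zero_closed[OF ideal.axioms(1)[OF rel_ideal_ideal]] assms(2)
    by (force simp: a_r_coset_def')
  ultimately have "free_ev A \<rho> ` (rel_ideal X R +>\<^bsub>free_alg X\<^esub> x) = {free_ev A \<rho> x}" by blast
  then show ?thesis by (simp add: pres_ev_def)
qed

lemma pres_alg_kalg: "kalg (pres_alg X R)"
  unfolding pres_alg_def by (rule kalg.alg_quot_kalg[OF free_alg_kalg rel_ideal_ideal])

lemma pres_alg_cases:
  assumes "Y \<in> carrier (pres_alg X R)"
  obtains x where "x \<in> carrier (free_alg X)" "Y = rel_ideal X R +>\<^bsub>free_alg X\<^esub> x"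
  using assms kalg.Quot_cases[OF free_alg_kalg rel_ideal_ideal] unfolding pres_alg_def
  by (metis alg_quot_simps(1))

lemma coset_in_pres_alg:
  "x \<in> carrier (free_alg X) \<Longrightarrow> rel_ideal X R +>\<^bsub>free_alg X\<^esub> x \<in> carrier (pres_alg X R)"
  using kalg.coset_in_Quot[OF free_alg_kalg rel_ideal_ideal] by (simp add: pres_alg_def)

lemma coset_hom_pres: "(+>\<^bsub>free_alg X\<^esub>) (rel_ideal X R) \<in> alg_hom (free_alg X) (pres_alg X R)"
  unfolding pres_alg_def by (rule kalg.coset_hom[OF free_alg_kalg rel_ideal_ideal])

lemma pres_ev_hom:
  assumes "sat_rels A \<rho> R"
  shows "pres_ev A \<rho> \<in> alg_hom (pres_alg X R) A"
proof -
  interpret F: kalg "free_alg X :: ('k, _) module" by (rule free_alg_kalg)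
  note h = free_ev_hom[of X \<rho>, OF \<rho>] and c = coset_hom_pres
  note ce = pres_ev_coset[OF assms]
  have c': "(+>\<^bsub>free_alg X\<^esub>) (rel_ideal X R) \<in> ring_hom (free_alg X) (pres_alg X R)"
    using c by (simp add: alg_hom_def)
  have h': "free_ev A \<rho> \<in> ring_hom (free_alg X) A" using h by (simp add: alg_hom_def)
  show ?thesis unfolding alg_hom_def
  proof (intro CollectI conjI ring_hom_memI allI ballI)
    fix Y assume Y: "Y \<in> carrier (pres_alg X R)"
    then obtain y where y: "y \<in> carrier (free_alg X)" "Y = rel_ideal X R +>\<^bsub>free_alg X\<^esub> y"
      by (rule pres_alg_cases)
    show "pres_ev A \<rho> Y \<in> carrier A"
      using y by (simp add: ce free_ev_closed[OF \<rho>])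
    show "pres_ev A \<rho> (a \<odot>\<^bsub>pres_alg X R\<^esub> Y) = a \<odot> pres_ev A \<rho> Y" for a
      unfolding y(2) alg_hom_smult[OF c y(1), symmetric] ce[OF F.smult_closed[OF y(1)]] ce[OF y(1)]
      by (rule alg_hom_smult[OF h y(1)])
    fix Z assume "Z \<in> carrier (pres_alg X R)"
    then obtain z where z: "z \<in> carrier (free_alg X)" "Z = rel_ideal X R +>\<^bsub>free_alg X\<^esub> z"
      by (rule pres_alg_cases)
    show "pres_ev A \<rho> (Y \<otimes>\<^bsub>pres_alg X R\<^esub> Z) = pres_ev A \<rho> Y \<otimes> pres_ev A \<rho> Z"
      unfolding y(2) z(2) ring_hom_mult[OF c' y(1) z(1), symmetric]
        ce[OF F.m_closed[OF y(1) z(1)]] ce[OF y(1)] ce[OF z(1)]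
      by (rule ring_hom_mult[OF h' y(1) z(1)])
    show "pres_ev A \<rho> (Y \<oplus>\<^bsub>pres_alg X R\<^esub> Z) = pres_ev A \<rho> Y \<oplus> pres_ev A \<rho> Z"
      unfolding y(2) z(2) ring_hom_add[OF c' y(1) z(1), symmetric]
        ce[OF F.add.m_closed[OF y(1) z(1)]] ce[OF y(1)] ce[OF z(1)]
      by (rule ring_hom_add[OF h' y(1) z(1)])
  next
    show "pres_ev A \<rho> \<one>\<^bsub>pres_alg X R\<^esub> = \<one>"
      unfolding ring_hom_one[OF c', symmetric] ce[OF F.one_closed] by (rule ring_hom_one[OF h'])
  qed
qed

lemma pres_ev_gen:
  assumes "sat_rels A \<rho> R" "g \<in> X"
  shows "pres_ev A \<rho> (pres_gen X R g) = \<rho> g"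
  using assms \<rho> unfolding pres_gen_def
  by (simp add: pres_ev_coset[OF assms(1)] free_ev_bv[OF \<rho>])

end

end

end

subsection \<open>Endomorphism algebras\<close>

lemma vec_closed [simp, intro]:
  "(\<lambda>i. 0) \<in> vec I"
  "x \<in> vec I \<Longrightarrow> y \<in> vec I \<Longrightarrow> (\<lambda>i. x i + y i) \<in> vec I"
  "x \<in> vec I \<Longrightarrow> (\<lambda>i. c * x i) \<in> vec I"
  by (auto simp: vec_def)

lemma bv_vec [simp, intro]: "i \<in> I \<Longrightarrow> bv i \<in> vec I"
  by (auto simp: vec_def bv_def)

lemma endo_simps [simp]:
  "mult (endo I) f g = compose (vec I) f g"
  "one (endo I) = (\<lambda>x\<in>vec I. x)"
  "zero (endo I) = (\<lambda>x\<in>vec I. \<lambda>i. 0)"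
  "add (endo I) f g = (\<lambda>x\<in>vec I. \<lambda>i. f x i + g x i)"
  "smult (endo I) c f = (\<lambda>x\<in>vec I. \<lambda>i. c * f x i)"
  by (simp_all add: endo_def)

lemma endo_carrier:
  "f \<in> carrier (endo I) \<longleftrightarrow> f \<in> vec I \<rightarrow>\<^sub>E vec I \<and>
     (\<forall>x\<in>vec I. \<forall>y\<in>vec I. f (\<lambda>i. x i + y i) = (\<lambda>i. f x i + f y i)) \<and>
     (\<forall>c. \<forall>x\<in>vec I. f (\<lambda>i. c * x i) = (\<lambda>i. c * f x i))"
  by (simp add: endo_def)

lemma endo_vec: "f \<in> carrier (endo I) \<Longrightarrow> x \<in> vec I \<Longrightarrow> f x \<in> vec I"
  by (auto simp: endo_carrier)

lemma endo_add: "f \<in> carrier (endo I) \<Longrightarrow> x \<in> vec I \<Longrightarrow> y \<in> vec I \<Longrightarrow>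
    f (\<lambda>i. x i + y i) = (\<lambda>i. f x i + f y i)"
  by (auto simp: endo_carrier)

lemma endo_smult: "f \<in> carrier (endo I) \<Longrightarrow> x \<in> vec I \<Longrightarrow> f (\<lambda>i. c * x i) = (\<lambda>i. c * f x i)"
  by (auto simp: endo_carrier)

lemma endo_eqI:
  assumes "f \<in> carrier (endo I)" "g \<in> carrier (endo I)" "\<And>x. x \<in> vec I \<Longrightarrow> f x = g x"
  shows "f = g"
  using assms by (auto simp: endo_carrier intro: PiE_ext)

lemma endo_kalg:
  fixes I :: "'a set"
  shows "kalg (endo I :: ('b::field, ('a \<Rightarrow> 'b) \<Rightarrow> ('a \<Rightarrow> 'b)) module)"
proof -
  let ?E = "endo I :: ('b, ('a \<Rightarrow> 'b) \<Rightarrow> ('a \<Rightarrow> 'b)) module"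
  have ext: "f = g" if "f \<in> extensional (vec I)" "g \<in> extensional (vec I)"
    "\<And>x i. x \<in> vec I \<Longrightarrow> f x i = g x i" for f g :: "('a \<Rightarrow> 'b) \<Rightarrow> ('a \<Rightarrow> 'b)"
    using that by (intro extensionalityI[of _ "vec I"]) auto
  have cl: "(\<lambda>x\<in>vec I. \<lambda>i. f x i + g x i) \<in> carrier (endo I)"
    if "f \<in> carrier (endo I)" "g \<in> carrier (endo I)" for f g :: "('a \<Rightarrow> 'b) \<Rightarrow> ('a \<Rightarrow> 'b)"
    using that by (auto simp: endo_carrier PiE_iff algebra_simps)
  have sm: "(\<lambda>x\<in>vec I. \<lambda>i. c * f x i) \<in> carrier (endo I)"
    if "f \<in> carrier (endo I)" for f :: "('a \<Rightarrow> 'b) \<Rightarrow> ('a \<Rightarrow> 'b)" and c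
    using that by (auto simp: endo_carrier PiE_iff algebra_simps)
  have mu: "compose (vec I) f g \<in> carrier (endo I)"
    if "f \<in> carrier (endo I)" "g \<in> carrier (endo I)" for f g :: "('a \<Rightarrow> 'b) \<Rightarrow> ('a \<Rightarrow> 'b)"
    using that by (auto simp: endo_carrier PiE_iff compose_def)
  have E: "f \<in> extensional (vec I)" if "f \<in> carrier (endo I)" for f :: "('a \<Rightarrow> 'b) \<Rightarrow> ('a \<Rightarrow> 'b)"
    using that by (auto simp: endo_carrier PiE_iff)
  have "ring ?E"
  proof (rule ringI)
    show "abelian_group ?E"
    proof (rule abelian_groupI)
      fix f :: "('a \<Rightarrow> 'b) \<Rightarrow> ('a \<Rightarrow> 'b)" assume f: "f \<in> carrier ?E"
      show "\<zero>\<^bsub>?E\<^esub> \<oplus>\<^bsub>?E\<^esub> f = f"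
        by (rule ext) (use E[OF f] in auto)
      show "\<exists>g\<in>carrier ?E. g \<oplus>\<^bsub>?E\<^esub> f = \<zero>\<^bsub>?E\<^esub>"
        by (rule bexI[OF _ sm[OF f, of "-1"]]) (rule ext, auto)
    qed (auto simp: cl E intro!: ext, auto simp: endo_carrier PiE_iff add_ac)
    show "Group.monoid ?E"
    proof (rule monoidI)
      fix f :: "('a \<Rightarrow> 'b) \<Rightarrow> ('a \<Rightarrow> 'b)" assume f: "f \<in> carrier ?E"
      show "\<one>\<^bsub>?E\<^esub> \<otimes>\<^bsub>?E\<^esub> f = f"
        by (rule ext) (use E[OF f] endo_vec[OF f] in \<open>auto simp: compose_def\<close>)
      show "f \<otimes>\<^bsub>?E\<^esub> \<one>\<^bsub>?E\<^esub> = f"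
        by (rule ext) (use E[OF f] in \<open>auto simp: compose_def\<close>)
    qed (auto simp: mu intro!: ext, auto simp: endo_carrier PiE_iff compose_def)
  qed (auto intro!: ext simp: compose_def endo_add endo_vec)
  then show ?thesis
    by (intro kalg.intro kalg_axioms.intro)
      (auto simp: sm compose_def endo_vec endo_smult algebra_simps intro: E intro!: ext restrict_extensional)
qed

text \<open>Members of \<open>endo I\<close> are only known to be additive and homogeneous; over a
  finite index set this is the passage to matrix entries.\<close>

lemma endo_expand:
  fixes f :: "('i \<Rightarrow> 'k::field) \<Rightarrow> ('i \<Rightarrow> 'k)"
  assumes f: "f \<in> carrier (endo I)" and I: "finite I" and x: "x \<in> vec I"
  shows "f x = (\<lambda>j. \<Sum>i\<in>I. x i * f (bv i) j)"
proof -
  have *: "f (\<lambda>k. \<Sum>i\<in>J. x i * bv i k) = (\<lambda>j. \<Sum>i\<in>J. x i * f (bv i) j) \<and> (\<lambda>k. \<Sum>i\<in>J. x i * bv i k) \<in> vec I"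
    if "finite J" "J \<subseteq> I" for J
    using that
  proof (induction J rule: finite_induct)
    case empty
    show ?case using endo_smult[OF f, of "\<lambda>i. 0" 0] by simp
  next
    case (insert i J)
    then show ?case
      using endo_add[OF f, of "\<lambda>k. x i * bv i k" "\<lambda>k. \<Sum>i\<in>J. x i * bv i k"]
      by (simp add: endo_smult[OF f])
  qed
  have "(\<lambda>k. \<Sum>i\<in>I. x i * bv i k) = x"
  proof
    fix k show "(\<Sum>i\<in>I. x i * bv i k) = x k"
      using x I by (auto simp: bv_def vec_def if_distrib cong: if_cong)
  qed
  then show ?thesis using *[OF I] by simp
qed

lemma lin_op_closed:
  assumes "\<And>i. i \<in> I \<Longrightarrow> \<phi> i \<in> vec I"
  shows "lin_op I \<phi> \<in> carrier (endo I)"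
  using assms
  by (auto simp: endo_carrier lin_op_def vec_def algebra_simps sum.distrib sum_distrib_left)


section \<open>Operators on functions of words\<close>

text \<open>The component of a tensor along the first letter \<open>a\<close>. A tensor power is
  \<open>V\<close> tensored with the next smaller one, so peeling off letters with \<open>sl\<close>
  permits induction on words with \<open>x\<close> arbitrary.\<close>

definition sl :: "'a \<Rightarrow> ('a list \<Rightarrow> 'k) \<Rightarrow> 'a list \<Rightarrow> 'k" where
  "sl a x = (\<lambda>u. x (a # u))"

text \<open>The eigenvalue, on a word, of a group-like element that scales each letter
  \<open>a\<close> by \<open>t powi m a\<close>.\<close>

primrec pw :: "'k::field \<Rightarrow> ('a \<Rightarrow> int) \<Rightarrow> 'a list \<Rightarrow> 'k" where
  "pw t m [] = 1"
| "pw t m (a # u) = t powi m a * pw t m u"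

definition PW :: "'k::field \<Rightarrow> ('a \<Rightarrow> int) \<Rightarrow> ('a list \<Rightarrow> 'k) \<Rightarrow> 'a list \<Rightarrow> 'k" where
  "PW t m x = (\<lambda>u. pw t m u * x u)"

text \<open>
  If \<open>X\<close> is the matrix unit sending the letter \<open>p'\<close> to \<open>p\<close>, then \<open>H t m m' p p'\<close> acts on words
  through the iterated coproduct \<open>X \<mapsto> X \<otimes> t\<^sup>m + t\<^sup>m\<^sup>' \<otimes> X\<close>; a function \<open>x\<close> on words stands
  for the vector with coordinates \<open>x u\<close>.
\<close>

primrec H_at ::
  "'k::field \<Rightarrow> ('a \<Rightarrow> int) \<Rightarrow> ('a \<Rightarrow> int) \<Rightarrow> 'a \<Rightarrow> 'a \<Rightarrow> 'a list \<Rightarrow> ('a list \<Rightarrow> 'k) \<Rightarrow> 'k" where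
  "H_at t m m' p p' [] x = 0"
| "H_at t m m' p p' (a # u) x =
     t powi m' a * H_at t m m' p p' u (sl a x) + (if a = p then pw t m u * x (p' # u) else 0)"

definition H ::
  "'k::field \<Rightarrow> ('a \<Rightarrow> int) \<Rightarrow> ('a \<Rightarrow> int) \<Rightarrow> 'a \<Rightarrow> 'a \<Rightarrow> ('a list \<Rightarrow> 'k) \<Rightarrow> 'a list \<Rightarrow> 'k" where
  "H t m m' p p' x = (\<lambda>u. H_at t m m' p p' u x)"

lemma sl_lambda [simp]:
  "sl a (\<lambda>u. x u + y u) = (\<lambda>u. sl a x u + sl a y u)"
  "sl a (\<lambda>u. x u - y u) = (\<lambda>u. sl a x u - sl a y u)"
  "sl a (\<lambda>u. c * x u) = (\<lambda>u. c * sl a x u)"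
  "sl a (\<lambda>u. pw t m u * x u) = (\<lambda>u. t powi m a * (pw t m u * sl a x u))"
  "sl a (\<lambda>u. 0) = (\<lambda>u. 0)"
  "x (a # u) = sl a x u"
  by (simp_all add: sl_def mult.assoc)

declare sl_lambda(6) [simp del]

lemma H_Nil [simp]: "H t m m' p p' x [] = 0"
  by (simp add: H_def)

lemma sl_H: "sl a (H t m m' p p' x)
    = (\<lambda>u. t powi m' a * H t m m' p p' (sl a x) u + (if a = p then pw t m u * sl p' x u else 0))"
  by (simp add: H_def sl_def cong: if_cong)

lemma H_Cons: "H t m m' p p' x (a # u)
    = t powi m' a * H t m m' p p' (sl a x) u + (if a = p then pw t m u * sl p' x u else 0)"
  by (simp add: H_def sl_def)

lemma H_add: "H t m m' p p' (\<lambda>u. x u + y u) = (\<lambda>u. H t m m' p p' x u + H t m m' p p' y u)"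
proof
  show "H t m m' p p' (\<lambda>u. x u + y u) u = H t m m' p p' x u + H t m m' p p' y u" for u
    by (induction u arbitrary: x y) (auto simp: H_Cons algebra_simps)
qed

lemma H_scale: "H t m m' p p' (\<lambda>u. c * x u) = (\<lambda>u. c * H t m m' p p' x u)"
proof
  show "H t m m' p p' (\<lambda>u. c * x u) u = c * H t m m' p p' x u" for u
    by (induction u arbitrary: x) (auto simp: H_Cons algebra_simps)
qed

lemma H_zero: "H t m m' p p' (\<lambda>u. 0) = (\<lambda>u. 0)"
  using H_scale[of t m m' p p' 0 "\<lambda>u. 0"] by simp

text \<open>\<open>H\<close> reads \<open>x\<close> at words in which one letter \<open>p\<close> is
  replaced by \<open>p'\<close>; such a replacement multiplies the weight \<open>pw t n\<close> by
  \<open>t powi (n p' - n p)\<close>.\<close>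

lemma H_pw:
  assumes t: "t \<noteq> 0"
  shows "H t m m' p p' (\<lambda>u. pw t n u * x u)
    = (\<lambda>u. t powi (n p' - n p) * (pw t n u * H t m m' p p' x u))"
proof
  show "H t m m' p p' (\<lambda>u. pw t n u * x u) u
      = t powi (n p' - n p) * (pw t n u * H t m m' p p' x u)" for u
  proof (induction u arbitrary: x)
    case (Cons a u)
    have "t powi n p' = t powi (n p' - n p) * t powi n p"
      using t by (simp flip: power_int_add)
    then show ?case by (simp add: H_Cons H_scale Cons.IH cong: if_cong) (simp add: algebra_simps)
  qed simp
qed

text \<open>The inequalities say that the two matrix units have zero product in either order, so
  only the terms acting on different letters remain. The two equations say that the twisting factors
  of these cross terms agree, according to which operator acts on the earlier letter.\<close>

lemma H_commute:
  assumes t: "t \<noteq> 0" and "p1' \<noteq> p2" "p2' \<noteq> p1"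
    and 1: "m2' p1' + m1 p2 = m2' p1 + m1 p2'"
    and 2: "m1' p2 + m2 p1' = m1' p2' + m2 p1"
  shows "H t m1 m1' p1 p1' (H t m2 m2' p2 p2' x) = H t m2 m2' p2 p2' (H t m1 m1' p1 p1' x)"
proof
  fix u
  have 1: "t powi m2' p1' = t powi m2' p1 * t powi (m1 p2' - m1 p2)"
    using t 1 by (subst power_int_add[symmetric]) (auto intro: arg_cong[of _ _ "power_int t"])
  have 2: "t powi m1' p2' = t powi m1' p2 * t powi (m2 p1' - m2 p1)"
    using t 2 by (subst power_int_add[symmetric]) (auto intro: arg_cong[of _ _ "power_int t"])
  show "H t m1 m1' p1 p1' (H t m2 m2' p2 p2' x) u = H t m2 m2' p2 p2' (H t m1 m1' p1 p1' x) u"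
  proof (induction u arbitrary: x)
    case (Cons a u)
    show ?case
      using assms(2,3) 1 2 Cons.IH[of "sl a x"]
      by (cases "a = p1"; cases "a = p2") (simp_all add: H_Cons sl_H H_add H_scale H_pw[OF t] H_zero cong: if_cong, simp_all add: algebra_simps)
  qed simp
qed

lemma PW_H_commute:
  assumes "t \<noteq> 0"
  shows "PW t n (H t m m' p p' x) = (\<lambda>u. t powi (n p - n p') * H t m m' p p' (PW t n x) u)"
proof
  fix u
  have "t powi (n p - n p') * t powi (n p' - n p) = 1"
    using assms by (simp flip: power_int_add)
  then show "PW t n (H t m m' p p' x) u = t powi (n p - n p') * H t m m' p p' (PW t n x) u"
    unfolding PW_def H_pw[OF assms] by (metis mult.assoc mult_1)
qed

lemma pw_add:
  assumes "t \<noteq> 0"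
  shows "pw t (\<lambda>a. m a + n a) u = pw t m u * pw t n u"
  using assms by (induction u) (auto simp: power_int_add)

lemma pw_zero [simp]: "pw t (\<lambda>a. 0) u = 1"
  by (induction u) auto

lemma pw_minus:
  assumes "t \<noteq> 0"
  shows "pw t (\<lambda>a. - m a) u = inverse (pw t m u)"
  using assms by (induction u) (auto simp: power_int_minus)

text \<open>The right side is the quantum integer [k] = (k - k^-1) / (t - t^-1) of the weight k of
  the word. On adding a letter the cross terms of the commutator cancel, and the rest is the
  addition rule for quantum integers.\<close>

lemma H_EF:
  assumes t: "t \<noteq> 0" and "p \<noteq> p'" and m: "m p = 1" "m p' = -1" and t2: "t - inverse t \<noteq> 0"
    and m0: "\<And>a. a \<noteq> p \<Longrightarrow> a \<noteq> p' \<Longrightarrow> m a = 0"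
  shows "H t m (\<lambda>_. 0) p p' (H t (\<lambda>_. 0) (\<lambda>a. - m a) p' p x) u
      - H t (\<lambda>_. 0) (\<lambda>a. - m a) p' p (H t m (\<lambda>_. 0) p p' x) u
    = (pw t m u - pw t (\<lambda>a. - m a) u) / (t - inverse t) * x u"
proof (induction u arbitrary: x)
  case (Cons a u)
  let ?E = "H t m (\<lambda>_. 0) p p'" and ?F = "H t (\<lambda>_. 0) (\<lambda>a. - m a) p' p"
  have IH: "?E (?F y) u = ?F (?E y) u + (pw t m u - inverse (pw t m u)) / (t - inverse t) * y u" for y
    using Cons[of y] by (simp add: pw_minus[OF t] algebra_simps)
  have xe: "x (a # u) = sl a x u" for a by (simp add: sl_def)
  note s = H_Cons sl_H H_add H_scale H_pw[OF t] H_zero xe pw_minus[OF t]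
  consider "a = p" | "a = p'" | "a \<noteq> p" "a \<noteq> p'" by auto
  then show ?case
  proof cases
    case 1
    \<comment> \<open>With k the weight of the tail, this case is the identity t^-1 [k] + k = [t k];
      \<open>D\<close> avoids divisions during rewriting.\<close>
    define k D where "k = pw t m u" and "D = inverse (t - inverse t)"
    have e: "?E (?F x) (p # u) = inverse t * ?E (?F (sl p x)) u + k * (t * ?F (sl p' x) u + sl p x u)"
      "?F (?E x) (p # u) = inverse t * (?F (?E (sl p x)) u + t * t * (k * ?F (sl p' x) u))"
      using m \<open>p \<noteq> p'\<close> by (simp_all add: s power_int_minus k_def power2_eq_square cong: if_cong)
    have D: "D * (t - inverse t) = 1" "inverse t * t = 1" using t2 t by (simp_all add: D_def)
    have "k * sl p x u * (D * (t - inverse t)) = k * sl p x u" using D by simp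
    then have "inverse t * ((k - inverse k) * D * sl p x u) + k * sl p x u
        = (t * k - inverse t * inverse k) * D * sl p x u"
      by (simp only: right_diff_distrib left_diff_distrib) (simp add: mult_ac diff_eq_eq add.commute)
    moreover have "inverse t * ef + k * (t * f + X) - inverse t * (fe + t * t * (k * f))
        = inverse t * (ef - fe) + k * X" for ef fe f X
      using t by (simp add: field_simps)
    ultimately show ?thesis
      unfolding 1 e IH using m
      by (simp add: xe[of p] pw_minus[OF t] power_int_minus divide_inverse flip: k_def D_def)
  next
    case 2
    \<comment> \<open>Here the identity is t [k] - k = [t^-1 k].\<close>
    define k D where "k = pw t m u" and "D = inverse (t - inverse t)"
    have e: "?E (?F x) (p' # u) = t * ?E (?F (sl p' x)) u + ?E (sl p x) u"
      "?F (?E x) (p' # u) = t * ?F (?E (sl p' x)) u + (?E (sl p x) u + k * sl p' x u)"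
      using m \<open>p \<noteq> p'\<close> by (simp_all add: s power_int_minus k_def cong: if_cong)
    have D: "D * (t - inverse t) = 1" using t2 by (simp add: D_def)
    have "k * sl p' x u * (D * (t - inverse t)) = k * sl p' x u" using D by simp
    then have "t * ((k - inverse k) * D * sl p' x u) - k * sl p' x u
        = (inverse t * k - t * inverse k) * D * sl p' x u"
      by (simp only: right_diff_distrib left_diff_distrib) (simp add: mult_ac diff_eq_eq add.commute)
    moreover have *: "t * (fe + z) + f - (t * fe + (f + X)) = t * z - X" for z fe f X
      by (simp add: algebra_simps)
    ultimately show ?thesis
      unfolding 2 e IH * using m
      by (simp only: xe pw.simps pw_minus[OF t] power_int_minus divide_inverse flip: k_def D_def) simp
  next
    case 3
    then show ?thesis using m0[of a]
      by (simp add: s IH cong: if_cong)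
  qed
qed simp

text \<open>\<open>A\<close> and \<open>B\<close> belong to neighbouring simple roots with letters
  \<open>a1\<close>, \<open>a2\<close>, \<open>a3\<close>. The rules \<open>s\<close> move them past
  the first letter and past weight factors; the Serre expression on the tail vanishes by induction,
  and the remaining terms are compared as polynomials in t and t^-1.\<close>

lemma H_Serre_E:
  assumes t: "t \<noteq> 0" and d: "a1 \<noteq> a2" "a2 \<noteq> a3" "a1 \<noteq> a3"
    and m: "m a1 = 1" "m a2 = -1" "m a3 = 0" and n: "n a1 = 0" "n a2 = 1" "n a3 = -1"
  defines "A \<equiv> H t m (\<lambda>_. 0) a1 a2" and "B \<equiv> H t n (\<lambda>_. 0) a2 a3"
  shows "A (A (B x)) u + B (A (A x)) u = (t + inverse t) * A (B (A x)) u"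
    and "B (B (A x)) u + A (B (B x)) u = (t + inverse t) * B (A (B x)) u"
proof -
  have s: "A y (a # u) = A (sl a y) u + (if a = a1 then pw t m u * sl a2 y u else 0)"
    "B y (a # u) = B (sl a y) u + (if a = a2 then pw t n u * sl a3 y u else 0)"
    "sl a (A y) = (\<lambda>u. A (sl a y) u + (if a = a1 then pw t m u * sl a2 y u else 0))"
    "sl a (B y) = (\<lambda>u. B (sl a y) u + (if a = a2 then pw t n u * sl a3 y u else 0))"
    "A (\<lambda>u. y u + z u) = (\<lambda>u. A y u + A z u)" "B (\<lambda>u. y u + z u) = (\<lambda>u. B y u + B z u)"
    "A (\<lambda>u. c * y u) = (\<lambda>u. c * A y u)" "B (\<lambda>u. c * y u) = (\<lambda>u. c * B y u)"
    "A (\<lambda>u. pw t m u * y u) = (\<lambda>u. inverse t * (inverse t * (pw t m u * A y u)))"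
    "A (\<lambda>u. pw t n u * y u) = (\<lambda>u. t * (pw t n u * A y u))"
    "B (\<lambda>u. pw t m u * y u) = (\<lambda>u. t * (pw t m u * B y u))"
    "B (\<lambda>u. pw t n u * y u) = (\<lambda>u. inverse t * (inverse t * (pw t n u * B y u)))"
    for y z c u a
    using d m n
    by (simp_all add: A_def B_def H_Cons sl_H H_add H_scale H_pw[OF t] power_int_minus power2_eq_square mult.assoc)
  show "A (A (B x)) u + B (A (A x)) u = (t + inverse t) * A (B (A x)) u"
  proof (induction u arbitrary: x)
    case (Cons a u)
    have IH: "A (A (B y)) u = (t + inverse t) * A (B (A y)) u - B (A (A y)) u" for y
      using Cons[of y] by (simp add: algebra_simps)
    consider "a = a1" | "a = a2" | "a = a3" | "a \<noteq> a1" "a \<noteq> a2" "a \<noteq> a3" by auto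
    then show ?case
      by cases (use d t in \<open>simp_all add: s IH cong: if_cong\<close>, simp_all add: field_simps)
  qed (simp add: A_def B_def)
  show "B (B (A x)) u + A (B (B x)) u = (t + inverse t) * B (A (B x)) u"
  proof (induction u arbitrary: x)
    case (Cons a u)
    have IH: "B (B (A y)) u = (t + inverse t) * B (A (B y)) u - A (B (B y)) u" for y
      using Cons[of y] by (simp add: algebra_simps)
    consider "a = a1" | "a = a2" | "a = a3" | "a \<noteq> a1" "a \<noteq> a2" "a \<noteq> a3" by auto
    then show ?case
      by cases (use d t in \<open>simp_all add: s IH cong: if_cong\<close>, simp_all add: field_simps)
  qed (simp add: A_def B_def)
qed

text \<open>For the lowering operators the twist sits on the left tensor factor, so it enters as a
  scalar for the first letter and no weight of the tail appears.\<close>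

lemma H_Serre_F:
  assumes t: "t \<noteq> 0" and d: "a1 \<noteq> a2" "a2 \<noteq> a3" "a1 \<noteq> a3"
    and m: "m a1 = 1" "m a2 = -1" "m a3 = 0" and n: "n a1 = 0" "n a2 = 1" "n a3 = -1"
  defines "A \<equiv> H t (\<lambda>_. 0) (\<lambda>a. - m a) a2 a1" and "B \<equiv> H t (\<lambda>_. 0) (\<lambda>a. - n a) a3 a2"
  shows "A (A (B x)) u + B (A (A x)) u = (t + inverse t) * A (B (A x)) u"
    and "B (B (A x)) u + A (B (B x)) u = (t + inverse t) * B (A (B x)) u"
proof -
  have s: "A y (a # u) = t powi (- m a) * A (sl a y) u + (if a = a2 then sl a1 y u else 0)"
    "B y (a # u) = t powi (- n a) * B (sl a y) u + (if a = a3 then sl a2 y u else 0)"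
    "sl a (A y) = (\<lambda>u. t powi (- m a) * A (sl a y) u + (if a = a2 then sl a1 y u else 0))"
    "sl a (B y) = (\<lambda>u. t powi (- n a) * B (sl a y) u + (if a = a3 then sl a2 y u else 0))"
    "A (\<lambda>u. y u + z u) = (\<lambda>u. A y u + A z u)" "B (\<lambda>u. y u + z u) = (\<lambda>u. B y u + B z u)"
    "A (\<lambda>u. c * y u) = (\<lambda>u. c * A y u)" "B (\<lambda>u. c * y u) = (\<lambda>u. c * B y u)"
    for y z c u a
    using d m n
    by (simp_all add: A_def B_def H_Cons sl_H H_add H_scale cong: if_cong)
  show "A (A (B x)) u + B (A (A x)) u = (t + inverse t) * A (B (A x)) u"
  proof (induction u arbitrary: x)
    case (Cons a u)
    have IH: "A (A (B y)) u = (t + inverse t) * A (B (A y)) u - B (A (A y)) u" for y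
      using Cons[of y] by (simp add: algebra_simps)
    consider "a = a1" | "a = a2" | "a = a3" | "a \<noteq> a1" "a \<noteq> a2" "a \<noteq> a3" by auto
    then show ?case
      by cases (use d t m n in \<open>simp_all add: s IH power_int_minus cong: if_cong\<close>, simp_all add: field_simps)
  qed (simp add: A_def B_def)
  show "B (B (A x)) u + A (B (B x)) u = (t + inverse t) * B (A (B x)) u"
  proof (induction u arbitrary: x)
    case (Cons a u)
    have IH: "B (B (A y)) u = (t + inverse t) * B (A (B y)) u - A (B (B y)) u" for y
      using Cons[of y] by (simp add: algebra_simps)
    consider "a = a1" | "a = a2" | "a = a3" | "a \<noteq> a1" "a \<noteq> a2" "a \<noteq> a3" by auto
    then show ?case
      by cases (use d t m n in \<open>simp_all add: s IH power_int_minus cong: if_cong\<close>, simp_all add: field_simps)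
  qed (simp add: A_def B_def)
qed


section \<open>The action of the quantum group on tensor powers\<close>

lemma q_ne_0 [simp]: "q \<noteq> 0"
  by (simp add: q_def Zero_fract_def eq_fract)

lemma q_power: "q ^ n = Fract (monom 1 n) 1"
proof (induction n)
  case 0
  then show ?case by (simp add: One_fract_def)
next
  case (Suc n)
  have "[:0, 1:] = (monom 1 1 :: complex poly)" by (simp add: monom_altdef)
  then show ?case using Suc by (simp add: q_def mult_monom)
qed

lemma q_power_eq_1: "q ^ n = 1 \<Longrightarrow> n = 0"
  by (simp add: q_power One_fract_def eq_fract)
    (metis degree_1 degree_monom_eq one_neq_zero)

lemma q_powi_eq_1: "q powi k = 1 \<longleftrightarrow> k = 0"
proof
  assume k: "q powi k = 1"
  have "q ^ nat \<bar>k\<bar> = 1"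
  proof (cases "k \<ge> 0")
    case True
    then show ?thesis using k by (simp add: power_int_def)
  next
    case False
    then show ?thesis using k by (simp add: power_int_def power_inverse)
  qed
  then show "k = 0" using q_power_eq_1 by force
qed simp

text \<open>\<open>q\<close> is not a root of unity, so integer weights can be read off from the
  eigenvalues of the group-like generators.\<close>

lemma q_powi_inj: "q powi k = q powi l \<longleftrightarrow> k = l"
proof
  assume "q powi k = q powi l"
  then have "q powi (k - l) = 1" by (simp add: power_int_diff)
  then show "k = l" by (simp add: q_powi_eq_1)
qed simp

lemma q_minus_inverse_ne_0 [simp]: "q - inverse q \<noteq> 0"
  using q_powi_inj[of 1 "-1"] by (simp add: power_int_minus)

lemma sum_list_all_zero: "(\<And>a. a \<in> set l \<Longrightarrow> f a = 0) \<Longrightarrow> (\<Sum>a\<leftarrow>l. f a) = (0 :: 'k :: comm_monoid_add)"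
  by (induction l) auto

subsection \<open>Restricting total operators\<close>

text \<open>Members of \<open>endo I\<close> are extensional, which is awkward under composition.
  Operators on all functions are composed freely, and only the resulting words of operators are
  restricted to \<open>vec I\<close>.\<close>

definition total_linear :: "(('i \<Rightarrow> 'k::field) \<Rightarrow> 'i \<Rightarrow> 'k) \<Rightarrow> bool" where
  "total_linear f \<longleftrightarrow> (\<forall>x y. f (\<lambda>u. x u + y u) = (\<lambda>u. f x u + f y u)) \<and>
     (\<forall>c x. f (\<lambda>u. c * x u) = (\<lambda>u. c * f x u))"

definition preserves :: "'i set \<Rightarrow> (('i \<Rightarrow> 'k::field) \<Rightarrow> 'i \<Rightarrow> 'k) \<Rightarrow> bool" where
  "preserves I f \<longleftrightarrow> (\<forall>x\<in>vec I. f x \<in> vec I)"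

abbreviation res :: "'i set \<Rightarrow> (('i \<Rightarrow> 'k::field) \<Rightarrow> 'i \<Rightarrow> 'k) \<Rightarrow> ('i \<Rightarrow> 'k) \<Rightarrow> 'i \<Rightarrow> 'k" where
  "res I f \<equiv> restrict f (vec I)"

lemma res_closed: "total_linear f \<Longrightarrow> preserves I f \<Longrightarrow> res I f \<in> carrier (endo I)"
  by (auto simp: endo_carrier total_linear_def preserves_def)

primrec wop :: "('g \<Rightarrow> ('i \<Rightarrow> 'k::field) \<Rightarrow> 'i \<Rightarrow> 'k) \<Rightarrow> 'g list \<Rightarrow> ('i \<Rightarrow> 'k) \<Rightarrow> 'i \<Rightarrow> 'k" where
  "wop T [] x = x"
| "wop T (g # w) x = T g (wop T w x)"

lemma wop_append: "wop T (v @ w) x = wop T v (wop T w x)"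
  by (induction v) auto

lemma wop_preserves: "(\<And>g. g \<in> set w \<Longrightarrow> preserves I (T g)) \<Longrightarrow> preserves I (wop T w)"
  by (induction w) (auto simp: preserves_def)

lemma wop_linear: "(\<And>g. g \<in> set w \<Longrightarrow> total_linear (T g)) \<Longrightarrow> total_linear (wop T w)"
  by (induction w) (auto simp: total_linear_def)

lemma word_ev_res:
  assumes "\<And>g. g \<in> set w \<Longrightarrow> preserves I (T g)" "\<And>g. g \<in> set w \<Longrightarrow> \<rho> g = res I (T g)"
  shows "word_ev (endo I) \<rho> w = res I (wop T w)"
  using assms
proof (induction w)
  case Nil
  then show ?case by (auto simp: word_ev_def)
next
  case (Cons g w)
  have "word_ev (endo I) \<rho> w = res I (wop T w)" and g: "\<rho> g = res I (T g)"
    using Cons by (blast intro: list.set_intros)+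
  then have "word_ev (endo I) \<rho> (g # w) = res I (T g) \<otimes>\<^bsub>endo I\<^esub> res I (wop T w)"
    by (simp only: kalg.word_ev_Cons[OF endo_kalg])
  also have "\<dots> = res I (wop T (g # w))"
    using wop_preserves[of w I T] Cons.prems by (auto simp: compose_def preserves_def)
  finally show ?case .
qed

definition lop :: "('g \<Rightarrow> ('i \<Rightarrow> 'k::field) \<Rightarrow> 'i \<Rightarrow> 'k) \<Rightarrow> ('k, 'g) lincomb \<Rightarrow> ('i \<Rightarrow> 'k) \<Rightarrow> 'i \<Rightarrow> 'k" where
  "lop T l x = (\<lambda>u. \<Sum>(c, w)\<leftarrow>l. c * wop T w x u)"

lemma lc_ev_res:
  assumes "\<And>g. g \<in> X \<Longrightarrow> preserves I (T g)" "\<And>g. g \<in> X \<Longrightarrow> \<rho> g = res I (T g)"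
    "\<forall>(c, u)\<in>set l. set u \<subseteq> X"
  shows "lc_ev (endo I) \<rho> l = res I (lop T l)"
  using assms(3)
proof (induction l)
  case Nil
  then show ?case by (auto simp: lop_def)
next
  case (Cons a l)
  obtain c w where a: "a = (c, w)" by (cases a)
  have "word_ev (endo I) \<rho> w = res I (wop T w)"
    using Cons.prems a assms(1,2) by (intro word_ev_res) auto
  then show ?case using Cons a by (auto simp: lop_def)
qed

text \<open>Both sides of a relation map \<open>vec I\<close> to itself and so vanish outside
  \<open>I\<close>. Checking coordinates in \<open>I\<close> suffices, which matters for relations
  that hold only on words of the right length.\<close>

lemma sat_rels_res:
  assumes "\<And>g. g \<in> X \<Longrightarrow> preserves I (T g)" "\<And>g. g \<in> X \<Longrightarrow> \<rho> g = res I (T g)"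
    and wf: "wf_rels X R"
    and R: "\<And>l r x u. (l, r) \<in> R \<Longrightarrow> x \<in> vec I \<Longrightarrow> u \<in> I \<Longrightarrow> lop T l x u = lop T r x u"
  shows "sat_rels (endo I) \<rho> R"
  unfolding sat_rels_def
proof clarify
  fix l r assume lr: "(l, r) \<in> R"
  have w: "\<forall>(c, u)\<in>set l. set u \<subseteq> X" "\<forall>(c, u)\<in>set r. set u \<subseteq> X"
    using wf lr unfolding wf_rels_def by fast+
  have z: "lop T l x u = 0" if "\<forall>(c, u)\<in>set l. set u \<subseteq> X" "x \<in> vec I" "u \<notin> I" for l x u
  proof -
    have "c * wop T v x u = 0" if "(c, v) \<in> set l" for c v
    proof -
      have "preserves I (wop T v)"
        using \<open>\<forall>(c, u)\<in>set l. set u \<subseteq> X\<close> assms(1) that by (intro wop_preserves) fastforce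
      then show ?thesis using \<open>x \<in> vec I\<close> \<open>u \<notin> I\<close> by (auto simp: preserves_def vec_def)
    qed
    then show ?thesis unfolding lop_def by (intro sum_list_all_zero) auto
  qed
  have "lop T l x u = lop T r x u" if "x \<in> vec I" for x u
    using R[OF lr that] z[OF w(1) that] z[OF w(2) that] by metis
  then show "lc_ev (endo I) \<rho> l = lc_ev (endo I) \<rho> r"
    using lc_ev_res[OF assms(1,2) w(1)] lc_ev_res[OF assms(1,2) w(2)] by (auto simp: fun_eq_iff restrict_def)
qed

subsection \<open>Index sets\<close>

lemma finite_vidx [simp]: "finite (vidx d N)"
  by (simp add: vidx_def)

lemma tidx_0 [simp]: "tidx d N 0 = {[]}"
  by (auto simp: tidx_def)

lemma tidx_Cons [simp]: "a # u \<in> tidx d N (Suc n) \<longleftrightarrow> a \<in> vidx d N \<and> u \<in> tidx d N n"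
  by (auto simp: tidx_def)

lemma Nil_tidx [simp]: "[] \<in> tidx d N n \<longleftrightarrow> n = 0"
  by (auto simp: tidx_def)

lemma tidx_Suc: "tidx d N (Suc n) = (\<lambda>(c, w). c # w) ` (vidx d N \<times> tidx d N n)"
  by (auto simp: tidx_def image_iff length_Suc_conv)

lemma finite_tidx [simp]: "finite (tidx d N n)"
  by (induction n) (auto simp: tidx_Suc)

lemma sl_vec: "x \<in> vec (tidx d N (Suc n)) \<Longrightarrow> sl a x \<in> vec (tidx d N n)"
  by (auto simp: vec_def sl_def)

lemma sum_tidx_Suc: "(\<Sum>w\<in>tidx d N (Suc n). f w) = (\<Sum>c\<in>vidx d N. \<Sum>w\<in>tidx d N n. f (c # w))"
  unfolding tidx_Suc
  by (subst sum.reindex) (auto simp: inj_on_def sum.cartesian_product case_prod_beta)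

lemma lin_op_bv:
  assumes "finite I" "i \<in> I"
  shows "lin_op I \<phi> (bv i) = \<phi> i"
proof
  fix j
  have "(\<Sum>k\<in>I. bv i k * \<phi> k j) = (\<Sum>k\<in>I. if k = i then \<phi> i j else 0)"
    by (rule sum.cong) (auto simp: bv_def)
  then show "lin_op I \<phi> (bv i) j = \<phi> i j"
    using assms by (simp add: lin_op_def)
qed

subsection \<open>The total operators\<close>

text \<open>The exponent of \<open>q\<close> by which \<open>UK b i UL b (i + 1)\<close> scales a
  letter.\<close>

definition alpha :: "nat \<Rightarrow> nat \<Rightarrow> nat \<times> nat \<Rightarrow> int" where
  "alpha b i = (\<lambda>(c, j). if c = b then wt j i else 0)"

text \<open>The coproduct of E twists the right factor by K and that of F the left factor by the
  inverse of K; this decides which of the two exponents of \<open>H\<close> is \<open>alpha\<close>.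
  On coordinates the source letter of a matrix unit is the last argument.\<close>

primrec Top :: "ugen \<Rightarrow> tens \<Rightarrow> tens" where
  "Top (UE b i) = H q (alpha b i) (\<lambda>_. 0) (b, i) (b, i + 1)"
| "Top (UF b i) = H q (\<lambda>_. 0) (\<lambda>a. - alpha b i a) (b, i + 1) (b, i)"
| "Top (UK b j) = PW q (\<lambda>a. of_bool (a = (b, j)))"
| "Top (UL b j) = PW q (\<lambda>a. - of_bool (a = (b, j)))"

lemma H_linear: "total_linear (H t m m' p p')"
  by (auto simp: total_linear_def H_add H_scale)

lemma PW_linear: "total_linear (PW t m)"
  by (auto simp: total_linear_def PW_def algebra_simps)

lemma Top_linear: "total_linear (Top g)"
  by (cases g) (auto simp: H_linear PW_linear)

lemma H_preserves:
  assumes p: "p \<in> vidx d N" "p' \<in> vidx d N"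
  shows "preserves (tidx d N n) (H t m m' p p')"
proof -
  have "H t m m' p p' x u = 0" if "x \<in> vec (tidx d N n)" "u \<notin> tidx d N n" for x u
    using that
  proof (induction u arbitrary: x n)
    case (Cons a u)
    show ?case
    proof (cases n)
      case 0
      then have "sl a x = (\<lambda>u. 0)" for a using Cons.prems by (auto simp: sl_def vec_def)
      then show ?thesis by (simp add: H_Cons H_zero)
    next
      case (Suc k)
      have "H t m m' p p' (sl a x) u = 0"
      proof (cases "a \<in> vidx d N")
        case True
        then show ?thesis using Cons.prems Suc Cons.IH[OF sl_vec] by auto
      next
        case False
        then have "sl a x = (\<lambda>u. 0)" using Cons.prems Suc by (auto simp: sl_def vec_def)
        then show ?thesis by (simp add: H_zero)
      qed
      moreover have "a = p \<Longrightarrow> sl p' x u = 0" using Cons.prems Suc p by (auto simp: sl_def vec_def)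
      ultimately show ?thesis by (simp add: H_Cons)
    qed
  qed simp
  then show ?thesis by (auto simp: preserves_def vec_def)
qed

lemma Top_preserves:
  assumes "g \<in> ugens d N" shows "preserves (tidx d N n) (Top g)"
proof (cases g)
  case (UE b i)
  then show ?thesis using assms by (auto intro!: H_preserves simp: ugens_def vidx_def)
next
  case (UF b i)
  then show ?thesis using assms by (auto intro!: H_preserves simp: ugens_def vidx_def)
qed (auto simp: preserves_def PW_def vec_def)

lemma tensor_Nil [simp]: "tensor x y [] = 0"
  and tensor_Cons [simp]: "tensor x y (a # u) = x a * y u"
  by (simp_all add: tensor_def)

lemma vec_rep_closed:
  assumes "g \<in> ugens d N" shows "vec_rep d N g \<in> carrier (endo (vidx d N))"
  unfolding vec_rep_def
proof (rule lin_op_closed)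
  fix v assume "v \<in> vidx d N"
  then show "vec_rep_basis g v \<in> vec (vidx d N)"
    using assms by (cases g) (auto simp: ugens_def vec_def vidx_def bv_def)
qed

lemma vec_rep_bv:
  assumes "c \<in> vidx d N" shows "vec_rep d N g (bv c) = vec_rep_basis g c"
  unfolding vec_rep_def using assms by (simp add: lin_op_bv)

lemma word_ev_vec1:
  assumes "c \<in> vidx d N"
  shows "word_ev (endo (vidx d N)) (vec_rep d N) [g] (bv c) = vec_rep_basis g c"
  using assms by (simp add: word_ev_def compose_def vec_rep_bv)

lemma word_ev_vec2:
  assumes "c \<in> vidx d N" "h \<in> ugens d N"
  shows "word_ev (endo (vidx d N)) (vec_rep d N) [g, h] (bv c) = vec_rep d N g (vec_rep_basis h c)"
  using assms endo_vec[OF vec_rep_closed[OF assms(2)], of "bv c"]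
  by (simp add: word_ev_def compose_def vec_rep_bv)

lemma comult_gens:
  assumes "g \<in> ugens d N" "(g1, g2) \<in> set (comult g)"
  shows "set g1 \<subseteq> ugens d N" "set g2 \<subseteq> ugens d N"
  using assms by (cases g; auto simp: ugens_def)+

text \<open>A sum over words is a sum over first letters and tails; the sum over tails is the matrix
  expansion of \<open>B\<close> on the slice.\<close>

lemma tens_rep_step:
  assumes B: "B \<in> carrier (endo (tidx d N n))" and x: "x \<in> vec (tidx d N (Suc n))"
  shows "(\<Sum>w\<in>tidx d N (Suc n). x w * (A (hd w) * B (bv (tl w)) u))
    = (\<Sum>c\<in>vidx d N. A c * B (sl c x) u)"
proof -
  have "B (sl c x) u = (\<Sum>w\<in>tidx d N n. x (c # w) * B (bv w) u)" for c
    using endo_expand[OF B finite_tidx sl_vec[OF x]] by (simp add: sl_def)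
  then show ?thesis by (simp add: sum_tidx_Suc sum_distrib_left algebra_simps)
qed

text \<open>Trades the recursive definition through the coproduct for the explicit operators
  \<open>Top\<close>. The second leg is known by induction, and the first leg is a matrix on
  \<open>V\<close> with at most one nonzero entry per row, so the sum over the first letter
  collapses.\<close>

lemma tens_rep_eq:
  assumes "g \<in> ugens d N"
  shows "tens_rep d N n g = res (tidx d N n) (Top g)"
  using assms
proof (induction n arbitrary: g)
  case 0
  show ?case
  proof
    fix x show "tens_rep d N 0 g x = res (tidx d N 0) (Top g) x"
    proof (cases "x \<in> vec {[]}")
      case True
      have "Top g x \<in> vec {[]}" using Top_preserves[OF 0, of 0] True by (simp add: preserves_def)
      moreover have "Top g x [] = x [] * counit g" by (cases g) (auto simp: PW_def)
      ultimately show ?thesis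
        using True by (auto simp: lin_op_def fun_eq_iff bv_def vec_def)
    qed (simp add: lin_op_def)
  qed
next
  case (Suc n)
  let ?W1 = "\<lambda>g1. word_ev (endo (vidx d N)) (vec_rep d N) g1"
  let ?W2 = "\<lambda>g2. word_ev (endo (tidx d N n)) (tens_rep d N n) g2"
  have W1: "?W1 g1 \<in> carrier (endo (vidx d N))" if "(g1, g2) \<in> set (comult g)" for g1 g2
    using comult_gens[OF Suc.prems that] vec_rep_closed by (intro kalg.word_ev_closed[OF endo_kalg, of "ugens d N"]) auto
  have W2: "?W2 g2 = res (tidx d N n) (wop Top g2)" if "(g1, g2) \<in> set (comult g)" for g1 g2
    using comult_gens[OF Suc.prems that] Suc.IH Top_preserves by (intro word_ev_res) blast+
  have W2c: "?W2 g2 \<in> carrier (endo (tidx d N n))" if "(g1, g2) \<in> set (comult g)" for g1 g2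
    unfolding W2[OF that] using comult_gens[OF Suc.prems that] Top_preserves Top_linear
    by (intro res_closed wop_linear wop_preserves) auto
  show ?case
  proof
    fix x show "tens_rep d N (Suc n) g x = res (tidx d N (Suc n)) (Top g) x"
    proof (cases "x \<in> vec (tidx d N (Suc n))")
      case x: True
      have "tens_rep d N (Suc n) g x u = Top g x u" for u
      proof (cases "u \<in> tidx d N (Suc n)")
        case False
        have "Top g x u = 0"
          using Top_preserves[OF Suc.prems, of "Suc n"] x False by (auto simp: preserves_def vec_def)
        moreover have "(\<Sum>(g1, g2)\<leftarrow>comult g. tensor (?W1 g1 (bv (hd w))) (?W2 g2 (bv (tl w))) u) = 0"
          if w: "w \<in> tidx d N (Suc n)" for w
        proof -
          have "tensor (?W1 g1 (bv (hd w))) (?W2 g2 (bv (tl w))) u = 0"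
            if "(g1, g2) \<in> set (comult g)" for g1 g2
          proof (cases u)
            case (Cons a v)
            have "?W1 g1 (bv (hd w)) \<in> vec (vidx d N)" "?W2 g2 (bv (tl w)) \<in> vec (tidx d N n)"
              using w by (auto intro!: endo_vec[OF W1[OF that]] endo_vec[OF W2c[OF that]] simp: tidx_Suc)
            then show ?thesis using False Cons by (auto simp: vec_def simp del: split_paired_All)
          qed simp
          then show ?thesis by (intro sum_list_all_zero) auto
        qed
        ultimately show ?thesis using x by (simp add: lin_op_def)
      next
        case True
        then obtain a v where u: "u = a # v" "a \<in> vidx d N" "v \<in> tidx d N n" by (auto simp: tidx_Suc)
        have slx: "sl c x \<in> vec (tidx d N n)" for c by (rule sl_vec[OF x])
        have "tens_rep d N (Suc n) g x u
            = (\<Sum>(g1, g2)\<leftarrow>comult g. \<Sum>w\<in>tidx d N (Suc n). x w * (?W1 g1 (bv (hd w)) a * ?W2 g2 (bv (tl w)) v))"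
          using x by (simp add: lin_op_def u(1) sum_list_const_mult[symmetric] sum_list_sum_nth
              case_prod_unfold sum_distrib_left sum.swap[of _ "tidx d N (Suc n)"])
        also have "\<dots> = (\<Sum>(g1, g2)\<leftarrow>comult g. \<Sum>c\<in>vidx d N. ?W1 g1 (bv c) a * wop Top g2 (sl c x) v)"
        proof (intro arg_cong[of _ _ sum_list] map_cong refl, clarify)
          fix g1 g2 assume g: "(g1, g2) \<in> set (comult g)"
          show "(\<Sum>w\<in>tidx d N (Suc n). x w * (?W1 g1 (bv (hd w)) a * ?W2 g2 (bv (tl w)) v))
              = (\<Sum>c\<in>vidx d N. ?W1 g1 (bv c) a * wop Top g2 (sl c x) v)"
            using tens_rep_step[OF W2c[OF g] x, of "\<lambda>c. ?W1 g1 (bv c) a" v]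
            by (simp add: W2[OF g] slx)
        qed
        also have "\<dots> = Top g x u"
        proof (cases g)
          case (UE b i)
          have i: "(b, i) \<in> vidx d N" "(b, i + 1) \<in> vidx d N"
            using Suc.prems UE by (auto simp: ugens_def vidx_def)
          have 1: "(\<Sum>c\<in>vidx d N. ?W1 [UE b i] (bv c) a * y c) = (if a = (b, i) then y (b, i + 1) else 0)" for y
          proof -
            have "(\<Sum>c\<in>vidx d N. ?W1 [UE b i] (bv c) a * y c)
              = (\<Sum>c\<in>vidx d N. if c = (b, i + 1) then (if a = (b, i) then y c else 0) else 0)"
              by (rule sum.cong) (simp_all only: word_ev_vec1, auto simp: bv_def)
            then show ?thesis using i by simp
          qed
          have 2: "(\<Sum>c\<in>vidx d N. ?W1 [] (bv c) a * y c) = y a" for y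
          proof -
            have "(\<Sum>c\<in>vidx d N. ?W1 [] (bv c) a * y c) = (\<Sum>c\<in>vidx d N. if c = a then y c else 0)"
              by (rule sum.cong) (simp_all add: word_ev_def, auto simp: bv_def)
            then show ?thesis using u by simp
          qed
          \<comment> \<open>The second leg of the coproduct is the two-letter word for K, and
            weights of group-like elements multiply.\<close>
          have 3: "pw q (alpha b i) v = pw q (\<lambda>a. of_bool (a = (b, i))) v * pw q (\<lambda>a. - of_bool (a = (b, i + 1))) v"
            by (subst pw_add[symmetric]) (auto simp: alpha_def wt_def intro!: arg_cong[of _ _ "\<lambda>m. pw q m v"])
          show ?thesis unfolding UE u(1)
            by (simp add: 1 2 3 H_Cons PW_def mult.assoc)
        next
          case (UF b i)
          have i: "(b, i) \<in> vidx d N" "(b, i + 1) \<in> vidx d N"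
            using Suc.prems UF by (auto simp: ugens_def vidx_def)
          have 1: "(\<Sum>c\<in>vidx d N. ?W1 [UF b i] (bv c) a * y c) = (if a = (b, i + 1) then y (b, i) else 0)" for y
          proof -
            have "(\<Sum>c\<in>vidx d N. ?W1 [UF b i] (bv c) a * y c)
              = (\<Sum>c\<in>vidx d N. if c = (b, i) then (if a = (b, i + 1) then y c else 0) else 0)"
              by (rule sum.cong) (simp_all only: word_ev_vec1, auto simp: bv_def)
            then show ?thesis using i by simp
          qed
          have 2: "(\<Sum>c\<in>vidx d N. ?W1 [UL b i, UK b (Suc i)] (bv c) a * y c) = q powi (- alpha b i a) * y a" for y
          proof -
            have g: "UL b i \<in> ugens d N" "UK b (Suc i) \<in> ugens d N"
              using Suc.prems UF by (auto simp: ugens_def)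
            have "?W1 [UL b i, UK b (Suc i)] (bv c) a = (if c = a then q powi (- alpha b i a) else 0)"
              if c: "c \<in> vidx d N" for c
            proof -
              let ?k = "if c = (b, Suc i) then q else 1"
              have e: "vec_rep_basis (UK b (Suc i)) c = (\<lambda>u. ?k * bv c u)" by auto
              have "?W1 [UL b i, UK b (Suc i)] (bv c) = vec_rep d N (UL b i) (\<lambda>u. ?k * bv c u)"
                unfolding word_ev_vec2[OF c g(2)] e ..
              also have "\<dots> = (\<lambda>u. ?k * vec_rep d N (UL b i) (bv c) u)"
                using c by (intro endo_smult[OF vec_rep_closed[OF g(1)]]) auto
              finally have W: "?W1 [UL b i, UK b (Suc i)] (bv c) a = ?k * vec_rep_basis (UL b i) c a"
                unfolding vec_rep_bv[OF c] by simp
              show ?thesis unfolding W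
                by (cases c) (auto simp: bv_def alpha_def wt_def power_int_minus)
            qed
            then have "(\<Sum>c\<in>vidx d N. ?W1 [UL b i, UK b (Suc i)] (bv c) a * y c)
              = (\<Sum>c\<in>vidx d N. if c = a then q powi (- alpha b i a) * y c else 0)"
              by (intro sum.cong) auto
            then show ?thesis using u by simp
          qed
          show ?thesis unfolding UF u(1)
            by (simp add: 1 2 H_Cons)
        next
          case (UK b j)
          have "(\<Sum>c\<in>vidx d N. ?W1 [UK b j] (bv c) a * y c) = (if a = (b, j) then q else 1) * y a" for y
          proof -
            have "(\<Sum>c\<in>vidx d N. ?W1 [UK b j] (bv c) a * y c)
              = (\<Sum>c\<in>vidx d N. if c = a then (if a = (b, j) then q else 1) * y c else 0)"
              by (rule sum.cong) (simp_all only: word_ev_vec1, auto simp: bv_def)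
            then show ?thesis using u by simp
          qed
          then show ?thesis unfolding UK u(1) by (simp add: PW_def sl_def)
        next
          case (UL b j)
          have "(\<Sum>c\<in>vidx d N. ?W1 [UL b j] (bv c) a * y c) = (if a = (b, j) then inverse q else 1) * y a" for y
          proof -
            have "(\<Sum>c\<in>vidx d N. ?W1 [UL b j] (bv c) a * y c)
              = (\<Sum>c\<in>vidx d N. if c = a then (if a = (b, j) then inverse q else 1) * y c else 0)"
              by (rule sum.cong) (simp_all only: word_ev_vec1, auto simp: bv_def)
            then show ?thesis using u by simp
          qed
          then show ?thesis unfolding UL u(1) by (simp add: PW_def sl_def power_int_minus)
        qed
        finally show ?thesis .
      qed
      then show ?thesis using x by auto
    qed (simp add: lin_op_def)
  qed
qed

subsection \<open>The defining relations\<close>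

lemma ugens_simps:
  "UE b i \<in> ugens d N \<longleftrightarrow> b \<in> {1..d} \<and> i \<in> {1..<N}"
  "UF b i \<in> ugens d N \<longleftrightarrow> b \<in> {1..d} \<and> i \<in> {1..<N}"
  "UK b i \<in> ugens d N \<longleftrightarrow> b \<in> {1..d} \<and> i \<in> {1..N}"
  "UL b i \<in> ugens d N \<longleftrightarrow> b \<in> {1..d} \<and> i \<in> {1..N}"
  by (auto simp: ugens_def)

lemma wf_rels_Un: "wf_rels X (R \<union> S) \<longleftrightarrow> wf_rels X R \<and> wf_rels X S"
  unfolding wf_rels_def ball_Un ..

lemma wf_rels_UN: "wf_rels X (\<Union>b\<in>B. R b) \<longleftrightarrow> (\<forall>b\<in>B. wf_rels X (R b))"
  unfolding wf_rels_def by (simp only: ball_UN)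

lemma wf_u_rels: "wf_rels (ugens d N) (u_rels d N)"
proof -
  have "wf_rels (ugens d N) (gl_rels N b)" if "b \<in> {1..d}" for b
    unfolding gl_rels_def wf_rels_Un
    by (intro conjI; use that in \<open>auto simp: wf_rels_def weq_def ugens_simps\<close>)
  moreover have "wf_rels (ugens d N)
      {weq [g, h] [h, g] | g h. g \<in> ugens d N \<and> h \<in> ugens d N \<and> summand g \<noteq> summand h}"
    by (auto simp: wf_rels_def weq_def)
  ultimately show ?thesis unfolding u_rels_def wf_rels_Un wf_rels_UN by blast
qed

lemma lop_simps [simp]:
  "lop T [] x u = 0" "lop T ((c, w) # l) x u = c * wop T w x u + lop T l x u"
  by (simp_all add: lop_def)

lemma pw_ne_0: "t \<noteq> 0 \<Longrightarrow> pw t m u \<noteq> 0"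
  by (induction u) auto

text \<open>Matrix units of different colours have zero products, and \<open>alpha\<close> of one
  colour vanishes on letters of the other; hence the conditions of \<open>H_commute\<close>
  hold.\<close>

lemma Top_commute:
  assumes "summand g \<noteq> summand h"
  shows "Top g (Top h x) = Top h (Top g x)"
  using assms
  by (cases g; cases h)
    (auto simp: PW_H_commute intro!: H_commute simp: alpha_def,
     auto simp: PW_def mult_ac)

lemma u_rels_Top:
  assumes "(l, r) \<in> u_rels d N"
  shows "lop Top l x u = lop Top r x u"
proof -
  have cross: ?thesis if "l = [(1, [g, h])]" "r = [(1, [h, g])]" "summand g \<noteq> summand h" for g h
    using that Top_commute[of g h x] by simp
  have gl: ?thesis if "(l, r) \<in> gl_rels N b" for b
    using that unfolding gl_rels_def
  proof (elim UnE)
    show ?thesis if S: "(l, r) \<in> {weq [UK b j, UL b j] [] | j. j \<in> {1..N}}"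
      using that by (auto simp: weq_def PW_def pw_minus[OF q_ne_0] pw_ne_0)
    show ?thesis if S: "(l, r) \<in> {weq [UL b j, UK b j] [] | j. j \<in> {1..N}}"
      using that by (auto simp: weq_def PW_def pw_minus[OF q_ne_0] pw_ne_0)
    show ?thesis if S: "(l, r) \<in> {weq [UK b j, UK b k] [UK b k, UK b j] | j k. j \<in> {1..N} \<and> k \<in> {1..N}}"
      using that by (auto simp: weq_def PW_def mult_ac)
    show ?thesis if S: "(l, r) \<in> {([(1, [UK b j, UE b i])], [(q powi wt j i, [UE b i, UK b j])])
        | j i. j \<in> {1..N} \<and> i \<in> {1..<N}}"
      using that by (auto simp: PW_H_commute wt_def)
    show ?thesis if S: "(l, r) \<in> {([(1, [UK b j, UF b i])], [(q powi (- wt j i), [UF b i, UK b j])])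
        | j i. j \<in> {1..N} \<and> i \<in> {1..<N}}"
      using that by (auto simp: PW_H_commute wt_def)
    show ?thesis if S: "(l, r) \<in> {([(1, [UE b i, UF b i]), (-1, [UF b i, UE b i])],
       [(1 / (q - inverse q), [UK b i, UL b (i + 1)]),
        (- 1 / (q - inverse q), [UL b i, UK b (i + 1)])]) | i. i \<in> {1..<N}}"
    proof -
      obtain i where i: "l = [(1, [UE b i, UF b i]), (-1, [UF b i, UE b i])]"
        "r = [(1 / (q - inverse q), [UK b i, UL b (i + 1)]), (- 1 / (q - inverse q), [UL b i, UK b (i + 1)])]"
        using S by blast
      have m: "alpha b i = (\<lambda>a. of_bool (a = (b, i)) + - of_bool (a = (b, i + 1)))"
        "(\<lambda>a. - alpha b i a) = (\<lambda>a. - of_bool (a = (b, i)) + of_bool (a = (b, i + 1)))"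
        by (auto simp: alpha_def wt_def)
      have p1: "pw q (alpha b i) u = pw q (\<lambda>a. of_bool (a = (b, i))) u * pw q (\<lambda>a. - of_bool (a = (b, i + 1))) u"
        unfolding m(1) by (rule pw_add) simp
      have p2: "pw q (\<lambda>a. - alpha b i a) u = pw q (\<lambda>a. - of_bool (a = (b, i))) u * pw q (\<lambda>a. of_bool (a = (b, i + 1))) u"
        unfolding m(2) by (rule pw_add) simp
      have "H q (alpha b i) (\<lambda>_. 0) (b, i) (b, i+1) (H q (\<lambda>_. 0) (\<lambda>a. - alpha b i a) (b, i+1) (b, i) x) u
          - H q (\<lambda>_. 0) (\<lambda>a. - alpha b i a) (b, i+1) (b, i) (H q (alpha b i) (\<lambda>_. 0) (b, i) (b, i+1) x) u
          = (pw q (alpha b i) u - pw q (\<lambda>a. - alpha b i a) u) / (q - inverse q) * x u"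
        by (rule H_EF) (use q_minus_inverse_ne_0 in \<open>auto simp: alpha_def wt_def split: if_splits\<close>)
      then show ?thesis unfolding i p1 p2
        by (simp add: PW_def diff_divide_distrib left_diff_distrib mult.assoc)
    qed
    show ?thesis if S: "(l, r) \<in> {weq [UE b i, UF b k] [UF b k, UE b i] | i k. i \<in> {1..<N} \<and> k \<in> {1..<N} \<and> i \<noteq> k}"
    proof -
      obtain i k where ik: "l = [(1, [UE b i, UF b k])]" "r = [(1, [UF b k, UE b i])]" "i \<noteq> k"
        using S unfolding weq_def by blast
      have "Top (UE b i) (Top (UF b k) x) = Top (UF b k) (Top (UE b i) x)"
        unfolding Top.simps by (rule H_commute) (use ik(3) in \<open>auto simp: alpha_def wt_def\<close>)
      then show ?thesis using ik by simp
    qed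
    show ?thesis if S: "(l, r) \<in> {weq [X b i, X b k] [X b k, X b i] | X i k.
        X \<in> {UE, UF} \<and> i \<in> {1..<N} \<and> k \<in> {1..<N} \<and> \<bar>int i - int k\<bar> > 1}"
    proof -
      obtain i k X where ik: "l = [(1, [X b i, X b k])]" "r = [(1, [X b k, X b i])]" "\<bar>int i - int k\<bar> > 1"
        "X \<in> {UE, UF}"
        using S unfolding weq_def by blast
      have "Top (UE b i) (Top (UE b k) x) = Top (UE b k) (Top (UE b i) x)"
        "Top (UF b i) (Top (UF b k) x) = Top (UF b k) (Top (UF b i) x)"
        unfolding Top.simps by (rule H_commute; use ik(3) in \<open>auto simp: alpha_def wt_def\<close>)+
      then show ?thesis using ik by auto
    qed
    show ?thesis if S: "(l, r) \<in> {([(1, [X b i, X b i, X b k]), (1, [X b k, X b i, X b i])],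
       [(q + inverse q, [X b i, X b k, X b i])]) | X i k.
        X \<in> {UE, UF} \<and> i \<in> {1..<N} \<and> k \<in> {1..<N} \<and> \<bar>int i - int k\<bar> = 1}"
    proof -
      obtain i k X where ik: "l = [(1, [X b i, X b i, X b k]), (1, [X b k, X b i, X b i])]"
        "r = [(q + inverse q, [X b i, X b k, X b i])]" "\<bar>int i - int k\<bar> = 1" "X \<in> {UE, UF}"
        using S by blast
      have a: "alpha b j (b, j) = 1" "alpha b j (b, j + 1) = -1" "alpha b j (b, j + 2) = 0"
        "alpha b (j + 1) (b, j) = 0" "alpha b (j + 1) (b, j + 1) = 1" "alpha b (j + 1) (b, j + 2) = - 1" for j
        by (auto simp: alpha_def wt_def)
      have d: "(b, j) \<noteq> (b, j + 1)" "(b, j + 1) \<noteq> (b, j + 2)" "(b, j) \<noteq> (b, j + 2)" for j :: nat by auto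
      note E = H_Serre_E[where x=x and u=u, OF q_ne_0] and F = H_Serre_F[where x=x and u=u, OF q_ne_0]
      \<comment> \<open>The Serre lemmas are stated for the roots j and j + 1; which of the two
        occurs twice decides which of their conclusions applies.\<close>
      from ik(3) consider "k = i + 1" | "i = k + 1" by linarith
      then show ?thesis
      proof cases
        case 1
        then show ?thesis using ik E(1)[OF d[of i] a[of i]] F(1)[OF d[of i] a[of i]] by (auto simp: add.commute)
      next
        case 2
        then show ?thesis using ik E(2)[OF d[of k] a[of k]] F(2)[OF d[of k] a[of k]] by (auto simp: add.commute)
      qed
    qed
  qed
  show ?thesis using assms cross gl by (auto simp: u_rels_def weq_def)
qed

lemma sat_u_rels: "sat_rels (endo (tidx d N n)) (tens_rep d N n) (u_rels d N)"
  by (rule sat_rels_res[OF Top_preserves tens_rep_eq wf_u_rels u_rels_Top])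

lemma tens_rep_closed: "g \<in> ugens d N \<Longrightarrow> tens_rep d N n g \<in> carrier (endo (tidx d N n))"
  by (simp add: tens_rep_eq res_closed Top_linear Top_preserves)

lemma Uq_rep_hom: "Uq_rep d N n \<in> alg_hom (Uq d N) (endo (tidx d N n))"
  unfolding Uq_rep_def Uq_def
  by (rule kalg.pres_ev_hom[OF endo_kalg tens_rep_closed wf_u_rels sat_u_rels])

lemma Uq_rep_gen:
  "g \<in> ugens d N \<Longrightarrow> Uq_rep d N n (pres_gen (ugens d N) (u_rels d N) g) = tens_rep d N n g"
  unfolding Uq_rep_def
  by (rule kalg.pres_ev_gen[OF endo_kalg tens_rep_closed wf_u_rels sat_u_rels])

lemma Uq_kalg: "kalg (Uq d N)"
  unfolding Uq_def by (rule kalg.pres_alg_kalg[OF endo_kalg tens_rep_closed wf_u_rels])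


section \<open>The operators on neighbouring factors\<close>

text \<open>Positions are counted from 0, so the i-th operator of the theorem is
  \<open>Sg q (i - 1)\<close>. Recursion on the position strips the letters in front, which reduces
  the relations to the first two or three letters. Words too short for the position get the value
  0.\<close>

primrec Sg :: "'k::field \<Rightarrow> nat \<Rightarrow> ((nat \<times> nat) list \<Rightarrow> 'k) \<Rightarrow> (nat \<times> nat) list \<Rightarrow> 'k" where
  "Sg t 0 x u = (case u of a # b # v \<Rightarrow>
     if a = b then t * x (a # b # v)
     else x (b # a # v) + (if fst a = fst b \<and> snd b < snd a then (t - inverse t) * x (a # b # v) else 0)
   | _ \<Rightarrow> 0)"
| "Sg t (Suc k) x u = (case u of a # v \<Rightarrow> Sg t k (sl a x) v | [] \<Rightarrow> 0)"

primrec Ep :: "nat \<Rightarrow> ((nat \<times> nat) list \<Rightarrow> 'k::field) \<Rightarrow> (nat \<times> nat) list \<Rightarrow> 'k" where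
  "Ep 0 x u = (case u of a # b # v \<Rightarrow> if fst a = fst b then x (a # b # v) else 0 | _ \<Rightarrow> 0)"
| "Ep (Suc k) x u = (case u of a # v \<Rightarrow> Ep k (sl a x) v | [] \<Rightarrow> 0)"

lemma Sg_word [simp]:
  "Sg t k x [] = 0" "Sg t k x [a] = 0"
  "Sg t 0 x (a # b # v) = (if a = b then t * x (a # b # v)
     else x (b # a # v) + (if fst a = fst b \<and> snd b < snd a then (t - inverse t) * x (a # b # v) else 0))"
  "Sg t (Suc k) x (a # u) = Sg t k (sl a x) u"
proof -
  show N: "Sg t k x [] = 0" for k x by (cases k) auto
  show "Sg t k x [a] = 0" by (cases k) (auto simp: N)
qed auto

lemma Ep_word [simp]:
  "Ep k x [] = 0" "Ep k x [a] = 0"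
  "Ep 0 x (a # b # v) = (if fst a = fst b then x (a # b # v) else 0)"
  "Ep (Suc k) x (a # u) = Ep k (sl a x) u"
proof -
  show N: "Ep k x [] = 0" for k x by (cases k) auto
  show "Ep k x [a] = 0" by (cases k) (auto simp: N)
qed auto

declare Sg.simps [simp del] Ep.simps [simp del]

lemma sl_Sg [simp]: "sl a (Sg t (Suc k) x) = Sg t k (sl a x)"
  by (auto simp: sl_def)

lemma sl_Ep [simp]: "sl a (Ep (Suc k) x) = Ep k (sl a x)"
  by (auto simp: sl_def)

lemma Sg_comb: "Sg t k (\<lambda>u. c * x u + c' * y u) u = c * Sg t k x u + c' * Sg t k y u"
proof (induction k arbitrary: x y u)
  case 0
  show ?case by (cases u rule: remdups_adj.cases) (auto simp: algebra_simps)
next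
  case (Suc k)
  show ?case by (cases u) (simp_all add: Suc)
qed

lemma Ep_comb: "Ep k (\<lambda>u. c * x u + c' * y u) u = c * Ep k x u + c' * Ep k y u"
proof (induction k arbitrary: x y u)
  case 0
  show ?case by (cases u rule: remdups_adj.cases) (auto simp: algebra_simps)
next
  case (Suc k)
  show ?case by (cases u) (simp_all add: Suc)
qed

lemma Sg_lin:
  "Sg t k (\<lambda>u. x u + y u) = (\<lambda>u. Sg t k x u + Sg t k y u)"
  "Sg t k (\<lambda>u. x u - y u) = (\<lambda>u. Sg t k x u - Sg t k y u)"
  "Sg t k (\<lambda>u. c * x u) = (\<lambda>u. c * Sg t k x u)"
  "Sg t k (\<lambda>u. 0) = (\<lambda>u. 0)"
  using Sg_comb[of t k 1 x 1 y] Sg_comb[of t k 1 x "-1" y] Sg_comb[of t k c x 0 x] Sg_comb[of t k 0 x 0 x]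
  by auto

lemma Ep_lin:
  "Ep k (\<lambda>u. x u + y u) = (\<lambda>u. Ep k x u + Ep k y u)"
  "Ep k (\<lambda>u. x u - y u) = (\<lambda>u. Ep k x u - Ep k y u)"
  "Ep k (\<lambda>u. c * x u) = (\<lambda>u. c * Ep k x u)"
  using Ep_comb[of k 1 x 1 y] Ep_comb[of k 1 x "-1" y] Ep_comb[of k c x 0 x]
  by auto

lemma Ep_zero: "Ep k (\<lambda>u. 0) = (\<lambda>u. 0)"
  using Ep_comb[of k 0 "\<lambda>u. 0" 0 "\<lambda>u. 0"] by auto

lemma Sg_linear: "total_linear (Sg t k)"
  by (simp add: total_linear_def Sg_lin)

lemma Ep_linear: "total_linear (Ep k)"
  by (simp add: total_linear_def Ep_lin)

lemma long_word_cases: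
  assumes "Suc k < length u"
  obtains (zero) a b v where "k = 0" "u = a # b # v"
  | (Suc) l a v where "k = Suc l" "u = a # v" "Suc l < length v"
proof (cases k)
  case 0
  then obtain a b v where "u = a # b # v" using assms by (cases u; cases "tl u") auto
  then show ?thesis using zero 0 by blast
next
  case (Suc l)
  then show ?thesis using assms that(2) by (cases u) auto
qed

lemma Sg_square:
  assumes "t \<noteq> 0" "Suc k < length u"
  shows "Sg t k (Sg t k x) u = (t - inverse t) * Sg t k (Ep k x) u + x u"
  using assms(2)
proof (induction k arbitrary: x u)
  case 0
  then show ?case
    by (cases rule: long_word_cases) (use assms(1) in \<open>auto simp: algebra_simps\<close>)
next
  case (Suc k)
  from Suc.prems show ?case by (cases rule: long_word_cases) (auto simp: Suc.IH sl_def[of _ x])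
qed

lemma Ep_idem: "Ep k (Ep k x) u = Ep k x u"
proof (induction k arbitrary: x u)
  case 0
  show ?case by (cases u rule: remdups_adj.cases) (auto)
next
  case (Suc k)
  show ?case by (cases u) (simp_all add: Suc)
qed

lemma Sg_Ep: "Sg t k (Ep k x) u = Ep k (Sg t k x) u"
proof (induction k arbitrary: x u)
  case 0
  show ?case by (cases u rule: remdups_adj.cases) (auto)
next
  case (Suc k)
  show ?case by (cases u) (simp_all add: Suc)
qed

lemma sl2_Sg0: "sl b (sl a (Sg t 0 x)) = (\<lambda>u. (if a = b then t * sl b (sl a x) u else sl a (sl b x) u)
    + (if fst a = fst b \<and> snd b < snd a then (t - inverse t) * sl b (sl a x) u else 0))"
  by (auto simp: sl_def fun_eq_iff)

lemma sl2_Ep0: "sl b (sl a (Ep 0 x)) = (\<lambda>u. if fst a = fst b then sl b (sl a x) u else 0)"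
  by (auto simp: sl_def fun_eq_iff)

lemma Ep_commute_add: "Ep k (Ep (k + m) x) u = Ep (k + m) (Ep k x) u"
proof (induction k arbitrary: x u)
  case 0
  show ?case
  proof (cases u rule: remdups_adj.cases)
    case (3 a b v)
    consider "m = 0" | "m = 1" | j where "m = Suc (Suc j)" by (metis One_nat_def not0_implies_Suc)
    then show ?thesis
    proof cases
      case 2
      then show ?thesis by (cases v) (auto simp: 3 sl_def)
    next
      case m: 3
      show ?thesis by (cases "fst a = fst b") (simp_all add: 3 m sl2_Ep0 Ep_zero)
    qed simp
  qed auto
next
  case (Suc k)
  show ?case by (cases u) (simp_all add: Suc)
qed

lemma Ep_commute: "Ep k (Ep l x) u = Ep l (Ep k x) u"
  using Ep_commute_add[of k "l - k" x u] Ep_commute_add[of l "k - l" x u] by (cases "k \<le> l") auto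

text \<open>Distance at least 2 is written \<open>k + 2 + m\<close> so that induction removes the
  first \<open>k\<close> letters. The operator at position 0 then touches only two letters that the
  other one passes over.\<close>

lemma far_commute:
  "Sg t k (Sg t (k + 2 + m) x) u = Sg t (k + 2 + m) (Sg t k x) u"
  "Sg t k (Ep (k + 2 + m) x) u = Ep (k + 2 + m) (Sg t k x) u"
  "Sg t (k + 2 + m) (Ep k x) u = Ep k (Sg t (k + 2 + m) x) u"
proof -
  have s: "sl b (sl a (Sg t 0 x)) = (if a = b then (\<lambda>u. t * sl b (sl a x) u) else
      if fst a = fst b \<and> snd b < snd a then (\<lambda>u. sl a (sl b x) u + (t - inverse t) * sl b (sl a x) u)
      else sl a (sl b x))"
    "sl b (sl a (Ep 0 x)) = (if fst a = fst b then sl b (sl a x) else (\<lambda>u. 0))" for a b x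
    by (auto simp: sl_def fun_eq_iff)
  have e: "F (Suc (Suc m)) x (a # b # v) = F m (sl b (sl a x)) v"
    if "F = Sg t \<or> F = Ep" for F :: "nat \<Rightarrow> _" and m x a b v
    using that by auto
  have slF: "sl b (sl a y) v = y (a # b # v)" for a b y v by (simp add: sl_def)
  show "Sg t k (Sg t (k + 2 + m) x) u = Sg t (k + 2 + m) (Sg t k x) u"
  proof (induction k arbitrary: x u)
    case 0
    show ?case
    proof (cases "\<exists>a b v. u = a # b # v")
      case True
      then obtain a b v where u: "u = a # b # v" by blast
      show ?thesis unfolding u
        by (simp add: s Sg_lin)
    qed (cases u rule: remdups_adj.cases; auto)
  next
    case (Suc k)
    show ?case using Suc by (cases u) simp_all
  qed
  show "Sg t k (Ep (k + 2 + m) x) u = Ep (k + 2 + m) (Sg t k x) u"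
  proof (induction k arbitrary: x u)
    case 0
    show ?case
    proof (cases "\<exists>a b v. u = a # b # v")
      case True
      then obtain a b v where u: "u = a # b # v" by blast
      show ?thesis unfolding u
        by (simp add: s Ep_lin Ep_zero)
    qed (cases u rule: remdups_adj.cases; auto)
  next
    case (Suc k)
    show ?case using Suc by (cases u) simp_all
  qed
  show "Sg t (k + 2 + m) (Ep k x) u = Ep k (Sg t (k + 2 + m) x) u"
  proof (induction k arbitrary: x u)
    case 0
    show ?case
    proof (cases "\<exists>a b v. u = a # b # v")
      case True
      then obtain a b v where u: "u = a # b # v" by blast
      show ?thesis unfolding u
        by (simp add: s Sg_lin)
    qed (cases u rule: remdups_adj.cases; auto)
  next
    case (Suc k)
    show ?case using Suc by (cases u) simp_all
  qed
qed

lemma longer_word_cases: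
  assumes "Suc (Suc k) < length u"
  obtains (zero) a b c v where "k = 0" "u = a # b # c # v"
  | (Suc) l a v where "k = Suc l" "u = a # v" "Suc (Suc l) < length v"
proof (cases k)
  case 0
  then obtain a b v where u: "u = a # b # v" using assms long_word_cases[of 0 u] by auto
  then have "v \<noteq> []" using assms by auto
  then show ?thesis using zero 0 u by (cases v) auto
next
  case (Suc l)
  then show ?thesis using assms that(2) by (cases u) auto
qed

section \<open>The braid relation and the mixed relations\<close>

definition gap :: "'k::field \<Rightarrow> nat \<times> nat \<Rightarrow> nat \<times> nat \<Rightarrow> 'k" where
  "gap t a b = (if fst a = fst b \<and> snd b < snd a then t - inverse t else 0)"

text \<open>\<open>exch1\<close> and \<open>exch2\<close> are \<open>Sg\<close> at positions 0 and 1
  with all later letters frozen, which turns the braid relation into an identity between functions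
  of three letters.\<close>

definition exch1 where
  "exch1 t g a b c = (if a = b then t * g a b c else g b a c + gap t a b * g a b c)"

definition exch2 where
  "exch2 t g a b c = (if b = c then t * g a b c else g a c b + gap t b c * g a b c)"

text \<open>The cases are the possible coincidences of the three letters. When two letters agree it
  is enough that G = \<open>gap\<close> satisfies t^2 G = G + t G^2 and that the gaps of (x, y) and
  (y, x) are never both nonzero.\<close>

lemma braid_exchange:
  fixes t :: "'k::field"
  assumes t: "t \<noteq> 0"
  shows "exch1 t (exch2 t (exch1 t g)) a b c = exch2 t (exch1 t (exch2 t g)) a b c"
proof -
  let ?S1 = "exch1 t" and ?S2 = "exch2 t" and ?G = "gap t"
  have s1: "?S1 h x x z = t * h x x z" "x \<noteq> y \<Longrightarrow> ?S1 h x y z = h y x z + ?G x y * h x y z"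
    and s2: "?S2 h z x x = t * h z x x" "x \<noteq> y \<Longrightarrow> ?S2 h z x y = h z y x + ?G x y * h z x y" for h x y z
    by (simp_all add: exch1_def exch2_def)
  have tG: "t * (t * (?G x y * z)) = ?G x y * z + t * (?G x y * (?G x y * z))" "?G x y * ?G y x = 0"
    "?G x y * (?G y x * z) = 0" for x y z
    using t by (auto simp: gap_def field_simps)
  consider "a = b" "b = c" | "a = b" "b \<noteq> c" | "a \<noteq> b" "b = c" | "a = c" "a \<noteq> b" | "a \<noteq> b" "b \<noteq> c" "a \<noteq> c" by blast
  then show ?thesis
  proof cases
    case 1
    then show ?thesis by (simp add: s1 s2)
  next
    case 2
    then have "c \<noteq> b" by simp
    then show ?thesis using 2  by (simp add: s1 s2 ) (simp add: algebra_simps tG)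
  next
    case 3
    then have "c \<noteq> a" by simp
    then show ?thesis using 3  by (simp add: s1 s2 ) (simp add: algebra_simps tG)
  next
    case 4
    then have "b \<noteq> a" by simp
    then show ?thesis using 4  by (simp add: s1 s2 ) (simp add: algebra_simps tG)
  next
    case 5
    then have ne: "b \<noteq> a" "c \<noteq> b" "c \<noteq> a" by auto
    \<comment> \<open>These identities compare the coefficients of the words on the two sides; they
      express that the letters of one colour are totally ordered, so that of two different letters
      exactly one order has a gap and descents compose.\<close>
    have c: "?G a c * ?G b a + ?G a b * ?G b c = ?G b c * ?G a c" "?G a b * ?G a c = ?G a c * ?G c b + ?G b c * ?G a b"
      "?G a b * ?G b c * ?G a b = ?G a b * ?G b c * ?G b c"
      using 5 by (cases a; cases b; cases c; auto simp: gap_def)+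
    let ?A = "g c b a + ?G b c * g b c a + ?G a c * g a b c + ?G a b * g c a b"
    have L: "?S1 (?S2 (?S1 g)) a b c = ?A + (?G a c * ?G b a + ?G a b * ?G b c) * g b a c
        + (?G a b * ?G a c) * g a c b + (?G a b * ?G b c * ?G a b) * g a b c"
      using 5 ne by (simp add: s1 s2 algebra_simps)
    have R: "?S2 (?S1 (?S2 g)) a b c = ?A + (?G b c * ?G a c) * g b a c
        + (?G a c * ?G c b + ?G b c * ?G a b) * g a c b + (?G a b * ?G b c * ?G b c) * g a b c"
      using 5 ne by (simp add: s1 s2 algebra_simps)
    show ?thesis unfolding L R c ..
  qed
qed
lemma braid:
  fixes t :: "'a::field"
  assumes "t \<noteq> 0" "Suc (Suc k) < length u"
  shows "Sg t k (Sg t (Suc k) (Sg t k x)) u = Sg t (Suc k) (Sg t k (Sg t (Suc k) x)) u"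
  using assms(2)
proof (induction k arbitrary: x u)
  case 0
  then show ?case
  proof (cases rule: longer_word_cases)
    case (zero a b c v)
    define F where "F y = (\<lambda>a b c. y (a # b # c # v))" for y :: "(nat \<times> nat) list \<Rightarrow> 'a"
    have e: "F (Sg t 0 y) = exch1 t (F y)" "F (Sg t (Suc 0) y) = exch2 t (F y)" for y
      by (intro ext; simp add: F_def exch1_def exch2_def gap_def sl_def)+
    have "F (Sg t 0 (Sg t (Suc 0) (Sg t 0 x))) a b c = F (Sg t (Suc 0) (Sg t 0 (Sg t (Suc 0) x))) a b c"
      unfolding e by (rule braid_exchange[OF assms(1)])
    then show ?thesis unfolding F_def zero(2) .
  qed simp
next
  case (Suc k)
  from Suc.prems show ?case by (cases rule: longer_word_cases) (auto simp: Suc.IH)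
qed

text \<open>All mixed relations are proved in one induction; once the letters in front are removed,
  everything depends on which of three colours agree.\<close>

lemma Ep_Sg_Sg:
  assumes "Suc (Suc k) < length u"
  shows "Ep k (Sg t (Suc k) (Sg t k x)) u = Sg t (Suc k) (Sg t k (Ep (Suc k) x)) u \<and>
    Ep (Suc k) (Sg t k (Sg t (Suc k) x)) u = Sg t k (Sg t (Suc k) (Ep k x)) u \<and>
    Ep k (Ep (Suc k) (Sg t k x)) u = Ep (Suc k) (Sg t k (Ep (Suc k) x)) u \<and>
    Ep (Suc k) (Sg t k (Ep (Suc k) x)) u = Sg t k (Ep (Suc k) (Ep k x)) u \<and>
    Ep (Suc k) (Ep k (Sg t (Suc k) x)) u = Ep k (Sg t (Suc k) (Ep k x)) u \<and>
    Ep k (Sg t (Suc k) (Ep k x)) u = Sg t (Suc k) (Ep k (Ep (Suc k) x)) u"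
  using assms
proof (induction k arbitrary: x u)
  case 0
  then show ?case
  proof (cases rule: longer_word_cases)
    case (zero a b c v)
    show ?thesis unfolding zero(2)
      by (cases a; cases b; cases c; cases "fst a = fst b"; cases "fst b = fst c"; cases "fst a = fst c";
          simp add: sl_def cong: if_cong split del: if_split)
  qed simp
next
  case (Suc k)
  obtain a v where u: "u = a # v" "Suc (Suc k) < length v" using Suc.prems by (cases u) auto
  show ?case
    using Suc.IH[OF u(2), of "sl a x"]
    by (simp add: u)
qed

subsection \<open>Commutation with the quantum group and with permutations of the colours\<close>

lemma Sg_pw: "Sg t k (\<lambda>u. pw t m u * x u) u = pw t m u * Sg t k x u"
proof (induction k arbitrary: x u)
  case 0
  show ?case by (cases u rule: remdups_adj.cases) (auto simp: algebra_simps)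
next
  case (Suc k)
  show ?case by (cases u) (simp_all add: Suc Sg_lin mult.assoc)
qed

lemma Ep_pw: "Ep k (\<lambda>u. pw t m u * x u) u = pw t m u * Ep k x u"
proof (induction k arbitrary: x u)
  case 0
  show ?case by (cases u rule: remdups_adj.cases) (auto simp: algebra_simps)
next
  case (Suc k)
  show ?case by (cases u) (simp_all add: Suc Ep_lin mult.assoc)
qed

lemma H_Cons2: "H t m m' p p' x (a # b # v) = t powi m' a * (t powi m' b * H t m m' p p' (sl b (sl a x)) v +
     (if b = p then pw t m v * x (a # p' # v) else 0)) + (if a = p then t powi m b * pw t m v * x (p' # b # v) else 0)"
  by (simp add: H_Cons) (simp add: sl_def)

text \<open>Apart from scaling by a weight, which \<open>Sg\<close> respects by
  \<open>Sg_pw\<close>, the letters in front do not interact with \<open>Sg\<close>. Commutation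
  therefore has to be verified at position 0 only.\<close>

lemma Sg_H_step:
  assumes "\<And>x a b v. Sg t 0 (H t m m' p p' x) (a # b # v) = H t m m' p p' (Sg t 0 x) (a # b # v)"
    and "Suc k < length u"
  shows "Sg t k (H t m m' p p' x) u = H t m m' p p' (Sg t k x) u"
  using assms(2)
proof (induction k arbitrary: x u)
  case 0
  then show ?case
    by (cases rule: long_word_cases) (use assms(1) in \<open>auto simp del: Sg_word\<close>)
next
  case (Suc k)
  from Suc.prems show ?case
  proof (cases rule: long_word_cases)
    case (Suc l a v)
    then have "Suc k < length v" by simp
    then show ?thesis unfolding Suc(2)
      by (simp add: H_Cons sl_H Sg_lin Sg_pw Suc.IH cong: if_cong)
  qed simp
qed

lemma Ep_H_step:
  assumes "\<And>x a b v. Ep 0 (H t m m' p p' x) (a # b # v) = H t m m' p p' (Ep 0 x) (a # b # v)"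
    and "Suc k < length u"
  shows "Ep k (H t m m' p p' x) u = H t m m' p p' (Ep k x) u"
  using assms(2)
proof (induction k arbitrary: x u)
  case 0
  then show ?case
    by (cases rule: long_word_cases) (use assms(1) in \<open>auto simp del: Ep_word\<close>)
next
  case (Suc k)
  from Suc.prems show ?case
  proof (cases rule: long_word_cases)
    case (Suc l a v)
    then have "Suc k < length v" by simp
    then show ?thesis unfolding Suc(2)
      by (simp add: H_Cons sl_H Ep_lin Ep_zero Ep_pw Suc.IH cong: if_cong)
  qed simp
qed

lemma alpha_simps [simp]:
  "alpha b i (b, i) = 1" "alpha b i (b, Suc i) = -1"
  "c \<noteq> b \<Longrightarrow> alpha b i (c, j) = 0" "j \<noteq> i \<Longrightarrow> j \<noteq> Suc i \<Longrightarrow> alpha b i (c, j) = 0"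
  by (auto simp: alpha_def wt_def)

text \<open>The R-matrix intertwines the coproduct on two factors. Only the position of each of the
  two letters relative to the simple root matters, which leaves four possibilities for each
  letter.\<close>

lemma Sg_Top:
  assumes "Suc k < length u"
  shows "Sg q k (Top g x) u = Top g (Sg q k x) u"
proof (cases g)
  case (UE \<beta> i)
  show ?thesis unfolding UE Top.simps
  proof (rule Sg_H_step[OF _ assms])
    fix x :: tens and a b :: "nat \<times> nat" and v
    let ?H = "H q (alpha \<beta> i) (\<lambda>_. 0) (\<beta>, i) (\<beta>, i + 1)"
    obtain c j where a: "a = (c, j)" by (cases a)
    obtain e l where b: "b = (e, l)" by (cases b)
    consider "c \<noteq> \<beta>" | "c = \<beta>" "j = i" | "c = \<beta>" "j = i + 1" | "c = \<beta>" "j \<noteq> i" "j \<noteq> i + 1" by auto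
    note A = this
    consider "e \<noteq> \<beta>" | "e = \<beta>" "l = i" | "e = \<beta>" "l = i + 1" | "e = \<beta>" "l \<noteq> i" "l \<noteq> i + 1" by auto
    note B = this
    show "Sg q 0 (?H x) (a # b # v) = ?H (Sg q 0 x) (a # b # v)"
      unfolding a b
      by (cases rule: A; cases rule: B;
          simp add: H_Cons2 sl2_Sg0 H_add H_scale H_zero power_int_minus cong: if_cong;
          (auto simp: field_simps H_scale H_add H_zero)?)
  qed
next
  case (UF \<beta> i)
  show ?thesis unfolding UF Top.simps
  proof (rule Sg_H_step[OF _ assms])
    fix x :: tens and a b :: "nat \<times> nat" and v
    let ?H = "H q (\<lambda>_. 0) (\<lambda>a. - alpha \<beta> i a) (\<beta>, i + 1) (\<beta>, i)"
    obtain c j where a: "a = (c, j)" by (cases a)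
    obtain e l where b: "b = (e, l)" by (cases b)
    consider "c \<noteq> \<beta>" | "c = \<beta>" "j = i" | "c = \<beta>" "j = i + 1" | "c = \<beta>" "j \<noteq> i" "j \<noteq> i + 1" by auto
    note A = this
    consider "e \<noteq> \<beta>" | "e = \<beta>" "l = i" | "e = \<beta>" "l = i + 1" | "e = \<beta>" "l \<noteq> i" "l \<noteq> i + 1" by auto
    note B = this
    show "Sg q 0 (?H x) (a # b # v) = ?H (Sg q 0 x) (a # b # v)"
      unfolding a b
      by (cases rule: A; cases rule: B;
          simp add: H_Cons2 sl2_Sg0 H_add H_scale H_zero power_int_minus cong: if_cong;
          (auto simp: field_simps H_scale H_add H_zero)?)
  qed
qed (auto simp: PW_def Sg_pw)

lemma Ep_Top:
  assumes "Suc k < length u"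
  shows "Ep k (Top g x) u = Top g (Ep k x) u"
proof (cases g)
  case (UE \<beta> i)
  show ?thesis unfolding UE Top.simps
    by (rule Ep_H_step[OF _ assms]) (auto simp: H_Cons2 sl2_Ep0 H_zero cong: if_cong)
next
  case (UF \<beta> i)
  show ?thesis unfolding UF Top.simps
    by (rule Ep_H_step[OF _ assms]) (auto simp: H_Cons2 sl2_Ep0 H_zero cong: if_cong)
qed (auto simp: PW_def Ep_pw)

text \<open>On coordinates a permutation acts by pullback, so \<open>PT \<tau>\<close> is the action
  of the inverse of \<open>\<tau>\<close> on tensors.\<close>

definition PT :: "(nat \<Rightarrow> nat) \<Rightarrow> ((nat \<times> nat) list \<Rightarrow> 'k) \<Rightarrow> (nat \<times> nat) list \<Rightarrow> 'k" where
  "PT \<tau> x u = x (map (\<lambda>(b, i). (\<tau> b, i)) u)"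

lemma sl_PT: "sl a (PT \<tau> x) = PT \<tau> (sl (case a of (b, i) \<Rightarrow> (\<tau> b, i)) x)"
  by (cases a) (simp add: sl_def PT_def fun_eq_iff)

lemma Sg_PT: "inj \<tau> \<Longrightarrow> Sg t k (PT \<tau> x) u = PT \<tau> (Sg t k x) u"
proof (induction k arbitrary: x u)
  case 0
  then show ?case by (cases u rule: remdups_adj.cases) (auto simp: PT_def inj_eq)
next
  case (Suc k)
  then show ?case by (cases u) (simp_all add: sl_PT, simp_all add: PT_def)
qed

lemma Ep_PT: "inj \<tau> \<Longrightarrow> Ep k (PT \<tau> x) u = PT \<tau> (Ep k x) u"
proof (induction k arbitrary: x u)
  case 0
  then show ?case by (cases u rule: remdups_adj.cases) (auto simp: PT_def inj_eq)
next
  case (Suc k)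
  then show ?case by (cases u) (simp_all add: sl_PT, simp_all add: PT_def)
qed

subsection \<open>Coordinates\<close>

definition swp :: "nat \<Rightarrow> 'a list \<Rightarrow> 'a list" where
  "swp k u = u[k := u ! Suc k, Suc k := u ! k]"

lemma length_swp [simp]: "length (swp k u) = length u"
  by (simp add: swp_def)

lemma swp_Cons [simp]: "swp (Suc k) (a # u) = a # swp k u" "swp 0 (a # b # u) = b # a # u"
  by (simp_all add: swp_def)

text \<open>The recursive form suits the verification of relations; this closed form serves to
  evaluate at given words.\<close>

lemma Sg_nth: "Suc k < length u \<Longrightarrow> Sg t k x u = (if u ! k = u ! Suc k then t * x u
    else x (swp k u) + (if fst (u ! k) = fst (u ! Suc k) \<and> snd (u ! Suc k) < snd (u ! k)
      then (t - inverse t) * x u else 0))"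
proof (induction k arbitrary: x u)
  case 0
  then show ?case by (cases rule: long_word_cases) auto
next
  case (Suc k)
  obtain a v where u: "u = a # v" "Suc k < length v" using Suc.prems by (cases u) auto
  show ?case using Suc.IH[OF u(2), of "sl a x"] by (simp add: u sl_def)
qed

lemma Ep_nth: "Suc k < length u \<Longrightarrow> Ep k x u = (if fst (u ! k) = fst (u ! Suc k) then x u else 0)"
proof (induction k arbitrary: x u)
  case 0
  then show ?case by (cases rule: long_word_cases) auto
next
  case (Suc k)
  obtain a v where u: "u = a # v" "Suc k < length v" using Suc.prems by (cases u) auto
  show ?case using Suc.IH[OF u(2), of "sl a x"] by (simp add: u sl_def)
qed

lemma Sg_short: "length u \<le> Suc k \<Longrightarrow> Sg t k x u = 0"
proof (induction k arbitrary: x u)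
  case 0
  then show ?case by (cases u rule: remdups_adj.cases) auto
next
  case (Suc k)
  then show ?case by (cases u) auto
qed

lemma Ep_short: "length u \<le> Suc k \<Longrightarrow> Ep k x u = 0"
proof (induction k arbitrary: x u)
  case 0
  then show ?case by (cases u rule: remdups_adj.cases) auto
next
  case (Suc k)
  then show ?case by (cases u) auto
qed

lemma swp_swp: "Suc k < length u \<Longrightarrow> swp k (swp k u) = u"
  by (auto simp: swp_def list_update_swap list_eq_iff_nth_eq nth_list_update)

lemma mset_swp: "Suc k < length u \<Longrightarrow> mset (swp k u) = mset u"
  unfolding swp_def using mset_swap[of k u "Suc k"] by (simp add: list_update_swap)

lemma swp_tidx: "Suc k < length u \<Longrightarrow> swp k u \<in> tidx d N n \<longleftrightarrow> u \<in> tidx d N n"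
  using mset_swp[of k u] unfolding tidx_def by (metis (no_types, lifting) length_swp mem_Collect_eq set_mset_mset)

lemma Sg_preserves:
  fixes t :: "'k::field"
  shows "preserves (tidx d N n) (Sg t k)"
  unfolding preserves_def vec_def
proof clarify
  fix x :: "_ \<Rightarrow> 'k" and u assume x: "\<forall>i. i \<notin> tidx d N n \<longrightarrow> x i = 0" and u: "u \<notin> tidx d N n"
  show "Sg t k x u = 0"
  proof (cases "Suc k < length u")
    case True
    then have "swp k u \<notin> tidx d N n" using u by (simp add: swp_tidx)
    then show ?thesis using x u True by (simp add: Sg_nth)
  qed (simp add: Sg_short)
qed

lemma Ep_preserves: "preserves (tidx d N n) (Ep k :: (_ \<Rightarrow> 'k::field) \<Rightarrow> _)"
  unfolding preserves_def vec_def
proof clarify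
  fix x :: "_ \<Rightarrow> 'k" and u assume x: "\<forall>i. i \<notin> tidx d N n \<longrightarrow> x i = 0" and u: "u \<notin> tidx d N n"
  then show "Ep k x u = 0"
    by (cases "Suc k < length u") (auto simp: Ep_nth Ep_short)
qed

text \<open>By the hypothesis on \<open>\<phi>\<close> a pair of letters can only be kept or
  exchanged, so the only words contributing to the coordinate \<open>u\<close> are \<open>u\<close>
  and \<open>swp k u\<close>.\<close>

lemma local_op_sum:
  assumes u: "u \<in> tidx d N n" "Suc k < n"
    and \<phi>: "\<And>a b c e. \<phi> a b [c, e] \<noteq> 0 \<Longrightarrow> (a, b) = (c, e) \<or> (a, b) = (e, c)"
    and x: "x \<in> vec (tidx d N n)"
  shows "local_op d N n (Suc k) \<phi> x u = (if u ! k = u ! Suc k then x u * \<phi> (u ! k) (u ! k) [u ! k, u ! k]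
    else x u * \<phi> (u ! k) (u ! Suc k) [u ! k, u ! Suc k] + x (swp k u) * \<phi> (u ! Suc k) (u ! k) [u ! k, u ! Suc k])"
proof -
  have lu: "length u = n" using u by (auto simp: tidx_def)
  define f where "f w = x w * (if length u = length w \<and> take k u = take k w \<and> drop (Suc (Suc k)) u = drop (Suc (Suc k)) w
     then \<phi> (w ! k) (w ! Suc k) [u ! k, u ! Suc k] else 0)" for w
  have eqI: "w = w'" if l: "length w = n" "length w' = n" and
    t: "take k w' = take k w" "drop (Suc (Suc k)) w' = drop (Suc (Suc k)) w"
    and n: "w ! k = w' ! k" "w ! Suc k = w' ! Suc k" for w w' :: "(nat \<times> nat) list"
  proof (rule nth_equalityI)
    show "length w = length w'" using l by simp
    fix i assume i: "i < length w"
    consider "i < k" | "i = k" | "i = Suc k" | "Suc (Suc k) \<le> i" by linarith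
    then show "w ! i = w' ! i"
    proof cases
      case 1
      then show ?thesis using t(1) by (metis nth_take)
    next
      case 4
      then obtain m where m: "i = Suc (Suc k) + m" by (metis le_iff_add)
      have "w ! i = drop (Suc (Suc k)) w ! m" "w' ! i = drop (Suc (Suc k)) w' ! m"
        unfolding m by (rule nth_drop[symmetric]; use i l m in simp)+
      then show ?thesis using t(2) by simp
    qed (use n in auto)
  qed
  have sw: "take k (swp k u) = take k u" "drop (Suc (Suc k)) (swp k u) = drop (Suc (Suc k)) u"
    "swp k u ! k = u ! Suc k" "swp k u ! Suc k = u ! k"
    using u(2) lu by (simp_all add: swp_def)
  have "local_op d N n (Suc k) \<phi> x u = (\<Sum>w\<in>tidx d N n. f w)"
    using x by (simp add: local_op_def lin_op_def f_def cong: if_cong)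
  also have "\<dots> = (\<Sum>w\<in>{u, swp k u}. f w)"
  proof (rule sum.mono_neutral_right)
    show "{u, swp k u} \<subseteq> tidx d N n" using u lu by (auto simp: swp_tidx)
    show "\<forall>w\<in>tidx d N n - {u, swp k u}. f w = 0"
    proof (rule ballI, rule ccontr)
      fix w assume w: "w \<in> tidx d N n - {u, swp k u}" and "f w \<noteq> 0"
      then have t: "take k u = take k w" "drop (Suc (Suc k)) u = drop (Suc (Suc k)) w"
        and nz: "\<phi> (w ! k) (w ! Suc k) [u ! k, u ! Suc k] \<noteq> 0"
        by (auto simp: f_def split: if_splits)
      have lw: "length w = n" using w by (auto simp: tidx_def)
      from \<phi>[OF nz] consider "w ! k = u ! k" "w ! Suc k = u ! Suc k" | "w ! k = u ! Suc k" "w ! Suc k = u ! k"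
        by auto
      then show False
      proof cases
        case 1
        then have "w = u" by (rule eqI[OF lw lu t])
        then show ?thesis using w by simp
      next
        case 2
        then have "w = swp k u" by (intro eqI[OF lw]) (simp_all add: sw lu t)
        then show ?thesis using w by simp
      qed
    qed
  qed simp
  also have "\<dots> = (if u ! k = u ! Suc k then x u * \<phi> (u ! k) (u ! k) [u ! k, u ! k]
    else x u * \<phi> (u ! k) (u ! Suc k) [u ! k, u ! Suc k] + x (swp k u) * \<phi> (u ! Suc k) (u ! k) [u ! k, u ! Suc k])"
  proof (cases "u ! k = u ! Suc k")
    case True
    then have "swp k u = u" by (simp add: swp_def) (metis list_update_id)
    then show ?thesis using True by (simp add: f_def)
  next
    case False
    then have "swp k u \<noteq> u" using sw by metis
    then show ?thesis using False sw by (simp add: f_def)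
  qed
  finally show ?thesis .
qed

lemma local_op_vec:
  assumes "x \<in> vec (tidx d N n)" "u \<notin> tidx d N n" "Suc k < n"
    and \<phi>: "\<And>a b c e. \<phi> a b [c, e] \<noteq> 0 \<Longrightarrow> (a, b) = (c, e) \<or> (a, b) = (e, c)"
  shows "local_op d N n (Suc k) \<phi> x u = 0"
proof -
  have "(if length u = length w \<and> take k u = take k w \<and> drop (Suc (Suc k)) u = drop (Suc (Suc k)) w
     then \<phi> (w ! k) (w ! Suc k) [u ! k, u ! Suc k] else 0) = 0" if w: "w \<in> tidx d N n" for w
  proof (rule ccontr)
    assume "\<not> ?thesis"
    then have t: "length u = length w" "take k u = take k w" "drop (Suc (Suc k)) u = drop (Suc (Suc k)) w"
      and nz: "\<phi> (w ! k) (w ! Suc k) [u ! k, u ! Suc k] \<noteq> 0" by (auto split: if_splits)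
    have l: "set v = set (take k v) \<union> {v ! k, v ! Suc k} \<union> set (drop (Suc (Suc k)) v)"
      if "Suc k < length v" for v :: "(nat \<times> nat) list"
    proof -
      have "take k v @ v ! k # v ! Suc k # drop (Suc (Suc k)) v = v"
        using that by (simp add: Cons_nth_drop_Suc)
      from arg_cong[of _ _ set, OF this] show ?thesis by auto
    qed
    have lw: "Suc k < length w" using w assms(3) by (auto simp: tidx_def)
    have "{w ! k, w ! Suc k} = {u ! k, u ! Suc k}" using \<phi>[OF nz] by auto
    then have "set u = set w" unfolding l[OF lw] l[of u, unfolded t(1), OF lw] t(2,3) by simp
    then show False using w assms(2) t(1) by (auto simp: tidx_def)
  qed
  then show ?thesis using assms(1) by (simp add: local_op_def lin_op_def cong: if_cong)
qed

lemma sigma_op_eq: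
  assumes "i \<in> {1..<n}"
  shows "sigma_op d N n i = res (tidx d N n) (Sg q (i - 1))"
proof -
  obtain k where k: "i = Suc k" "Suc k < n" using assms by (cases i) auto
  let ?\<phi> = "\<lambda>(b, k) (c, l). if b = c then R_check b k l else bv [(c, l), (b, k)]"
  have \<phi>: "(a, b) = (c, e) \<or> (a, b) = (e, c)" if "?\<phi> a b [c, e] \<noteq> (0::Cq)" for a b c e
    using that by (cases a; cases b; cases c; cases e) (auto simp: R_check_def bv_def split: if_splits)
  show ?thesis
  proof
    fix x show "sigma_op d N n i x = res (tidx d N n) (Sg q (i - 1)) x"
    proof (cases "x \<in> vec (tidx d N n)")
      case x: True
      have "local_op d N n (Suc k) ?\<phi> x u = Sg q k x u" for u
      proof (cases "u \<in> tidx d N n")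
        case True
        then have "length u = n" by (simp add: tidx_def)
        then have lu: "Suc k < length u" using k by simp
        have "local_op d N n (Suc k) ?\<phi> x u = (if u ! k = u ! Suc k then x u * ?\<phi> (u ! k) (u ! k) [u ! k, u ! k]
          else x u * ?\<phi> (u ! k) (u ! Suc k) [u ! k, u ! Suc k] + x (swp k u) * ?\<phi> (u ! Suc k) (u ! k) [u ! k, u ! Suc k])"
          by (rule local_op_sum[OF True k(2) \<phi> x])
        also have "\<dots> = Sg q k x u"
          by (cases "u ! k"; cases "u ! Suc k") (use lu in \<open>auto simp: Sg_nth R_check_def bv_def algebra_simps\<close>)
        finally show ?thesis .
      next
        case False
        then have "Sg q k x u = 0" using Sg_preserves[of d N n q k] x by (auto simp: preserves_def vec_def)
        then show ?thesis using local_op_vec[where \<phi> = ?\<phi>, OF x False k(2) \<phi>] by simp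
      qed
      then show ?thesis using x k by (auto simp: sigma_op_def)
    qed (simp add: sigma_op_def local_op_def lin_op_def)
  qed
qed

lemma eps_op_eq:
  assumes "i \<in> {1..<n}"
  shows "eps_op d N n i = res (tidx d N n) (Ep (i - 1))"
proof -
  obtain k where k: "i = Suc k" "Suc k < n" using assms by (cases i) auto
  let ?\<phi> = "\<lambda>(b, k) (c, l). if b = c then bv [(b, k), (c, l)] else (\<lambda>_. 0 :: Cq)"
  have \<phi>: "(a, b) = (c, e) \<or> (a, b) = (e, c)" if "?\<phi> a b [c, e] \<noteq> (0::Cq)" for a b c e
    using that by (cases a; cases b; cases c; cases e) (auto simp: bv_def split: if_splits)
  show ?thesis
  proof
    fix x show "eps_op d N n i x = res (tidx d N n) (Ep (i - 1)) x"
    proof (cases "x \<in> vec (tidx d N n)")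
      case x: True
      have "local_op d N n (Suc k) ?\<phi> x u = Ep k x u" for u
      proof (cases "u \<in> tidx d N n")
        case True
        then have "length u = n" by (simp add: tidx_def)
        then have lu: "Suc k < length u" using k by simp
        have "local_op d N n (Suc k) ?\<phi> x u = (if u ! k = u ! Suc k then x u * ?\<phi> (u ! k) (u ! k) [u ! k, u ! k]
          else x u * ?\<phi> (u ! k) (u ! Suc k) [u ! k, u ! Suc k] + x (swp k u) * ?\<phi> (u ! Suc k) (u ! k) [u ! k, u ! Suc k])"
          by (rule local_op_sum[OF True k(2) \<phi> x])
        also have "\<dots> = Ep k x u"
          by (cases "u ! k"; cases "u ! Suc k") (use lu in \<open>auto simp: Ep_nth bv_def\<close>)
        finally show ?thesis .
      next
        case False
        then have "Ep k x u = 0" using Ep_preserves[of d N n k] x by (auto simp: preserves_def vec_def)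
        then show ?thesis using local_op_vec[where \<phi> = ?\<phi>, OF x False k(2) \<phi>] by simp
      qed
      then show ?thesis using x k by (auto simp: eps_op_def)
    qed (simp add: eps_op_def local_op_def lin_op_def)
  qed
qed


section \<open>The representation of the algebra of braids and ties\<close>

text \<open>The formula for the inverse comes from the quadratic relation: s (s - (q - q^-1) E) =
  1.\<close>

primrec btop :: "btgen \<Rightarrow> tens \<Rightarrow> tens" where
  "btop (BS i) = Sg q (i - 1)"
| "btop (BE i) = Ep (i - 1)"
| "btop (BS' i) = (\<lambda>x u. Sg q (i - 1) x u - (q - inverse q) * Ep (i - 1) x u)"

definition bt_rho :: "nat \<Rightarrow> nat \<Rightarrow> nat \<Rightarrow> btgen \<Rightarrow> tens \<Rightarrow> tens" where
  "bt_rho d N n g = res (tidx d N n) (btop g)"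

lemma btop_linear: "total_linear (btop g)"
proof (cases g)
  case (BS' i)
  then show ?thesis by (simp add: total_linear_def Sg_lin Ep_lin algebra_simps)
qed (simp_all add: Sg_linear Ep_linear)

lemma btop_preserves: "preserves (tidx d N n) (btop g)"
proof (cases g)
  case (BS' i)
  then show ?thesis
    using Sg_preserves[of d N n q "i - 1"] Ep_preserves[where 'k = Cq, of d N n "i - 1"]
    by (simp add: preserves_def vec_def)
qed (simp_all add: Sg_preserves Ep_preserves)

lemma bt_rho_closed: "bt_rho d N n g \<in> carrier (endo (tidx d N n))"
  by (simp add: bt_rho_def res_closed btop_linear btop_preserves)

lemma btgens_simps [simp]:
  "BS i \<in> btgens n \<longleftrightarrow> i \<in> {1..<n}" "BS' i \<in> btgens n \<longleftrightarrow> i \<in> {1..<n}" "BE i \<in> btgens n \<longleftrightarrow> i \<in> {1..<n}"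
  by (auto simp: btgens_def)

lemma wf_bth_rels: "wf_rels (btgens n) (bth_rels n)"
  unfolding bth_rels_def tb_rels_def wf_rels_Un
  by (intro conjI; auto simp: wf_rels_def weq_def)

lemma Sg_S'_cancel:
  assumes "Suc k < length u"
  shows "Sg q k (\<lambda>u. Sg q k x u - (q - inverse q) * Ep k x u) u = x u"
    and "Sg q k (Sg q k x) u - (q - inverse q) * Ep k (Sg q k x) u = x u"
  using Sg_square[OF q_ne_0 assms, of x] by (simp_all add: Sg_lin Sg_Ep)

lemma bth_rels_btop:
  assumes "(l, r) \<in> bth_rels n" "length u = n"
  shows "lop btop l x u = lop btop r x u"
proof -
  have far: "Sg q k (Sg q j x) u = Sg q j (Sg q k x) u" "Sg q k (Ep j x) u = Ep j (Sg q k x) u"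
    if "\<bar>int k - int j\<bar> > 1" for k j
  proof -
    have "j = k + 2 + (j - k - 2)" if "k < j" using that \<open>\<bar>int k - int j\<bar> > 1\<close> by linarith
    moreover have "k = j + 2 + (k - j - 2)" if "\<not> k < j" using that \<open>\<bar>int k - int j\<bar> > 1\<close> by linarith
    ultimately consider m where "j = k + 2 + m" | m where "k = j + 2 + m" by blast
    then show "Sg q k (Sg q j x) u = Sg q j (Sg q k x) u" "Sg q k (Ep j x) u = Ep j (Sg q k x) u"
      using far_commute[of q] by (cases; simp)+
  qed
  have quad: ?thesis if S: "(l, r) \<in> {([(1, [BS i, BS i])], [(q - inverse q, [BS i, BE i]), (1, [])]) | i. i \<in> {1..<n}}"
  proof -
    obtain i where i: "i \<in> {1..<n}" "l = [(1, [BS i, BS i])]" "r = [(q - inverse q, [BS i, BE i]), (1, [])]"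
      using S by blast
    have "Suc (i - 1) < length u" using i(1) assms(2) by auto
    then show ?thesis using Sg_square[OF q_ne_0, of "i - 1" u x] by (simp add: i)
  qed
  show ?thesis using assms(1) unfolding bth_rels_def tb_rels_def
  proof (elim UnE)
    assume S: "(l, r) \<in> {r. \<exists>i\<in>{1..<n}. r \<in>
        {weq [BS i, BS' i] [], weq [BS' i, BS i] [],
         weq [BE i, BE i] [BE i], weq [BS i, BE i] [BE i, BS i]}}"
    then obtain i where i: "i \<in> {1..<n}" and "(l, r) = weq [BS i, BS' i] [] \<or> (l, r) = weq [BS' i, BS i] [] \<or>
       (l, r) = weq [BE i, BE i] [BE i] \<or> (l, r) = weq [BS i, BE i] [BE i, BS i]" by blast
    moreover have "Suc (i - 1) < length u" using i assms(2) by auto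
    ultimately show ?thesis
      using Sg_S'_cancel[of "i - 1" u x] by (auto simp: weq_def Ep_idem Sg_Ep)
  next
    assume "(l, r) \<in> {r. \<exists>i\<in>{1..<n}. \<exists>j\<in>{1..<n}. r = weq [BE i, BE j] [BE j, BE i]}"
    then obtain i j where "(l, r) = weq [BE i, BE j] [BE j, BE i]" by blast
    then show ?thesis using Ep_commute[of "i - 1" "j - 1"] by (auto simp: weq_def)
  next
    assume "(l, r) \<in> {r. \<exists>i\<in>{1..<n}. \<exists>j\<in>{1..<n}. \<bar>int i - int j\<bar> > 1 \<and> r \<in>
        {weq [BS i, BS j] [BS j, BS i], weq [BS i, BE j] [BE j, BS i]}}"
    then obtain i j where ij: "i \<in> {1..<n}" "j \<in> {1..<n}" "\<bar>int i - int j\<bar> > 1"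
      and "(l, r) = weq [BS i, BS j] [BS j, BS i] \<or> (l, r) = weq [BS i, BE j] [BE j, BS i]" by blast
    moreover have "\<bar>int (i - 1) - int (j - 1)\<bar> > 1" using ij by auto
    ultimately show ?thesis using far[of "i - 1" "j - 1"] by (auto simp: weq_def)
  next
    assume "(l, r) \<in> {r. \<exists>i\<in>{1..<n}. \<exists>j\<in>{1..<n}. \<bar>int i - int j\<bar> = 1 \<and> r \<in>
        {weq [BS i, BS j, BS i] [BS j, BS i, BS j],
         weq [BE i, BS j, BS i] [BS j, BS i, BE j],
         weq [BE i, BS j, BS' i] [BS j, BS' i, BE j],
         weq [BE i, BE j, BS i] [BE j, BS i, BE j],
         weq [BE j, BS i, BE j] [BS i, BE j, BE i]}}"
    then obtain i j where ij: "i \<in> {1..<n}" "j \<in> {1..<n}" "\<bar>int i - int j\<bar> = 1"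
      and c: "(l, r) = weq [BS i, BS j, BS i] [BS j, BS i, BS j] \<or>
         (l, r) = weq [BE i, BS j, BS i] [BS j, BS i, BE j] \<or>
         (l, r) = weq [BE i, BS j, BS' i] [BS j, BS' i, BE j] \<or>
         (l, r) = weq [BE i, BE j, BS i] [BE j, BS i, BE j] \<or>
         (l, r) = weq [BE j, BS i, BE j] [BS i, BE j, BE i]" by blast
    have lc: "lop btop [(1, w)] x u = wop btop w x u" for w by simp
    from ij consider k where "i = Suc k" "j = Suc (Suc k)" "Suc (Suc k) < length u"
      | k where "j = Suc k" "i = Suc (Suc k)" "Suc (Suc k) < length u"
    proof (cases "i < j")
      case True
      then show ?thesis using that(1)[of "i - 1"] ij assms(2) by auto
    next
      case False
      then show ?thesis using that(2)[of "j - 1"] ij assms(2) by auto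
    qed
    then show ?thesis
    proof cases
      case 1
      note E = Ep_Sg_Sg[OF 1(3), of q x, THEN conjunct1]
        Ep_Sg_Sg[OF 1(3), of q x, THEN conjunct2, THEN conjunct2, THEN conjunct1]
        Ep_Sg_Sg[OF 1(3), of q x, THEN conjunct2, THEN conjunct2, THEN conjunct2, THEN conjunct1]
        Ep_Sg_Sg[OF 1(3), of q x, THEN conjunct2, THEN conjunct2, THEN conjunct2, THEN conjunct2, THEN conjunct2]
      show ?thesis using c
        by (elim disjE) (auto simp: weq_def 1(1,2) braid[OF q_ne_0 1(3)] E Sg_lin Ep_lin)
    next
      case 2
      note E = Ep_Sg_Sg[OF 2(3), of q x, THEN conjunct2, THEN conjunct1]
        Ep_Sg_Sg[OF 2(3), of q x, THEN conjunct2, THEN conjunct2, THEN conjunct2, THEN conjunct1]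
        Ep_Sg_Sg[OF 2(3), of q x, THEN conjunct2, THEN conjunct2, THEN conjunct2, THEN conjunct2, THEN conjunct1]
        Ep_Sg_Sg[OF 2(3), of q x, THEN conjunct2, THEN conjunct2, THEN conjunct2, THEN conjunct2, THEN conjunct2]
      show ?thesis using c
        by (elim disjE) (auto simp: weq_def 2(1,2) braid[OF q_ne_0 2(3), symmetric] E Sg_lin Ep_lin)
    qed
  qed (rule quad)
qed

lemma sat_bth_rels: "sat_rels (endo (tidx d N n)) (bt_rho d N n) (bth_rels n)"
  by (rule sat_rels_res[where T = btop, OF btop_preserves bt_rho_def wf_bth_rels bth_rels_btop])
    (auto simp: tidx_def)

definition BTev :: "nat \<Rightarrow> nat \<Rightarrow> nat \<Rightarrow> (btgen list \<Rightarrow> Cq) set \<Rightarrow> tens \<Rightarrow> tens" where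
  "BTev d N n = pres_ev (endo (tidx d N n)) (bt_rho d N n)"

lemma BTev_hom: "BTev d N n \<in> alg_hom (BTH n) (endo (tidx d N n))"
  unfolding BTev_def BTH_def
  by (rule kalg.pres_ev_hom[OF endo_kalg bt_rho_closed wf_bth_rels sat_bth_rels])

lemma BTev_gens:
  assumes "i \<in> {1..<n}"
  shows "BTev d N n (bth_s n i) = sigma_op d N n i" "BTev d N n (bth_E n i) = eps_op d N n i"
  using assms unfolding BTev_def bth_s_def bth_E_def
  by (simp_all add: kalg.pres_ev_gen[OF endo_kalg bt_rho_closed wf_bth_rels sat_bth_rels]
      bt_rho_def sigma_op_eq eps_op_eq)

lemma BTev_coset:
  assumes "x \<in> carrier (free_alg (btgens n))"
  shows "BTev d N n (rel_ideal (btgens n) (bth_rels n) +>\<^bsub>free_alg (btgens n)\<^esub> x)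
    = free_ev (endo (tidx d N n)) (bt_rho d N n) x"
  unfolding BTev_def
  by (rule kalg.pres_ev_coset[OF endo_kalg bt_rho_closed wf_bth_rels sat_bth_rels assms])

lemma BTH_kalg: "kalg (BTH n)"
  unfolding BTH_def by (rule kalg.pres_alg_kalg[OF endo_kalg bt_rho_closed wf_bth_rels])

lemma BTH_cases:
  assumes "X \<in> carrier (BTH n)"
  obtains x where "x \<in> carrier (free_alg (btgens n))"
    "X = rel_ideal (btgens n) (bth_rels n) +>\<^bsub>free_alg (btgens n)\<^esub> x"
  using kalg.pres_alg_cases[OF endo_kalg bt_rho_closed wf_bth_rels] assms unfolding BTH_def by metis

subsection \<open>The commutant of the smash product\<close>

lemma (in kalg) commute_free_ev:
  assumes \<rho>: "\<And>g. g \<in> X \<Longrightarrow> \<rho> g \<in> carrier A" and f: "f \<in> carrier A"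
    and c: "\<And>g. g \<in> X \<Longrightarrow> f \<otimes> \<rho> g = \<rho> g \<otimes> f"
    and x: "x \<in> carrier (free_alg X)"
  shows "f \<otimes> free_ev A \<rho> x = free_ev A \<rho> x \<otimes> f"
proof -
  have w: "f \<otimes> word_ev A \<rho> w = word_ev A \<rho> w \<otimes> f" if "set w \<subseteq> X" for w
    using that
  proof (induction w)
    case (Cons g w)
    have cl: "\<rho> g \<in> carrier A" "word_ev A \<rho> w \<in> carrier A"
      using Cons.prems \<rho> by (auto intro: word_ev_closed[of X])
    have "f \<otimes> (\<rho> g \<otimes> word_ev A \<rho> w) = (f \<otimes> \<rho> g) \<otimes> word_ev A \<rho> w" using cl f by (simp add: m_assoc)
    also have "\<dots> = \<rho> g \<otimes> (f \<otimes> word_ev A \<rho> w)" using cl f c Cons.prems by (simp add: m_assoc)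
    also have "\<dots> = (\<rho> g \<otimes> word_ev A \<rho> w) \<otimes> f" using cl f Cons by (simp add: m_assoc)
    finally show ?case by simp
  qed (use f in simp)
  show ?thesis using x
  proof (induction rule: free_alg_induct)
    case zero
    then show ?case using f by (simp add: free_ev_zero[of X, OF \<rho>])
  next
    case (add x c w)
    have m: "(\<lambda>u. c * bv w u) \<in> carrier (free_alg X)"
      using kalg.smult_closed[OF free_alg_kalg bv_free_alg[OF add(2)], of c] by simp
    have cl: "word_ev A \<rho> w \<in> carrier A" using \<rho> add(2) by (rule word_ev_closed)
    have e: "free_ev A \<rho> (\<lambda>u. x u + c * bv w u) = free_ev A \<rho> x \<oplus> c \<odot> word_ev A \<rho> w"
      using \<rho> add(1,2) m by (simp add: free_ev_add[of X] free_ev_smult[of X] free_ev_bv[of X])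
    show ?case unfolding e
      using f cl free_ev_closed[OF \<rho> add(1)] w[OF add(2)] add(3)
      by (simp add: r_distr l_distr smult_mult_l smult_mult_r)
  qed
qed

lemma EndUqS_simps [simp]:
  "mult (EndUqS d N n) = mult (endo (tidx d N n))" "one (EndUqS d N n) = one (endo (tidx d N n))"
  "add (EndUqS d N n) = add (endo (tidx d N n))" "smult (EndUqS d N n) = smult (endo (tidx d N n))"
  by (simp_all add: EndUqS_def endo_over_def)

lemma perm_rep_eq:
  assumes "\<tau> permutes {1..d}"
  shows "perm_rep d N n \<tau> = res (tidx d N n) (PT (inv' \<tau>))"
proof
  fix x show "perm_rep d N n \<tau> x = res (tidx d N n) (PT (inv' \<tau>)) x"
  proof (cases "x \<in> vec (tidx d N n)")
    case True
    have "(\<Sum>w\<in>tidx d N n. x w * bv (map (\<lambda>(b, i). (\<tau> b, i)) w) u) = PT (inv' \<tau>) x u" for u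
    proof -
      let ?v = "map (\<lambda>(b, i). (inv' \<tau> b, i)) u"
      have e: "u = map (\<lambda>(b, i). (\<tau> b, i)) w \<longleftrightarrow> ?v = w" for w
        using assms by (auto simp: permutes_inverses case_prod_beta comp_def intro!: map_idI[symmetric])
      have "(\<Sum>w\<in>tidx d N n. x w * bv (map (\<lambda>(b, i). (\<tau> b, i)) w) u)
        = (\<Sum>w\<in>tidx d N n. if ?v = w then x ?v else 0)"
        by (rule sum.cong) (auto simp: bv_def e)
      also have "\<dots> = x ?v" using True by (auto simp: vec_def)
      finally show ?thesis by (simp add: PT_def)
    qed
    then show ?thesis using True by (auto simp: perm_rep_def lin_op_def)
  qed (simp add: perm_rep_def lin_op_def)
qed

lemma PT_preserves:
  assumes "\<tau> permutes {1..d}"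
  shows "preserves (tidx d N n) (PT \<tau>)"
proof -
  have "\<tau> b \<in> {1..d} \<longleftrightarrow> b \<in> {1..d}" for b using assms by (rule permutes_in_image)
  then have "map (\<lambda>(b, i). (\<tau> b, i)) u \<in> tidx d N n \<longleftrightarrow> u \<in> tidx d N n" for u
    by (fastforce simp: tidx_def vidx_def)
  then show ?thesis by (auto simp: preserves_def vec_def PT_def)
qed

lemma PT_linear: "total_linear (PT \<tau>)"
  by (auto simp: total_linear_def PT_def fun_eq_iff)

lemma perm_rep_closed: "\<tau> permutes {1..d} \<Longrightarrow> perm_rep d N n \<tau> \<in> carrier (endo (tidx d N n))"
  by (simp add: perm_rep_eq res_closed PT_linear PT_preserves permutes_inv)

lemma endo_commute_iff:
  assumes "f \<in> carrier (endo I)" "g \<in> carrier (endo I)"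
  shows "f \<otimes>\<^bsub>endo I\<^esub> g = g \<otimes>\<^bsub>endo I\<^esub> f \<longleftrightarrow> (\<forall>x\<in>vec I. f (g x) = g (f x))"
  using assms by (auto simp: compose_def fun_eq_iff restrict_def)

lemma UqS_rep_closed:
  assumes "a \<in> carrier (UqS d N)"
  shows "(\<lambda>\<tau>. Uq_rep d N n (a \<tau>) \<otimes>\<^bsub>endo (tidx d N n)\<^esub> perm_rep d N n \<tau>) \<in> carrier (sym_group d) \<rightarrow> carrier (endo (tidx d N n))"
    "UqS_rep d N n a \<in> carrier (endo (tidx d N n))"
proof -
  interpret E: kalg "endo (tidx d N n) :: (Cq, _) module" by (rule endo_kalg)
  show *: "(\<lambda>\<tau>. Uq_rep d N n (a \<tau>) \<otimes>\<^bsub>endo (tidx d N n)\<^esub> perm_rep d N n \<tau>) \<in> carrier (sym_group d) \<rightarrow> carrier (endo (tidx d N n))"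
  proof
    fix \<tau> assume t: "\<tau> \<in> carrier (sym_group d)"
    then have "a \<tau> \<in> carrier (Uq d N)" using assms by (auto simp: UqS_def smash_def)
    then show "Uq_rep d N n (a \<tau>) \<otimes>\<^bsub>endo (tidx d N n)\<^esub> perm_rep d N n \<tau> \<in> carrier (endo (tidx d N n))"
      using t by (intro E.m_closed perm_rep_closed ring_hom_closed[OF alg_hom_ring_hom[OF Uq_rep_hom]])
        (auto simp: sym_group_carrier)
  qed
  show "UqS_rep d N n a \<in> carrier (endo (tidx d N n))"
    unfolding UqS_rep_def by (rule E.finsum_closed[OF *])
qed

lemma finite_sym_group [simp]: "finite (carrier (sym_group d))"
  by (simp add: sym_group_def finite_permutations)

text \<open>The element X times \<tau> of the smash product. It permits commutation with the quantum
  group and with the permutations to be tested separately.\<close>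

lemma UqS_rep_single:
  assumes t: "\<tau> permutes {1..d}" and X: "X \<in> carrier (Uq d N)"
  defines "a \<equiv> \<lambda>\<sigma>\<in>carrier (sym_group d). if \<tau> = \<sigma> then X else \<zero>\<^bsub>Uq d N\<^esub>"
  shows "a \<in> carrier (UqS d N)"
    and "UqS_rep d N n a = Uq_rep d N n X \<otimes>\<^bsub>endo (tidx d N n)\<^esub> perm_rep d N n \<tau>"
proof -
  interpret E: kalg "endo (tidx d N n) :: (Cq, _) module" by (rule endo_kalg)
  interpret U: kalg "Uq d N" by (rule Uq_kalg)
  interpret h: ring_hom_ring "Uq d N" "endo (tidx d N n)" "Uq_rep d N n"
    by (rule U.alg_hom_ring_hom_ring[OF E.kalg_axioms Uq_rep_hom])
  show "a \<in> carrier (UqS d N)" using X by (auto simp: a_def UqS_def smash_def)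
  have t': "\<tau> \<in> carrier (sym_group d)" using t by (simp add: sym_group_carrier)
  let ?f = "\<lambda>\<sigma>. Uq_rep d N n X \<otimes>\<^bsub>endo (tidx d N n)\<^esub> perm_rep d N n \<sigma>"
  have cl: "?f \<in> carrier (sym_group d) \<rightarrow> carrier (endo (tidx d N n))"
    using X by (intro funcsetI E.m_closed perm_rep_closed h.hom_closed) (auto simp: sym_group_carrier)
  have "UqS_rep d N n a = (\<Oplus>\<^bsub>endo (tidx d N n)\<^esub>\<sigma>\<in>carrier (sym_group d). if \<tau> = \<sigma> then ?f \<sigma> else \<zero>\<^bsub>endo (tidx d N n)\<^esub>)"
    unfolding UqS_rep_def
  proof (rule E.finsum_cong')
    show "(\<lambda>\<sigma>. if \<tau> = \<sigma> then ?f \<sigma> else \<zero>\<^bsub>endo (tidx d N n)\<^esub>) \<in> carrier (sym_group d) \<rightarrow> carrier (endo (tidx d N n))"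
      using cl by (auto simp del: endo_simps)
    fix \<sigma> assume s: "\<sigma> \<in> carrier (sym_group d)"
    then have "perm_rep d N n \<sigma> \<in> carrier (endo (tidx d N n))"
      by (intro perm_rep_closed) (simp add: sym_group_carrier)
    then show "Uq_rep d N n (a \<sigma>) \<otimes>\<^bsub>endo (tidx d N n)\<^esub> perm_rep d N n \<sigma> = (if \<tau> = \<sigma> then ?f \<sigma> else \<zero>\<^bsub>endo (tidx d N n)\<^esub>)"
      using s by (auto simp: a_def h.hom_zero E.l_null simp del: endo_simps)
  qed simp
  also have "\<dots> = ?f \<tau>" by (rule E.finsum_singleton[OF t' _ cl]) simp
  finally show "UqS_rep d N n a = ?f \<tau>" .
qed

text \<open>Replaces the smash product by generators: the identity permutation with a generator as
  coefficient gives the condition on \<open>Top\<close>, and coefficient one gives the condition on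
  \<open>PT\<close>. Conversely the centraliser of \<open>f\<close> is a subalgebra, and every
  element acts as a sum of products of the two kinds.\<close>

lemma EndUqS_iff:
  "f \<in> carrier (EndUqS d N n) \<longleftrightarrow> f \<in> carrier (endo (tidx d N n)) \<and>
    (\<forall>g\<in>ugens d N. \<forall>x\<in>vec (tidx d N n). f (Top g x) = Top g (f x)) \<and>
    (\<forall>\<tau>. \<tau> permutes {1..d} \<longrightarrow> (\<forall>x\<in>vec (tidx d N n). f (PT \<tau> x) = PT \<tau> (f x)))"
  (is "_ \<longleftrightarrow> ?C \<and> ?U \<and> ?P")
proof -
  let ?I = "tidx d N n"
  interpret E: kalg "endo ?I :: (Cq, _) module" by (rule endo_kalg)
  interpret U: kalg "Uq d N" by (rule Uq_kalg)
  note Uh = alg_hom_ring_hom[OF Uq_rep_hom[of d N n]]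
  have eq: "f \<otimes>\<^bsub>endo ?I\<^esub> UqS_rep d N n a = UqS_rep d N n a \<otimes>\<^bsub>endo ?I\<^esub> f \<longleftrightarrow>
      (\<forall>x\<in>vec ?I. f (UqS_rep d N n a x) = UqS_rep d N n a (f x))"
    if ?C "a \<in> carrier (UqS d N)" for a
    by (rule endo_commute_iff[OF that(1) UqS_rep_closed(2)[OF that(2)]])
  have "f \<in> carrier (EndUqS d N n) \<longleftrightarrow> ?C \<and> (\<forall>a\<in>carrier (UqS d N). \<forall>x\<in>vec ?I. f (UqS_rep d N n a x) = UqS_rep d N n a (f x))"
    unfolding EndUqS_def endo_over_def by simp
  also have "\<dots> \<longleftrightarrow> ?C \<and> (\<forall>a\<in>carrier (UqS d N). f \<otimes>\<^bsub>endo ?I\<^esub> UqS_rep d N n a = UqS_rep d N n a \<otimes>\<^bsub>endo ?I\<^esub> f)"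
    using eq by blast
  finally have iff: "f \<in> carrier (EndUqS d N n) \<longleftrightarrow> \<dots>" .
  show ?thesis
  proof
    assume "f \<in> carrier (EndUqS d N n)"
    then have f: ?C and c: "\<And>a. a \<in> carrier (UqS d N) \<Longrightarrow> f \<otimes>\<^bsub>endo ?I\<^esub> UqS_rep d N n a = UqS_rep d N n a \<otimes>\<^bsub>endo ?I\<^esub> f"
      unfolding iff by auto
    have s: "f \<otimes>\<^bsub>endo ?I\<^esub> (Uq_rep d N n X \<otimes>\<^bsub>endo ?I\<^esub> perm_rep d N n \<tau>) = (Uq_rep d N n X \<otimes>\<^bsub>endo ?I\<^esub> perm_rep d N n \<tau>) \<otimes>\<^bsub>endo ?I\<^esub> f"
      if "\<tau> permutes {1..d}" "X \<in> carrier (Uq d N)" for \<tau> X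
      using c[OF UqS_rep_single(1)[OF that]] unfolding UqS_rep_single(2)[OF that] .
    have "PT id = (\<lambda>x :: tens. x)" by (intro ext) (simp add: PT_def case_prod_unfold)
    then have id: "perm_rep d N n id = \<one>\<^bsub>endo ?I\<^esub>"
      by (simp add: perm_rep_eq permutes_id)
    have ?U
    proof (intro ballI)
      fix g and x :: tens assume g: "g \<in> ugens d N" and x: "x \<in> vec ?I"
      have X: "pres_gen (ugens d N) (u_rels d N) g \<in> carrier (Uq d N)"
        unfolding pres_gen_def Uq_def using g
        by (intro kalg.coset_in_pres_alg[OF endo_kalg tens_rep_closed wf_u_rels]) auto
      have "f \<otimes>\<^bsub>endo ?I\<^esub> tens_rep d N n g = tens_rep d N n g \<otimes>\<^bsub>endo ?I\<^esub> f"
        using s[OF permutes_id X] g tens_rep_closed[OF g, of n] unfolding Uq_rep_gen[OF g] id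
        by (simp add: E.r_one del: endo_simps)
      then show "f (Top g x) = Top g (f x)"
        using x endo_commute_iff[OF f tens_rep_closed[OF g]] endo_vec[OF f x] by (simp add: tens_rep_eq[OF g])
    qed
    moreover have ?P
    proof (intro allI impI ballI)
      fix \<tau> and x :: tens assume t: "\<tau> permutes {1..d}" and x: "x \<in> vec ?I"
      have t': "inv' \<tau> permutes {1..d}" "inv' (inv' \<tau>) = \<tau>" using t by (simp_all add: permutes_inv permutes_inv_inv)
      have "f \<otimes>\<^bsub>endo ?I\<^esub> perm_rep d N n (inv' \<tau>) = perm_rep d N n (inv' \<tau>) \<otimes>\<^bsub>endo ?I\<^esub> f"
        using s[OF t'(1) U.one_closed] perm_rep_closed[OF t'(1), of N n] ring_hom_one[OF Uh]
        by (simp add: E.l_one del: endo_simps)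
      then show "f (PT \<tau> x) = PT \<tau> (f x)"
        using x endo_commute_iff[OF f perm_rep_closed[OF t'(1)]] endo_vec[OF f x]
        by (simp add: perm_rep_eq[OF t'(1)] t'(2))
    qed
    ultimately show "?C \<and> ?U \<and> ?P" using f by blast
  next
    assume A: "?C \<and> ?U \<and> ?P"
    then have f: ?C by blast
    have gens: "f \<otimes>\<^bsub>endo ?I\<^esub> tens_rep d N n g = tens_rep d N n g \<otimes>\<^bsub>endo ?I\<^esub> f" if g: "g \<in> ugens d N" for g
      unfolding endo_commute_iff[OF f tens_rep_closed[OF g]] unfolding tens_rep_eq[OF g]
      using A g endo_vec[OF f] Top_preserves[OF g, of n] by (auto simp: preserves_def)
    have perms: "f \<otimes>\<^bsub>endo ?I\<^esub> perm_rep d N n \<tau> = perm_rep d N n \<tau> \<otimes>\<^bsub>endo ?I\<^esub> f" if t: "\<tau> permutes {1..d}" for \<tau>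
      unfolding endo_commute_iff[OF f perm_rep_closed[OF t]] unfolding perm_rep_eq[OF t]
      using A permutes_inv[OF t] endo_vec[OF f] by auto
    have Ur: "f \<otimes>\<^bsub>endo ?I\<^esub> Uq_rep d N n X = Uq_rep d N n X \<otimes>\<^bsub>endo ?I\<^esub> f" if "X \<in> carrier (Uq d N)" for X
    proof -
      from that obtain x where x: "x \<in> carrier (free_alg (ugens d N))"
        "X = rel_ideal (ugens d N) (u_rels d N) +>\<^bsub>free_alg (ugens d N)\<^esub> x"
        by (auto simp: Uq_def pres_alg_def FactRing_def A_RCOSETS_def')
      have "Uq_rep d N n X = free_ev (endo ?I) (tens_rep d N n) x"
        unfolding x(2) Uq_rep_def
        by (rule kalg.pres_ev_coset[OF endo_kalg tens_rep_closed wf_u_rels sat_u_rels x(1)])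
      then show ?thesis using E.commute_free_ev[OF tens_rep_closed f gens x(1)] by simp
    qed
    have "f \<otimes>\<^bsub>endo ?I\<^esub> UqS_rep d N n a = UqS_rep d N n a \<otimes>\<^bsub>endo ?I\<^esub> f" if a: "a \<in> carrier (UqS d N)" for a
    proof -
      note cl = UqS_rep_closed(1)[OF a, of n]
      have c: "f \<otimes>\<^bsub>endo ?I\<^esub> (Uq_rep d N n (a \<tau>) \<otimes>\<^bsub>endo ?I\<^esub> perm_rep d N n \<tau>) = (Uq_rep d N n (a \<tau>) \<otimes>\<^bsub>endo ?I\<^esub> perm_rep d N n \<tau>) \<otimes>\<^bsub>endo ?I\<^esub> f"
        if t: "\<tau> \<in> carrier (sym_group d)" for \<tau>
      proof -
        have X: "a \<tau> \<in> carrier (Uq d N)" using a t by (auto simp: UqS_def smash_def)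
        have p: "\<tau> permutes {1..d}" using t by (simp add: sym_group_carrier)
        show ?thesis
          using Ur[OF X] perms[OF p] f ring_hom_closed[OF Uh X] perm_rep_closed[OF p, of N n]
          by (metis E.m_assoc)
      qed
      have "f \<otimes>\<^bsub>endo ?I\<^esub> UqS_rep d N n a = (\<Oplus>\<^bsub>endo ?I\<^esub>\<tau>\<in>carrier (sym_group d). f \<otimes>\<^bsub>endo ?I\<^esub> (Uq_rep d N n (a \<tau>) \<otimes>\<^bsub>endo ?I\<^esub> perm_rep d N n \<tau>))"
        unfolding UqS_rep_def by (rule E.finsum_rdistr[OF finite_sym_group f cl])
      also have "\<dots> = (\<Oplus>\<^bsub>endo ?I\<^esub>\<tau>\<in>carrier (sym_group d). (Uq_rep d N n (a \<tau>) \<otimes>\<^bsub>endo ?I\<^esub> perm_rep d N n \<tau>) \<otimes>\<^bsub>endo ?I\<^esub> f)"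
      proof (rule E.finsum_cong')
        show "(\<lambda>\<tau>. (Uq_rep d N n (a \<tau>) \<otimes>\<^bsub>endo ?I\<^esub> perm_rep d N n \<tau>) \<otimes>\<^bsub>endo ?I\<^esub> f) \<in> carrier (sym_group d) \<rightarrow> carrier (endo ?I)"
          by (rule funcsetI, rule E.m_closed[OF funcset_mem[OF cl] f])
      qed (use c in auto)
      also have "\<dots> = UqS_rep d N n a \<otimes>\<^bsub>endo ?I\<^esub> f"
        unfolding UqS_rep_def by (rule E.finsum_ldistr[OF finite_sym_group f cl, symmetric])
      finally show ?thesis .
    qed
    then show "f \<in> carrier (EndUqS d N n)" unfolding iff using f by blast
  qed
qed

lemma btop_EndUqS: "g \<in> btgens n \<Longrightarrow> bt_rho d N n g \<in> carrier (EndUqS d N n)"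
  unfolding EndUqS_iff
proof (intro conjI allI impI ballI)
  assume g: "g \<in> btgens n"
  have vecI: "y = z" if "y \<in> vec (tidx d N n)" "z \<in> vec (tidx d N n)" "\<And>u. length u = n \<Longrightarrow> y u = z u" for y z :: tens
    using that by (auto simp: vec_def tidx_def fun_eq_iff) metis
  obtain k where k: "g = BS (Suc k) \<or> g = BS' (Suc k) \<or> g = BE (Suc k)" "Suc k < n"
    using g by (cases g) (auto simp: Suc_le_eq gr0_conv_Suc)
  note bp = btop_preserves[of d N n g, unfolded preserves_def, rule_format]
  show "bt_rho d N n g \<in> carrier (endo (tidx d N n))" by (rule bt_rho_closed)
  show "bt_rho d N n g (Top h x) = Top h (bt_rho d N n g x)" if h: "h \<in> ugens d N" and x: "x \<in> vec (tidx d N n)" for h x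
  proof -
    note tp = Top_preserves[OF h, of n, unfolded preserves_def, rule_format]
    have l: "Top h (\<lambda>u. y u - c * z u) = (\<lambda>u. Top h y u - c * Top h z u)" for y z c
    proof -
      have "Top h (\<lambda>u. y u + - c * z u) = (\<lambda>u. Top h y u + Top h (\<lambda>u. - c * z u) u)"
        using Top_linear[of h] unfolding total_linear_def by (elim conjE allE[of _ y] allE[of _ "\<lambda>u. - c * z u"])
      moreover have "Top h (\<lambda>u. - c * z u) = (\<lambda>u. - c * Top h z u)"
        using Top_linear[of h] unfolding total_linear_def by blast
      ultimately show ?thesis by simp
    qed
    have "btop g (Top h x) = Top h (btop g x)"
    proof (rule vecI)
      fix u :: "(nat \<times> nat) list" assume "length u = n"
      then have "Suc k < length u" using k by simp
      then show "btop g (Top h x) u = Top h (btop g x) u"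
        using k(1) by (auto simp: Sg_Top Ep_Top l)
    qed (intro tp bp x)+
    then show ?thesis using x tp by (simp add: bt_rho_def)
  qed
  show "bt_rho d N n g (PT \<tau> x) = PT \<tau> (bt_rho d N n g x)" if t: "\<tau> permutes {1..d}" and x: "x \<in> vec (tidx d N n)" for \<tau> x
  proof -
    have i: "inj \<tau>" using t by (rule permutes_inj)
    have pp: "PT \<tau> x \<in> vec (tidx d N n)" using PT_preserves[OF t, of N n] x unfolding preserves_def by blast
    have l: "PT \<tau> (\<lambda>u. y u - c * z u) = (\<lambda>u. PT \<tau> y u - c * PT \<tau> z u)" for y z and c :: Cq
      by (auto simp: PT_def fun_eq_iff)
    have "btop g (PT \<tau> x) = PT \<tau> (btop g x)"
      using k(1) by (auto simp: Sg_PT[OF i] Ep_PT[OF i] l)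
    then show ?thesis using x pp by (simp add: bt_rho_def)
  qed
qed


section \<open>The commutant at q = 1\<close>

definition mm :: "'i set \<Rightarrow> ('i \<Rightarrow> 'i \<Rightarrow> 'k::field) \<Rightarrow> ('i \<Rightarrow> 'i \<Rightarrow> 'k) \<Rightarrow> 'i \<Rightarrow> 'i \<Rightarrow> 'k" where
  "mm I A B = (\<lambda>u v. \<Sum>w\<in>I. A u w * B w v)"

text \<open>Equality is demanded only inside \<open>I\<close>, because the matrices used below are
  functions on all pairs of words.\<close>

definition com :: "'i set \<Rightarrow> ('i \<Rightarrow> 'i \<Rightarrow> 'k::field) \<Rightarrow> ('i \<Rightarrow> 'i \<Rightarrow> 'k) \<Rightarrow> bool" where
  "com I f A \<longleftrightarrow> (\<forall>u\<in>I. \<forall>v\<in>I. mm I f A u v = mm I A f u v)"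

lemma mm_assoc: "mm I (mm I A B) C u v = mm I A (mm I B C) u v"
  by (simp add: mm_def sum_distrib_left sum_distrib_right mult.assoc) (rule sum.swap)

lemma com_mm:
  assumes "com I f A" "com I f B" shows "com I f (mm I A B)"
  unfolding com_def
proof (intro ballI)
  fix u v assume uv: "u \<in> I" "v \<in> I"
  have "mm I f (mm I A B) u v = mm I (mm I f A) B u v" by (simp add: mm_assoc)
  also have "\<dots> = mm I (mm I A f) B u v"
    unfolding mm_def[of I _ B] by (rule sum.cong) (use assms(1) uv in \<open>auto simp: com_def\<close>)
  also have "\<dots> = mm I A (mm I f B) u v" by (simp add: mm_assoc)
  also have "\<dots> = mm I A (mm I B f) u v"
    unfolding mm_def[of I A] by (rule sum.cong) (use assms(2) uv in \<open>auto simp: com_def\<close>)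
  also have "\<dots> = mm I (mm I A B) f u v" by (simp add: mm_assoc)
  finally show "mm I f (mm I A B) u v = mm I (mm I A B) f u v" .
qed

lemma com_cong:
  assumes "com I f A" "\<And>u v. u \<in> I \<Longrightarrow> v \<in> I \<Longrightarrow> A u v = B u v" shows "com I f B"
proof -
  have "mm I f B u v = mm I f A u v" "mm I B f u v = mm I A f u v" if "u \<in> I" "v \<in> I" for u v
    unfolding mm_def by (rule sum.cong; use assms(2) that in auto)+
  then show ?thesis using assms(1) by (auto simp: com_def)
qed

lemma com_diff: "com I f A \<Longrightarrow> com I f B \<Longrightarrow> com I f (\<lambda>u v. A u v - B u v)"
  by (simp add: com_def mm_def algebra_simps sum_subtractf)

lemma com_scale: "com I f A \<Longrightarrow> com I f (\<lambda>u v. c * A u v)"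
  by (simp add: com_def mm_def mult.left_commute mult.assoc flip: sum_distrib_left)

lemma com_sum:
  assumes "\<And>s. s \<in> S \<Longrightarrow> com I f (A s)" shows "com I f (\<lambda>u v. \<Sum>s\<in>S. A s u v)"
proof -
  have "mm I f (\<lambda>u v. \<Sum>s\<in>S. A s u v) u v = (\<Sum>s\<in>S. mm I f (A s) u v)"
    "mm I (\<lambda>u v. \<Sum>s\<in>S. A s u v) f u v = (\<Sum>s\<in>S. mm I (A s) f u v)" for u v
    unfolding mm_def sum_distrib_left sum_distrib_right by (rule sum.swap)+
  then show ?thesis using assms by (auto simp: com_def intro: sum.cong)
qed

subsection \<open>Derivations\<close>

text \<open>At \<open>t = 1\<close> both twists disappear and the matrix unit acts as a primitive
  element, that is, as a derivation of the tensor power.\<close>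

definition Dop :: "'a \<Rightarrow> 'a \<Rightarrow> ('a list \<Rightarrow> 'k::field) \<Rightarrow> 'a list \<Rightarrow> 'k" where
  "Dop = H 1 (\<lambda>_. 0) (\<lambda>_. 0)"

lemma Dop_Nil [simp]: "Dop a b x [] = 0" by (simp add: Dop_def)

lemma Dop_Cons: "Dop a b x (c # u) = Dop a b (sl c x) u + (if c = a then sl b x u else 0)"
  by (simp add: Dop_def H_Cons)

lemma sl_Dop: "sl c (Dop a b x) = (\<lambda>u. Dop a b (sl c x) u + (if c = a then sl b x u else 0))"
  by (simp add: Dop_def sl_H cong: if_cong)

lemma Dop_add: "Dop a b (\<lambda>u. x u + y u) = (\<lambda>u. Dop a b x u + Dop a b y u)"
  by (simp add: Dop_def H_add)

lemma Dop_commutator: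
  fixes x :: "'a list \<Rightarrow> 'k::field"
  assumes "a \<noteq> c" "a \<noteq> b"
  shows "Dop a b (Dop b c x) u - Dop b c (Dop a b x) u = Dop a c x u"
proof (induction u arbitrary: x)
  case (Cons e u)
  have IH: "Dop a b (Dop b c y) u = Dop a c y u + Dop b c (Dop a b y) u" for y :: "'a list \<Rightarrow> 'k"
    using Cons[of y] by (simp add: algebra_simps)
  show ?case using assms
    by (cases "e = a"; cases "e = b") (simp_all add: Dop_Cons sl_Dop Dop_add IH cong: if_cong)
qed simp

lemma Dop_nth: "Dop a b x u = (\<Sum>k<length u. if u ! k = a then x (u[k := b]) else 0)"
proof (induction u arbitrary: x)
  case (Cons e u)
  show ?case by (simp add: Dop_Cons Cons sum.lessThan_Suc_shift sl_def del: sum.lessThan_Suc cong: if_cong)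
qed simp

definition dmat :: "'a \<Rightarrow> 'a \<Rightarrow> 'a list \<Rightarrow> 'a list \<Rightarrow> 'k::field" where
  "dmat a b u w = Dop a b (bv w) u"

lemma update_tidx: "u \<in> tidx d N n \<Longrightarrow> b \<in> vidx d N \<Longrightarrow> u[k := b] \<in> tidx d N n"
  using set_update_subset_insert[of u k b] by (auto simp: tidx_def)

lemma mm_dmat:
  assumes "u \<in> tidx d N n" "b \<in> vidx d N"
  shows "mm (tidx d N n) (dmat a b) B u v = Dop a b (\<lambda>w. B w v) u"
proof -
  have "(\<Sum>w\<in>tidx d N n. dmat a b u w * B w v)
      = (\<Sum>w\<in>tidx d N n. \<Sum>k<length u. if u ! k = a \<and> w = u[k := b] then B w v else 0)"
    by (rule sum.cong) (auto simp: dmat_def Dop_nth sum_distrib_right bv_def intro!: sum.cong)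
  also have "\<dots> = (\<Sum>k<length u. \<Sum>w\<in>tidx d N n. if u ! k = a \<and> w = u[k := b] then B w v else 0)"
    by (rule sum.swap)
  also have "\<dots> = (\<Sum>k<length u. if u ! k = a then B (u[k := b]) v else 0)"
    using update_tidx[OF assms] by (intro sum.cong) (auto cong: conj_cong)
  finally show ?thesis by (simp add: mm_def Dop_nth)
qed

text \<open>The matrix units satisfy [E_ab, E_bc] = E_ac for distinct \<open>a\<close> and
  \<open>c\<close>, and a commutant is closed under commutators.\<close>

lemma com_commutator:
  assumes "com (tidx d N n) f (dmat a b)" "com (tidx d N n) f (dmat b c)"
    and "a \<noteq> c" "a \<noteq> b" "a \<in> vidx d N" "b \<in> vidx d N" "c \<in> vidx d N"
  shows "com (tidx d N n) f (dmat a c)"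
proof (rule com_cong)
  show "com (tidx d N n) f (\<lambda>u v. mm (tidx d N n) (dmat a b) (dmat b c) u v - mm (tidx d N n) (dmat b c) (dmat a b) u v)"
    by (intro com_diff com_mm assms)
  have e: "(\<lambda>w. dmat p p' w v) = Dop p p' (bv v)" for p p' and v :: "(nat \<times> nat) list"
    by (simp add: dmat_def)
  show "mm (tidx d N n) (dmat a b) (dmat b c) u v - mm (tidx d N n) (dmat b c) (dmat a b) u v = dmat a c u v"
    if "u \<in> tidx d N n" for u v
    using Dop_commutator[OF assms(3,4), of "bv v" u] that assms
    by (simp add: mm_dmat e) (simp add: dmat_def)
qed

text \<open>Every root vector of gl_N is an iterated commutator of simple ones; the induction is on
  the distance of the two letters.\<close>

lemma com_dmat_colour:
  assumes adj: "\<And>i. i \<in> {1..<N} \<Longrightarrow> com (tidx d N n) f (dmat (b, i) (b, i + 1))"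
    "\<And>i. i \<in> {1..<N} \<Longrightarrow> com (tidx d N n) f (dmat (b, i + 1) (b, i))"
    and b: "b \<in> {1..d}" and ij: "i \<in> {1..N}" "j \<in> {1..N}" "i \<noteq> j"
  shows "com (tidx d N n) f (dmat (b, i) (b, j))"
proof -
  have *: "com (tidx d N n) f (dmat (b, i) (b, i + Suc k)) \<and> com (tidx d N n) f (dmat (b, i + Suc k) (b, i))"
    if "i \<ge> 1" "i + Suc k \<le> N" for i k
    using that
  proof (induction k)
    case 0
    then show ?case using adj[of i] by auto
  next
    case (Suc k)
    have v: "(b, i) \<in> vidx d N" "(b, i + Suc k) \<in> vidx d N" "(b, i + Suc (Suc k)) \<in> vidx d N"
      using Suc.prems b by (auto simp: vidx_def)
    have a: "com (tidx d N n) f (dmat (b, i + Suc k) (b, i + Suc (Suc k)))"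
      "com (tidx d N n) f (dmat (b, i + Suc (Suc k)) (b, i + Suc k))"
      using adj[of "i + Suc k"] Suc.prems by auto
    have IH: "com (tidx d N n) f (dmat (b, i) (b, i + Suc k))" "com (tidx d N n) f (dmat (b, i + Suc k) (b, i))"
      using Suc by auto
    show ?case
      using com_commutator[OF IH(1) a(1) _ _ v] com_commutator[OF a(2) IH(2) _ _ v(3,2,1)] by simp
  qed
  show ?thesis
  proof (cases "i < j")
    case True
    then obtain k where "j = i + Suc k" using less_imp_Suc_add by fastforce
    then show ?thesis using *[of i k] ij by auto
  next
    case False
    then have "j < i" using ij(3) by simp
    then obtain k where "i = j + Suc k" using less_imp_Suc_add by fastforce
    then show ?thesis using *[of j k] ij by auto
  qed
qed

subsection \<open>The basis of the Schur algebra\<close>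

text \<open>The standard basis of the Schur algebra: the multiset of letter pairs labels the orbit
  of \<open>(u, v)\<close> under simultaneous permutation of places, and \<open>Bmat M\<close> is
  the indicator matrix of that orbit.\<close>

definition Bmat :: "('a \<times> 'a) multiset \<Rightarrow> 'a list \<Rightarrow> 'a list \<Rightarrow> 'k::field" where
  "Bmat M u v = (if mset (zip u v) = M then 1 else 0)"

lemma mset_zip_update:
  assumes "k < length u" "length u = length v"
  shows "mset (zip (u[k := b]) v) = add_mset (b, v ! k) (mset (zip u v) - {#(u ! k, v ! k)#})"
proof -
  have "zip (u[k := b]) (v[k := v ! k]) = (zip u v)[k := (b, v ! k)]" by (simp add: update_zip)
  then show ?thesis using assms by (simp add: mset_update)
qed

lemma count_zip:
  assumes "length u = length v"
  shows "count (mset (zip u v)) (a, z) = card {k. k < length u \<and> u ! k = a \<and> v ! k = z}"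
proof -
  have "count (mset (zip u v)) (a, z) = length (filter (\<lambda>p. (a, z) = p) (zip u v))"
    by (induction u v rule: list_induct2') auto
  also have "\<dots> = card {k. k < length u \<and> u ! k = a \<and> v ! k = z}"
    unfolding length_filter_conv_card using assms by (intro arg_cong[of _ _ card]) auto
  finally show ?thesis .
qed

text \<open>The derivation changes one letter \<open>a\<close> of the row word to \<open>b\<close>.
  To land in the orbit \<open>M\<close> it must use up a pair \<open>(b, z)\<close> of
  \<open>M\<close> coming from a pair \<open>(a, z)\<close>; the coefficient counts the places where
  this is possible.\<close>

lemma dmat_Bmat:
  fixes M :: "((nat \<times> nat) \<times> (nat \<times> nat)) multiset"
  assumes u: "u \<in> tidx d N n" and v: "v \<in> tidx d N n" and ab: "a \<in> vidx d N" "b \<in> vidx d N" "a \<noteq> b"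
  defines "Mz \<equiv> \<lambda>z. add_mset (a, z) (M - {#(b, z)#})"
  shows "mm (tidx d N n) (dmat a b) (Bmat M) u v
    = (\<Sum>z\<in>vidx d N. (if (b, z) \<in># M then of_nat (count (Mz z) (a, z)) * Bmat (Mz z) u v else (0 :: 'k::field)))"
proof -
  have l: "length u = n" "length v = n" using u v by (auto simp: tidx_def)
  have vk: "v ! k \<in> vidx d N" if "k < n" for k using v l that by (auto simp: tidx_def intro!: nth_mem)
  have one: "Bmat M (u[k := b]) v = (\<Sum>z\<in>vidx d N. if v ! k = z \<and> (b, z) \<in># M \<and> mset (zip u v) = Mz z then 1 else (0::'k))"
    if k: "k < n" "u ! k = a" for k
  proof -
    have m: "(a, v ! k) \<in># mset (zip u v)" using k l by (auto simp: in_set_zip)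
    have "mset (zip (u[k := b]) v) = M \<longleftrightarrow> (b, v ! k) \<in># M \<and> mset (zip u v) = Mz (v ! k)"
      unfolding mset_zip_update[of k u v b, unfolded l, OF k(1) refl] k(2) Mz_def using m ab(3)
      by (metis add_mset_remove_trivial insert_DiffM union_single_eq_member)
    then have "Bmat M (u[k := b]) v = (if (b, v ! k) \<in># M \<and> mset (zip u v) = Mz (v ! k) then 1 else (0::'k))"
      by (simp add: Bmat_def)
    also have "\<dots> = (\<Sum>z\<in>vidx d N. if v ! k = z then (if (b, v ! k) \<in># M \<and> mset (zip u v) = Mz (v ! k) then 1 else 0) else 0)"
      using vk[OF k(1)] by simp
    also have "\<dots> = (\<Sum>z\<in>vidx d N. if v ! k = z \<and> (b, z) \<in># M \<and> mset (zip u v) = Mz z then 1 else (0::'k))"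
      by (rule sum.cong) auto
    finally show ?thesis .
  qed
  have "mm (tidx d N n) (dmat a b) (Bmat M) u v = (\<Sum>k<n. if u ! k = a then Bmat M (u[k := b]) v else (0::'k))"
    using mm_dmat[OF u ab(2)] l by (simp add: Dop_nth)
  also have "\<dots> = (\<Sum>k<n. \<Sum>z\<in>vidx d N. if u ! k = a \<and> v ! k = z \<and> (b, z) \<in># M \<and> mset (zip u v) = Mz z then 1 else 0)"
    by (rule sum.cong) (simp_all add: one)
  also have "\<dots> = (\<Sum>z\<in>vidx d N. \<Sum>k<n. if u ! k = a \<and> v ! k = z \<and> (b, z) \<in># M \<and> mset (zip u v) = Mz z then 1 else 0)"
    by (rule sum.swap)
  also have "\<dots> = (\<Sum>z\<in>vidx d N. (if (b, z) \<in># M then of_nat (count (Mz z) (a, z)) * Bmat (Mz z) u v else 0))"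
  proof (rule sum.cong)
    fix z
    show "(\<Sum>k<n. if u ! k = a \<and> v ! k = z \<and> (b, z) \<in># M \<and> mset (zip u v) = Mz z then 1 else (0::'k))
      = (if (b, z) \<in># M then of_nat (count (Mz z) (a, z)) * Bmat (Mz z) u v else 0)"
    proof (cases "(b, z) \<in># M \<and> mset (zip u v) = Mz z")
      case True
      have "(\<Sum>k<n. if u ! k = a \<and> v ! k = z then 1 else (0::'k)) = of_nat (card {k. k < n \<and> u ! k = a \<and> v ! k = z})"
        by (simp add: sum.If_cases) (rule arg_cong[of _ _ "\<lambda>S. of_nat (card S)"], auto)
      then show ?thesis using True count_zip[of u v a z] l by (simp add: Bmat_def)
    qed (auto simp: Bmat_def)
  qed simp
  finally show ?thesis .
qed

definition offdiag :: "('a \<times> 'a) multiset \<Rightarrow> nat" where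
  "offdiag M = size (filter_mset (\<lambda>(p, p'). p \<noteq> p') M)"

definition same_colour :: "nat \<Rightarrow> nat \<Rightarrow> ((nat \<times> nat) \<times> (nat \<times> nat)) multiset \<Rightarrow> bool" where
  "same_colour d N M \<longleftrightarrow> (\<forall>(p, p')\<in>#M. p \<in> vidx d N \<and> p' \<in> vidx d N \<and> fst p = fst p')"

text \<open>The basis is generated triangularly from derivations and weight projections. The
  induction is on the number of pairs with different entries; characteristic 0 is needed to divide
  by a multiplicity.\<close>

lemma com_Bmat:
  fixes f :: "(nat \<times> nat) list \<Rightarrow> (nat \<times> nat) list \<Rightarrow> 'k::field_char_0"
  assumes D: "\<And>p p'. p \<in> vidx d N \<Longrightarrow> p' \<in> vidx d N \<Longrightarrow> fst p = fst p' \<Longrightarrow> p \<noteq> p' \<Longrightarrow>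
      com (tidx d N n) f (dmat p p')"
    and W: "\<And>u v. u \<in> tidx d N n \<Longrightarrow> v \<in> tidx d N n \<Longrightarrow> f u v \<noteq> 0 \<Longrightarrow> mset u = mset v"
    and M: "same_colour d N M"
  shows "com (tidx d N n) f (Bmat M)"
  using M
proof (induction "offdiag M" arbitrary: M rule: less_induct)
  case less
  show ?case
  proof (cases "offdiag M = 0")
    case True
    \<comment> \<open>With only diagonal pairs, \<open>Bmat M\<close> projects onto the words of one
      content, and \<open>f\<close> preserves contents by \<open>W\<close>.\<close>
    have diag: "w = v" if "mset (zip w v) = M" "length w = length v" for w v
    proof -
      have "\<forall>(p, p')\<in>#M. p = p'" using True unfolding offdiag_def size_eq_0_iff_empty filter_mset_eq_mempty_iff by auto
      then have "\<forall>(p, p')\<in>set (zip w v). p = p'" using that(1) by (metis set_mset_mset)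
      then have "list_all2 (=) w v" using that(2) unfolding list_all2_iff by simp
      then show ?thesis by (simp add: list.rel_eq)
    qed
    have zz: "mset (zip u u) = image_mset (\<lambda>p. (p, p)) (mset u)" for u :: "(nat \<times> nat) list"
      by (induction u) auto
    have "mm (tidx d N n) f (Bmat M) u v = mm (tidx d N n) (Bmat M) f u v"
      if uv: "u \<in> tidx d N n" "v \<in> tidx d N n" for u v
    proof -
      have "(\<Sum>w\<in>tidx d N n. f u w * Bmat M w v) = (\<Sum>w\<in>tidx d N n. if w = v then f u v * Bmat M v v else 0)"
        by (rule sum.cong) (use diag uv in \<open>auto simp: Bmat_def tidx_def\<close>)
      also have "\<dots> = f u v * Bmat M v v" using uv by simp
      also have "\<dots> = Bmat M u u * f u v"
        using W[OF uv] by (cases "f u v = 0") (auto simp: Bmat_def zz)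
      also have "\<dots> = (\<Sum>w\<in>tidx d N n. if u = w then Bmat M u u * f u v else 0)" using uv by simp
      also have "\<dots> = (\<Sum>w\<in>tidx d N n. Bmat M u w * f w v)"
        by (rule sum.cong) (use diag uv in \<open>auto simp: Bmat_def tidx_def\<close>)
      finally show ?thesis by (simp add: mm_def)
    qed
    then show ?thesis by (simp add: com_def)
  next
    case False
    then obtain a b where ab: "(a, b) \<in># M" "a \<noteq> b"
      unfolding offdiag_def size_eq_0_iff_empty filter_mset_eq_mempty_iff by auto
    have v: "a \<in> vidx d N" "b \<in> vidx d N" "fst a = fst b" using less.prems ab by (auto simp: same_colour_def)
    \<comment> \<open>Turning one pair \<open>(a, b)\<close> into \<open>(b, b)\<close> gives a
      smaller multiset. Applying the derivation to \<open>Bmat M0\<close> restores \<open>M\<close>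
      from the summand \<open>z = b\<close>; every other summand consumes an off-diagonal pair
      \<open>(b, z)\<close> and is therefore smaller than \<open>M\<close>.\<close>
    define M0 where "M0 = add_mset (b, b) (M - {#(a, b)#})"
    define Mz where "Mz z = add_mset (a, z) (M0 - {#(b, z)#})" for z
    obtain M' where M': "M = add_mset (a, b) M'" using ab(1) by (metis insert_DiffM)
    have sc0: "same_colour d N M0" using less.prems v by (auto simp: same_colour_def M0_def M')
    have o0: "Suc (offdiag M0) = offdiag M" using ab by (simp add: offdiag_def M0_def M')
    have Mb: "Mz b = M" by (simp add: Mz_def M0_def M')
    have z: "same_colour d N (Mz z)" "z \<noteq> b \<Longrightarrow> offdiag (Mz z) < offdiag M" if "(b, z) \<in># M0" for z
    proof -
      obtain M'' where M'': "M0 = add_mset (b, z) M''" using \<open>(b, z) \<in># M0\<close> by (metis insert_DiffM)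
      show "same_colour d N (Mz z)" using sc0 v by (auto simp: same_colour_def Mz_def M'')
      show "offdiag (Mz z) < offdiag M" if "z \<noteq> b"
        using o0 that by (simp add: offdiag_def Mz_def M'')
    qed
    have c0: "com (tidx d N n) f (mm (tidx d N n) (dmat a b) (Bmat M0))"
      using less.hyps[OF _ sc0] o0 D v ab(2) by (intro com_mm) auto
    let ?t = "\<lambda>z u v. if (b, z) \<in># M0 then of_nat (count (Mz z) (a, z)) * Bmat (Mz z) u v else (0 :: 'k)"
    have "com (tidx d N n) f (?t z)" if "z \<in> vidx d N - {b}" for z
    proof (cases "(b, z) \<in># M0")
      case True
      then show ?thesis using that z[OF True] by (simp add: com_scale less.hyps)
    next
      case False
      then show ?thesis by (simp add: com_def mm_def)
    qed
    then have "com (tidx d N n) f (\<lambda>u v. \<Sum>z\<in>vidx d N - {b}. ?t z u v)" by (rule com_sum)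
    then have c1: "com (tidx d N n) f (\<lambda>u v. inverse (of_nat (count M (a, b))) * (mm (tidx d N n) (dmat a b) (Bmat M0) u v
        - (\<Sum>z\<in>vidx d N - {b}. ?t z u v)))"
      by (intro com_scale com_diff c0)
    show ?thesis
    proof (rule com_cong[OF c1])
      fix u w assume uw: "u \<in> tidx d N n" "w \<in> tidx d N n"
      have "mm (tidx d N n) (dmat a b) (Bmat M0) u w = (\<Sum>z\<in>vidx d N. ?t z u w)"
        unfolding dmat_Bmat[OF uw v(1,2) ab(2)] Mz_def ..
      also have "\<dots> = ?t b u w + (\<Sum>z\<in>vidx d N - {b}. ?t z u w)"
        using v(2) by (intro sum.remove) auto
      also have "?t b u w = of_nat (count M (a, b)) * Bmat M u w" by (simp add: Mb) (simp add: M0_def)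
      moreover have "of_nat (count M (a, b)) \<noteq> (0 :: 'k)"
        unfolding of_nat_eq_0_iff using ab(1) by simp
      ultimately show "inverse (of_nat (count M (a, b))) * (mm (tidx d N n) (dmat a b) (Bmat M0) u w
        - (\<Sum>z\<in>vidx d N - {b}. ?t z u w)) = Bmat M u w"
        by simp
    qed
  qed
qed


subsection \<open>Pivots\<close>

text \<open>
  The relation \<open>sp x a\<close> says that \<open>x\<close> lies in a valuation ring with residue \<open>a\<close>.
  Lifting a basis of the residues of a space \<open>A\<close> of functions so that it is dual to a set of pivots
  gives linearly independent elements of \<open>A\<close> itself; this replaces an appeal to Nakayama's lemma.
\<close>

locale residue =
  fixes sp :: "'K::field \<Rightarrow> 'k::field \<Rightarrow> bool"
  assumes sp_one: "sp 1 1"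
    and sp_add: "sp x a \<Longrightarrow> sp y b \<Longrightarrow> sp (x + y) (a + b)"
    and sp_uminus: "sp x a \<Longrightarrow> sp (- x) (- a)"
    and sp_mult: "sp x a \<Longrightarrow> sp y b \<Longrightarrow> sp (x * y) (a * b)"
    and sp_inverse: "sp x a \<Longrightarrow> a \<noteq> 0 \<Longrightarrow> sp (inverse x) (inverse a)"
    and sp_unique: "sp x a \<Longrightarrow> sp x b \<Longrightarrow> a = b"
begin

lemma sp_zero: "sp 0 0"
  using sp_add[OF sp_one sp_uminus[OF sp_one]] by simp

lemma sp_sum: "(\<And>i. i \<in> S \<Longrightarrow> sp (f i) (g i)) \<Longrightarrow> sp (\<Sum>i\<in>S. f i) (\<Sum>i\<in>S. g i)"
  by (induction S rule: infinite_finite_induct) (auto simp: sp_zero sp_add)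

lemma sp_nonzero: "sp x a \<Longrightarrow> a \<noteq> 0 \<Longrightarrow> x \<noteq> 0"
  using sp_unique[OF sp_zero] by blast

text \<open>Gaussian elimination over a valuation ring. Members of \<open>A\<close> carry their
  residues along; \<open>P\<close> is a largest set of positions admitting a dual family in
  \<open>A\<close>, and an element whose residue vanishes on \<open>P\<close> but not everywhere
  would enlarge it.\<close>

lemma pivots:
  fixes A :: "(('t \<Rightarrow> 'K) \<times> ('t \<Rightarrow> 'k)) set"
  assumes T: "finite T"
    and add: "\<And>x x' y y'. (x, x') \<in> A \<Longrightarrow> (y, y') \<in> A \<Longrightarrow> (\<lambda>t. x t + y t, \<lambda>t. x' t + y' t) \<in> A"
    and scale: "\<And>x x' c c'. (x, x') \<in> A \<Longrightarrow> sp c c' \<Longrightarrow> (\<lambda>t. c * x t, \<lambda>t. c' * x' t) \<in> A"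
    and sp: "\<And>x x' t. (x, x') \<in> A \<Longrightarrow> t \<in> T \<Longrightarrow> sp (x t) (x' t)"
  obtains P a a' where "P \<subseteq> T" "\<And>p. p \<in> P \<Longrightarrow> (a p, a' p) \<in> A"
    "\<And>p r. p \<in> P \<Longrightarrow> r \<in> P \<Longrightarrow> a p r = (if p = r then 1 else 0)"
    "\<And>x x' t. (x, x') \<in> A \<Longrightarrow> (\<And>p. p \<in> P \<Longrightarrow> x' p = 0) \<Longrightarrow> t \<in> T \<Longrightarrow> x' t = 0"
proof -
  define good where "good P \<longleftrightarrow> P \<subseteq> T \<and> (\<exists>a a'. (\<forall>p\<in>P. (a p, a' p) \<in> A) \<and>
    (\<forall>p\<in>P. \<forall>r\<in>P. a p r = (if p = r then 1 else 0)))" for P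
  have "good {}" by (simp add: good_def)
  moreover have "good Q \<Longrightarrow> card Q \<le> card T" for Q using T by (simp add: good_def card_mono)
  ultimately obtain P where P: "good P" and max: "\<And>Q. good Q \<Longrightarrow> card Q \<le> card P"
    using ex_has_greatest_nat[of good "{}" card "Suc (card T)"] by (auto simp: less_Suc_eq_le)
  obtain a a' where a: "\<And>p. p \<in> P \<Longrightarrow> (a p, a' p) \<in> A"
    "\<And>p r. p \<in> P \<Longrightarrow> r \<in> P \<Longrightarrow> a p r = (if p = r then 1 else 0)" and PT: "P \<subseteq> T"
    using P unfolding good_def by blast
  have finP: "finite P" using PT T by (rule finite_subset)
  have "x' t = 0" if x: "(x, x') \<in> A" and x0: "\<And>p. p \<in> P \<Longrightarrow> x' p = 0" and t: "t \<in> T" for x x' t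
  proof (rule ccontr)
    assume nz: "x' t \<noteq> 0"
    have tP: "t \<notin> P" using nz x0 by blast
    \<comment> \<open>Clears the entries at the pivots. The coefficients \<open>x p\<close> have
      residue \<open>x' p = 0\<close>, so the residue at \<open>t\<close> is unchanged.\<close>
    define y where "y s = x s + (\<Sum>p\<in>P. - x p * a p s)" for s
    define y' where "y' s = x' s + (\<Sum>p\<in>P. - x' p * a' p s)" for s
    have "(\<lambda>s. x s + (\<Sum>p\<in>Q. - x p * a p s), \<lambda>s. x' s + (\<Sum>p\<in>Q. - x' p * a' p s)) \<in> A" if "Q \<subseteq> P" for Q
      using finite_subset[OF that finP] that
    proof (induction Q rule: finite_induct)
      case (insert p Q)
      then show ?case
        using add[OF insert.IH scale[OF a(1)[of p] sp_uminus[OF sp[OF x, of p]]]] PT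
        by (auto simp: add_ac)
    qed (use x in simp)
    then have yA: "(y, y') \<in> A" unfolding y_def y'_def by blast
    have y0: "y p = 0" if "p \<in> P" for p
    proof -
      have "(\<Sum>r\<in>P. - x r * a r p) = (\<Sum>r\<in>P. if r = p then - x p else 0)"
        by (rule sum.cong) (use a(2) that in auto)
      then show ?thesis using that finP by (simp add: y_def)
    qed
    have y't: "y' t = x' t" by (simp add: y'_def x0)
    have yt: "sp (y t) (x' t)" using sp[OF yA t] y't by simp
    \<comment> \<open>The entry at \<open>t\<close> has nonzero residue, so its inverse has a
      residue too and scaling stays inside \<open>A\<close>.\<close>
    define z z' where "z s = inverse (y t) * y s" and "z' s = inverse (x' t) * y' s" for s
    have zA: "(z, z') \<in> A" unfolding z_def z'_def by (rule scale[OF yA sp_inverse[OF yt nz]])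
    have zt: "z t = 1" "\<And>p. p \<in> P \<Longrightarrow> z p = 0"
      using sp_nonzero[OF yt nz] y0 by (simp_all add: z_def)
    \<comment> \<open>The new row \<open>z\<close> clears column \<open>t\<close> of the old rows;
      since \<open>z\<close> vanishes on \<open>P\<close>, duality there is preserved.\<close>
    define b where "b p = (if p = t then z else (\<lambda>s. a p s + - a p t * z s))" for p
    define b' where "b' p = (if p = t then z' else (\<lambda>s. a' p s + - a' p t * z' s))" for p
    have "(b p, b' p) \<in> A" if "p \<in> insert t P" for p
      using that zA add[OF a(1)[of p] scale[OF zA sp_uminus[OF sp[OF a(1)[of p] t]]]]
      by (auto simp: b_def b'_def)
    moreover have "b p r = (if p = r then 1 else 0)" if "p \<in> insert t P" "r \<in> insert t P" for p r
      using that zt a(2) tP by (auto simp: b_def)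
    ultimately have "good (insert t P)" unfolding good_def using t PT by blast
    then show False using max[of "insert t P"] tP finP by simp
  qed
  with that[OF PT a] show thesis by blast
qed

text \<open>Subtract from an element of \<open>B\<close> the combination of pivot rows that agrees
  with it on \<open>P\<close>. If the difference were nonzero, it could be normalised to have a
  nonzero residue, which by \<open>lift\<close> is a residue of \<open>A\<close> vanishing on the
  pivots; such a residue is zero.\<close>

lemma lift_from_residues:
  fixes A B :: "('t \<Rightarrow> 'K) set"
  assumes T: "finite T"
    and A: "\<And>x y. x \<in> A \<Longrightarrow> y \<in> A \<Longrightarrow> (\<lambda>t. x t + y t) \<in> A" "\<And>x c. x \<in> A \<Longrightarrow> (\<lambda>t. c * x t) \<in> A" "(\<lambda>t. 0) \<in> A"
    and B: "\<And>x y. x \<in> B \<Longrightarrow> y \<in> B \<Longrightarrow> (\<lambda>t. x t + y t) \<in> B" "\<And>x c. x \<in> B \<Longrightarrow> (\<lambda>t. c * x t) \<in> B"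
    and AB: "A \<subseteq> B"
    and sup: "\<And>x t. x \<in> B \<Longrightarrow> t \<notin> T \<Longrightarrow> x t = 0"
    and lift: "\<And>x x'. x \<in> B \<Longrightarrow> (\<And>t. t \<in> T \<Longrightarrow> sp (x t) (x' t)) \<Longrightarrow> \<exists>y\<in>A. \<forall>t\<in>T. sp (y t) (x' t)"
    and normalise: "\<And>x. \<exists>t\<in>T. x t \<noteq> 0 \<Longrightarrow> \<exists>c x'. (\<forall>t\<in>T. sp (c * x t) (x' t)) \<and> (\<exists>t\<in>T. x' t \<noteq> 0)"
  shows "B \<subseteq> A"
proof
  fix x assume x: "x \<in> B"
  let ?A = "{(y, y'). y \<in> A \<and> (\<forall>t\<in>T. sp (y t) (y' t))}"
  obtain P a a' where P: "P \<subseteq> T" "\<And>p. p \<in> P \<Longrightarrow> (a p, a' p) \<in> ?A"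
    "\<And>p r. p \<in> P \<Longrightarrow> r \<in> P \<Longrightarrow> a p r = (if p = r then 1 else 0)"
    "\<And>x x' t. (x, x') \<in> ?A \<Longrightarrow> (\<And>p. p \<in> P \<Longrightarrow> x' p = 0) \<Longrightarrow> t \<in> T \<Longrightarrow> x' t = 0"
    by (rule pivots[of T ?A]) (use T A in \<open>auto intro: sp_add sp_mult\<close>)
  have finP: "finite P" using P(1) T by (rule finite_subset)
  define y where "y Q s = (\<Sum>p\<in>Q. x p * a p s)" for Q s
  have yA: "y Q \<in> A" if "Q \<subseteq> P" for Q
    using finite_subset[OF that finP] that
  proof (induction Q rule: finite_induct)
    case empty
    then show ?case using A(3) by (simp add: y_def)
  next
    case (insert p Q)
    then have "(\<lambda>t. x p * a p t + y Q t) \<in> A" using P(2)[of p] by (intro A) auto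
    moreover have "y (insert p Q) = (\<lambda>t. x p * a p t + y Q t)" using insert by (simp add: y_def fun_eq_iff)
    ultimately show ?case by simp
  qed
  have yp: "y P p = x p" if "p \<in> P" for p
  proof -
    have "y P p = (\<Sum>r\<in>P. if r = p then x p else 0)"
      unfolding y_def by (rule sum.cong) (use P(3) that in auto)
    then show ?thesis using that finP by simp
  qed
  \<comment> \<open>The factor \<open>-1\<close> is written out so that the closure of
    \<open>B\<close> under sums and multiples applies.\<close>
  define g where "g t = x t + (-1) * y P t" for t
  have gB: "g \<in> B" unfolding g_def using x yA[OF order_refl] AB by (intro B) auto
  have "g t = 0" if tT: "t \<in> T" for t
  proof (rule ccontr)
    assume "g t \<noteq> 0"
    then obtain c g' where c: "\<And>t. t \<in> T \<Longrightarrow> sp (c * g t) (g' t)" "\<exists>t\<in>T. g' t \<noteq> 0"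
      using normalise[of g] tT by blast
    obtain h where h: "h \<in> A" "\<forall>t\<in>T. sp (h t) (g' t)" using lift[OF B(2)[OF gB] c(1)] by blast
    have g0: "g' p = 0" if "p \<in> P" for p
    proof -
      have "g p = 0" using yp[OF that] by (simp add: g_def)
      then show ?thesis using c(1)[of p] that P(1) sp_unique[OF sp_zero] by auto
    qed
    have "\<And>t. t \<in> T \<Longrightarrow> g' t = 0" by (rule P(4)[of h g']) (use h g0 in auto)
    then show False using c(2) by blast
  qed
  then have "x = y P" using sup[OF gB] by (force simp: g_def fun_eq_iff)
  then show "x \<in> A" using yA[OF order_refl] by simp
qed

end

lemma residue_eq: "residue (=)"
  by unfold_locales auto

text \<open>Linear algebra over one field is the case of the trivial residue, where every element is
  its own residue.\<close>

lemma dual_basis: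
  fixes A :: "('t \<Rightarrow> 'k::field) set"
  assumes T: "finite T"
    and A: "\<And>x y. x \<in> A \<Longrightarrow> y \<in> A \<Longrightarrow> (\<lambda>t. x t + y t) \<in> A" "\<And>x c. x \<in> A \<Longrightarrow> (\<lambda>t. c * x t) \<in> A"
  obtains P a where "P \<subseteq> T" "\<And>p. p \<in> P \<Longrightarrow> a p \<in> A" "\<And>x t. x \<in> A \<Longrightarrow> t \<in> T \<Longrightarrow> x t = (\<Sum>p\<in>P. x p * a p t)"
proof -
  interpret residue "(=) :: 'k \<Rightarrow> 'k \<Rightarrow> bool" by (rule residue_eq)
  let ?A = "{(y, y'). y \<in> A \<and> y' = y}"
  obtain P a a' where P: "P \<subseteq> T" "\<And>p. p \<in> P \<Longrightarrow> (a p, a' p) \<in> ?A"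
    "\<And>p r. p \<in> P \<Longrightarrow> r \<in> P \<Longrightarrow> a p r = (if p = r then 1 else 0)"
    "\<And>x x' t. (x, x') \<in> ?A \<Longrightarrow> (\<And>p. p \<in> P \<Longrightarrow> x' p = 0) \<Longrightarrow> t \<in> T \<Longrightarrow> x' t = 0"
    by (rule pivots[of T ?A]) (use T A in auto)
  have finP: "finite P" using P(1) T by (rule finite_subset)
  have "x t = (\<Sum>p\<in>P. x p * a p t)" if x: "x \<in> A" and t: "t \<in> T" for x t
  proof -
    define y where "y Q s = x s + (\<Sum>p\<in>Q. - x p * a p s)" for Q s
    have yA: "y Q \<in> A" if "Q \<subseteq> P" for Q
      using finite_subset[OF that finP] that
    proof (induction Q rule: finite_induct)
      case empty
      then show ?case using x by (simp add: y_def)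
    next
      case (insert p Q)
      then have "(\<lambda>t. - x p * a p t + y Q t) \<in> A" using P(2)[of p] by (intro A) auto
      moreover have "y (insert p Q) = (\<lambda>t. - x p * a p t + y Q t)" using insert by (simp add: y_def fun_eq_iff)
      ultimately show ?case by simp
    qed
    have y0: "y P p = 0" if "p \<in> P" for p
    proof -
      have "(\<Sum>r\<in>P. - x r * a r p) = (\<Sum>r\<in>P. if r = p then - x p else 0)"
        by (rule sum.cong) (use P(3) that in auto)
      then show ?thesis using that finP by (simp add: y_def)
    qed
    have "y P t = 0" by (rule P(4)[of "y P" "y P"]) (use yA y0 t in auto)
    then show ?thesis by (simp add: y_def sum_negf)
  qed
  then show thesis using that[of P a] P(1,2) by blast
qed

subsection \<open>The double commutant\<close>

lemma permute_list_tidx: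
  assumes "w permutes {..<n}" "x \<in> tidx d N n"
  shows "permute_list w x \<in> tidx d N n"
  using assms by (auto simp: tidx_def)

lemma permute_list_inv:
  assumes "w permutes {..<length x}"
  shows "permute_list (inv' w) (permute_list w x) = x" "permute_list w (permute_list (inv' w) x) = x"
  using assms permutes_inv[OF assms]
  by (simp_all add: permutes_inv_o flip: permute_list_compose)

text \<open>Pairs of words with the same multiset of letter pairs lie in one orbit of the
  simultaneous place permutations.\<close>

lemma mset_zip_eq_permute:
  assumes "mset (zip x x') = mset (zip y y')" "length x = n" "length x' = n" "length y = n" "length y' = n"
  obtains w where "w permutes {..<n}" "permute_list w y = x" "permute_list w y' = x'"
proof -
  obtain w where w: "w permutes {..<length (zip y y')}" "permute_list w (zip y y') = zip x x'"
    using mset_eq_permutation[OF assms(1)] by blast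
  have wn: "w permutes {..<n}" using w(1) assms by simp
  have "zip (permute_list w y) (permute_list w y') = zip x x'"
    unfolding w(2)[symmetric] by (rule permute_list_zip[symmetric, OF w(1)]) (use assms in simp_all)
  from arg_cong[of _ _ "map fst", OF this] arg_cong[of _ _ "map snd", OF this]
  have "permute_list w y = x" "permute_list w y' = x'" using assms by simp_all
  then show thesis using that wn by blast
qed

text \<open>The matrix of the colour idempotent for \<open>c\<close> followed by the place
  permutation \<open>w\<close>.\<close>

definition Rm :: "(nat \<times> nat) list set \<Rightarrow> (nat \<Rightarrow> nat) \<Rightarrow> nat list \<Rightarrow> (nat \<times> nat) list \<times> (nat \<times> nat) list \<Rightarrow> 'k::field" where
  "Rm I w c = (\<lambda>(x, y). if x \<in> I \<and> y = permute_list w x \<and> map fst y = c then 1 else 0)"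

inductive_set fspan :: "('t \<Rightarrow> 'k::field) set \<Rightarrow> ('t \<Rightarrow> 'k) set" for G where
  zero: "(\<lambda>t. 0) \<in> fspan G"
| gen: "x \<in> G \<Longrightarrow> x \<in> fspan G"
| add: "x \<in> fspan G \<Longrightarrow> y \<in> fspan G \<Longrightarrow> (\<lambda>t. x t + y t) \<in> fspan G"
| scale: "x \<in> fspan G \<Longrightarrow> (\<lambda>t. c * x t) \<in> fspan G"

lemma fspan_sum: "(\<And>i. i \<in> S \<Longrightarrow> f i \<in> fspan G) \<Longrightarrow> (\<lambda>t. \<Sum>i\<in>S. f i t) \<in> fspan G"
  by (induction S rule: infinite_finite_induct) (auto intro: fspan.intros)

text \<open>Averaging a linear projection onto the span gives a map \<open>PP\<close> that commutes
  with left multiplication by \<open>f\<close>: its coefficient matrices lie in the Schur algebra,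
  with which \<open>f\<close> commutes. Since \<open>PP\<close> maps the identity to a nonzero
  multiple of itself, \<open>f\<close> is a multiple of \<open>PP f\<close>, which lies in the
  span.\<close>

lemma commutant_span:
  fixes f :: "(nat \<times> nat) list \<Rightarrow> (nat \<times> nat) list \<Rightarrow> 'k::field_char_0"
  assumes B: "\<And>M. same_colour d N M \<Longrightarrow> com (tidx d N n) f (Bmat M)"
    and sup: "\<And>x y. x \<notin> tidx d N n \<or> y \<notin> tidx d N n \<Longrightarrow> f x y = 0"
  shows "case_prod f \<in> fspan {Rm (tidx d N n) w c | w c. w permutes {..<n}}"
proof -
  let ?I = "tidx d N n" and ?W = "{w. w permutes {..<n}}"
  let ?G = "{Rm ?I w c | w c. w permutes {..<n}} :: ((nat \<times> nat) list \<times> (nat \<times> nat) list \<Rightarrow> 'k) set"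
  let ?pl = "permute_list"
  have finW: "finite ?W" by (simp add: finite_permutations)
  have lenI: "length x = n" if "x \<in> ?I" for x using that by (simp add: tidx_def)
  have plI: "?pl w x \<in> ?I \<longleftrightarrow> x \<in> ?I" if "w permutes {..<n}" for w x
  proof
    assume a: "?pl w x \<in> ?I"
    then have l: "length x = n" by (auto simp: tidx_def)
    show "x \<in> ?I" using permute_list_tidx[OF permutes_inv[OF that] a] permute_list_inv(1)[of w x] that l by simp
  qed (rule permute_list_tidx[OF that])
  have inv: "?pl (inv' w) (?pl w x) = x" "?pl w (?pl (inv' w) x) = x" if "w permutes {..<n}" "x \<in> ?I" for w x
    using permute_list_inv[of w x] that lenI[OF that(2)] by auto
  obtain P a where P: "P \<subseteq> ?I \<times> ?I" "\<And>p. p \<in> P \<Longrightarrow> a p \<in> fspan ?G"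
    "\<And>X t. X \<in> fspan ?G \<Longrightarrow> t \<in> ?I \<times> ?I \<Longrightarrow> X t = (\<Sum>p\<in>P. X p * a p t)"
    by (rule dual_basis[of "?I \<times> ?I" "fspan ?G"]) (auto intro: fspan.intros)
  have finP: "finite P" using P(1) by (rule finite_subset) simp
  \<comment> \<open>the linear projection \<open>pr\<close> onto the span, made equivariant by averaging\<close>
  define pr where "pr X t = (\<Sum>p\<in>P. X p * a p t)" for X :: "_ \<Rightarrow> 'k" and t
  define C where "C = map fst ` ?I"
  \<comment> \<open>\<open>Lr w c\<close> is left multiplication by \<open>Rm ?I w c\<close>, and
    \<open>Li w c\<close> is left multiplication by the transposed matrix, which undoes it on words
    of the matching colour.\<close>
  define Lr where "Lr w c X = (\<lambda>(x, y). if x \<in> ?I \<and> map fst (?pl w x) = c then X (?pl w x, y) else (0::'k))"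
    for w and c :: "nat list" and X :: "(nat \<times> nat) list \<times> (nat \<times> nat) list \<Rightarrow> 'k"
  define Li where "Li w c X = (\<lambda>(x, y). if x \<in> ?I \<and> map fst x = c then X (?pl (inv' w) x, y) else (0::'k))"
    for w and c :: "nat list" and X :: "(nat \<times> nat) list \<times> (nat \<times> nat) list \<Rightarrow> 'k"
  define PP where "PP X = (\<lambda>t. \<Sum>w\<in>?W. \<Sum>c\<in>C. Lr w c (pr (Li w c X)) t)" for X
  have finC: "finite C" by (simp add: C_def)
  have pr_span: "pr X \<in> fspan ?G" for X
    unfolding pr_def using P(2) by (intro fspan_sum fspan.scale) auto
  have Lr_span: "Lr w c X \<in> fspan ?G" if w: "w permutes {..<n}" and "X \<in> fspan ?G" for w c X
    using that(2)
  proof (induction rule: fspan.induct)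
    case zero
    then show ?case using fspan.zero[of ?G] by (simp add: Lr_def case_prod_unfold)
  next
    case (gen X)
    then obtain w' c' where X: "X = Rm ?I w' c'" "w' permutes {..<n}" by auto
    have "Lr w c X t = (if c' = ?pl w' c then 1 else 0) * Rm ?I (w \<circ> w') c' t" for t
    proof (cases t)
      case (Pair x y)
      show ?thesis
      proof (cases "x \<in> ?I")
        case True
        have l: "length x = n" using True by (rule lenI)
        have e: "?pl (w \<circ> w') x = ?pl w' (?pl w x)" using X(2) l by (simp add: permute_list_compose)
        have m: "map fst (?pl w' (?pl w x)) = ?pl w' (map fst (?pl w x))"
          using X(2) l by (subst permute_list_map) auto
        have "map fst (?pl w x) = c \<longleftrightarrow> ?pl w' (map fst (?pl w x)) = ?pl w' c" if "length c = n"
          using permute_list_inv(1)[of w' "map fst (?pl w x)"] permute_list_inv(1)[of w' c] X(2) l that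
          by (metis length_map length_permute_list)
        moreover have "length c = n" if "?pl w' (map fst (?pl w x)) = ?pl w' c"
          using that l by (metis length_map length_permute_list)
        ultimately show ?thesis using True plI[OF w, of x]
          unfolding X Pair Lr_def Rm_def by (auto simp: e m)
      qed (simp add: Pair Lr_def Rm_def)
    qed
    moreover have "Rm ?I (w \<circ> w') c' \<in> fspan ?G"
      by (rule fspan.gen) (use X(2) w permutes_compose in blast)
    ultimately have "Lr w c X = (\<lambda>t. (if c' = ?pl w' c then 1 else 0) * Rm ?I (w \<circ> w') c' t)" by blast
    then show ?case using fspan.scale[OF \<open>Rm ?I (w \<circ> w') c' \<in> fspan ?G\<close>] by simp
  next
    case (add X Y)
    have "Lr w c (\<lambda>t. X t + Y t) = (\<lambda>t. Lr w c X t + Lr w c Y t)" by (auto simp: Lr_def)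
    then show ?case using fspan.add[OF add(3,4)] by simp
  next
    case (scale X k)
    have "Lr w c (\<lambda>t. k * X t) = (\<lambda>t. k * Lr w c X t)" by (auto simp: Lr_def)
    then show ?case using fspan.scale[OF scale(2)] by simp
  qed
  have PP_span: "PP X \<in> fspan ?G" for X
    unfolding PP_def by (intro fspan_sum Lr_span pr_span) auto
  let ?id = "\<lambda>(x, y). if x \<in> ?I \<and> x = y then 1 else (0::'k)"
  \<comment> \<open>\<open>Li w c\<close> of the identity is again one of the spanning matrices and
    is fixed by \<open>pr\<close>. For each \<open>w\<close> the idempotents of the different
    \<open>c\<close> add up to the identity, so the total is the number of permutations.\<close>
  have PP_id: "PP ?id (x, y) = (if x = y then of_nat (card ?W) else 0)" if x: "x \<in> ?I" and y: "y \<in> ?I" for x y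
  proof -
    have "Lr w c (pr (Li w c ?id)) (x, y) = (if x = y then (if map fst (?pl w x) = c then 1 else 0) else 0)"
      if w: "w permutes {..<n}" for w c
    proof -
      have "Li w c ?id t = Rm ?I (inv' w) (?pl (inv' w) c) t" for t
      proof (cases t)
        case (Pair z z')
        have wi: "inv' w permutes {..<n}" using w by (rule permutes_inv)
        show ?thesis
        proof (cases "z \<in> ?I")
          case True
          have l: "length z = n" using True by (rule lenI)
          have m: "map fst (?pl (inv' w) z) = ?pl (inv' w) (map fst z)"
            using wi l by (subst permute_list_map) auto
          have "map fst z = c \<longleftrightarrow> ?pl (inv' w) (map fst z) = ?pl (inv' w) c"
            using permute_list_inv(2)[of w "map fst z"] permute_list_inv(2)[of w c] w l
            by (metis length_map length_permute_list)
          then show ?thesis using True plI[OF wi, of z] unfolding Pair Li_def Rm_def by (auto simp: m)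
        qed (simp add: Pair Li_def Rm_def)
      qed
      then have "Li w c ?id = Rm ?I (inv' w) (?pl (inv' w) c)" by (rule ext)
      then have Li: "Li w c ?id \<in> fspan ?G" using permutes_inv[OF w] by (intro fspan.gen) blast
      have "pr (Li w c ?id) (?pl w x, y) = Li w c ?id (?pl w x, y)"
        unfolding pr_def using P(3)[OF Li, of "(?pl w x, y)"] x y plI[OF w, of x] by simp
      then show ?thesis using x y inv(1)[OF w x] plI[OF w, of x] by (auto simp: Lr_def Li_def)
    qed
    then have "PP ?id (x, y) = (\<Sum>w\<in>?W. \<Sum>c\<in>C. if x = y then (if map fst (?pl w x) = c then 1 else 0) else 0)"
      unfolding PP_def by (intro sum.cong) auto
    also have "\<dots> = (\<Sum>w\<in>?W. if x = y then 1 else 0)"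
    proof (rule sum.cong)
      fix w assume "w \<in> ?W"
      then have "map fst (?pl w x) \<in> C" using plI[of w x] x by (auto simp: C_def)
      then show "(\<Sum>c\<in>C. if x = y then (if map fst (?pl w x) = c then 1 else 0) else 0) = (if x = y then 1 else (0::'k))"
        using finC by (cases "x = y") simp_all
    qed simp
    finally show ?thesis by simp
  qed
  \<comment> \<open>For fixed columns \<open>y\<close> and \<open>y'\<close>, the matrix in the row
    words through which \<open>PP\<close> acts. The colour test arises from summing over
    \<open>c\<close>, the average from summing over \<open>w\<close>.\<close>
  define T where "T y y' x z = (if map fst x = map fst z then (\<Sum>w\<in>?W. pr (\<lambda>t. if t = (?pl w z, y') then 1 else 0) (?pl w x, y)) else (0::'k))"
    for y y' x z
  have PP_T: "PP X (x, y) = (\<Sum>z\<in>?I. \<Sum>y'\<in>?I. T y y' x z * X (z, y'))" if x: "x \<in> ?I" and y: "y \<in> ?I" for X x y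
  proof -
    have pr_expand: "pr X t = (\<Sum>z\<in>?I. \<Sum>y'\<in>?I. X (z, y') * pr (\<lambda>s. if s = (z, y') then 1 else 0) t)" for X t
    proof -
      have "(\<Sum>s\<in>?I \<times> ?I. X s * pr (\<lambda>r. if r = s then 1 else 0) t) = (\<Sum>s\<in>?I \<times> ?I. \<Sum>p\<in>P. if p = s then X s * a p t else 0)"
        unfolding pr_def sum_distrib_left by (intro sum.cong) auto
      also have "\<dots> = (\<Sum>p\<in>P. \<Sum>s\<in>?I \<times> ?I. if p = s then X s * a p t else 0)" by (rule sum.swap)
      also have "\<dots> = pr X t" unfolding pr_def using P(1) by (intro sum.cong) (auto simp: subset_iff)
      finally show ?thesis by (simp add: sum.cartesian_product case_prod_unfold)
    qed
    have "PP X (x, y) = (\<Sum>w\<in>?W. pr (Li w (map fst (?pl w x)) X) (?pl w x, y))"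
      unfolding PP_def
    proof (rule sum.cong)
      fix w assume w: "w \<in> ?W"
      have "(\<Sum>c\<in>C. Lr w c (pr (Li w c X)) (x, y))
          = (\<Sum>c\<in>C. if map fst (?pl w x) = c then pr (Li w (map fst (?pl w x)) X) (?pl w x, y) else 0)"
        by (rule sum.cong) (use x in \<open>auto simp: Lr_def\<close>)
      also have "\<dots> = pr (Li w (map fst (?pl w x)) X) (?pl w x, y)"
        using finC plI[of w x] w x by (auto simp: C_def)
      finally show "(\<Sum>c\<in>C. Lr w c (pr (Li w c X)) (x, y)) = pr (Li w (map fst (?pl w x)) X) (?pl w x, y)" .
    qed simp
    also have "\<dots> = (\<Sum>w\<in>?W. \<Sum>z\<in>?I. \<Sum>y'\<in>?I. (if map fst x = map fst z then X (z, y') * pr (\<lambda>s. if s = (?pl w z, y') then 1 else 0) (?pl w x, y) else 0))"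
    proof (rule sum.cong)
      fix w assume "w \<in> ?W"
      then have w: "w permutes {..<n}" by simp
      have bij: "bij_betw (?pl w) ?I ?I"
        by (rule bij_betw_byWitness[of _ "?pl (inv' w)"]) (use inv[OF w] plI[OF w] plI[OF permutes_inv[OF w]] in auto)
      have cf: "map fst (?pl w z) = map fst (?pl w x) \<longleftrightarrow> map fst x = map fst z" if z: "z \<in> ?I" for z
      proof -
        have m: "map fst (?pl w v) = ?pl w (map fst v)" if "v \<in> ?I" for v
          using w lenI[OF that] by (subst permute_list_map) auto
        show ?thesis unfolding m[OF x] m[OF z]
          using permute_list_inv(1)[of w "map fst x"] permute_list_inv(1)[of w "map fst z"] w lenI[OF x] lenI[OF z]
          by (metis length_map)
      qed
      have "pr (Li w (map fst (?pl w x)) X) (?pl w x, y)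
        = (\<Sum>z\<in>?I. \<Sum>y'\<in>?I. Li w (map fst (?pl w x)) X (z, y') * pr (\<lambda>s. if s = (z, y') then 1 else 0) (?pl w x, y))"
        by (rule pr_expand)
      also have "\<dots> = (\<Sum>z\<in>?I. \<Sum>y'\<in>?I. Li w (map fst (?pl w x)) X (?pl w z, y') * pr (\<lambda>s. if s = (?pl w z, y') then 1 else 0) (?pl w x, y))"
        by (rule sum.reindex_bij_betw[OF bij, symmetric])
      also have "\<dots> = (\<Sum>z\<in>?I. \<Sum>y'\<in>?I. (if map fst x = map fst z then X (z, y') * pr (\<lambda>s. if s = (?pl w z, y') then 1 else 0) (?pl w x, y) else 0))"
        by (intro sum.cong refl) (use inv(1)[OF w] plI[OF w] cf in \<open>auto simp: Li_def\<close>)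
      finally show "pr (Li w (map fst (?pl w x)) X) (?pl w x, y) = \<dots>" .
    qed simp
    also have "\<dots> = (\<Sum>z\<in>?I. \<Sum>w\<in>?W. \<Sum>y'\<in>?I. (if map fst x = map fst z then X (z, y') * pr (\<lambda>s. if s = (?pl w z, y') then 1 else 0) (?pl w x, y) else 0))"
      by (rule sum.swap)
    also have "\<dots> = (\<Sum>z\<in>?I. \<Sum>y'\<in>?I. \<Sum>w\<in>?W. (if map fst x = map fst z then X (z, y') * pr (\<lambda>s. if s = (?pl w z, y') then 1 else 0) (?pl w x, y) else 0))"
      by (intro sum.cong refl sum.swap)
    also have "\<dots> = (\<Sum>z\<in>?I. \<Sum>y'\<in>?I. T y y' x z * X (z, y'))"
      by (intro sum.cong refl) (auto simp: T_def sum_distrib_left mult.commute)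
    finally show ?thesis .
  qed
  have T_com: "com ?I f (T y y')" for y y'
  proof -
    \<comment> \<open>Invariance under simultaneous place permutations, by reindexing the average;
      it makes \<open>T y y'\<close> constant on orbits of pairs.\<close>
    have T_inv: "T y y' (?pl v x) (?pl v z) = T y y' x z"
      if v: "v permutes {..<n}" and x: "x \<in> ?I" and z: "z \<in> ?I" for v x z
    proof -
      have m: "map fst (?pl v u) = ?pl v (map fst u)" if "u \<in> ?I" for u
        using v lenI[OF that] by (subst permute_list_map) auto
      have c: "map fst (?pl v x) = map fst (?pl v z) \<longleftrightarrow> map fst x = map fst z"
        unfolding m[OF x] m[OF z]
        using permute_list_inv(1)[of v "map fst x"] permute_list_inv(1)[of v "map fst z"] v lenI[OF x] lenI[OF z]
        by (metis length_map)
      have bij: "bij_betw ((\<circ>) v) ?W ?W"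
        by (rule bij_betw_byWitness[of _ "(\<circ>) (inv' v)"])
          (use v in \<open>auto simp: permutes_compose permutes_inv permutes_inv_o comp_assoc[symmetric]\<close>)
      have "(\<Sum>w\<in>?W. pr (\<lambda>t. if t = (?pl w (?pl v z), y') then 1 else 0) (?pl w (?pl v x), y))
        = (\<Sum>w\<in>?W. pr (\<lambda>t. if t = (?pl (v \<circ> w) z, y') then 1 else 0) (?pl (v \<circ> w) x, y))"
        by (rule sum.cong) (use lenI[OF x] lenI[OF z] in \<open>auto simp: permute_list_compose\<close>)
      also have "\<dots> = (\<Sum>w\<in>?W. pr (\<lambda>t. if t = (?pl w z, y') then 1 else 0) (?pl w x, y))"
        by (rule sum.reindex_bij_betw[OF bij])
      finally show ?thesis by (simp add: T_def c)
    qed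
    define Ms where "Ms = (\<lambda>(x, z). mset (zip x z)) ` {(x, z) \<in> ?I \<times> ?I. map fst x = map fst z}"
    \<comment> \<open>The common value of \<open>T y y'\<close> on the orbit \<open>M\<close>; the
      choice is harmless because of \<open>T_inv\<close>. The colour test restricts the orbits to
      those with \<open>same_colour\<close>.\<close>
    define co where "co M = (SOME k. \<exists>x\<in>?I. \<exists>z\<in>?I. map fst x = map fst z \<and> M = mset (zip x z) \<and> k = T y y' x z)" for M
    have co: "co (mset (zip x z)) = T y y' x z" if xz: "x \<in> ?I" "z \<in> ?I" "map fst x = map fst z" for x z
    proof -
      have "\<exists>x'\<in>?I. \<exists>z'\<in>?I. map fst x' = map fst z' \<and> mset (zip x z) = mset (zip x' z') \<and> co (mset (zip x z)) = T y y' x' z'"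
        unfolding co_def by (rule someI[of _ "T y y' x z"]) (use xz in blast)
      then obtain x' z' where x': "x' \<in> ?I" "z' \<in> ?I" "mset (zip x z) = mset (zip x' z')" "co (mset (zip x z)) = T y y' x' z'"
        by blast
      obtain v where "v permutes {..<n}" "?pl v x' = x" "?pl v z' = z"
        using mset_zip_eq_permute[OF x'(3)] lenI xz x' by metis
      then show ?thesis using T_inv[of v x' z'] x' by simp
    qed
    have finMs: "finite Ms" unfolding Ms_def by (rule finite_imageI, rule finite_subset[of _ "?I \<times> ?I"]) auto
    have "same_colour d N M" if MMs: "M \<in> Ms" for M
    proof -
      obtain x z where xz: "x \<in> ?I" "z \<in> ?I" "map fst x = map fst z" "M = mset (zip x z)" using MMs by (auto simp: Ms_def)
      have "p \<in> vidx d N \<and> p' \<in> vidx d N \<and> fst p = fst p'" if pp: "(p, p') \<in> set (zip x z)" for p p'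
      proof -
        from pp obtain i where i: "i < length x" "i < length z" "p = x ! i" "p' = z ! i" unfolding set_zip by fastforce
        then have "fst p = fst p'" using xz(3) by (metis nth_map)
        then show ?thesis using xz(1,2) i by (auto simp: tidx_def intro!: subsetD[OF _ nth_mem])
      qed
      then show ?thesis by (auto simp: same_colour_def xz(4))
    qed
    then have "com ?I f (\<lambda>x z. \<Sum>M\<in>Ms. co M * Bmat M x z)" by (intro com_sum com_scale B)
    then show ?thesis
    proof (rule com_cong)
      fix x z assume xz: "x \<in> ?I" "z \<in> ?I"
      show "(\<Sum>M\<in>Ms. co M * Bmat M x z) = T y y' x z"
      proof (cases "map fst x = map fst z")
        case True
        then have "mset (zip x z) \<in> Ms" using xz by (auto simp: Ms_def)
        have "(\<Sum>M\<in>Ms. co M * Bmat M x z) = (\<Sum>M\<in>Ms. if mset (zip x z) = M then co M else 0)"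
          by (rule sum.cong) (auto simp: Bmat_def)
        also have "\<dots> = T y y' x z" using finMs \<open>mset (zip x z) \<in> Ms\<close> co[OF xz True] by simp
        finally show ?thesis .
      next
        case False
        have "mset (zip x z) \<notin> Ms"
        proof
          assume "mset (zip x z) \<in> Ms"
          then obtain x' z' where x': "x' \<in> ?I" "z' \<in> ?I" "map fst x' = map fst z'" "mset (zip x z) = mset (zip x' z')"
            by (auto simp: Ms_def)
          obtain v where v: "v permutes {..<n}" "?pl v x' = x" "?pl v z' = z"
            using mset_zip_eq_permute[OF x'(4)] lenI xz x' by metis
          have "map fst (?pl v x') = map fst (?pl v z')"
            using v(1) lenI[OF x'(1)] lenI[OF x'(2)] x'(3) by (metis permute_list_map)
          then show False using False v by simp
        qed
        then have "(\<Sum>M\<in>Ms. co M * Bmat M x z) = 0" by (intro sum.neutral) (auto simp: Bmat_def)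
        then show ?thesis using False by (simp add: T_def)
      qed
    qed
  qed
  \<comment> \<open>Since \<open>f\<close> commutes with each \<open>T y y'\<close> it can be pulled
    out on the left, leaving \<open>PP\<close> of the identity.\<close>
  have PPf: "PP (case_prod f) (x, y) = of_nat (card ?W) * f x y" if x: "x \<in> ?I" and y: "y \<in> ?I" for x y
  proof -
    have "PP (case_prod f) (x, y) = (\<Sum>y'\<in>?I. \<Sum>z\<in>?I. T y y' x z * f z y')"
      unfolding PP_T[OF x y] by (subst sum.swap) simp
    also have "\<dots> = (\<Sum>y'\<in>?I. \<Sum>z\<in>?I. f x z * T y y' z y')"
    proof (rule sum.cong)
      fix y' assume y': "y' \<in> ?I"
      have "(\<Sum>z\<in>?I. f x z * T y y' z y') = (\<Sum>z\<in>?I. T y y' x z * f z y')"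
        using T_com[of y y'] x y' unfolding com_def mm_def by blast
      then show "(\<Sum>z\<in>?I. T y y' x z * f z y') = (\<Sum>z\<in>?I. f x z * T y y' z y')" ..
    qed simp
    also have "\<dots> = (\<Sum>z\<in>?I. f x z * (\<Sum>y'\<in>?I. T y y' z y'))"
      unfolding sum_distrib_left by (rule sum.swap)
    also have "\<dots> = (\<Sum>z\<in>?I. f x z * PP ?id (z, y))"
    proof (rule sum.cong)
      fix z assume z: "z \<in> ?I"
      have "PP ?id (z, y) = (\<Sum>r\<in>?I. \<Sum>y'\<in>?I. if r = y' then T y y' z y' else 0)"
        unfolding PP_T[OF z y] by (intro sum.cong) auto
      also have "\<dots> = (\<Sum>y'\<in>?I. \<Sum>r\<in>?I. if r = y' then T y y' z y' else 0)" by (rule sum.swap)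
      also have "\<dots> = (\<Sum>y'\<in>?I. T y y' z y')" by simp
      finally show "f x z * (\<Sum>y'\<in>?I. T y y' z y') = f x z * PP ?id (z, y)" by simp
    qed simp
    also have "\<dots> = (\<Sum>z\<in>?I. if z = y then of_nat (card ?W) * f x y else 0)"
      using PP_id[OF _ y] by (intro sum.cong) auto
    also have "\<dots> = of_nat (card ?W) * f x y" using y by simp
    finally show ?thesis .
  qed
  have sup_span: "X (x, y) = 0" if "X \<in> fspan ?G" "x \<notin> ?I \<or> y \<notin> ?I" for X x y
    using that
  proof (induction rule: fspan.induct)
    case (gen X)
    then show ?case using plI by (auto simp: Rm_def)
  qed auto
  have "id \<in> ?W" by (simp add: permutes_id)
  then have cW: "card ?W \<noteq> 0" using finW card_0_eq by blast
  have "case_prod f t = inverse (of_nat (card ?W)) * PP (case_prod f) t" for t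
  proof (cases t)
    case (Pair x y)
    show ?thesis
    proof (cases "x \<in> ?I \<and> y \<in> ?I")
      case True
      then show ?thesis using PPf[of x y] cW by (simp add: Pair)
    next
      case False
      then show ?thesis using sup[of x y] sup_span[OF PP_span, of x y] by (simp add: Pair)
    qed
  qed
  then have "case_prod f = (\<lambda>t. inverse (of_nat (card ?W)) * PP (case_prod f) t)" by (rule ext)
  then show ?thesis using fspan.scale[OF PP_span, of "inverse (of_nat (card ?W))" "case_prod f"] by simp
qed


section \<open>Specialisation at \<open>q = 1\<close>\<close>

text \<open>The local ring of C(q) at \<open>q = 1\<close> together with evaluation there. It is a
  relation because a function with a pole at 1 has no value.\<close>

definition spec :: "Cq \<Rightarrow> complex \<Rightarrow> bool" where
  "spec x a \<longleftrightarrow> (\<exists>p r. poly r 1 \<noteq> 0 \<and> x = Fract p r \<and> a = poly p 1 / poly r 1)"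

lemma spec_Fract: "poly r 1 \<noteq> 0 \<Longrightarrow> spec (Fract p r) (poly p 1 / poly r 1)"
  unfolding spec_def by blast

lemma spec_cases:
  assumes "spec x a"
  obtains p r where "poly r 1 \<noteq> 0" "r \<noteq> 0" "x = Fract p r" "a = poly p 1 / poly r 1"
proof -
  obtain p r where s: "poly r 1 \<noteq> 0" "x = Fract p r" "a = poly p 1 / poly r 1"
    using assms unfolding spec_def by blast
  have "r \<noteq> 0" using s(1) by auto
  then show thesis using that s by blast
qed

interpretation spec: residue spec
proof
  show "spec 1 1" using spec_Fract[of 1 1] by (simp add: One_fract_def)
next
  fix x y a b assume "spec x a" "spec y b"
  then obtain p r p' r' where s: "poly r 1 \<noteq> 0" "r \<noteq> 0" "x = Fract p r" "a = poly p 1 / poly r 1"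
    "poly r' 1 \<noteq> 0" "r' \<noteq> 0" "y = Fract p' r'" "b = poly p' 1 / poly r' 1"
    by (metis spec_cases)
  show "spec (x + y) (a + b)"
    using spec_Fract[of "r * r'" "p * r' + p' * r"] s by (simp add: add_frac_eq)
  show "spec (x * y) (a * b)"
    using spec_Fract[of "r * r'" "p * p'"] s by simp
next
  fix x a assume "spec x a"
  then obtain p r where s: "poly r 1 \<noteq> 0" "r \<noteq> 0" "x = Fract p r" "a = poly p 1 / poly r 1"
    by (rule spec_cases)
  show "spec (- x) (- a)" using spec_Fract[of r "- p"] s by simp
  show "spec (inverse x) (inverse a)" if "a \<noteq> 0"
    using spec_Fract[of p r] s that by simp
  fix b assume "spec x b"
  then obtain p' r' where t: "poly r' 1 \<noteq> 0" "r' \<noteq> 0" "x = Fract p' r'" "b = poly p' 1 / poly r' 1"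
    by (rule spec_cases)
  have "p * r' = p' * r" using s t by (simp add: eq_fract)
  then have "poly p 1 * poly r' 1 = poly p' 1 * poly r 1" by (metis poly_mult)
  then show "a = b" using s t by (simp add: frac_eq_eq)
qed

lemma spec_q: "spec q 1"
  using spec_Fract[of 1 "[:0, 1:]"] by (simp add: q_def)

lemma spec_const: "\<exists>x. spec x a"
  using spec_Fract[of 1 "[:a:]"] by (intro exI[of _ "Fract [:a:] 1"]) simp

lemma spec_q_power: "spec (q ^ k) 1"
proof (induction k)
  case (Suc k)
  then show ?case using spec.sp_mult[OF spec_q Suc] by simp
qed (simp add: spec.sp_one)

lemma spec_q_powi: "spec (q powi k) 1"
  using spec_q_power[of "nat k"] spec.sp_inverse[OF spec_q_power[of "nat (- k)"]]
  by (simp add: power_int_def power_inverse)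

text \<open>Multiplying by denominators makes all entries polynomial; then the common factors q - 1
  are removed until some entry survives at \<open>q = 1\<close>.\<close>

lemma spec_normalise:
  assumes T: "finite T" and x: "\<exists>t\<in>T. x t \<noteq> 0"
  shows "\<exists>c x'. (\<forall>t\<in>T. spec (c * x t) (x' t)) \<and> (\<exists>t\<in>T. x' t \<noteq> 0)"
proof -
  have "\<exists>c. c \<noteq> 0 \<and> (\<forall>t\<in>T. \<exists>p. c * x t = Fract p 1)"
    using T
  proof induction
    case empty
    show ?case by (intro exI[of _ 1]) simp
  next
    case (insert s T)
    then obtain c where c: "c \<noteq> 0" "\<forall>t\<in>T. \<exists>p. c * x t = Fract p 1" by blast
    obtain a b where ab: "c * x s = Fract a b" "b \<noteq> 0" by (cases "c * x s") auto
    have b: "Fract b 1 \<noteq> 0" using ab(2) by (simp add: Zero_fract_def eq_fract)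
    have "Fract b 1 * c * x s = Fract a 1"
      using ab by (simp add: mult.assoc eq_fract)
    moreover have "\<exists>p. Fract b 1 * c * x t = Fract p 1" if t: "t \<in> T" for t
    proof -
      obtain p where "c * x t = Fract p 1" using c t by blast
      then have "Fract b 1 * c * x t = Fract (b * p) 1" by (simp add: mult.assoc)
      then show ?thesis by blast
    qed
    ultimately show ?case using b c by (intro exI[of _ "Fract b 1 * c"]) auto
  qed
  then obtain c where c: "c \<noteq> 0" "\<forall>t\<in>T. \<exists>p. c * x t = Fract p 1" by blast
  then obtain p where p: "\<And>t. t \<in> T \<Longrightarrow> c * x t = Fract (p t) 1" by metis
  \<comment> \<open>The degree of one fixed nonzero entry drops with every division by q - 1, which
    bounds the number of divisions.\<close>
  have *: "\<exists>c x'. (\<forall>t\<in>T. spec (c * Fract (p t) 1) (x' t)) \<and> (\<exists>t\<in>T. x' t \<noteq> 0)"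
    if "t0 \<in> T" "p t0 \<noteq> 0" for p t0
    using that
  proof (induction "degree (p t0)" arbitrary: p rule: less_induct)
    case less
    show ?case
    proof (cases "\<exists>t\<in>T. poly (p t) 1 \<noteq> 0")
      case True
      then show ?thesis
        using spec_Fract[of 1] by (intro exI[of _ 1] exI[of _ "\<lambda>t. poly (p t) 1"]) (auto dest: spec_Fract[of 1])
    next
      case False
      then have "\<forall>t\<in>T. \<exists>g. p t = [:- 1, 1:] * g" by (metis dvdE poly_eq_0_iff_dvd)
      then obtain g where g: "\<And>t. t \<in> T \<Longrightarrow> p t = [:- 1, 1:] * g t" by metis
      have g0: "g t0 \<noteq> 0" using g less.prems by auto
      have "degree (p t0) = Suc (degree (g t0))"
        using g[OF less.prems(1)] g0 by (simp add: degree_mult_eq del: mult_pCons_left)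
      then obtain c x' where c: "\<forall>t\<in>T. spec (c * Fract (g t) 1) (x' t)" "\<exists>t\<in>T. x' t \<noteq> 0"
        using less.hyps[of g] less.prems(1) g0 by auto
      define e :: Cq where "e = Fract [:- 1, 1:] 1"
      have n: "e \<noteq> 0" by (simp add: e_def Zero_fract_def eq_fract)
      have eq: "c * inverse e * Fract (p t) 1 = c * Fract (g t) 1" if "t \<in> T" for t
      proof -
        have "Fract (p t) 1 = e * Fract (g t) 1" using g[OF that] by (simp add: e_def)
        then show ?thesis using n by (simp add: field_simps)
      qed
      have "\<forall>t\<in>T. spec (c * inverse e * Fract (p t) 1) (x' t)"
      proof
        fix t assume t: "t \<in> T"
        show "spec (c * inverse e * Fract (p t) 1) (x' t)" unfolding eq[OF t] by (rule bspec[OF c(1) t])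
      qed
      then show ?thesis using c(2) by blast
    qed
  qed
  obtain t0 where t0: "t0 \<in> T" "x t0 \<noteq> 0" using x by blast
  then have "p t0 \<noteq> 0" using p[OF t0(1)] c(1) by (auto simp: Zero_fract_def[symmetric])
  then obtain c' x' where c': "\<forall>t\<in>T. spec (c' * Fract (p t) 1) (x' t)" "\<exists>t\<in>T. x' t \<noteq> 0"
    using *[OF t0(1)] by blast
  have "\<forall>t\<in>T. spec (c' * c * x t) (x' t)" using c'(1) p by (simp add: mult.assoc)
  then show ?thesis using c'(2) by blast
qed

lemma spec_pw: "spec (pw q m u) 1"
proof (induction u)
  case (Cons a u)
  then show ?case using spec.sp_mult[OF spec_q_powi Cons] by simp
qed (simp add: spec.sp_one)

text \<open>All powers of \<open>q\<close> have residue 1, so the twists in the coproduct disappear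
  and a derivation remains.\<close>

lemma spec_H:
  assumes "\<And>u. spec (x u) (x' u)"
  shows "spec (H q m m' p p' x u) (Dop p p' x' u)"
  using assms
proof (induction u arbitrary: x x')
  case (Cons a u)
  have 1: "spec (H q m m' p p' (sl a x) u) (Dop p p' (sl a x') u)"
    by (rule Cons.IH) (simp add: sl_def Cons.prems)
  have 2: "spec (if a = p then pw q m u * sl p' x u else 0) (if a = p then sl p' x' u else 0)"
    using spec.sp_mult[OF spec_pw[of m u] Cons.prems[of "p' # u"]] by (simp add: spec.sp_zero sl_def)
  show ?case unfolding H_Cons Dop_Cons
    using spec.sp_add[OF spec.sp_mult[OF spec_q_powi 1] 2] by simp
qed (simp add: spec.sp_zero)

lemma spec_bv: "spec (bv v u) (bv v u)"
  by (simp add: bv_def spec.sp_one spec.sp_zero)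


section \<open>Operators in the image of the free algebra\<close>

text \<open>One element of the free algebra has to work for all \<open>d\<close> and \<open>N\<close> at once.\<close>

definition AlgR :: "nat \<Rightarrow> (tens \<Rightarrow> tens) \<Rightarrow> bool" where
  "AlgR n f \<longleftrightarrow> (\<exists>x\<in>carrier (free_alg (btgens n)). \<forall>d N.
     free_ev (endo (tidx d N n)) (bt_rho d N n) x = res (tidx d N n) f)"

lemma AlgR_closed:
  assumes "AlgR n f" shows "res (tidx d N n) f \<in> carrier (endo (tidx d N n))"
  using assms kalg.free_ev_closed[OF endo_kalg, of "btgens n" "bt_rho d N n"] bt_rho_closed
  unfolding AlgR_def by metis

lemma AlgR_vec: "AlgR n f \<Longrightarrow> x \<in> vec (tidx d N n) \<Longrightarrow> f x \<in> vec (tidx d N n)"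
  using endo_vec[OF AlgR_closed, of n f x d N] by simp

lemma AlgR_cong:
  assumes "AlgR n f" "\<And>d N x. x \<in> vec (tidx d N n) \<Longrightarrow> f x = g x" shows "AlgR n g"
proof -
  have "res (tidx d N n) f = res (tidx d N n) g" for d N
    using assms(2) by (auto simp: fun_eq_iff)
  then show ?thesis using assms(1) by (simp add: AlgR_def)
qed

lemma AlgR_id: "AlgR n (\<lambda>x. x)"
  unfolding AlgR_def
proof (intro bexI allI)
  fix d N
  show "free_ev (endo (tidx d N n)) (bt_rho d N n) (bv []) = res (tidx d N n) (\<lambda>x. x)"
  proof -
    interpret kalg "endo (tidx d N n) :: (Cq, tens \<Rightarrow> tens) module" by (rule endo_kalg)
    have "free_ev (endo (tidx d N n)) (bt_rho d N n) (bv []) = word_ev (endo (tidx d N n)) (bt_rho d N n) []"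
      by (rule free_ev_bv[of "btgens n"]) (use bt_rho_closed in auto)
    then show ?thesis by simp
  qed
qed simp

lemma AlgR_gen:
  assumes "g \<in> btgens n" shows "AlgR n (btop g)"
  unfolding AlgR_def
proof (intro bexI allI)
  fix d N
  interpret kalg "endo (tidx d N n) :: (Cq, tens \<Rightarrow> tens) module" by (rule endo_kalg)
  have "free_ev (endo (tidx d N n)) (bt_rho d N n) (bv [g]) = word_ev (endo (tidx d N n)) (bt_rho d N n) [g]"
    by (rule free_ev_bv[of "btgens n"]) (use bt_rho_closed assms in auto)
  also have "\<dots> = bt_rho d N n g" using r_one[OF bt_rho_closed[of d N n g]] by (simp del: endo_simps)
  finally show "free_ev (endo (tidx d N n)) (bt_rho d N n) (bv [g]) = res (tidx d N n) (btop g)"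
    by (simp add: bt_rho_def)
qed (use assms in simp)

lemma AlgR_add:
  assumes "AlgR n f" "AlgR n g" shows "AlgR n (\<lambda>x u. f x u + g x u)"
proof -
  obtain x y where x: "x \<in> carrier (free_alg (btgens n))" "y \<in> carrier (free_alg (btgens n))"
    "\<And>d N. free_ev (endo (tidx d N n)) (bt_rho d N n) x = res (tidx d N n) f"
    "\<And>d N. free_ev (endo (tidx d N n)) (bt_rho d N n) y = res (tidx d N n) g"
    using assms unfolding AlgR_def by blast
  show ?thesis unfolding AlgR_def
  proof (intro bexI allI)
    fix d N
    show "free_ev (endo (tidx d N n)) (bt_rho d N n) (\<lambda>w. x w + y w) = res (tidx d N n) (\<lambda>x u. f x u + g x u)"
      using kalg.free_ev_add[OF endo_kalg bt_rho_closed x(1,2), of d N]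
      by (simp add: x(3,4) fun_eq_iff)
    interpret F: kalg "free_alg (btgens n) :: (Cq, _) module" by (rule free_alg_kalg)
    show "(\<lambda>w. x w + y w) \<in> carrier (free_alg (btgens n))" using F.a_closed[OF x(1,2)] by simp
  qed
qed

lemma AlgR_scale:
  assumes "AlgR n f" shows "AlgR n (\<lambda>x u. c * f x u)"
proof -
  obtain x where x: "x \<in> carrier (free_alg (btgens n))"
    "\<And>d N. free_ev (endo (tidx d N n)) (bt_rho d N n) x = res (tidx d N n) f"
    using assms unfolding AlgR_def by blast
  show ?thesis unfolding AlgR_def
  proof (intro bexI allI)
    fix d N
    show "free_ev (endo (tidx d N n)) (bt_rho d N n) (\<lambda>w. c * x w) = res (tidx d N n) (\<lambda>x u. c * f x u)"
      using kalg.free_ev_smult[OF endo_kalg bt_rho_closed x(1), of d N]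
      by (simp add: x(2) fun_eq_iff)
    interpret F: kalg "free_alg (btgens n) :: (Cq, _) module" by (rule free_alg_kalg)
    show "(\<lambda>w. c * x w) \<in> carrier (free_alg (btgens n))" using F.smult_closed[OF x(1), of c] by simp
  qed
qed

lemma AlgR_zero: "AlgR n (\<lambda>x u. 0)"
  using AlgR_scale[OF AlgR_id, of n 0] by simp

lemma AlgR_diff: "AlgR n f \<Longrightarrow> AlgR n g \<Longrightarrow> AlgR n (\<lambda>x u. f x u - g x u)"
  using AlgR_add[OF _ AlgR_scale[of n g "- 1"], of f] by simp

lemma AlgR_sum:
  "(\<And>i. i \<in> S \<Longrightarrow> AlgR n (f i)) \<Longrightarrow> AlgR n (\<lambda>x u. \<Sum>i\<in>S. f i x u)"
  by (induction S rule: infinite_finite_induct) (auto simp: AlgR_zero AlgR_add)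

lemma AlgR_comp:
  assumes f: "AlgR n f" and g: "AlgR n g" shows "AlgR n (\<lambda>x. f (g x))"
proof -
  obtain x y where x: "x \<in> carrier (free_alg (btgens n))" "y \<in> carrier (free_alg (btgens n))"
    "\<And>d N. free_ev (endo (tidx d N n)) (bt_rho d N n) x = res (tidx d N n) f"
    "\<And>d N. free_ev (endo (tidx d N n)) (bt_rho d N n) y = res (tidx d N n) g"
    using assms unfolding AlgR_def by blast
  show ?thesis unfolding AlgR_def
  proof (intro bexI allI)
    fix d N
    show "free_ev (endo (tidx d N n)) (bt_rho d N n) (x \<otimes>\<^bsub>free_alg (btgens n)\<^esub> y)
        = res (tidx d N n) (\<lambda>x. f (g x))"
      using kalg.free_ev_mult[OF endo_kalg bt_rho_closed x(1,2), of d N] AlgR_vec[OF g]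
      by (simp add: x(3,4) fun_eq_iff compose_def)
  qed (rule free_alg_mult_closed[OF x(1,2)])
qed

lemma AlgR_Sg: "Suc k < n \<Longrightarrow> AlgR n (Sg q k)"
  using AlgR_gen[of "BS (Suc k)" n] by simp

lemma AlgR_Ep: "Suc k < n \<Longrightarrow> AlgR n (Ep k)"
  using AlgR_gen[of "BE (Suc k)" n] by simp

section \<open>Projections given by conditions on colour words\<close>

definition Diag :: "(nat list \<Rightarrow> bool) \<Rightarrow> tens \<Rightarrow> tens" where
  "Diag P x u = (if P (map fst u) then x u else 0)"

lemma vec_length: "x \<in> vec (tidx d N n) \<Longrightarrow> length u \<noteq> n \<Longrightarrow> x u = 0"
  by (auto simp: vec_def tidx_def)

lemma Diag_cong_vec:
  assumes x: "x \<in> vec (tidx d N n)" and PQ: "\<And>c. length c = n \<Longrightarrow> P c \<longleftrightarrow> Q c"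
  shows "Diag P x = Diag Q x"
proof
  fix u show "Diag P x u = Diag Q x u"
    using vec_length[OF x, of u] PQ[of "map fst u"] by (cases "length u = n") (auto simp: Diag_def)
qed

lemma Diag_cong_AlgR:
  assumes "AlgR n (Diag P)" "\<And>c. length c = n \<Longrightarrow> P c \<longleftrightarrow> Q c" shows "AlgR n (Diag Q)"
  by (rule AlgR_cong[OF assms(1)]) (rule Diag_cong_vec[OF _ assms(2)])

lemma AlgR_Diag_not:
  assumes "AlgR n (Diag P)" shows "AlgR n (Diag (\<lambda>c. \<not> P c))"
proof -
  have "(\<lambda>x u. x u - Diag P x u) = Diag (\<lambda>c. \<not> P c)" by (auto simp: Diag_def fun_eq_iff)
  then show ?thesis using AlgR_diff[OF AlgR_id assms] by simp
qed

lemma AlgR_Diag_conj: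
  assumes "AlgR n (Diag P)" "AlgR n (Diag Q)" shows "AlgR n (Diag (\<lambda>c. P c \<and> Q c))"
proof -
  have "(\<lambda>x. Diag P (Diag Q x)) = Diag (\<lambda>c. P c \<and> Q c)" by (auto simp: Diag_def fun_eq_iff)
  then show ?thesis using AlgR_comp[OF assms] by simp
qed

lemma AlgR_Diag_all:
  fixes m :: nat
  assumes "\<And>i. i < m \<Longrightarrow> AlgR n (Diag (P i))" shows "AlgR n (Diag (\<lambda>c. \<forall>i<m. P i c))"
  using assms
proof (induction m)
  case 0
  have "Diag (\<lambda>c. True) = (\<lambda>x. x)" by (auto simp: Diag_def fun_eq_iff)
  then show ?case using AlgR_id by simp
next
  case (Suc m)
  have "AlgR n (Diag (\<lambda>c. (\<forall>i<m. P i c) \<and> P m c))" using Suc by (intro AlgR_Diag_conj) auto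
  then show ?case by (rule Diag_cong_AlgR) (auto simp: less_Suc_eq)
qed

lemma map_swp: "Suc k < length u \<Longrightarrow> map f (swp k u) = swp k (map f u)"
  by (simp add: swp_def map_update)

lemma swp_nth: "Suc k < length u \<Longrightarrow> i < length u \<Longrightarrow>
    swp k u ! i = (if i = k then u ! Suc k else if i = Suc k then u ! k else u ! i)"
  by (auto simp: swp_def nth_list_update)

lemma swp_same: "Suc k < length u \<Longrightarrow> u ! k = u ! Suc k \<Longrightarrow> swp k u = u"
  by (rule nth_equalityI) (auto simp: swp_nth)

text \<open>The terms of \<open>Sg\<close> that leave the word in place occur only when the two
  letters have equal colour, and then the swap does not change the colour word.\<close>

lemma Sg_Diag:
  assumes "Suc k < length u"
  shows "Sg q k (Diag P y) u = Diag (\<lambda>c. P (swp k c)) (Sg q k y) u"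
proof -
  have "swp k (map fst u) = map fst u" if "fst (u ! k) = fst (u ! Suc k)"
    using that assms by (intro swp_same) simp_all
  then show ?thesis using assms by (auto simp: Sg_nth Diag_def map_swp)
qed

lemma Sg_Diag_conj:
  assumes x: "x \<in> vec (tidx d N n)" and k: "Suc k < n"
  shows "Sg q k (Diag P (btop (BS' (Suc k)) x)) = Diag (\<lambda>c. P (swp k c)) x"
proof
  have y: "btop (BS' (Suc k)) x \<in> vec (tidx d N n)"
    using btop_preserves x unfolding preserves_def by blast
  fix u show "Sg q k (Diag P (btop (BS' (Suc k)) x)) u = Diag (\<lambda>c. P (swp k c)) x u"
  proof (cases "length u = n")
    case True
    then show ?thesis using Sg_S'_cancel(1)[of k u x] k by (simp add: Sg_Diag) (simp add: Diag_def)
  next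
    case False
    have "Diag P (btop (BS' (Suc k)) x) \<in> vec (tidx d N n)" using y by (auto simp: vec_def Diag_def)
    then have v: "Sg q k (Diag P (btop (BS' (Suc k)) x)) \<in> vec (tidx d N n)"
      using Sg_preserves unfolding preserves_def by blast
    show ?thesis unfolding vec_length[OF v False] using vec_length[OF x False] by (simp add: Diag_def)
  qed
qed

text \<open>Conjugation by a braid generator transports a colour condition along the swap of two
  neighbouring positions.\<close>

lemma AlgR_Diag_swp:
  assumes P: "AlgR n (Diag P)" and k: "Suc k < n" shows "AlgR n (Diag (\<lambda>c. P (swp k c)))"
proof -
  have "AlgR n (\<lambda>x. Sg q k (Diag P (btop (BS' (Suc k)) x)))"
    using AlgR_comp[OF AlgR_Sg[OF k] AlgR_comp[OF P AlgR_gen[of "BS' (Suc k)" n]]] k by simp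
  then show ?thesis by (rule AlgR_cong) (rule Sg_Diag_conj[OF _ k])
qed

lemma Ep_Diag:
  assumes x: "x \<in> vec (tidx d N n)" and k: "Suc k < n"
  shows "Ep k x = Diag (\<lambda>c. c ! k = c ! Suc k) x"
proof
  fix u show "Ep k x u = Diag (\<lambda>c. c ! k = c ! Suc k) x u"
  proof (cases "length u = n")
    case True
    then show ?thesis using k by (simp add: Ep_nth Diag_def)
  next
    case False
    have v: "Ep k x \<in> vec (tidx d N n)" using Ep_preserves x unfolding preserves_def by blast
    show ?thesis unfolding vec_length[OF v False] using vec_length[OF x False] by (simp add: Diag_def)
  qed
qed

text \<open>Adjacent positions are compared by \<open>Ep\<close>; conjugating by one braid generator
  at a time moves the second position to the right.\<close>

lemma AlgR_Diag_eq:
  assumes "i < j" "j < n" shows "AlgR n (Diag (\<lambda>c. c ! i = c ! j))"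
  using assms
proof (induction j)
  case (Suc j)
  show ?case
  proof (cases "i = j")
    case True
    have k: "Suc i < n" using True Suc.prems by simp
    show ?thesis unfolding True[symmetric]
      by (rule AlgR_cong[OF AlgR_Ep[OF k]]) (rule Ep_Diag[OF _ k])
  next
    case False
    then have "AlgR n (Diag (\<lambda>c. swp j c ! i = swp j c ! j))"
      using Suc by (intro AlgR_Diag_swp) auto
    then show ?thesis by (rule Diag_cong_AlgR) (use False Suc.prems in \<open>simp add: swp_nth\<close>)
  qed
qed simp

lemma AlgR_Diag_eq':
  assumes "i < n" "j < n" shows "AlgR n (Diag (\<lambda>c. c ! i = c ! j))"
proof -
  consider "i < j" | "i = j" | "j < i" by linarith
  then show ?thesis
  proof cases
    case 1
    then show ?thesis using AlgR_Diag_eq assms by simp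
  next
    case 2
    have "AlgR n (Diag (\<lambda>c. True))" using AlgR_Diag_all[of 0 n "\<lambda>_ _. True"] by simp
    then show ?thesis using 2 by simp
  next
    case 3
    then show ?thesis using AlgR_Diag_eq[of j i n] assms by (simp add: eq_commute)
  qed
qed

text \<open>The two words cut the first \<open>n\<close> positions into the same set
  partition.\<close>

definition same_ker :: "nat \<Rightarrow> 'a list \<Rightarrow> 'b list \<Rightarrow> bool" where
  "same_ker n c c' \<longleftrightarrow> (\<forall>i<n. \<forall>j<n. c ! i = c ! j \<longleftrightarrow> c' ! i = c' ! j)"

text \<open>Complements and products of commuting projections realise every Boolean combination of
  the comparisons of two positions.\<close>

lemma AlgR_Diag_ker: "AlgR n (Diag (same_ker n c0))"
  unfolding same_ker_def
proof (intro AlgR_Diag_all)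
  fix i j assume "i < n" "j < n"
  note A = AlgR_Diag_eq'[OF this]
  show "AlgR n (Diag (\<lambda>c. c0 ! i = c0 ! j \<longleftrightarrow> c ! i = c ! j))"
    by (cases "c0 ! i = c0 ! j") (use A AlgR_Diag_not[OF A] in auto)
qed

text \<open>An operator commuting with the generators commutes with everything they generate; this
  is applied with the roles exchanged, to \<open>Top\<close> and \<open>PT\<close> as the commuting
  operators.\<close>

lemma AlgR_EndUqS:
  assumes "AlgR n f" shows "res (tidx d N n) f \<in> carrier (EndUqS d N n)"
proof -
  let ?I = "tidx d N n"
  interpret kalg "endo ?I :: (Cq, tens \<Rightarrow> tens) module" by (rule endo_kalg)
  obtain x where x: "x \<in> carrier (free_alg (btgens n))" "free_ev (endo ?I) (bt_rho d N n) x = res ?I f"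
    using assms unfolding AlgR_def by blast
  have f: "res ?I f \<in> carrier (endo ?I)" by (rule AlgR_closed[OF assms])
  have com: "\<forall>y\<in>vec ?I. res ?I f (T y) = T (res ?I f y)"
    if T: "total_linear T" "preserves ?I T" and c: "\<And>g y. g \<in> btgens n \<Longrightarrow> y \<in> vec ?I \<Longrightarrow> bt_rho d N n g (T y) = T (bt_rho d N n g y)" for T
  proof -
    have r: "res ?I T \<in> carrier (endo ?I)" by (rule res_closed[OF T])
    have v: "T y \<in> vec ?I" "bt_rho d N n g y \<in> vec ?I" "res ?I f y \<in> vec ?I" if "y \<in> vec ?I" for y g
      using that T(2) endo_vec[OF bt_rho_closed that] endo_vec[OF f that] by (auto simp: preserves_def)
    have c': "res ?I T \<otimes>\<^bsub>endo ?I\<^esub> bt_rho d N n g = bt_rho d N n g \<otimes>\<^bsub>endo ?I\<^esub> res ?I T" if "g \<in> btgens n" for g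
      unfolding endo_commute_iff[OF r bt_rho_closed] using c[OF that] v by simp
    have "res ?I T \<otimes>\<^bsub>endo ?I\<^esub> free_ev (endo ?I) (bt_rho d N n) x
        = free_ev (endo ?I) (bt_rho d N n) x \<otimes>\<^bsub>endo ?I\<^esub> res ?I T"
      by (rule commute_free_ev[of "btgens n"]) (rule bt_rho_closed r c' x(1) | assumption)+
    then have "res ?I T \<otimes>\<^bsub>endo ?I\<^esub> res ?I f = res ?I f \<otimes>\<^bsub>endo ?I\<^esub> res ?I T"
      unfolding x(2) .
    then have "\<forall>y\<in>vec ?I. res ?I T (res ?I f y) = res ?I f (res ?I T y)"
      unfolding endo_commute_iff[OF r f] .
    then show ?thesis using v by simp
  qed
  show ?thesis unfolding EndUqS_iff
  proof (intro conjI f ballI allI impI)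
    fix g and y :: tens assume "g \<in> ugens d N" "y \<in> vec ?I"
    then show "res ?I f (Top g y) = Top g (res ?I f y)"
      using com[OF Top_linear[of g] Top_preserves] btop_EndUqS unfolding EndUqS_iff by blast
  next
    fix \<tau> and y :: tens assume "\<tau> permutes {1..d}" "y \<in> vec ?I"
    then show "res ?I f (PT \<tau> y) = PT \<tau> (res ?I f y)"
      using com[OF PT_linear[of \<tau>] PT_preserves] btop_EndUqS unfolding EndUqS_iff by blast
  qed
qed


section \<open>A spanning set of the algebra of braids and ties\<close>

lemma extend_permutation:
  assumes S: "finite S" and A: "A \<subseteq> S" and f: "inj_on f A" "f ` A \<subseteq> S"
  shows "\<exists>\<pi>. \<pi> permutes S \<and> (\<forall>x\<in>A. \<pi> x = f x)"
proof -
  have "card (S - A) = card (S - f ` A)"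
    using S A f by (simp add: card_Diff_subset finite_subset card_image)
  then obtain g where g: "bij_betw g (S - A) (S - f ` A)"
    using S by (metis finite_Diff finite_same_card_bij)
  define \<pi> where "\<pi> x = (if x \<in> A then f x else if x \<in> S then g x else x)" for x
  have "bij_betw \<pi> (A \<union> (S - A)) (f ` A \<union> (S - f ` A))"
  proof (rule bij_betw_combine)
    show "bij_betw \<pi> A (f ` A)" using f(1) by (simp add: bij_betw_def inj_on_def \<pi>_def)
    have "bij_betw \<pi> (S - A) (S - f ` A) \<longleftrightarrow> bij_betw g (S - A) (S - f ` A)"
      by (rule bij_betw_cong) (simp add: \<pi>_def)
    then show "bij_betw \<pi> (S - A) (S - f ` A)" using g by simp
  qed auto
  moreover have "A \<union> (S - A) = S" "f ` A \<union> (S - f ` A) = S" using A f(2) by auto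
  ultimately have "\<pi> permutes S"
    using A by (intro bij_imp_permutes) (auto simp: \<pi>_def)
  then show ?thesis by (intro exI[of _ \<pi>]) (simp add: \<pi>_def)
qed

section \<open>Conjugation of ties by braid generators\<close>

locale ties = kalg A for A :: "('k::field, 'a) module" (structure) +
  fixes n :: nat and s s' E :: "nat \<Rightarrow> 'a" and \<kappa> :: 'k
  assumes s_closed [simp]: "i \<in> {1..<n} \<Longrightarrow> s i \<in> carrier A"
    and s'_closed [simp]: "i \<in> {1..<n} \<Longrightarrow> s' i \<in> carrier A"
    and E_closed [simp]: "i \<in> {1..<n} \<Longrightarrow> E i \<in> carrier A"
    and s_s' [simp]: "i \<in> {1..<n} \<Longrightarrow> s i \<otimes> s' i = \<one>"
    and s'_s [simp]: "i \<in> {1..<n} \<Longrightarrow> s' i \<otimes> s i = \<one>"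
    and E_E: "i \<in> {1..<n} \<Longrightarrow> E i \<otimes> E i = E i"
    and s_E: "i \<in> {1..<n} \<Longrightarrow> s i \<otimes> E i = E i \<otimes> s i"
    and E_comm: "i \<in> {1..<n} \<Longrightarrow> j \<in> {1..<n} \<Longrightarrow> E i \<otimes> E j = E j \<otimes> E i"
    and far_s: "i \<in> {1..<n} \<Longrightarrow> j \<in> {1..<n} \<Longrightarrow> \<bar>int i - int j\<bar> > 1 \<Longrightarrow> s i \<otimes> s j = s j \<otimes> s i"
    and far_E: "i \<in> {1..<n} \<Longrightarrow> j \<in> {1..<n} \<Longrightarrow> \<bar>int i - int j\<bar> > 1 \<Longrightarrow> s i \<otimes> E j = E j \<otimes> s i"
    and s_braid: "i \<in> {1..<n} \<Longrightarrow> j \<in> {1..<n} \<Longrightarrow> \<bar>int i - int j\<bar> = 1 \<Longrightarrow>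
      s i \<otimes> (s j \<otimes> s i) = s j \<otimes> (s i \<otimes> s j)"
    and E_s_s: "i \<in> {1..<n} \<Longrightarrow> j \<in> {1..<n} \<Longrightarrow> \<bar>int i - int j\<bar> = 1 \<Longrightarrow>
      E i \<otimes> (s j \<otimes> s i) = s j \<otimes> (s i \<otimes> E j)"
    and E_s_s': "i \<in> {1..<n} \<Longrightarrow> j \<in> {1..<n} \<Longrightarrow> \<bar>int i - int j\<bar> = 1 \<Longrightarrow>
      E i \<otimes> (s j \<otimes> s' i) = s j \<otimes> (s' i \<otimes> E j)"
    and E_E_s: "i \<in> {1..<n} \<Longrightarrow> j \<in> {1..<n} \<Longrightarrow> \<bar>int i - int j\<bar> = 1 \<Longrightarrow>
      E i \<otimes> (E j \<otimes> s i) = E j \<otimes> (s i \<otimes> E j)"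
    and s_quad: "i \<in> {1..<n} \<Longrightarrow> s i \<otimes> s i = \<kappa> \<odot> (s i \<otimes> E i) \<oplus> \<one>"
begin

definition cj :: "nat \<Rightarrow> 'a \<Rightarrow> 'a" where
  "cj i x = s i \<otimes> (x \<otimes> s' i)"

definition cj' :: "nat \<Rightarrow> 'a \<Rightarrow> 'a" where
  "cj' i x = s' i \<otimes> (x \<otimes> s i)"

lemma cancel_s [simp]:
  "i \<in> {1..<n} \<Longrightarrow> x \<in> carrier A \<Longrightarrow> s i \<otimes> (s' i \<otimes> x) = x"
  "i \<in> {1..<n} \<Longrightarrow> x \<in> carrier A \<Longrightarrow> s' i \<otimes> (s i \<otimes> x) = x"
  by (simp_all flip: m_assoc)

lemma cj_closed [simp]: "i \<in> {1..<n} \<Longrightarrow> x \<in> carrier A \<Longrightarrow> cj i x \<in> carrier A"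
  and cj'_closed [simp]: "i \<in> {1..<n} \<Longrightarrow> x \<in> carrier A \<Longrightarrow> cj' i x \<in> carrier A"
  by (simp_all add: cj_def cj'_def)

lemma cj_cj' [simp]: "i \<in> {1..<n} \<Longrightarrow> x \<in> carrier A \<Longrightarrow> cj i (cj' i x) = x"
  and cj'_cj [simp]: "i \<in> {1..<n} \<Longrightarrow> x \<in> carrier A \<Longrightarrow> cj' i (cj i x) = x"
  by (simp_all add: cj_def cj'_def m_assoc)

lemma cj_mult: "i \<in> {1..<n} \<Longrightarrow> x \<in> carrier A \<Longrightarrow> y \<in> carrier A \<Longrightarrow> cj i (x \<otimes> y) = cj i x \<otimes> cj i y"
  by (simp add: cj_def m_assoc)

lemma cj_s: "i \<in> {1..<n} \<Longrightarrow> x \<in> carrier A \<Longrightarrow> s i \<otimes> x = cj i x \<otimes> s i"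
  by (simp add: cj_def m_assoc)

lemma cj_inj:
  assumes "i \<in> {1..<n}" "x \<in> carrier A" "y \<in> carrier A" "cj i x = cj i y"
  shows "x = y"
  using arg_cong[OF assms(4), of "cj' i"] assms(1-3) by simp

lemma cj_E: assumes i: "i \<in> {1..<n}" shows "cj i (E i) = E i"
proof -
  have "cj i (E i) = (s i \<otimes> E i) \<otimes> s' i" using i by (simp add: cj_def m_assoc)
  also have "\<dots> = E i" unfolding s_E[OF i] using i by (simp add: m_assoc)
  finally show ?thesis .
qed

lemma cj_far_E:
  assumes i: "i \<in> {1..<n}" and j: "j \<in> {1..<n}" and ij: "\<bar>int i - int j\<bar> > 1"
  shows "cj i (E j) = E j"
proof -
  have "cj i (E j) = (s i \<otimes> E j) \<otimes> s' i" using i j by (simp add: cj_def m_assoc)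
  also have "\<dots> = E j" unfolding far_E[OF i j ij] using i j by (simp add: m_assoc)
  finally show ?thesis .
qed

lemma cj_far:
  assumes i: "i \<in> {1..<n}" and j: "j \<in> {1..<n}" and ij: "\<bar>int i - int j\<bar> > 1" and x: "x \<in> carrier A"
  shows "cj i (cj j x) = cj j (cj i x)"
proof -
  have b: "s i \<otimes> s j = s j \<otimes> s i" using far_s[OF i j ij] .
  have "s' i \<otimes> s' j = s' j \<otimes> s' i"
  proof (rule inv_unique[symmetric, of _ "s j \<otimes> s i"])
    show "s j \<otimes> s i \<otimes> (s' i \<otimes> s' j) = \<one>" using i j by (simp add: m_assoc)
    show "s' j \<otimes> s' i \<otimes> (s j \<otimes> s i) = \<one>" unfolding b[symmetric] using i j by (simp add: m_assoc)
  qed (use i j in simp_all)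
  moreover have "s i \<otimes> (s j \<otimes> y) = s j \<otimes> (s i \<otimes> y)" if "y \<in> carrier A" for y
    using arg_cong[OF b, of "\<lambda>z. z \<otimes> y"] that i j by (simp add: m_assoc)
  ultimately show ?thesis using x i j by (simp add: cj_def m_assoc)
qed

lemma cj_braid:
  assumes i: "i \<in> {1..<n}" and j: "j \<in> {1..<n}" and ij: "\<bar>int i - int j\<bar> = 1" and x: "x \<in> carrier A"
  shows "cj i (cj j (cj i x)) = cj j (cj i (cj j x))"
proof -
  have b: "s i \<otimes> (s j \<otimes> s i) = s j \<otimes> (s i \<otimes> s j)" using s_braid[OF i j ij] .
  have "s' i \<otimes> (s' j \<otimes> s' i) = s' j \<otimes> (s' i \<otimes> s' j)"
  proof (rule inv_unique[symmetric, of _ "s i \<otimes> (s j \<otimes> s i)"])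
    show "s i \<otimes> (s j \<otimes> s i) \<otimes> (s' i \<otimes> (s' j \<otimes> s' i)) = \<one>" using i j by (simp add: m_assoc)
    show "s' j \<otimes> (s' i \<otimes> s' j) \<otimes> (s i \<otimes> (s j \<otimes> s i)) = \<one>" unfolding b using i j by (simp add: m_assoc)
  qed (use i j in simp_all)
  moreover have "s i \<otimes> (s j \<otimes> (s i \<otimes> y)) = s j \<otimes> (s i \<otimes> (s j \<otimes> y))" if "y \<in> carrier A" for y
    using arg_cong[OF b, of "\<lambda>z. z \<otimes> y"] that i j by (simp add: m_assoc)
  ultimately show ?thesis using x i j by (simp add: cj_def m_assoc)
qed

text \<open>The relations with \<open>s j \<otimes> s i\<close> and
  \<open>s j \<otimes> s' i\<close> say that conjugating \<open>E j\<close> by \<open>s i\<close> or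
  by its inverse gives the same element. Hence conjugation by a braid generator is an involution on
  neighbouring ties, as needed for an action of the symmetric group.\<close>

lemma cj_adj:
  assumes ij: "i \<in> {1..<n}" "j \<in> {1..<n}" "\<bar>int i - int j\<bar> = 1"
  shows "cj i (E j) = cj j (E i)" and "cj i (cj i (E j)) = E j"
proof -
  note c = ij(1,2)
  have 1: "cj j (cj i (E j)) = E i" if "i \<in> {1..<n}" "j \<in> {1..<n}" "\<bar>int i - int j\<bar> = 1" for i j
  proof -
    have "cj j (cj i (E j)) = (s j \<otimes> (s i \<otimes> E j)) \<otimes> (s' i \<otimes> s' j)"
      using that(1,2) by (simp add: cj_def m_assoc)
    also have "\<dots> = E i" unfolding E_s_s[OF that, symmetric] using that(1,2) by (simp add: m_assoc)
    finally show ?thesis .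
  qed
  have 2: "cj j (cj' i (E j)) = E i" if "i \<in> {1..<n}" "j \<in> {1..<n}" "\<bar>int i - int j\<bar> = 1" for i j
  proof -
    have "cj j (cj' i (E j)) = (s j \<otimes> (s' i \<otimes> E j)) \<otimes> (s i \<otimes> s' j)"
      using that(1,2) by (simp add: cj_def cj'_def m_assoc)
    also have "\<dots> = E i" unfolding E_s_s'[OF that, symmetric] using that(1,2) by (simp add: m_assoc)
    finally show ?thesis .
  qed
  have "cj i (E j) = cj' i (E j)"
    by (rule cj_inj[OF c(2)]) (use 1[OF ij] 2[OF ij] c in simp_all)
  then show s2: "cj i (cj i (E j)) = E j" using c by simp
  have "cj i (cj j (E i)) = E j" using 1[of j i] ij by (simp add: abs_minus_commute)
  then show "cj i (E j) = cj j (E i)" using s2 c by (metis cj_inj cj_closed E_closed)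
qed

text \<open>\<open>e i j\<close> ties the strands \<open>i < j\<close>.\<close>

fun e :: "nat \<Rightarrow> nat \<Rightarrow> 'a" where
  "e i 0 = \<one>"
| "e i (Suc j) = (if j \<le> i then E i else cj j (e i j))"

lemma e_Suc [simp]: "e i (Suc i) = E i" by simp

lemma e_step: "i < j \<Longrightarrow> e i (Suc j) = cj j (e i j)" by simp

lemma e_closed [simp]: "1 \<le> i \<Longrightarrow> i < j \<Longrightarrow> j \<le> n \<Longrightarrow> e i j \<in> carrier A"
  by (induction j) auto

declare e.simps [simp del]
declare e_Suc [simp]

lemma cj_e_outside:
  assumes "1 \<le> i" "i < j" "j \<le> n" "k \<in> {1..<n}" "Suc k < i \<or> j < k"
  shows "cj k (e i j) = e i j"
  using assms(2,3,5)
proof (induction j)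
  case (Suc j)
  show ?case
  proof (cases "j = i")
    case True
    then show ?thesis using Suc.prems assms(1,4) by (auto intro!: cj_far_E)
  next
    case False
    then have ij: "i < j" using Suc.prems by simp
    have "cj k (cj j (e i j)) = cj j (cj k (e i j))"
      using ij Suc.prems assms by (intro cj_far) auto
    then show ?thesis using Suc ij assms by (auto simp: e_step)
  qed
qed simp

text \<open>Carries the involution property from neighbouring ties to \<open>e i j\<close> by
  induction on \<open>j\<close>, with the braid relation for conjugations.\<close>

lemma cj_square_e:
  assumes "1 \<le> i" "i < j" "j < n" shows "cj j (cj j (e i j)) = e i j"
  using assms(2,3)
proof (induction j)
  case (Suc j)
  show ?case
  proof (cases "j = i")
    case True
    then show ?thesis using Suc.prems assms(1) cj_adj(2)[of "Suc i" i] by simp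
  next
    case False
    then have ij: "i < j" using Suc.prems by simp
    let ?y = "e i j" and ?a = "cj j" and ?b = "cj (Suc j)" and ?a' = "cj' j" and ?b' = "cj' (Suc j)"
    have r: "j \<in> {1..<n}" "Suc j \<in> {1..<n}" using Suc.prems ij by auto
    have y [simp]: "?y \<in> carrier A" using assms(1) ij Suc.prems by simp
    have fy: "?b ?y = ?y" using cj_e_outside[of i j "Suc j"] assms(1) ij Suc.prems r by simp
    have aa: "?a (?a ?y) = ?y" using Suc ij by simp
    have br: "?a (?b (?a x)) = ?b (?a (?b x))" if "x \<in> carrier A" for x
      using cj_braid[OF r _ that] by simp
    note cl = cj_closed[OF r(1)] cj_closed[OF r(2)]
    \<comment> \<open>The braid relation applied to \<open>?y\<close>, which \<open>?b\<close>
      fixes.\<close>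
    have "?b (?a ?y) = ?a (?b (?a ?y))"
    proof -
      have "?a (?b (?a ?y)) = ?b (?a (?b ?y))" by (rule br) simp
      then show ?thesis by (simp add: fy)
    qed
    have "?a (?b (?b (?a ?y))) = ?y"
    proof -
      have "?a (?b (?b (?a ?y))) = ?a (?b (?a (?b (?a ?y))))" using \<open>?b (?a ?y) = ?a (?b (?a ?y))\<close> by simp
      also have "\<dots> = ?b (?a (?b (?b (?a ?y))))" by (rule br) (simp add: cl)
      finally have *: "?a (?b (?b (?a ?y))) = ?b (?a (?b (?b (?a ?y))))" .
      have "?b (?a (?b (?a ?y))) = ?b (?b (?a ?y))" using \<open>?b (?a ?y) = ?a (?b (?a ?y))\<close> by simp
      moreover have "?b (?a (?b (?a ?y))) = ?a (?b (?a (?a ?y)))" using br[of "?a ?y"] cl by simp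
      ultimately have "?b (?b (?a ?y)) = ?a (?b ?y)" by (simp add: aa)
      then show ?thesis by (simp add: fy aa)
    qed
    then have "?a (?b (?b (?a ?y))) = ?a (?a ?y)" by (simp add: aa)
    then have "?b (?b (?a ?y)) = ?a ?y" by (rule cj_inj[OF r(1), rotated 2]) (simp_all add: cl)
    then show ?thesis using ij by (simp add: e_step)
  qed
qed simp

lemma cj_e_inside:
  assumes "1 \<le> i" "i < k" "Suc k < j" "j \<le> n" shows "cj k (e i j) = e i j"
  using assms(3,4)
proof (induction j)
  case (Suc j)
  show ?case
  proof (cases "Suc k = j")
    case True
    let ?y = "e i k"
    have r: "k \<in> {1..<n}" "Suc k \<in> {1..<n}" using Suc.prems True assms by auto
    have y: "?y \<in> carrier A" using assms r by simp
    have fy: "cj (Suc k) ?y = ?y" using cj_e_outside[of i k "Suc k"] assms r by simp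
    have "cj k (cj (Suc k) (cj k ?y)) = cj (Suc k) (cj k (cj (Suc k) ?y))"
      using cj_braid[OF r _ y] by simp
    then show ?thesis using True assms(2) by (auto simp: e_step fy)
  next
    case False
    then have kj: "Suc k < j" using Suc.prems by simp
    have "cj k (cj j (e i j)) = cj j (cj k (e i j))"
      using kj Suc.prems assms by (intro cj_far) auto
    then show ?thesis using Suc kj assms by (auto simp: e_step)
  qed
qed simp

lemma cj_e_left:
  assumes "1 \<le> i" "Suc i < j" "j \<le> n" shows "cj i (e i j) = e (Suc i) j"
  using assms(2,3)
proof (induction j)
  case (Suc j)
  show ?case
  proof (cases "j = Suc i")
    case True
    then have "cj i (e i (Suc j)) = cj i (cj (Suc i) (E i))" by (simp add: e_step)
    also have "\<dots> = cj i (cj i (E (Suc i)))" using cj_adj(1)[of "Suc i" i] assms(1) Suc.prems True by simp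
    also have "\<dots> = E (Suc i)" using cj_adj(2)[of i "Suc i"] assms(1) Suc.prems True by simp
    finally show ?thesis using True by simp
  next
    case False
    then have ij: "Suc i < j" using Suc.prems by simp
    have "cj i (cj j (e i j)) = cj j (cj i (e i j))"
      using ij Suc.prems assms by (intro cj_far) auto
    then show ?thesis using Suc ij assms by (auto simp: e_step)
  qed
qed simp

lemma cj_e_left':
  assumes "1 < i" "i < j" "j \<le> n" shows "cj (i - 1) (e i j) = e (i - 1) j"
  using assms(2,3)
proof (induction j)
  case (Suc j)
  show ?case
  proof (cases "j = i")
    case True
    have "e (i - 1) (Suc i) = cj i (e (i - 1) i)" using assms(1) by (intro e_step) simp
    also have "e (i - 1) i = E (i - 1)" using assms(1) e_Suc[of "i - 1"] by simp
    finally have "e (i - 1) (Suc i) = cj i (E (i - 1))" .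
    moreover have "cj (i - 1) (E i) = cj i (E (i - 1))"
      using assms(1) Suc.prems True by (intro cj_adj(1)) auto
    ultimately show ?thesis using True by simp
  next
    case False
    then have ij: "i < j" using Suc.prems by simp
    have "cj (i - 1) (cj j (e i j)) = cj j (cj (i - 1) (e i j))"
      using ij Suc.prems assms by (intro cj_far) auto
    then show ?thesis using Suc ij assms by (auto simp: e_step)
  qed
qed simp

definition tr :: "nat \<Rightarrow> nat \<Rightarrow> nat" where
  "tr k x = (if x = k then Suc k else if x = Suc k then k else x)"

definition ee :: "nat \<Rightarrow> nat \<Rightarrow> 'a" where
  "ee i j = e (min i j) (max i j)"

lemma ee_closed [simp]: "i \<in> {1..n} \<Longrightarrow> j \<in> {1..n} \<Longrightarrow> i \<noteq> j \<Longrightarrow> ee i j \<in> carrier A"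
  by (auto simp: ee_def min_def max_def)

lemma ee_sym: "ee i j = ee j i"
  by (simp add: ee_def min.commute max.commute)

lemma ee_adj: "ee i (Suc i) = E i" by (simp add: ee_def)

text \<open>The seven cases are the positions of \<open>k\<close> relative to \<open>i\<close> and
  \<open>j\<close>; together they show that conjugation permutes the indices of a tie.\<close>

lemma cj_e:
  assumes ij: "1 \<le> i" "i < j" "j \<le> n" and k: "k \<in> {1..<n}"
  shows "cj k (e i j) = ee (tr k i) (tr k j)"
proof -
  consider "Suc k < i \<or> j < k" | "Suc k = i" | "k = i" "j = Suc i" | "k = i" "Suc i < j"
    | "i < k" "Suc k < j" | "i < k" "Suc k = j" | "k = j" using ij by linarith
  then show ?thesis
  proof cases
    case 1
    then show ?thesis using cj_e_outside[of i j k] ij k by (auto simp: tr_def ee_def)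
  next
    case 2
    then show ?thesis using cj_e_left'[of i j] ij k by (auto simp: tr_def ee_def)
  next
    case 3
    then show ?thesis using cj_E[of i] ij k by (auto simp: tr_def ee_def)
  next
    case 4
    then show ?thesis using cj_e_left[of i j] ij k by (auto simp: tr_def ee_def)
  next
    case 5
    then show ?thesis using cj_e_inside[of i k j] ij k by (auto simp: tr_def ee_def)
  next
    case 6
    then have "e i j = cj k (e i k)" using e_step[of i k] by simp
    then show ?thesis using 6 cj_square_e[of i k] ij k by (auto simp: tr_def ee_def)
  next
    case 7
    then show ?thesis using e_step[of i j] ij k by (auto simp: tr_def ee_def)
  qed
qed

lemma cj_ee:
  assumes "i \<in> {1..n}" "j \<in> {1..n}" "i \<noteq> j" "k \<in> {1..<n}"
  shows "cj k (ee i j) = ee (tr k i) (tr k j)"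
proof (cases "i < j")
  case True
  then show ?thesis using cj_e[of i j k] assms by (simp add: ee_def)
next
  case False
  then have "cj k (ee i j) = ee (tr k j) (tr k i)" using cj_e[of j i k] assms by (simp add: ee_def)
  then show ?thesis by (simp add: ee_sym)
qed

lemma tr_tr [simp]: "tr k (tr k x) = x" by (auto simp: tr_def)

lemma tr_range: "k \<in> {1..<n} \<Longrightarrow> x \<in> {1..n} \<Longrightarrow> tr k x \<in> {1..n}" by (auto simp: tr_def)

lemma tr_inj: "tr k x = tr k y \<longleftrightarrow> x = y" by (metis tr_tr)

lemma ee_idem:
  assumes "i \<in> {1..n}" "j \<in> {1..n}" "i \<noteq> j" shows "ee i j \<otimes> ee i j = ee i j"
proof -
  have "e i j \<otimes> e i j = e i j" if "1 \<le> i" "i < j" "j \<le> n" for i j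
    using that(2,3)
  proof (induction j)
    case (Suc j)
    show ?case
    proof (cases "j = i")
      case True
      then show ?thesis using E_E Suc.prems that(1) by simp
    next
      case False
      then show ?thesis using Suc that(1) by (simp add: e_step flip: cj_mult)
    qed
  qed simp
  then show ?thesis using assms by (auto simp: ee_def min_def max_def)
qed

text \<open>
  The symmetric group acts by automorphisms on the algebra generated by the ties, so that
  relations between them need to be checked for one choice of distinct indices only.
\<close>

definition good :: "(nat \<Rightarrow> nat) \<Rightarrow> bool" where
  "good \<pi> \<longleftrightarrow> (\<exists>h. h \<in> carrier A \<rightarrow> carrier A \<and> inj_on h (carrier A) \<and>
     (\<forall>x\<in>carrier A. \<forall>y\<in>carrier A. h (x \<otimes> y) = h x \<otimes> h y) \<and>
     (\<forall>i\<in>{1..n}. \<forall>j\<in>{1..n}. i \<noteq> j \<longrightarrow> h (ee i j) = ee (\<pi> i) (\<pi> j)))"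

lemma good_comp:
  assumes "good \<sigma>" "good \<pi>" "\<pi> permutes {1..n}"
  shows "good (\<sigma> \<circ> \<pi>)"
proof -
  obtain g where g: "g \<in> carrier A \<rightarrow> carrier A" "inj_on g (carrier A)"
    "\<And>x y. x \<in> carrier A \<Longrightarrow> y \<in> carrier A \<Longrightarrow> g (x \<otimes> y) = g x \<otimes> g y"
    "\<And>i j. i \<in> {1..n} \<Longrightarrow> j \<in> {1..n} \<Longrightarrow> i \<noteq> j \<Longrightarrow> g (ee i j) = ee (\<sigma> i) (\<sigma> j)"
    using assms(1) unfolding good_def by blast
  obtain h where h: "h \<in> carrier A \<rightarrow> carrier A" "inj_on h (carrier A)"
    "\<And>x y. x \<in> carrier A \<Longrightarrow> y \<in> carrier A \<Longrightarrow> h (x \<otimes> y) = h x \<otimes> h y"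
    "\<And>i j. i \<in> {1..n} \<Longrightarrow> j \<in> {1..n} \<Longrightarrow> i \<noteq> j \<Longrightarrow> h (ee i j) = ee (\<pi> i) (\<pi> j)"
    using assms(2) unfolding good_def by blast
  have m: "\<pi> i \<in> {1..n}" if "i \<in> {1..n}" for i using permutes_in_image[OF assms(3)] that by blast
  have ne: "\<pi> i \<noteq> \<pi> j" if "i \<noteq> j" for i j using permutes_inj[OF assms(3)] that by (auto dest: injD)
  show ?thesis unfolding good_def
  proof (intro exI[of _ "g \<circ> h"] conjI ballI impI)
    show "g \<circ> h \<in> carrier A \<rightarrow> carrier A" using g(1) h(1) by (auto simp: Pi_def)
    have "inj_on g (h ` carrier A)" by (rule inj_on_subset[OF g(2)]) (use h(1) in auto)
    then show "inj_on (g \<circ> h) (carrier A)" by (rule comp_inj_on[OF h(2)])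
    show "(g \<circ> h) (x \<otimes> y) = (g \<circ> h) x \<otimes> (g \<circ> h) y" if "x \<in> carrier A" "y \<in> carrier A" for x y
      using that g(3)[of "h x" "h y"] h(1) h(3)[OF that] by (auto simp: Pi_def)
    show "(g \<circ> h) (ee i j) = ee ((\<sigma> \<circ> \<pi>) i) ((\<sigma> \<circ> \<pi>) j)" if "i \<in> {1..n}" "j \<in> {1..n}" "i \<noteq> j" for i j
      using h(4)[OF that] g(4)[OF m[OF that(1)] m[OF that(2)] ne[OF that(3)]] by simp
  qed
qed

lemma tr_transpose: "tr k = transpose k (Suc k)"
  by (auto simp: fun_eq_iff tr_def transpose_def)

lemma good_tr: assumes "k \<in> {1..<n}" shows "good (transpose k (Suc k))"
  unfolding good_def
proof (intro exI[of _ "cj k"] conjI ballI impI)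
  show "inj_on (cj k) (carrier A)" by (rule inj_onI) (rule cj_inj[OF assms])
qed (use assms in \<open>auto simp: cj_mult cj_ee tr_transpose\<close>)

lemma good_transpose:
  assumes "1 \<le> a" "a < b" "b \<le> n" shows "good (transpose a b)"
  using assms(2,3)
proof (induction b)
  case (Suc b)
  show ?case
  proof (cases "a = b")
    case True
    then show ?thesis using good_tr[of b] Suc.prems assms by simp
  next
    case False
    then have ab: "a < b" using Suc.prems by simp
    have eq: "transpose a (Suc b) = transpose b (Suc b) \<circ> (transpose a b \<circ> transpose b (Suc b))"
      using ab by (auto simp: fun_eq_iff transpose_def)
    have p: "transpose x y permutes {1..n}" if "x \<in> {1..n}" "y \<in> {1..n}" for x y :: nat
      using permutes_swap_id[OF that] .
    have b: "b \<in> {1..<n}" using ab Suc.prems assms by simp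
    show ?thesis unfolding eq
      by (intro good_comp good_tr Suc.IH permutes_compose p) (use ab b Suc.prems assms in auto)
  qed
qed simp

lemma good_permutes:
  assumes "\<pi> permutes {1..n}" shows "good \<pi>"
proof -
  have "\<pi> permutes {1..n} \<and> good \<pi>"
    using assms finite_atLeastAtMost
  proof (induction rule: permutes_induct)
    case id
    show ?case unfolding good_def by (intro conjI permutes_id exI[of _ "\<lambda>x. x"]) auto
  next
    case (swap a b p)
    have "good (transpose a b)"
    proof (cases a b rule: linorder_cases)
      case less
      then show ?thesis using good_transpose[of a b] swap by simp
    next
      case equal
      have "good id" unfolding good_def by (intro exI[of _ "\<lambda>x. x"]) auto
      then show ?thesis using equal by (simp add: id_def)
    next
      case greater
      then show ?thesis using good_transpose[of b a] swap by (simp add: transpose_commute)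
    qed
    moreover have pp: "p permutes {1..n}" "good p" using swap by auto
    ultimately show ?case
      using permutes_compose[OF pp(1) permutes_swap_id[OF swap(1,2)]] good_comp[OF _ pp(2,1)] by blast
  qed
  then show ?thesis by simp
qed

text \<open>An injective multiplicative map from \<open>good_permutes\<close> moves the three
  strands to 1, 2, 3, where the claims follow from the relations between \<open>E 1\<close>,
  \<open>E 2\<close> and \<open>s 1\<close>.\<close>

lemma ee_triple:
  assumes "i \<in> {1..n}" "j \<in> {1..n}" "k \<in> {1..n}" "i \<noteq> j" "j \<noteq> k" "i \<noteq> k"
  shows "ee i j \<otimes> ee j k = ee j k \<otimes> ee i k" "ee i j \<otimes> ee j k = ee j k \<otimes> ee i j"
proof -
  have n: "3 \<le> n"
    using card_mono[of "{1..n}" "{i, j, k}"] assms by simp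
  define f where "f x = (if x = i then 1 else if x = j then 2 else 3 :: nat)" for x
  have "inj_on f {i, j, k}" using assms by (auto simp: f_def inj_on_def)
  moreover have "f ` {i, j, k} \<subseteq> {1..n}" using n by (auto simp: f_def)
  ultimately obtain \<pi> where \<pi>: "\<pi> permutes {1..n}" "\<forall>x\<in>{i, j, k}. \<pi> x = f x"
    using extend_permutation[of "{1..n}" "{i, j, k}" f] assms(1-3) by blast
  obtain h where h: "h \<in> carrier A \<rightarrow> carrier A" "inj_on h (carrier A)"
    "\<And>x y. x \<in> carrier A \<Longrightarrow> y \<in> carrier A \<Longrightarrow> h (x \<otimes> y) = h x \<otimes> h y"
    "\<And>i j. i \<in> {1..n} \<Longrightarrow> j \<in> {1..n} \<Longrightarrow> i \<noteq> j \<Longrightarrow> h (ee i j) = ee (\<pi> i) (\<pi> j)"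
    using good_permutes[OF \<pi>(1)] unfolding good_def by blast
  have e: "h (ee i j) = ee 1 2" "h (ee j k) = ee 2 3" "h (ee i k) = ee 1 3"
    using h(4)[of i j] h(4)[of j k] h(4)[of i k] assms \<pi>(2) by (auto simp: f_def)
  have r: "1 \<in> {1..<n}" "2 \<in> {1..<n}" "\<bar>int 1 - int 2\<bar> = 1" using n by auto
  \<comment> \<open>Inserting \<open>s 1 \<otimes> s' 1\<close> lets \<open>E_E_s\<close> apply; the
    conjugate of \<open>E 2\<close> by \<open>s 1\<close> is the tie of strands 1 and 3.\<close>
  have "E 1 \<otimes> E 2 = (E 1 \<otimes> (E 2 \<otimes> s 1)) \<otimes> s' 1" using r(1,2) by (simp add: m_assoc)
  also have "\<dots> = E 2 \<otimes> cj 1 (E 2)" unfolding E_E_s[OF r] using r(1,2) by (simp add: cj_def m_assoc)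
  also have "cj 1 (E 2) = ee 1 3" using cj_e[of 2 3 1] e_Suc[of 2] n by (simp add: tr_def eval_nat_numeral)
  finally have 1: "ee 1 2 \<otimes> ee 2 3 = ee 2 3 \<otimes> ee 1 3"
    using ee_adj[of 1] ee_adj[of 2] by (simp add: eval_nat_numeral)
  have 2: "ee 1 2 \<otimes> ee 2 3 = ee 2 3 \<otimes> ee 1 2"
    using ee_adj[of 1] ee_adj[of 2] E_comm[OF r(1,2)] by (simp add: eval_nat_numeral)
  have c: "ee i j \<in> carrier A" "ee j k \<in> carrier A" "ee i k \<in> carrier A" using assms by simp_all
  show "ee i j \<otimes> ee j k = ee j k \<otimes> ee i k"
    by (rule inj_onD[OF h(2)]) (use c 1 in \<open>simp_all add: h(3) e\<close>)
  show "ee i j \<otimes> ee j k = ee j k \<otimes> ee i j"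
    by (rule inj_onD[OF h(2)]) (use c 2 in \<open>simp_all add: h(3) e\<close>)
qed

lemma ee_disjoint:
  assumes "i \<in> {1..n}" "j \<in> {1..n}" "k \<in> {1..n}" "l \<in> {1..n}" "distinct [i, j, k, l]"
  shows "ee i j \<otimes> ee k l = ee k l \<otimes> ee i j"
proof -
  have n: "4 \<le> n"
    using card_mono[of "{1..n}" "set [i, j, k, l]"] assms by (simp add: distinct_card)
  have d: "i \<noteq> j" "i \<noteq> k" "i \<noteq> l" "j \<noteq> k" "j \<noteq> l" "k \<noteq> l" using assms(5) by auto
  define f where "f x = (if x = i then 1 else if x = j then 2 else if x = k then 3 else 4 :: nat)" for x
  have "inj_on f {i, j, k, l}" using d by (auto simp: f_def inj_on_def)
  moreover have "f ` {i, j, k, l} \<subseteq> {1..n}" using n by (auto simp: f_def)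
  ultimately obtain \<pi> where \<pi>: "\<pi> permutes {1..n}" "\<forall>x\<in>{i, j, k, l}. \<pi> x = f x"
    using extend_permutation[of "{1..n}" "{i, j, k, l}" f] assms(1-4) by blast
  obtain h where h: "h \<in> carrier A \<rightarrow> carrier A" "inj_on h (carrier A)"
    "\<And>x y. x \<in> carrier A \<Longrightarrow> y \<in> carrier A \<Longrightarrow> h (x \<otimes> y) = h x \<otimes> h y"
    "\<And>i j. i \<in> {1..n} \<Longrightarrow> j \<in> {1..n} \<Longrightarrow> i \<noteq> j \<Longrightarrow> h (ee i j) = ee (\<pi> i) (\<pi> j)"
    using good_permutes[OF \<pi>(1)] unfolding good_def by blast
  have f: "\<pi> i = 1" "\<pi> j = 2" "\<pi> k = 3" "\<pi> l = 4" using \<pi>(2) d by (auto simp: f_def)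
  have e: "h (ee i j) = ee 1 2" "h (ee k l) = ee 3 4"
    using h(4)[of i j] h(4)[of k l] assms(1-4) d f by auto
  have 1: "ee 1 2 \<otimes> ee 3 4 = ee 3 4 \<otimes> ee 1 2"
    using ee_adj[of 1] ee_adj[of 3] E_comm[of 1 3] n by (simp add: eval_nat_numeral)
  have c: "ee i j \<in> carrier A" "ee k l \<in> carrier A" using ee_closed assms(1-4) d by blast+
  show ?thesis
    by (rule inj_onD[OF h(2)]) (use c 1 in \<open>simp_all only: h(3) e m_closed\<close>)
qed

end


context ties
begin

section \<open>Ties as equivalence relations\<close>

text \<open>A strand tied to itself gives one, so that symmetry, idempotency and transitivity hold
  without assuming distinct indices.\<close>

definition et :: "nat \<Rightarrow> nat \<Rightarrow> 'a" where
  "et i j = (if i = j then \<one> else ee i j)"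

lemma et_closed [simp]: "i \<in> {1..n} \<Longrightarrow> j \<in> {1..n} \<Longrightarrow> et i j \<in> carrier A"
  using ee_closed[of i j] by (simp add: et_def)

lemma et_same [simp]: "et i i = \<one>" by (simp add: et_def)

lemma et_sym: "et i j = et j i"
  by (simp add: et_def ee_sym[of i j])

lemma et_idem: "i \<in> {1..n} \<Longrightarrow> j \<in> {1..n} \<Longrightarrow> et i j \<otimes> et i j = et i j"
  using ee_idem[of i j] by (simp add: et_def)

lemma et_comm:
  assumes r: "i \<in> {1..n}" "j \<in> {1..n}" "k \<in> {1..n}" "l \<in> {1..n}"
  shows "et i j \<otimes> et k l = et k l \<otimes> et i j"
proof -
  have share: "et a b \<otimes> et b c = et b c \<otimes> et a b" if "a \<in> {1..n}" "b \<in> {1..n}" "c \<in> {1..n}" for a b c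
  proof (cases "a \<noteq> b \<and> b \<noteq> c \<and> a \<noteq> c")
    case True
    then show ?thesis using ee_triple(2)[OF that] by (simp add: et_def)
  next
    case False
    then consider "a = b" | "b = c" | "a = c" by blast
    then show ?thesis
    proof cases
      case 1
      then show ?thesis using et_closed[OF that(2,3)] by simp
    next
      case 2
      then show ?thesis using et_closed[OF that(1,2)] by simp
    next
      case 3
      then show ?thesis using et_sym[of a b] by simp
    qed
  qed
  consider "i = j" | "k = l" | "distinct [i, j, k, l]" | "j = k" | "i = k" | "j = l" | "i = l" by auto
  then show ?thesis
  proof cases
    case 1
    then show ?thesis using et_closed[OF r(3,4)] by simp
  next
    case 2
    then show ?thesis using et_closed[OF r(1,2)] by simp
  next
    case 3
    then show ?thesis using ee_disjoint[OF r 3] by (simp add: et_def)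
  next
    case 4
    then show ?thesis using share[of i j l] r by simp
  next
    case 5
    then show ?thesis using share[of j i l] r et_sym[of i j] by simp
  next
    case 6
    then show ?thesis using share[of i j k] r et_sym[of k l] by simp
  next
    case 7
    then show ?thesis using share[of j i k] r et_sym[of i j] et_sym[of k l] by simp
  qed
qed

lemma et_trans:
  assumes r: "i \<in> {1..n}" "j \<in> {1..n}" "k \<in> {1..n}"
  shows "et i j \<otimes> (et j k \<otimes> et i k) = et i j \<otimes> et j k"
proof (cases "i \<noteq> j \<and> j \<noteq> k \<and> i \<noteq> k")
  case True
  then have d: "i \<noteq> j" "j \<noteq> k" "i \<noteq> k" by auto
  have c: "ee i j \<in> carrier A" "ee j k \<in> carrier A" "ee i k \<in> carrier A" using r d by simp_all
  have "ee i j \<otimes> (ee j k \<otimes> ee i k) = (ee i j \<otimes> ee j k) \<otimes> ee i k" using c by (simp add: m_assoc)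
  also have "\<dots> = ee j k \<otimes> (ee i k \<otimes> ee i k)"
    unfolding ee_triple(1)[OF r d] using c by (simp add: m_assoc)
  also have "\<dots> = ee i j \<otimes> ee j k" using ee_triple(1)[OF r d] ee_idem[OF r(1,3) d(3)] by simp
  finally show ?thesis using d by (simp add: et_def)
next
  case False
  then consider "i = j" | "j = k" | "i = k" by blast
  then show ?thesis
  proof cases
    case 1
    then show ?thesis using et_idem[OF r(2,3)] by (simp add: r)
  next
    case 2
    then show ?thesis using et_idem[OF r(1,2)] et_closed[OF r(1,2)] by simp
  next
    case 3
    then show ?thesis using et_closed[OF r(2,3)] by simp
  qed
qed

primrec TE :: "(nat \<times> nat) list \<Rightarrow> 'a" where
  "TE [] = \<one>"
| "TE (p # L) = et (fst p) (snd p) \<otimes> TE L"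

lemma TE_closed [simp]: "set L \<subseteq> {1..n} \<times> {1..n} \<Longrightarrow> TE L \<in> carrier A"
proof (induction L)
  case (Cons p L)
  then have "fst p \<in> {1..n}" "snd p \<in> {1..n}" "TE L \<in> carrier A" by auto
  then show ?case by (simp only: TE.simps m_closed et_closed)
qed simp

lemma commute_TE:
  assumes "x \<in> carrier A" "\<And>i j. (i, j) \<in> set L \<Longrightarrow> x \<otimes> et i j = et i j \<otimes> x" "set L \<subseteq> {1..n} \<times> {1..n}"
  shows "x \<otimes> TE L = TE L \<otimes> x"
  using assms(2,3)
proof (induction L)
  case (Cons p L)
  have c: "fst p \<in> {1..n}" "snd p \<in> {1..n}" using Cons.prems by auto
  note c = et_closed[OF c]
  have cl: "TE L \<in> carrier A" using Cons.prems by simp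
  have i: "x \<otimes> TE L = TE L \<otimes> x" using Cons by simp
  have "x \<otimes> TE (p # L) = (x \<otimes> et (fst p) (snd p)) \<otimes> TE L" using c cl assms(1) by (simp add: m_assoc)
  also have "x \<otimes> et (fst p) (snd p) = et (fst p) (snd p) \<otimes> x" using Cons.prems(1)[of "fst p" "snd p"] by simp
  also have "\<dots> \<otimes> TE L = TE (p # L) \<otimes> x" using c cl assms(1) i by (simp add: m_assoc)
  finally show ?case .
qed (use assms in simp)

lemma et_TE: "i \<in> {1..n} \<Longrightarrow> j \<in> {1..n} \<Longrightarrow> set L \<subseteq> {1..n} \<times> {1..n} \<Longrightarrow> et i j \<otimes> TE L = TE L \<otimes> et i j"
  by (rule commute_TE[OF et_closed]) (auto intro!: et_comm)

lemma TE_TE: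
  assumes "set L \<subseteq> {1..n} \<times> {1..n}" "set L' \<subseteq> {1..n} \<times> {1..n}"
  shows "TE L \<otimes> TE L' = TE L' \<otimes> TE L"
proof (rule commute_TE[OF TE_closed[OF assms(1)] _ assms(2)])
  fix i j assume "(i, j) \<in> set L'"
  then have "i \<in> {1..n}" "j \<in> {1..n}" using assms(2) by auto
  then show "TE L \<otimes> et i j = et i j \<otimes> TE L" using et_TE[of i j L] assms by simp
qed

lemma TE_absorb:
  assumes "set L \<subseteq> {1..n} \<times> {1..n}" "(i, j) \<in> set L"
  shows "TE L \<otimes> et i j = TE L"
  using assms
proof (induction L)
  case (Cons p L)
  have c: "fst p \<in> {1..n}" "snd p \<in> {1..n}" "i \<in> {1..n}" "j \<in> {1..n}" using Cons.prems by auto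
  have L: "set L \<subseteq> {1..n} \<times> {1..n}" using Cons.prems by simp
  note cl = et_closed[OF c(1,2)] et_closed[OF c(3,4)] TE_closed[OF L]
  show ?case
  proof (cases "p = (i, j)")
    case True
    have "TE (p # L) \<otimes> et i j = et i j \<otimes> (TE L \<otimes> et i j)" using True cl by (simp add: m_assoc)
    also have "TE L \<otimes> et i j = et i j \<otimes> TE L" using et_TE[OF c(3,4) L] by simp
    also have "et i j \<otimes> (et i j \<otimes> TE L) = (et i j \<otimes> et i j) \<otimes> TE L" using cl by (simp add: m_assoc)
    finally show ?thesis using True et_idem[OF c(3,4)] by simp
  next
    case False
    then have "TE L \<otimes> et i j = TE L" using Cons L by auto
    then show ?thesis using cl by (simp add: m_assoc)
  qed
qed simp

lemma absorb_TE:
  assumes "set L \<subseteq> {1..n} \<times> {1..n}" "x \<in> carrier A" "\<And>i j. (i, j) \<in> set L \<Longrightarrow> x \<otimes> et i j = x"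
  shows "x \<otimes> TE L = x"
  using assms(1,3)
proof (induction L)
  case (Cons p L)
  have "fst p \<in> {1..n}" "snd p \<in> {1..n}" "set L \<subseteq> {1..n} \<times> {1..n}" using Cons.prems by auto
  then have "x \<otimes> TE (p # L) = (x \<otimes> et (fst p) (snd p)) \<otimes> TE L"
    using assms(2) et_closed TE_closed by (simp add: m_assoc del: One_nat_def atLeastAtMost_iff)
  also have "\<dots> = x" using Cons.prems(2)[of "fst p" "snd p"] Cons by simp
  finally show ?case .
qed (use assms in simp)

text \<open>Products of ties commute, so two products that absorb each other's factors coincide: x =
  x y = y x = y.\<close>

lemma TE_eqI:
  assumes L: "set L \<subseteq> {1..n} \<times> {1..n}" "set L' \<subseteq> {1..n} \<times> {1..n}"
    and "\<And>i j. (i, j) \<in> set L \<Longrightarrow> TE L' \<otimes> et i j = TE L'"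
    and "\<And>i j. (i, j) \<in> set L' \<Longrightarrow> TE L \<otimes> et i j = TE L"
  shows "TE L = TE L'"
proof -
  have "TE L = TE L \<otimes> TE L'" using absorb_TE[OF L(2) TE_closed[OF L(1)] assms(4)] by simp
  also have "\<dots> = TE L' \<otimes> TE L" by (rule TE_TE[OF L])
  also have "\<dots> = TE L'" using absorb_TE[OF L(1) TE_closed[OF L(2)] assms(3)] by simp
  finally show ?thesis .
qed

text \<open>\<open>EC c\<close> ties the strands on which \<open>c\<close> agrees.\<close>

definition EL :: "(nat \<Rightarrow> nat) \<Rightarrow> (nat \<times> nat) list" where
  "EL c = filter (\<lambda>(i, j). c i = c j) (List.product [1..<Suc n] [1..<Suc n])"

definition EC :: "(nat \<Rightarrow> nat) \<Rightarrow> 'a" where "EC c = TE (EL c)"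

lemma set_EL: "set (EL c) = {(i, j). i \<in> {1..n} \<and> j \<in> {1..n} \<and> c i = c j}"
  by (auto simp: EL_def simp del: upt_Suc)

lemma EL_range: "set (EL c) \<subseteq> {1..n} \<times> {1..n}"
  by (auto simp: set_EL)

lemma EC_closed [simp]: "EC c \<in> carrier A"
  unfolding EC_def by (rule TE_closed[OF EL_range])

lemma EC_absorb: "i \<in> {1..n} \<Longrightarrow> j \<in> {1..n} \<Longrightarrow> c i = c j \<Longrightarrow> EC c \<otimes> et i j = EC c"
  unfolding EC_def by (rule TE_absorb[OF EL_range]) (auto simp: set_EL)

lemma EC_cong:
  assumes "\<And>i j. i \<in> {1..n} \<Longrightarrow> j \<in> {1..n} \<Longrightarrow> c i = c j \<longleftrightarrow> c' i = c' j"
  shows "EC c = EC c'"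
proof -
  have "EL c = EL c'" unfolding EL_def using assms by (intro filter_cong) (auto simp del: upt_Suc)
  then show ?thesis by (simp add: EC_def)
qed

lemma EC_id: "EC id = \<one>"
proof -
  have "TE L = \<one>" if "\<And>i j. (i, j) \<in> set L \<Longrightarrow> i = j" for L
    using that
  proof (induction L)
    case (Cons p L)
    then have "fst p = snd p" by (cases p) auto
    then have "et (fst p) (snd p) = \<one>" by (simp add: et_def)
    then show ?case using Cons by simp
  qed simp
  from this[of "EL id"] have "TE (EL id) = \<one>" by (simp add: set_EL)
  then show ?thesis by (simp add: EC_def)
qed

text \<open>Tying \<open>a\<close> to \<open>b\<close> merges their blocks, and the new labelling
  gives the label of \<open>a\<close> to the whole block of \<open>b\<close>. The two sides absorb
  each other, by transitivity of ties.\<close>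

lemma EC_et:
  assumes ab: "a \<in> {1..n}" "b \<in> {1..n}"
  shows "EC c \<otimes> et a b = EC (\<lambda>x. if c x = c b then c a else c x)"
proof -
  define c' where "c' x = (if c x = c b then c a else c x)" for x
  define T where "T = EC c \<otimes> et a b"
  note e = et_closed[OF ab]
  have T: "T \<in> carrier A" using e by (simp add: T_def)
  have "EC c' \<otimes> TE (EL c) = EC c'"
    by (rule absorb_TE[OF EL_range EC_closed], rule EC_absorb) (auto simp: set_EL c'_def)
  then have "EC c' \<otimes> EC c = EC c'" by (simp add: EC_def)
  moreover have "EC c' \<otimes> T = (EC c' \<otimes> EC c) \<otimes> et a b" using e by (simp add: T_def m_assoc)
  ultimately have "EC c' \<otimes> T = EC c' \<otimes> et a b" by simp
  also have "\<dots> = EC c'" by (rule EC_absorb[OF ab]) (simp add: c'_def)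
  finally have 1: "EC c' \<otimes> T = EC c'" .
  have R: "T \<otimes> et i j = T" if "i \<in> {1..n}" "j \<in> {1..n}" "c i = c j" for i j
  proof -
    have "T \<otimes> et i j = EC c \<otimes> (et a b \<otimes> et i j)" using e et_closed[OF that(1,2)] by (simp add: T_def m_assoc)
    also have "et a b \<otimes> et i j = et i j \<otimes> et a b" using et_comm that ab by blast
    also have "EC c \<otimes> (et i j \<otimes> et a b) = (EC c \<otimes> et i j) \<otimes> et a b"
      using e et_closed[OF that(1,2)] by (simp add: m_assoc)
    finally show ?thesis using EC_absorb[of i j c] that by (simp add: T_def)
  qed
  have Rab: "T \<otimes> et a b = T" using e et_idem[OF ab] by (simp add: T_def m_assoc)
  have trans: "T \<otimes> et i k = T" if "T \<otimes> et i j = T" "T \<otimes> et j k = T" "i \<in> {1..n}" "j \<in> {1..n}" "k \<in> {1..n}" for i j k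
  proof -
    note c = et_closed[OF that(3,4)] et_closed[OF that(4,5)] et_closed[OF that(3,5)]
    have "T \<otimes> et i k = ((T \<otimes> et i j) \<otimes> et j k) \<otimes> et i k" using that by simp
    also have "\<dots> = T \<otimes> (et i j \<otimes> (et j k \<otimes> et i k))" using c T by (simp add: m_assoc)
    also have "\<dots> = (T \<otimes> et i j) \<otimes> et j k" unfolding et_trans[OF that(3-5)] using c T by (simp add: m_assoc)
    finally show ?thesis using that by simp
  qed
  \<comment> \<open>Strands with equal new label were already in one block, or one of them was in
    the block of \<open>b\<close> and the other in that of \<open>a\<close>; then they are joined
    through the tie of \<open>a\<close> and \<open>b\<close>.\<close>
  have 2: "T \<otimes> et i j = T" if ij: "i \<in> {1..n}" "j \<in> {1..n}" "c' i = c' j" for i j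
  proof -
    consider "c i = c j" | "c i = c b" "c j = c a" | "c i = c a" "c j = c b"
      using ij(3) by (auto simp: c'_def split: if_splits)
    then show ?thesis
    proof cases
      case 1
      then show ?thesis using R ij by blast
    next
      case 2
      have "T \<otimes> et b a = T" using Rab et_sym[of a b] by simp
      then have "T \<otimes> et i a = T" using trans[of i b a] R[of i b] 2 ij ab by blast
      then show ?thesis using trans[of i a j] R[of a j] 2 ij ab by simp
    next
      case 3
      have "T \<otimes> et i b = T" using trans[of i a b] R[of i a] 3 ij ab Rab by blast
      then show ?thesis using trans[of i b j] R[of b j] 3 ij ab by simp
    qed
  qed
  have "T \<otimes> TE (EL c') = T"
    by (rule absorb_TE[OF EL_range T], rule 2) (auto simp: set_EL)
  moreover have "T \<otimes> TE (EL c') = TE (EL c') \<otimes> T"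
  proof -
    define M where "M = (a, b) # EL c"
    have "T = TE M" using et_TE[OF ab EL_range[of c]] by (simp add: T_def EC_def M_def)
    moreover have "set M \<subseteq> {1..n} \<times> {1..n}" using EL_range[of c] ab by (simp add: M_def)
    ultimately show ?thesis using TE_TE[of M "EL c'"] EL_range[of c'] by simp
  qed
  ultimately show ?thesis using 1 by (simp add: EC_def T_def c'_def[abs_def])
qed

lemma cj_et:
  assumes "i \<in> {1..n}" "j \<in> {1..n}" "k \<in> {1..<n}"
  shows "cj k (et i j) = et (tr k i) (tr k j)"
  using cj_ee[of i j k] assms by (auto simp: et_def tr_inj cj_def)

lemma cj_TE:
  assumes "set L \<subseteq> {1..n} \<times> {1..n}" "k \<in> {1..<n}"
  shows "cj k (TE L) = TE (map (map_prod (tr k) (tr k)) L)"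
  using assms(1)
proof (induction L)
  case Nil
  then show ?case using assms(2) by (simp add: cj_def)
next
  case (Cons p L)
  have c: "fst p \<in> {1..n}" "snd p \<in> {1..n}" "set L \<subseteq> {1..n} \<times> {1..n}" using Cons.prems by auto
  have "cj k (TE (p # L)) = cj k (et (fst p) (snd p)) \<otimes> cj k (TE L)"
    using cj_mult[OF assms(2) et_closed[OF c(1,2)] TE_closed[OF c(3)]] by simp
  then show ?case using Cons c cj_et[OF c(1,2) assms(2)] by simp
qed

text \<open>Conjugation permutes the tied pairs, so the lists of pairs have the same members,
  possibly in another order; mutual absorption makes the products equal.\<close>

lemma cj_EC:
  assumes k: "k \<in> {1..<n}" shows "cj k (EC (\<lambda>x. c (tr k x))) = EC c"
proof -
  let ?L = "map (map_prod (tr k) (tr k)) (EL (\<lambda>x. c (tr k x)))"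
  have s: "set ?L = set (EL c)"
  proof (rule subset_antisym; rule subsetI)
    fix p assume "p \<in> set ?L"
    then obtain i j where p: "p = (tr k i, tr k j)" and "(i, j) \<in> set (EL (\<lambda>x. c (tr k x)))"
      unfolding set_map by auto
    then have "i \<in> {1..n}" "j \<in> {1..n}" "c (tr k i) = c (tr k j)" by (simp_all add: set_EL)
    then show "p \<in> set (EL c)" using tr_range[OF k, of i] tr_range[OF k, of j] by (simp add: set_EL p)
  next
    fix p assume "p \<in> set (EL c)"
    then obtain i j where p: "p = (i, j)" and ij: "i \<in> {1..n}" "j \<in> {1..n}" "c i = c j"
      by (auto simp: set_EL)
    have "(tr k i, tr k j) \<in> set (EL (\<lambda>x. c (tr k x)))"
      using tr_range[OF k ij(1)] tr_range[OF k ij(2)] ij(3) by (simp add: set_EL)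
    moreover have "p = map_prod (tr k) (tr k) (tr k i, tr k j)" by (simp add: p)
    ultimately show "p \<in> set ?L" unfolding set_map by (rule rev_image_eqI)
  qed
  have r: "set ?L \<subseteq> {1..n} \<times> {1..n}" unfolding s by (rule EL_range)
  have "cj k (EC (\<lambda>x. c (tr k x))) = TE ?L"
    unfolding EC_def by (rule cj_TE[OF EL_range k])
  also have "\<dots> = TE (EL c)"
    by (rule TE_eqI[OF r EL_range])
      (use TE_absorb[OF EL_range[of c]] TE_absorb[OF r] s in \<open>auto simp del: set_map\<close>)
  finally show ?thesis by (simp add: EC_def)
qed

lemma EC_s: "k \<in> {1..<n} \<Longrightarrow> EC c \<otimes> s k = s k \<otimes> EC (\<lambda>x. c (tr k x))"
  using cj_s[of k "EC (\<lambda>x. c (tr k x))"] cj_EC[of k c] by simp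

section \<open>Normal words in the braid generators and the spanning set\<close>

definition T :: "nat list \<Rightarrow> 'a" where "T w = word_ev A s w"

lemma T_closed [simp]: "set w \<subseteq> {1..<n} \<Longrightarrow> T w \<in> carrier A"
  unfolding T_def by (rule word_ev_closed[of "{1..<n}"]) simp_all

lemma T_append: "set v \<subseteq> {1..<n} \<Longrightarrow> set w \<subseteq> {1..<n} \<Longrightarrow> T (v @ w) = T v \<otimes> T w"
  unfolding T_def by (rule word_ev_append[of "{1..<n}"]) simp_all

lemma T_simps [simp]: "T [] = \<one>" "T (i # w) = s i \<otimes> T w"
  by (simp_all add: T_def)

lemma EC_T:
  assumes "set w \<subseteq> {1..<n}" shows "\<exists>c'. EC c \<otimes> T w = T w \<otimes> EC c'"
  using assms
proof (induction w arbitrary: c)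
  case Nil
  show ?case by (rule exI[of _ c]) simp
next
  case (Cons k w)
  then have k: "k \<in> {1..<n}" and w: "set w \<subseteq> {1..<n}" by simp_all
  obtain c' where c': "EC (\<lambda>x. c (tr k x)) \<otimes> T w = T w \<otimes> EC c'" using Cons.IH[OF w] by blast
  note cl = s_closed[OF k] T_closed[OF w]
  have "EC c \<otimes> T (k # w) = (EC c \<otimes> s k) \<otimes> T w" using cl by (simp add: m_assoc)
  also have "\<dots> = s k \<otimes> (EC (\<lambda>x. c (tr k x)) \<otimes> T w)" unfolding EC_s[OF k] using cl by (simp add: m_assoc)
  also have "\<dots> = T (k # w) \<otimes> EC c'" unfolding c' using cl by (simp add: m_assoc)
  finally show ?case by blast
qed

lemma T_far:
  assumes "set w \<subseteq> {1..<n}" "i \<in> {1..<n}" "\<And>k. k \<in> set w \<Longrightarrow> Suc i < k \<or> Suc k < i"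
  shows "T w \<otimes> s i = s i \<otimes> T w"
  using assms(1,3)
proof (induction w)
  case (Cons k w)
  then have k: "k \<in> {1..<n}" and w: "set w \<subseteq> {1..<n}" by simp_all
  note cl = s_closed[OF k] s_closed[OF assms(2)] T_closed[OF w]
  have f: "s k \<otimes> s i = s i \<otimes> s k" using Cons.prems(2)[of k] by (intro far_s[OF k assms(2)]) auto
  have "T (k # w) \<otimes> s i = s k \<otimes> (T w \<otimes> s i)" using cl by (simp add: m_assoc)
  also have "T w \<otimes> s i = s i \<otimes> T w" using Cons by simp
  also have "s k \<otimes> (s i \<otimes> T w) = (s k \<otimes> s i) \<otimes> T w" using cl by (simp add: m_assoc)
  also have "\<dots> = s i \<otimes> T (k # w)" unfolding f using cl by (simp add: m_assoc)
  finally show ?case .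
qed (use assms(2) in simp)

end

text \<open>Normal forms of the permutations of \<open>Suc m\<close> strands: one for
  \<open>m\<close> strands followed by the coset representative \<open>rev [j..<Suc m]\<close>,
  which is empty for \<open>j = Suc m\<close>.\<close>

primrec NW :: "nat \<Rightarrow> nat list set" where
  "NW 0 = {[]}"
| "NW (Suc m) = {u @ rev [j..<Suc m] | u j. u \<in> NW m \<and> 1 \<le> j \<and> j \<le> Suc m}"

lemma NW_SucI: "u \<in> NW m \<Longrightarrow> 1 \<le> j \<Longrightarrow> j \<le> Suc m \<Longrightarrow> u @ rev [j..<Suc m] \<in> NW (Suc m)"
  by auto

lemma NW_set: "u \<in> NW m \<Longrightarrow> set u \<subseteq> {1..<m}"
proof (induction m arbitrary: u)
  case (Suc m)
  then obtain v j where v: "u = v @ rev [j..<Suc m]" "v \<in> NW m" "1 \<le> j" by auto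
  then show ?case using Suc.IH[OF v(2)] by (auto simp del: upt_Suc)
qed simp

lemma finite_NW: "finite (NW m)"
proof (induction m)
  case (Suc m)
  have "NW (Suc m) = (\<lambda>(u, j). u @ rev [j..<Suc m]) ` (NW m \<times> {1..Suc m})"
    by (auto simp: image_iff simp del: upt_Suc) blast+
  then show ?case using Suc by simp
qed simp

declare NW.simps(2) [simp del]

context ties
begin

text \<open>Only the braid words are limited to \<open>m\<close> strands; \<open>EC c\<close> may
  tie any of the \<open>n\<close> strands. Ties produced by the quadratic relation therefore never
  leave the span.\<close>

inductive_set sp :: "nat \<Rightarrow> 'a set" for m where
  zero: "\<zero> \<in> sp m"
| add: "x \<in> sp m \<Longrightarrow> u \<in> NW m \<Longrightarrow> x \<oplus> a \<odot> (T u \<otimes> EC c) \<in> sp m"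

lemma NW_T: "u \<in> NW m \<Longrightarrow> m \<le> n \<Longrightarrow> T u \<in> carrier A"
  using NW_set[of u m] by (intro T_closed) auto

lemma sp_closed: "x \<in> sp m \<Longrightarrow> m \<le> n \<Longrightarrow> x \<in> carrier A"
  by (induction rule: sp.induct) (auto simp: NW_T)

lemma sp_add:
  assumes "y \<in> sp m" "x \<in> sp m" "m \<le> n" shows "x \<oplus> y \<in> sp m"
  using assms(1)
proof induction
  case zero
  show ?case using assms sp_closed by simp
next
  case (add y u a c)
  have "x \<oplus> (y \<oplus> a \<odot> (T u \<otimes> EC c)) = (x \<oplus> y) \<oplus> a \<odot> (T u \<otimes> EC c)"
    using assms add sp_closed NW_T by (intro a_assoc[symmetric]) auto
  then show ?case using add by (simp add: sp.add)
qed

lemma sp_smult: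
  assumes "x \<in> sp m" "m \<le> n" shows "k \<odot> x \<in> sp m"
  using assms(1)
proof induction
  case zero
  show ?case by (simp add: sp.zero)
next
  case (add y u a c)
  have "k \<odot> (y \<oplus> a \<odot> (T u \<otimes> EC c)) = k \<odot> y \<oplus> (k * a) \<odot> (T u \<otimes> EC c)"
    using assms add sp_closed NW_T by (simp add: smult_r_distr smult_assoc)
  then show ?case using add by (simp add: sp.add)
qed

lemma sp_base: assumes "u \<in> NW m" "m \<le> n" shows "T u \<otimes> EC c \<in> sp m"
  using sp.add[OF sp.zero assms(1), of 1 c] NW_T[OF assms] by simp

lemma sp_base': assumes "u \<in> NW m" "m \<le> n" shows "T u \<in> sp m"
  using sp_base[OF assms, of id] NW_T[OF assms] by (simp add: EC_id)

lemma sp_mult: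
  assumes "x \<in> sp m" "y \<in> carrier A" "m \<le> n" "m' \<le> n"
    and "\<And>u c. u \<in> NW m \<Longrightarrow> (T u \<otimes> EC c) \<otimes> y \<in> sp m'"
  shows "x \<otimes> y \<in> sp m'"
  using assms(1)
proof induction
  case zero
  show ?case using assms(2) by (simp add: sp.zero)
next
  case (add x u a c)
  have "(x \<oplus> a \<odot> (T u \<otimes> EC c)) \<otimes> y = x \<otimes> y \<oplus> a \<odot> ((T u \<otimes> EC c) \<otimes> y)"
    using assms(2,3) add sp_closed NW_T by (simp add: l_distr smult_mult_l)
  then show ?case using add assms(4,5) by (simp add: sp_add sp_smult)
qed

lemma sp_et:
  assumes "x \<in> sp m" "m \<le> n" "i \<in> {1..n}" "j \<in> {1..n}" shows "x \<otimes> et i j \<in> sp m"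
proof (rule sp_mult[OF assms(1) et_closed[OF assms(3,4)] assms(2,2)])
  fix u c assume u: "u \<in> NW m"
  have "(T u \<otimes> EC c) \<otimes> et i j = T u \<otimes> (EC c \<otimes> et i j)"
    using NW_T[OF u assms(2)] et_closed[OF assms(3,4)] by (simp add: m_assoc)
  then show "(T u \<otimes> EC c) \<otimes> et i j \<in> sp m" unfolding EC_et[OF assms(3,4)] using sp_base[OF u assms(2)] by simp
qed

lemma sp_EC:
  assumes "x \<in> sp m" "m \<le> n" shows "x \<otimes> EC c \<in> sp m"
proof -
  have "x \<otimes> TE L \<in> sp m" if "set L \<subseteq> {1..n} \<times> {1..n}" "x \<in> sp m" for L x
    using that
  proof (induction L arbitrary: x)
    case Nil
    then show ?case using sp_closed[OF Nil(2) assms(2)] by simp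
  next
    case (Cons p L)
    have c: "fst p \<in> {1..n}" "snd p \<in> {1..n}" "set L \<subseteq> {1..n} \<times> {1..n}" using Cons.prems by auto
    have "x \<otimes> TE (p # L) = (x \<otimes> et (fst p) (snd p)) \<otimes> TE L"
      using sp_closed[OF Cons.prems(2) assms(2)] et_closed[OF c(1,2)] TE_closed[OF c(3)] by (simp add: m_assoc)
    then show ?case using Cons.IH[OF c(3) sp_et[OF Cons.prems(2) assms(2) c(1,2)]] by simp
  qed
  from this[OF EL_range assms(1)] show ?thesis by (simp add: EC_def)
qed

lemma sp_block:
  assumes x: "x \<in> sp m" and m: "Suc m \<le> n" and j: "1 \<le> j" "j \<le> Suc m"
  shows "x \<otimes> T (rev [j..<Suc m]) \<in> sp (Suc m)"
proof -
  let ?b = "rev [j..<Suc m]"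
  have b: "set ?b \<subseteq> {1..<n}" using m j by (auto simp del: upt_Suc)
  show ?thesis
  proof (rule sp_mult[OF x T_closed[OF b] _ m])
    fix u c assume u: "u \<in> NW m"
    have u': "set u \<subseteq> {1..<n}" using NW_set[OF u] m by auto
    obtain c' where c': "EC c \<otimes> T ?b = T ?b \<otimes> EC c'" using EC_T[OF b] by blast
    have "(T u \<otimes> EC c) \<otimes> T ?b = T u \<otimes> (EC c \<otimes> T ?b)"
      using T_closed[OF u'] T_closed[OF b] by (simp add: m_assoc)
    also have "\<dots> = T (u @ ?b) \<otimes> EC c'"
      unfolding c' T_append[OF u' b] using T_closed[OF u'] T_closed[OF b] by (simp add: m_assoc)
    finally show "(T u \<otimes> EC c) \<otimes> T ?b \<in> sp (Suc m)"
      using sp_base[OF NW_SucI[OF u j] m] by simp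
  qed (use m in simp)
qed

text \<open>A generator with index inside the descending block commutes past its lower end, is
  lowered by one braid relation, and commutes past its upper end.\<close>

lemma block_s:
  assumes m: "Suc m \<le> n" and j: "1 \<le> j" "j \<le> p" and p: "Suc p \<le> m"
  shows "T (rev [j..<Suc m]) \<otimes> s (Suc p) = s p \<otimes> T (rev [j..<Suc m])"
proof -
  let ?hi = "rev [Suc (Suc p)..<Suc m]" and ?lo = "rev [j..<p]"
  have "[j..<Suc m] = [j..<p] @ [p, Suc p] @ [Suc (Suc p)..<Suc m]"
    using j p upt_add_eq_append[of j p "Suc m - p"] upt_conv_Cons[of p "Suc m"] upt_conv_Cons[of "Suc p" "Suc m"]
    by (simp del: upt_Suc)
  then have d: "rev [j..<Suc m] = ?hi @ ([Suc p, p] @ ?lo)" by simp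
  have r: "set ?hi \<subseteq> {1..<n}" "set ?lo \<subseteq> {1..<n}" "p \<in> {1..<n}" "Suc p \<in> {1..<n}"
    using m j p by (auto simp del: upt_Suc)
  note cl = T_closed[OF r(1)] T_closed[OF r(2)] s_closed[OF r(3)] s_closed[OF r(4)]
  have e: "T (rev [j..<Suc m]) = T ?hi \<otimes> (s (Suc p) \<otimes> (s p \<otimes> T ?lo))"
    unfolding d using r by (subst T_append) (auto simp del: upt_Suc)
  have lo: "T ?lo \<otimes> s (Suc p) = s (Suc p) \<otimes> T ?lo" by (rule T_far) (use r in \<open>auto simp del: upt_Suc\<close>)
  have hi: "T ?hi \<otimes> s p = s p \<otimes> T ?hi" by (rule T_far) (use r in \<open>auto simp del: upt_Suc\<close>)
  have br: "s (Suc p) \<otimes> (s p \<otimes> s (Suc p)) = s p \<otimes> (s (Suc p) \<otimes> s p)"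
    by (rule s_braid) (use r in auto)
  have "T (rev [j..<Suc m]) \<otimes> s (Suc p) = T ?hi \<otimes> (s (Suc p) \<otimes> (s p \<otimes> (T ?lo \<otimes> s (Suc p))))"
    unfolding e using cl by (simp add: m_assoc)
  also have "\<dots> = T ?hi \<otimes> ((s (Suc p) \<otimes> (s p \<otimes> s (Suc p))) \<otimes> T ?lo)"
    unfolding lo using cl by (simp add: m_assoc)
  also have "\<dots> = (T ?hi \<otimes> s p) \<otimes> (s (Suc p) \<otimes> (s p \<otimes> T ?lo))"
    unfolding br using cl by (simp add: m_assoc)
  also have "\<dots> = s p \<otimes> T (rev [j..<Suc m])" unfolding hi e using cl by (simp add: m_assoc)
  finally show ?thesis .
qed

text \<open>Multiplication by a generator either changes the coset representative or passes through
  it to the shorter normal word, where the induction hypothesis applies.\<close>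

lemma sp_s:
  assumes "m \<le> n" "i \<in> {1..<m}" "x \<in> sp m" shows "x \<otimes> s i \<in> sp m"
  using assms
proof (induction m arbitrary: i x)
  case (Suc m)
  have m: "m \<le> n" "Suc m \<le> n" using Suc.prems by auto
  have i: "i \<in> {1..<n}" "1 \<le> i" "i \<le> m" using Suc.prems by auto
  note si = s_closed[OF i(1)]
  show ?case
  proof (rule sp_mult[OF Suc.prems(3) si m(2,2)])
    fix v c assume v: "v \<in> NW (Suc m)"
    then obtain u j where u: "v = u @ rev [j..<Suc m]" "u \<in> NW m" "1 \<le> j" "j \<le> Suc m"
      by (auto simp: NW.simps(2))
    have r: "set u \<subseteq> {1..<n}" "set (rev [j..<Suc m]) \<subseteq> {1..<n}"
      using NW_set[OF u(2)] m u(3) by (auto simp del: upt_Suc)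
    note cl = T_closed[OF r(1)] T_closed[OF r(2)] NW_T[OF v m(2)] si
    have Tv: "T v = T u \<otimes> T (rev [j..<Suc m])" unfolding u(1) by (rule T_append[OF r])
    have "T v \<otimes> s i \<in> sp (Suc m)"
    proof -
      \<comment> \<open>The generator commutes with the block, lengthens it, meets its own last
        letter, or is lowered by \<open>block_s\<close>.\<close>
      consider "Suc i < j" | "Suc i = j" | "i = j" | "j < i" by linarith
      then show ?thesis
      proof cases
        case 1
        have f: "T (rev [j..<Suc m]) \<otimes> s i = s i \<otimes> T (rev [j..<Suc m])"
          by (rule T_far[OF r(2) i(1)]) (use 1 in \<open>auto simp del: upt_Suc\<close>)
        have "T v \<otimes> s i = (T u \<otimes> s i) \<otimes> T (rev [j..<Suc m])"
          unfolding Tv using cl by (simp add: m_assoc f del: upt_Suc)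
        moreover have "T u \<otimes> s i \<in> sp m"
          by (rule Suc.IH[OF m(1) _ sp_base'[OF u(2) m(1)]]) (use 1 u i in auto)
        ultimately show ?thesis using sp_block[OF _ m(2) u(3,4)] by simp
      next
        case 2
        have "rev [i..<Suc m] = rev [j..<Suc m] @ [i]"
          using 2 i upt_conv_Cons[of i "Suc m"] by (simp del: upt_Suc)
        then have "T (u @ rev [i..<Suc m]) = T v \<otimes> s i"
          unfolding u(1) using r i(1) T_append[of "u @ rev [j..<Suc m]" "[i]"] si by (simp del: upt_Suc)
        moreover have "u @ rev [i..<Suc m] \<in> NW (Suc m)" using NW_SucI[OF u(2), of i] i by simp
        ultimately show ?thesis using sp_base'[OF _ m(2)] by metis
      next
        case 3
        let ?v = "u @ rev [Suc i..<Suc m]"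
        have v0: "?v \<in> NW (Suc m)" using i by (intro NW_SucI[OF u(2)]) auto
        have r0: "set ?v \<subseteq> {1..<n}" using NW_set[OF v0] m by auto
        have "rev [i..<Suc m] = rev [Suc i..<Suc m] @ [i]"
          using i upt_conv_Cons[of i "Suc m"] by (simp del: upt_Suc)
        then have Tv0: "T v = T ?v \<otimes> s i"
          unfolding u(1) using 3 r0 i(1) T_append[of ?v "[i]"] si by (simp del: upt_Suc)
        have cl0: "T ?v \<in> carrier A" "E i \<in> carrier A" using T_closed[OF r0] E_closed[OF i(1)] by simp_all
        \<comment> \<open>The quadratic relation gives a shorter normal word plus \<open>T v\<close>
          times a tie, and both lie in the span.\<close>
        have "T v \<otimes> s i = T ?v \<otimes> (s i \<otimes> s i)" unfolding Tv0 using cl0 si by (simp add: m_assoc del: upt_Suc)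
        also have "\<dots> = \<kappa> \<odot> ((T ?v \<otimes> s i) \<otimes> E i) \<oplus> T ?v"
          unfolding s_quad[OF i(1)] using cl0 si by (simp add: r_distr smult_mult_r m_assoc del: upt_Suc)
        also have "(T ?v \<otimes> s i) \<otimes> E i = T v \<otimes> et i (Suc i)"
          unfolding Tv0 by (simp add: et_def ee_adj del: upt_Suc)
        finally have eq: "T v \<otimes> s i = \<kappa> \<odot> (T v \<otimes> et i (Suc i)) \<oplus> T ?v" .
        have "T v \<otimes> et i (Suc i) \<in> sp (Suc m)"
          by (rule sp_et[OF sp_base'[OF v m(2)] m(2)]) (use i m in auto)
        then show ?thesis unfolding eq using sp_base'[OF v0 m(2)] m(2) by (intro sp_add sp_smult)
      next
        case 4
        define p where "p = i - 1"
        have p: "i = Suc p" "j \<le> p" "1 \<le> p" using 4 u(3) by (auto simp: p_def)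
        have sp: "s p \<in> carrier A" using p i by (intro s_closed) auto
        have "T v \<otimes> s i = (T u \<otimes> s p) \<otimes> T (rev [j..<Suc m])"
          unfolding Tv using cl sp block_s[OF m(2) u(3) p(2)] p i by (simp add: m_assoc del: upt_Suc)
        moreover have "T u \<otimes> s p \<in> sp m"
          by (rule Suc.IH[OF m(1) _ sp_base'[OF u(2) m(1)]]) (use p i in auto)
        ultimately show ?thesis using sp_block[OF _ m(2) u(3,4)] by simp
      qed
    qed
    moreover have "(T v \<otimes> EC c) \<otimes> s i = (T v \<otimes> s i) \<otimes> EC (\<lambda>x. c (tr i x))"
      using cl EC_s[OF i(1), of c] by (simp add: m_assoc)
    ultimately show "(T v \<otimes> EC c) \<otimes> s i \<in> sp (Suc m)" using sp_EC[OF _ m(2)] by simp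
  qed
qed simp

lemma s'_eq: assumes i: "i \<in> {1..<n}" shows "s' i = s i \<oplus> (- \<kappa>) \<odot> E i"
proof -
  have "s i = s' i \<otimes> (s i \<otimes> s i)" using i by (simp flip: m_assoc)
  also have "\<dots> = \<kappa> \<odot> E i \<oplus> s' i"
    unfolding s_quad[OF i] using i by (simp add: r_distr smult_mult_r)
  finally have "s i \<oplus> (- \<kappa>) \<odot> E i = (\<kappa> \<odot> E i \<oplus> s' i) \<oplus> (- \<kappa>) \<odot> E i" by simp
  also have "\<dots> = s' i \<oplus> (\<kappa> \<odot> E i \<oplus> (- \<kappa>) \<odot> E i)"
    using i by (simp add: a_ac)
  also have "\<kappa> \<odot> E i \<oplus> (- \<kappa>) \<odot> E i = \<zero>"
    using smult_l_distr[of "E i" \<kappa> "- \<kappa>"] i by simp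
  finally show ?thesis using i by simp
qed

definition gen :: "btgen \<Rightarrow> 'a" where
  "gen g = (case g of BS i \<Rightarrow> s i | BS' i \<Rightarrow> s' i | BE i \<Rightarrow> E i)"

lemma gen_closed: "g \<in> btgens n \<Longrightarrow> gen g \<in> carrier A"
  by (auto simp: gen_def btgens_def)

lemma sp_gen:
  assumes "x \<in> sp n" "g \<in> btgens n" shows "x \<otimes> gen g \<in> sp n"
proof -
  note x = sp_closed[OF assms(1) order_refl]
  have e: "x \<otimes> E i \<in> sp n" if "i \<in> {1..<n}" for i
    using sp_et[OF assms(1) order_refl, of i "Suc i"] that by (simp add: et_def ee_adj)
  have s: "x \<otimes> s i \<in> sp n" if "i \<in> {1..<n}" for i
    using sp_s[OF order_refl that assms(1)] .
  have "x \<otimes> s' i \<in> sp n" if i: "i \<in> {1..<n}" for i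
  proof -
    have "x \<otimes> s' i = x \<otimes> s i \<oplus> (- \<kappa>) \<odot> (x \<otimes> E i)"
      using i x by (simp add: s'_eq r_distr smult_mult_r)
    then show ?thesis using sp_add[OF sp_smult[OF e[OF i]] s[OF i]] by simp
  qed
  then show ?thesis using assms(2) e s by (auto simp: gen_def btgens_def)
qed

lemma Nil_NW: "[] \<in> NW m"
proof (induction m)
  case (Suc m)
  then show ?case using NW_SucI[of "[]" m "Suc m"] by simp
qed simp

lemma sp_word: "set w \<subseteq> btgens n \<Longrightarrow> word_ev A gen w \<in> sp n"
proof (induction w rule: rev_induct)
  case Nil
  show ?case using sp_base'[OF Nil_NW order_refl] by simp
next
  case (snoc g w)
  then have "word_ev A gen (w @ [g]) = word_ev A gen w \<otimes> gen g"
    using word_ev_append[of "btgens n" gen w "[g]"] gen_closed by simp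
  then show ?case using snoc sp_gen by simp
qed

lemma sp_free_ev:
  assumes "x \<in> carrier (free_alg (btgens n))" shows "free_ev A gen x \<in> sp n"
  using assms
proof (induction rule: free_alg_induct)
  case zero
  show ?case using free_ev_zero[of "btgens n" gen] gen_closed sp.zero by simp
next
  case (add x c w)
  have "free_ev A gen (\<lambda>u. x u + c * bv w u) = free_ev A gen x \<oplus> c \<odot> word_ev A gen w"
    using add kalg.smult_closed[OF free_alg_kalg bv_free_alg[OF add(2)], of c]
      free_ev_add[of "btgens n" gen x "\<lambda>u. c * bv w u"]
      free_ev_smult[OF gen_closed bv_free_alg[OF add(2)]] free_ev_bv[OF gen_closed add(2)] gen_closed by simp
  then show ?case using add sp_word[OF add(2)] by (simp add: sp_add sp_smult)
qed

text \<open>Labelling every strand by the least strand in its block makes the labels unique.\<close>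

definition CC :: "(nat \<Rightarrow> nat) set" where
  "CC = {c. (\<forall>x\<in>{1..n}. c x \<in> {1..n} \<and> c (c x) = c x \<and> (\<forall>y\<in>{1..n}. c y = c x \<longrightarrow> c x \<le> y)) \<and>
            (\<forall>x. x \<notin> {1..n} \<longrightarrow> c x = 0)}"

lemma finite_CC: "finite CC"
  by (rule finite_subset[OF _ finite_set_of_finite_funs[of "{1..n}" "{1..n}" 0]]) (auto simp: CC_def)

lemma CC_inj:
  assumes "c \<in> CC" "c' \<in> CC" "\<And>i j. i \<in> {1..n} \<Longrightarrow> j \<in> {1..n} \<Longrightarrow> c i = c j \<longleftrightarrow> c' i = c' j"
  shows "c = c'"
proof
  fix x
  have le: "c x \<le> c' x" if "c \<in> CC" "c' \<in> CC" "x \<in> {1..n}"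
    "\<And>i j. i \<in> {1..n} \<Longrightarrow> j \<in> {1..n} \<Longrightarrow> c i = c j \<longleftrightarrow> c' i = c' j" for c c'
  proof -
    have "c' x \<in> {1..n}" "c' (c' x) = c' x" using that by (auto simp: CC_def)
    then have "c (c' x) = c x" using that(3,4) by blast
    then show ?thesis using that(1,3) \<open>c' x \<in> {1..n}\<close> unfolding CC_def by blast
  qed
  show "c x = c' x"
  proof (cases "x \<in> {1..n}")
    case True
    then show ?thesis using le[of c c'] le[of c' c] assms by (metis order_antisym)
  next
    case False
    then show ?thesis using assms(1,2) by (auto simp: CC_def)
  qed
qed

lemma EC_CC: "\<exists>c'\<in>CC. EC c = EC c'"
proof -
  define l where "l x = (if x \<in> {1..n} then LEAST y. y \<in> {1..n} \<and> c y = c x else 0)" for x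
  have l: "l x \<in> {1..n}" "c (l x) = c x" if "x \<in> {1..n}" for x
    using LeastI[of "\<lambda>y. y \<in> {1..n} \<and> c y = c x" x] that by (auto simp: l_def)
  have le: "l x \<le> y" if "x \<in> {1..n}" "y \<in> {1..n}" "c y = c x" for x y
    using Least_le[of "\<lambda>y. y \<in> {1..n} \<and> c y = c x" y] that by (simp add: l_def)
  have eq: "l x = l y \<longleftrightarrow> c x = c y" if "x \<in> {1..n}" "y \<in> {1..n}" for x y
  proof
    assume "l x = l y"
    then show "c x = c y" using l(2)[OF that(1)] l(2)[OF that(2)] by metis
  next
    assume "c x = c y"
    then show "l x = l y" using that by (simp add: l_def)
  qed
  have "l \<in> CC"
    unfolding CC_def
  proof (intro CollectI conjI ballI allI impI)
    fix x assume x: "x \<in> {1..n}"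
    show "l x \<in> {1..n}" using l x by blast
    show "l (l x) = l x" using eq[OF l(1)[OF x] x] l(2)[OF x] by blast
    show "l x \<le> y" if "y \<in> {1..n}" "l y = l x" for y
      by (rule le[OF x that(1)]) (use eq[OF that(1) x] that(2) in blast)
  qed (simp only: l_def if_False)
  moreover have "EC c = EC l" by (rule EC_cong) (use eq in blast)
  ultimately show ?thesis by blast
qed

text \<open>A fixed finite index set for the coefficients prepares the comparison of coefficients in
  the proof of injectivity.\<close>

theorem normal_form:
  assumes "x \<in> sp n"
  shows "\<exists>a. x = (\<Oplus>p\<in>NW n \<times> CC. a p \<odot> (T (fst p) \<otimes> EC (snd p)))"
  using assms
proof induction
  case zero
  have "(\<Oplus>p\<in>NW n \<times> CC. 0 \<odot> (T (fst p) \<otimes> EC (snd p))) = (\<Oplus>p\<in>NW n \<times> CC. \<zero>)"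
    by (rule finsum_cong') (auto simp: NW_T)
  then have "\<zero> = (\<Oplus>p\<in>NW n \<times> CC. 0 \<odot> (T (fst p) \<otimes> EC (snd p)))" by simp
  then show ?case by (intro exI[of _ "\<lambda>_. 0"])
next
  case (add x u k c)
  from add.IH obtain a where a: "x = (\<Oplus>p\<in>NW n \<times> CC. a p \<odot> (T (fst p) \<otimes> EC (snd p)))" by (rule exE)
  obtain c' where c': "c' \<in> CC" "EC c = EC c'" using EC_CC[of c] by (elim bexE)
  let ?P = "NW n \<times> CC" and ?t = "\<lambda>p. T (fst p) \<otimes> EC (snd p)"
  have P: "finite ?P" using finite_NW finite_CC by simp
  have t: "?t p \<in> carrier A" if "p \<in> ?P" for p using that by (auto simp: NW_T)
  have uc: "(u, c') \<in> ?P" using add c' by simp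
  have "(\<Oplus>p\<in>?P. (if p = (u, c') then k else 0) \<odot> ?t p) =
      (\<Oplus>p\<in>?P. if (u, c') = p then k \<odot> ?t p else \<zero>)"
    by (rule finsum_cong') (use t in auto)
  also have "\<dots> = k \<odot> ?t (u, c')"
    by (rule finsum_singleton[OF uc P, of "\<lambda>p. k \<odot> ?t p"]) (use t in auto)
  finally have 1: "k \<odot> (T u \<otimes> EC c) = (\<Oplus>p\<in>?P. (if p = (u, c') then k else 0) \<odot> ?t p)" using c' by simp
  have "x \<oplus> k \<odot> (T u \<otimes> EC c) = (\<Oplus>p\<in>?P. a p \<odot> ?t p \<oplus> (if p = (u, c') then k else 0) \<odot> ?t p)"
    unfolding 1 a by (rule finsum_addf[symmetric]) (use t in auto)
  also have "\<dots> = (\<Oplus>p\<in>?P. (a p + (if p = (u, c') then k else 0)) \<odot> ?t p)"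
    by (rule finsum_cong') (use t in \<open>auto simp: smult_l_distr\<close>)
  finally show ?case by (intro exI[of _ "\<lambda>p. a p + (if p = (u, c') then k else 0)"])
qed

end


section \<open>Surjectivity\<close>

text \<open>A transposition is reached from adjacent ones by conjugation, and every permutation is a
  product of transpositions.\<close>

lemma permutes_adjacent_induct:
  assumes p: "\<pi> permutes {..<n :: nat}" and id: "P id"
    and adj: "\<And>k. Suc k < n \<Longrightarrow> P (transpose k (Suc k))"
    and comp: "\<And>\<sigma> \<tau>. \<sigma> permutes {..<n} \<Longrightarrow> \<tau> permutes {..<n} \<Longrightarrow> P \<sigma> \<Longrightarrow> P \<tau> \<Longrightarrow> P (\<sigma> \<circ> \<tau>)"
  shows "P \<pi>"
proof -
  have tp: "transpose a b permutes {..<n}" if "a < n" "b < n" for a b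
    using permutes_swap_id[of a "{..<n}" b] that by simp
  have lt: "P (transpose a b)" if "a < b" "b < n" for a b
    using that
  proof (induction b)
    case (Suc b)
    show ?case
    proof (cases "a = b")
      case True
      then show ?thesis using adj Suc.prems by simp
    next
      case False
      then have ab: "a < b" using Suc.prems by simp
      have eq: "transpose a (Suc b) = transpose b (Suc b) \<circ> (transpose a b \<circ> transpose b (Suc b))"
        using ab by (auto simp: fun_eq_iff transpose_def)
      show ?thesis unfolding eq
        by (intro comp adj Suc.IH permutes_compose tp) (use ab Suc.prems in auto)
    qed
  qed simp
  have tr: "P (transpose a b)" if "a < n" "b < n" "a \<noteq> b" for a b
    using lt[of a b] lt[of b a] that by (cases "a < b") (auto simp: transpose_commute)
  show ?thesis
    using p finite_lessThan[of n]
  proof (induction rule: permutes_induct)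
    case id
    show ?case by (rule assms(2))
  next
    case (swap a b p)
    then show ?case by (intro comp tr tp) auto
  qed
qed

lemma swp_permute: "Suc k < length u \<Longrightarrow> swp k u = permute_list (transpose k (Suc k)) u"
  by (rule nth_equalityI) (auto simp: swp_nth permute_list_def transpose_def)

text \<open>The matrices over \<open>\<complex>\<close> that are specialisations of operators in the image.\<close>

definition Abar :: "nat \<Rightarrow> nat \<Rightarrow> nat \<Rightarrow> ((nat \<times> nat) list \<times> (nat \<times> nat) list \<Rightarrow> complex) \<Rightarrow> bool" where
  "Abar d N n t \<longleftrightarrow> (\<exists>F. AlgR n F \<and> (\<forall>u\<in>tidx d N n. \<forall>v\<in>tidx d N n. spec (F (bv v) u) (t (u, v))))"

lemma Abar_cong:
  assumes "Abar d N n t" "\<And>u v. u \<in> tidx d N n \<Longrightarrow> v \<in> tidx d N n \<Longrightarrow> t (u, v) = t' (u, v)"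
  shows "Abar d N n t'"
  using assms unfolding Abar_def by metis

lemma Abar_add:
  assumes "Abar d N n t" "Abar d N n t'" shows "Abar d N n (\<lambda>p. t p + t' p)"
proof -
  obtain F G where F: "AlgR n F" "\<And>u v. u \<in> tidx d N n \<Longrightarrow> v \<in> tidx d N n \<Longrightarrow> spec (F (bv v) u) (t (u, v))"
    and G: "AlgR n G" "\<And>u v. u \<in> tidx d N n \<Longrightarrow> v \<in> tidx d N n \<Longrightarrow> spec (G (bv v) u) (t' (u, v))"
    using assms unfolding Abar_def by blast
  show ?thesis unfolding Abar_def
    by (rule exI[of _ "\<lambda>x u. F x u + G x u"]) (use F G AlgR_add spec.sp_add in auto)
qed

lemma Abar_scale:
  assumes "Abar d N n t" shows "Abar d N n (\<lambda>p. c * t p)"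
proof -
  obtain F where F: "AlgR n F" "\<And>u v. u \<in> tidx d N n \<Longrightarrow> v \<in> tidx d N n \<Longrightarrow> spec (F (bv v) u) (t (u, v))"
    using assms unfolding Abar_def by blast
  obtain x where x: "spec x c" using spec_const by blast
  show ?thesis unfolding Abar_def
    by (rule exI[of _ "\<lambda>y u. x * F y u"]) (use F x AlgR_scale spec.sp_mult in auto)
qed

lemma Abar_zero: "Abar d N n (\<lambda>p. 0)"
  unfolding Abar_def by (rule exI[of _ "\<lambda>x u. 0"]) (simp add: AlgR_zero spec.sp_zero)

lemma Abar_mult:
  assumes "Abar d N n t" "Abar d N n t'"
  shows "Abar d N n (\<lambda>(u, v). \<Sum>w\<in>tidx d N n. t (u, w) * t' (w, v))"
proof -
  let ?I = "tidx d N n"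
  obtain F G where F: "AlgR n F" "\<And>u v. u \<in> ?I \<Longrightarrow> v \<in> ?I \<Longrightarrow> spec (F (bv v) u) (t (u, v))"
    and G: "AlgR n G" "\<And>u v. u \<in> ?I \<Longrightarrow> v \<in> ?I \<Longrightarrow> spec (G (bv v) u) (t' (u, v))"
    using assms unfolding Abar_def by blast
  have "spec (F (G (bv v)) u) (\<Sum>w\<in>?I. t (u, w) * t' (w, v))" if uv: "u \<in> ?I" "v \<in> ?I" for u v
  proof -
    have g: "G (bv v) \<in> vec ?I" using AlgR_vec[OF G(1)] uv by simp
    have "F (G (bv v)) u = (\<Sum>w\<in>?I. G (bv v) w * F (bv w) u)"
      using fun_cong[OF endo_expand[OF AlgR_closed[OF F(1)] finite_tidx g], of u] g by simp
    also have "\<dots> = (\<Sum>w\<in>?I. F (bv w) u * G (bv v) w)" by (simp add: mult.commute)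
    finally have eq: "F (G (bv v)) u = (\<Sum>w\<in>?I. F (bv w) u * G (bv v) w)" .
    show ?thesis unfolding eq by (intro spec.sp_sum spec.sp_mult F(2) G(2)) (use uv in auto)
  qed
  then show ?thesis unfolding Abar_def
    by (intro exI[of _ "\<lambda>x. F (G x)"]) (use AlgR_comp[OF F(1) G(1)] in auto)
qed

text \<open>At \<open>q = 1\<close> the braid generators become the adjacent place permutations,
  which generate all the others.\<close>

lemma Abar_permute:
  assumes "w permutes {..<n}"
  shows "Abar d N n (\<lambda>(u, v). of_bool (v = permute_list w u))"
  using assms
proof (rule permutes_adjacent_induct)
  let ?I = "tidx d N n"
  show "Abar d N n (\<lambda>(u, v). of_bool (v = permute_list id u))"
    unfolding Abar_def
    by (rule exI[of _ "\<lambda>x. x"]) (auto simp: AlgR_id bv_def spec.sp_one spec.sp_zero)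
  show "Abar d N n (\<lambda>(u, v). of_bool (v = permute_list (transpose k (Suc k)) u))" if k: "Suc k < n" for k
    unfolding Abar_def
  proof (intro exI[of _ "Sg q k"] conjI ballI)
    show "AlgR n (Sg q k)" by (rule AlgR_Sg[OF k])
    fix u v assume uv: "u \<in> ?I" "v \<in> ?I"
    then have l: "Suc k < length u" using k by (simp add: tidx_def)
    \<comment> \<open>The correction term of the R-matrix carries the factor q - q^-1, whose residue
      is 0.\<close>
    have z: "spec (if b then (q - inverse q) * bv v u else 0) 0" for b
    proof -
      have "spec (q - inverse q) 0"
        using spec.sp_add[OF spec_q spec.sp_uminus[OF spec.sp_inverse[OF spec_q]]] by simp
      from spec.sp_mult[OF this spec_bv[of v u]] show ?thesis by (simp add: spec.sp_zero)
    qed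
    have "spec (Sg q k (bv v) u) (bv v (swp k u))"
    proof (cases "u ! k = u ! Suc k")
      case True
      then show ?thesis
        using spec.sp_mult[OF spec_q spec_bv[of v u]] l by (simp add: Sg_nth swp_same)
    next
      case False
      then show ?thesis
        using spec.sp_add[OF spec_bv[of v "swp k u"] z] l by (simp add: Sg_nth)
    qed
    also have "bv v (swp k u) = (of_bool (v = permute_list (transpose k (Suc k)) u) :: complex)"
      using l by (auto simp: bv_def swp_permute)
    finally show "spec (Sg q k (bv v) u)
      (case (u, v) of (u, v) \<Rightarrow> of_bool (v = permute_list (transpose k (Suc k)) u))" by simp
  qed
  fix \<sigma> \<tau>
  assume p: "\<sigma> permutes {..<n}" "\<tau> permutes {..<n}"
    and A: "Abar d N n (\<lambda>(u, v). of_bool (v = permute_list \<sigma> u))" "Abar d N n (\<lambda>(u, v). of_bool (v = permute_list \<tau> u))"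
  show "Abar d N n (\<lambda>(u, v). of_bool (v = permute_list (\<sigma> \<circ> \<tau>) u))"
  proof (rule Abar_cong[OF Abar_mult[OF A]])
    fix u v assume uv: "u \<in> ?I" "v \<in> ?I"
    have s: "permute_list \<sigma> u \<in> ?I" by (rule permute_list_tidx[OF p(1) uv(1)])
    have c: "permute_list \<tau> (permute_list \<sigma> u) = permute_list (\<sigma> \<circ> \<tau>) u"
      using permute_list_compose[of \<tau> u \<sigma>] p uv by (simp add: tidx_def)
    have "(\<Sum>w\<in>?I. of_bool (w = permute_list \<sigma> u) * of_bool (v = permute_list \<tau> w))
        = (\<Sum>w\<in>?I. if w = permute_list \<sigma> u then of_bool (v = permute_list \<tau> (permute_list \<sigma> u)) else (0 :: complex))"
      by (rule sum.cong) auto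
    also have "\<dots> = of_bool (v = permute_list (\<sigma> \<circ> \<tau>) u)" using s by (simp add: c)
    finally show "(case (u, v) of (u, v) \<Rightarrow> \<Sum>w\<in>?I. (case (u, w) of (u, v) \<Rightarrow> of_bool (v = permute_list \<sigma> u)) *
       (case (w, v) of (u, v) \<Rightarrow> of_bool (v = permute_list \<tau> u))) =
      (case (u, v) of (u, v) \<Rightarrow> (of_bool (v = permute_list (\<sigma> \<circ> \<tau>) u) :: complex))" by simp
  qed
qed

lemma Abar_permute_ker:
  assumes w: "w permutes {..<n}"
  shows "Abar d N n (\<lambda>(u, v). of_bool (v = permute_list w u \<and> same_ker n c0 (map fst v)))"
proof -
  let ?I = "tidx d N n"
  have "Abar d N n (\<lambda>(u, v). of_bool (u = v \<and> same_ker n c0 (map fst v)))"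
    unfolding Abar_def
    by (rule exI[of _ "Diag (same_ker n c0)"])
      (auto simp: AlgR_Diag_ker Diag_def bv_def spec.sp_one spec.sp_zero)
  from Abar_mult[OF Abar_permute[OF w] this] show ?thesis
  proof (rule Abar_cong)
    fix u v assume uv: "u \<in> ?I" "v \<in> ?I"
    have "(\<Sum>x\<in>?I. of_bool (x = permute_list w u) * of_bool (x = v \<and> same_ker n c0 (map fst v)))
        = (\<Sum>x\<in>?I. if x = v then of_bool (v = permute_list w u \<and> same_ker n c0 (map fst v)) else (0 :: complex))"
      by (rule sum.cong) auto
    then show "(case (u, v) of (u, v) \<Rightarrow> \<Sum>x\<in>?I. (case (u, x) of (u, v) \<Rightarrow> of_bool (v = permute_list w u)) *
       (case (x, v) of (u, v) \<Rightarrow> of_bool (u = v \<and> same_ker n c0 (map fst v)))) =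
      (case (u, v) of (u, v) \<Rightarrow> (of_bool (v = permute_list w u \<and> same_ker n c0 (map fst v)) :: complex))"
      using uv by simp
  qed
qed

abbreviation cmap :: "(nat \<Rightarrow> nat) \<Rightarrow> (nat \<times> nat) list \<Rightarrow> (nat \<times> nat) list" where
  "cmap \<tau> \<equiv> map (\<lambda>(b, i). (\<tau> b, i))"

lemma map_fst_cmap: "map fst (cmap \<tau> u) = map \<tau> (map fst u)"
  by (simp add: case_prod_beta)

lemma cmap_tidx: "\<tau> permutes {1..d} \<Longrightarrow> cmap \<tau> u \<in> tidx d N n \<longleftrightarrow> u \<in> tidx d N n"
proof -
  assume t: "\<tau> permutes {1..d}"
  have "(case p of (b, i) \<Rightarrow> (\<tau> b, i)) \<in> vidx d N \<longleftrightarrow> p \<in> vidx d N" for p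
    using permutes_in_image[OF t, of "fst p"] by (cases p) (auto simp: vidx_def)
  then show ?thesis by (auto simp: tidx_def)
qed

lemma cmap_inj: "inj \<tau> \<Longrightarrow> cmap \<tau> u = cmap \<tau> v \<longleftrightarrow> u = v"
  by (rule inj_eq, rule injI, rule map_injective) (auto simp: inj_def)

lemma cmap_permute: "w permutes {..<length u} \<Longrightarrow> cmap \<tau> (permute_list w u) = permute_list w (cmap \<tau> u)"
  by (simp add: permute_list_map)

definition Av :: "nat \<Rightarrow> ((nat \<times> nat) list \<times> (nat \<times> nat) list \<Rightarrow> complex)
    \<Rightarrow> (nat \<times> nat) list \<times> (nat \<times> nat) list \<Rightarrow> complex" where
  "Av d t = (\<lambda>(u, v). \<Sum>\<tau> | \<tau> permutes {1..d}. t (cmap \<tau> u, cmap \<tau> v))"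

text \<open>
  The average of \<open>Rm w c\<close> over the permutations of the colours only depends on which entries of
  \<open>c\<close> agree.
\<close>

lemma Abar_Av_Rm:
  assumes w: "w permutes {..<n}"
  shows "Abar d N n (Av d (Rm (tidx d N n) w c))"
proof -
  let ?I = "tidx d N n"
  \<comment> \<open>\<open>K c'\<close> counts the colour permutations that carry \<open>c'\<close>
    to \<open>c\<close>; it is the only trace of the colours left in the average.\<close>
  define K where "K c' = (\<Sum>\<tau> | \<tau> permutes {1..d}. of_bool (map \<tau> c' = c) :: complex)" for c'
  have K_perm: "K (map \<pi> c') = K c'" if "\<pi> permutes {1..d}" for \<pi> c'
  proof -
    have "K c' = (\<Sum>\<tau> | \<tau> permutes {1..d}. of_bool (map (\<tau> \<circ> \<pi>) c' = c))"
      unfolding K_def by (rule sum_permutations_compose_right[OF that])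
    then show ?thesis by (simp add: K_def)
  qed
  \<comment> \<open>Colour words with the same coincidences are related by a partial injection of
    the colours, which extends to a permutation; reindexing by it does not change the count.\<close>
  have K_ker: "K c' = K c''"
    if ker: "same_ker n c' c''" and c': "length c' = n" "set c' \<subseteq> {1..d}" and c'': "length c'' = n" "set c'' \<subseteq> {1..d}" for c' c''
  proof -
    define f where "f b = c'' ! (SOME i. i < n \<and> c' ! i = b)" for b
    have f: "f (c' ! i) = c'' ! i" if i: "i < n" for i
    proof -
      have "(SOME j. j < n \<and> c' ! j = c' ! i) < n \<and> c' ! (SOME j. j < n \<and> c' ! j = c' ! i) = c' ! i"
        by (rule someI[of _ i]) (use i in simp)
      then show ?thesis using ker i unfolding f_def same_ker_def by blast
    qed
    have "inj_on f (set c')"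
      using ker c'(1) f unfolding same_ker_def by (auto simp: inj_on_def in_set_conv_nth)
    moreover have "f ` set c' \<subseteq> {1..d}"
    proof
      fix b assume "b \<in> f ` set c'"
      then obtain i where "i < n" "b = f (c' ! i)" using c'(1) by (auto simp: in_set_conv_nth)
      then have "b = c'' ! i" "c'' ! i \<in> set c''" using f c''(1) by auto
      then show "b \<in> {1..d}" using c''(2) by blast
    qed
    ultimately obtain \<pi> where \<pi>: "\<pi> permutes {1..d}" "\<forall>x\<in>set c'. \<pi> x = f x"
      using extend_permutation[of "{1..d}" "set c'" f] c'(2) by auto
    have "map \<pi> c' = c''"
      by (rule nth_equalityI) (use \<pi>(2) f c'(1) c''(1) in auto)
    then show ?thesis using K_perm[OF \<pi>(1), of c'] by simp
  qed
  have Kn: "same_ker n c c'" if "K c' \<noteq> 0" "length c' = n" for c'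
  proof -
    have "\<exists>\<tau>. \<tau> permutes {1..d} \<and> map \<tau> c' = c"
    proof (rule ccontr)
      assume "\<not> ?thesis"
      then have "K c' = 0" unfolding K_def by (intro sum.neutral) auto
      with \<open>K c' \<noteq> 0\<close> show False by simp
    qed
    then obtain \<tau> where t: "\<tau> permutes {1..d}" "map \<tau> c' = c" by blast
    have "inj \<tau>" using permutes_inj[OF t(1)] .
    then show ?thesis using t(2)[symmetric] that(2) by (auto simp: same_ker_def inj_eq)
  qed
  have Av: "Av d (Rm ?I w c) (u, v) = of_bool (v = permute_list w u) * K (map fst v)" if uv: "u \<in> ?I" "v \<in> ?I" for u v
  proof -
    have "Rm ?I w c (cmap \<tau> u, cmap \<tau> v) = of_bool (v = permute_list w u) * (of_bool (map \<tau> (map fst v) = c) :: complex)"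
      if t: "\<tau> permutes {1..d}" for \<tau>
    proof -
      have "cmap \<tau> v = permute_list w (cmap \<tau> u) \<longleftrightarrow> v = permute_list w u"
      proof -
        have "w permutes {..<length u}" using w uv by (simp add: tidx_def)
        from cmap_permute[OF this, of \<tau>] show ?thesis
          using cmap_inj[OF permutes_inj[OF t], of v "permute_list w u"] by simp
      qed
      moreover have "cmap \<tau> u \<in> ?I" using cmap_tidx[OF t] uv by simp
      ultimately show ?thesis by (auto simp: Rm_def map_fst_cmap simp del: map_map)
    qed
    then show ?thesis by (simp add: Av_def K_def sum_distrib_left)
  qed
  show ?thesis
  \<comment> \<open>Either \<open>K\<close> vanishes on all admissible colour words and the average
    is 0, or it is the value \<open>K c0\<close> on one class of partitions and 0 elsewhere.\<close>
  proof (cases "\<exists>c0. length c0 = n \<and> set c0 \<subseteq> {1..d} \<and> K c0 \<noteq> 0")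
    case True
    then obtain c0 where c0: "length c0 = n" "set c0 \<subseteq> {1..d}" "K c0 \<noteq> 0" by blast
    show ?thesis
    proof (rule Abar_cong[OF Abar_scale[OF Abar_permute_ker[OF w, of d N c0], of "K c0"]])
      fix u v assume uv: "u \<in> ?I" "v \<in> ?I"
      have v: "length (map fst v) = n" "set (map fst v) \<subseteq> {1..d}" using uv by (auto simp: tidx_def vidx_def)
      have k: "same_ker n c c0" by (rule Kn[OF c0(3,1)])
      have "K (map fst v) = (if same_ker n c0 (map fst v) then K c0 else 0)"
      proof (cases "same_ker n c0 (map fst v)")
        case True
        then show ?thesis using K_ker[OF True c0(1,2) v] by simp
      next
        case False
        then have "\<not> same_ker n c (map fst v)" using k by (auto simp: same_ker_def)
        then have "K (map fst v) = 0" using Kn v(1) by blast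
        then show ?thesis using False by simp
      qed
      then show "K c0 * (case (u, v) of (u, v) \<Rightarrow> of_bool (v = permute_list w u \<and> same_ker n c0 (map fst v)))
          = Av d (Rm ?I w c) (u, v)"
        unfolding Av[OF uv] by simp
    qed
  next
    case False
    show ?thesis
    proof (rule Abar_cong[OF Abar_zero])
      fix u v assume uv: "u \<in> ?I" "v \<in> ?I"
      have "length (map fst v) = n" "set (map fst v) \<subseteq> {1..d}" using uv by (auto simp: tidx_def vidx_def)
      then have "K (map fst v) = 0" using False by blast
      then show "0 = Av d (Rm ?I w c) (u, v)" unfolding Av[OF uv] by simp
    qed
  qed
qed

lemma Abar_Av_fspan:
  assumes "t \<in> fspan {Rm (tidx d N n) w c | w c. w permutes {..<n}}"
  shows "Abar d N n (Av d t)"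
  using assms
proof induction
  case zero
  show ?case by (rule Abar_cong[OF Abar_zero]) (simp add: Av_def)
next
  case (gen t)
  then show ?case using Abar_Av_Rm by blast
next
  case (add x y)
  show ?case by (rule Abar_cong[OF Abar_add[OF add.IH]]) (simp add: Av_def sum.distrib)
next
  case (scale x c)
  show ?case by (rule Abar_cong[OF Abar_scale[OF scale.IH, of c]]) (simp add: Av_def sum_distrib_left)
qed

section \<open>Residues of the commutant\<close>

lemma pw_count: "pw q (\<lambda>a. of_bool (a = p)) u = q powi (int (count (mset u) p))"
  by (induction u) (auto simp: power_int_add)

definition mat :: "(nat \<times> nat) list set \<Rightarrow> (tens \<Rightarrow> tens) \<Rightarrow> (nat \<times> nat) list \<times> (nat \<times> nat) list \<Rightarrow> Cq" where
  "mat I f = (\<lambda>(u, v). if u \<in> I \<and> v \<in> I then f (bv v) u else 0)"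

lemma bv_in_vec: "v \<in> I \<Longrightarrow> bv v \<in> vec I" by simp

text \<open>Commuting with the group-like generators preserves their eigenvalues, and these
  determine the multiplicity of each letter.\<close>

lemma EndUqS_weight:
  assumes f: "f \<in> carrier (EndUqS d N n)" and uv: "u \<in> tidx d N n" "v \<in> tidx d N n" and nz: "f (bv v) u \<noteq> 0"
  shows "mset u = mset v"
proof (rule multiset_eqI)
  fix p
  show "count (mset u) p = count (mset v) p"
  proof (cases "p \<in> vidx d N")
    case True
    then obtain b j where p: "p = (b, j)" "UK b j \<in> ugens d N" by (cases p) (auto simp: vidx_def ugens_simps)
    let ?m = "\<lambda>a. of_bool (a = p) :: int"
    have fe: "f \<in> carrier (endo (tidx d N n))" using f unfolding EndUqS_iff by blast
    have "f (Top (UK b j) (bv v)) = Top (UK b j) (f (bv v))"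
      using f p(2) bv_in_vec[OF uv(2)] unfolding EndUqS_iff by blast
    moreover have "Top (UK b j) (bv v) = (\<lambda>u. pw q ?m v * bv v u)"
      by (auto simp: p PW_def bv_def fun_eq_iff)
    ultimately have "(\<lambda>u. pw q ?m v * f (bv v) u) = Top (UK b j) (f (bv v))"
      using endo_smult[OF fe bv_in_vec[OF uv(2)]] by simp
    from fun_cong[OF this, of u] have "pw q ?m v * f (bv v) u = pw q ?m u * f (bv v) u"
      by (simp add: p PW_def)
    then have "pw q ?m v = pw q ?m u" using nz by simp
    then show ?thesis unfolding pw_count q_powi_inj by simp
  next
    case False
    then have "p \<notin> set u" "p \<notin> set v" using uv by (auto simp: tidx_def)
    then have "p \<notin># mset u" "p \<notin># mset v" by simp_all
    then show ?thesis unfolding not_in_iff by (simp only:)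
  qed
qed

text \<open>Commutation is an equation between sums of products of entries with residues, so it
  passes to the residues; the operators for E and F both become derivations, whatever their
  twists.\<close>

lemma residue_com:
  assumes f: "f \<in> carrier (EndUqS d N n)"
    and T: "T \<in> ugens d N" "Top T = H q m m' a b"
    and sp: "\<And>u v. u \<in> tidx d N n \<Longrightarrow> v \<in> tidx d N n \<Longrightarrow> spec (f (bv v) u) (g u v)"
  shows "com (tidx d N n) g (dmat a b)"
  unfolding com_def mm_def
proof (intro ballI)
  let ?I = "tidx d N n"
  fix u v assume uv: "u \<in> ?I" "v \<in> ?I"
  have fe: "f \<in> carrier (endo ?I)" using f unfolding EndUqS_iff by blast
  have Te: "res ?I (Top T) \<in> carrier (endo ?I)" by (rule res_closed[OF Top_linear Top_preserves[OF T(1)]])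
  have tv: "Top T (bv v) \<in> vec ?I" using Top_preserves[OF T(1), of n] uv by (simp add: preserves_def)
  have fv: "f (bv v) \<in> vec ?I" using endo_vec[OF fe] uv by simp
  have sd: "spec (Top T (bv w) u) (dmat a b u w)" for u w
    unfolding T(2) dmat_def by (rule spec_H[OF spec_bv])
  have 1: "f (Top T (bv v)) u = (\<Sum>w\<in>?I. f (bv w) u * Top T (bv v) w)"
    using fun_cong[OF endo_expand[OF fe finite_tidx tv], of u] by (simp add: mult.commute)
  have 2: "Top T (f (bv v)) u = (\<Sum>w\<in>?I. Top T (bv w) u * f (bv v) w)"
    using fun_cong[OF endo_expand[OF Te finite_tidx fv], of u] fv by (simp add: mult.commute)
  have "f (Top T (bv v)) = Top T (f (bv v))"
    using f T(1) bv_in_vec[OF uv(2)] unfolding EndUqS_iff by blast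
  then have eq: "(\<Sum>w\<in>?I. f (bv w) u * Top T (bv v) w) = (\<Sum>w\<in>?I. Top T (bv w) u * f (bv v) w)"
    using 1 2 by simp
  have "spec (\<Sum>w\<in>?I. f (bv w) u * Top T (bv v) w) (\<Sum>w\<in>?I. g u w * dmat a b w v)"
    by (intro spec.sp_sum spec.sp_mult sp sd) (use uv in auto)
  moreover have "spec (\<Sum>w\<in>?I. Top T (bv w) u * f (bv v) w) (\<Sum>w\<in>?I. dmat a b u w * g w v)"
    by (intro spec.sp_sum spec.sp_mult sp sd) (use uv in auto)
  ultimately show "(\<Sum>w\<in>?I. g u w * dmat a b w v) = (\<Sum>w\<in>?I. dmat a b u w * g w v)"
    unfolding eq by (rule spec.sp_unique)
qed

text \<open>Commuting with all derivations puts the residue in the span of the matrices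
  \<open>Rm\<close>. These are not residues of the image one by one, but their averages over the
  colours are.\<close>

lemma EndUqS_residue:
  assumes f: "f \<in> carrier (EndUqS d N n)"
    and sp: "\<And>t. t \<in> tidx d N n \<times> tidx d N n \<Longrightarrow> spec (mat (tidx d N n) f t) (x' t)"
  shows "Abar d N n x'"
proof -
  let ?I = "tidx d N n"
  define g where "g u v = (if u \<in> ?I \<and> v \<in> ?I then x' (u, v) else 0)" for u v
  have sg: "spec (f (bv v) u) (g u v)" if "u \<in> ?I" "v \<in> ?I" for u v
    using sp[of "(u, v)"] that by (simp add: mat_def g_def)
  have W: "mset u = mset v" if "u \<in> ?I" "v \<in> ?I" "g u v \<noteq> 0" for u v
    using EndUqS_weight[OF f that(1,2)] spec.sp_nonzero[OF sg[OF that(1,2)] that(3)] by blast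
  have D: "com ?I g (dmat p p')" if pp: "p \<in> vidx d N" "p' \<in> vidx d N" "fst p = fst p'" "p \<noteq> p'" for p p'
  proof -
    obtain b i j where p: "p = (b, i)" "p' = (b, j)" using pp(3) by (cases p, cases p') auto
    have r: "b \<in> {1..d}" "i \<in> {1..N}" "j \<in> {1..N}" "i \<noteq> j" using pp by (auto simp: p vidx_def)
    show ?thesis unfolding p
    proof (rule com_dmat_colour[OF _ _ r])
      fix i assume i: "i \<in> {1..<N}"
      have "UE b i \<in> ugens d N" "UF b i \<in> ugens d N" using i r(1) by (auto simp: ugens_simps)
      then show "com ?I g (dmat (b, i) (b, i + 1))" "com ?I g (dmat (b, i + 1) (b, i))"
        using residue_com[OF f _ Top.simps(1) sg] residue_com[OF f _ Top.simps(2) sg] by blast+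
    qed
  qed
  have "case_prod g \<in> fspan {Rm ?I w c | w c. w permutes {..<n}}"
  proof (rule commutant_span)
    show "com ?I g (Bmat M)" if "same_colour d N M" for M by (rule com_Bmat[OF D W that])
    show "g x y = 0" if "x \<notin> ?I \<or> y \<notin> ?I" for x y using that unfolding g_def by auto
  qed
  then have A: "Abar d N n (Av d (case_prod g))" by (rule Abar_Av_fspan)
  \<comment> \<open>The residue inherits invariance under colour permutations, so averaging only
    multiplies it by the factorial of \<open>d\<close>.\<close>
  have inv: "g (cmap \<tau> u) (cmap \<tau> v) = g u v" if t: "\<tau> permutes {1..d}" and uv: "u \<in> ?I" "v \<in> ?I" for \<tau> u v
  proof -
    have c: "cmap \<tau> u \<in> ?I" "cmap \<tau> v \<in> ?I" using uv cmap_tidx[OF t] by simp_all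
    have "PT \<tau> (bv (cmap \<tau> v)) = (bv v :: tens)"
      using cmap_inj[OF permutes_inj[OF t]] by (auto simp: PT_def bv_def fun_eq_iff)
    moreover have "f (PT \<tau> (bv (cmap \<tau> v))) = PT \<tau> (f (bv (cmap \<tau> v)))"
      using f t bv_in_vec[OF c(2)] unfolding EndUqS_iff by blast
    ultimately have "f (bv v) u = f (bv (cmap \<tau> v)) (cmap \<tau> u)" by (simp add: PT_def)
    then show ?thesis using spec.sp_unique sg[OF uv] sg[OF c] by simp
  qed
  have "Av d (case_prod g) (u, v) = of_nat (fact d) * g u v" if "u \<in> ?I" "v \<in> ?I" for u v
  proof -
    have "Av d (case_prod g) (u, v) = (\<Sum>\<tau> | \<tau> permutes {1..d}. g u v)"
      unfolding Av_def using inv that by simp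
    also have "\<dots> = of_nat (card {\<tau>. \<tau> permutes {1..d}}) * g u v" by simp
    also have "card {\<tau>. \<tau> permutes {1..d}} = fact d" by (rule card_permutations) simp_all
    finally show ?thesis .
  qed
  then show ?thesis
    by (intro Abar_cong[OF Abar_scale[OF A, of "inverse (of_nat (fact d))"]]) (simp add: g_def)
qed

text \<open>The matrices of the image and of the commutant are the spaces \<open>A\<close> and
  \<open>B\<close> of \<open>lift_from_residues\<close>; equality of matrices gives equality of
  operators.\<close>

theorem EndUqS_AlgR:
  assumes f: "f \<in> carrier (EndUqS d N n)"
  obtains F where "AlgR n F" "f = res (tidx d N n) F"
proof -
  let ?I = "tidx d N n"
  define A where "A = {mat ?I F | F. AlgR n F}"
  define B where "B = {mat ?I f | f. f \<in> carrier (EndUqS d N n)}"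
  have "B \<subseteq> A"
  proof (rule spec.lift_from_residues[of "?I \<times> ?I"])
    show "finite (?I \<times> ?I)" by simp
    show "(\<lambda>t. x t + y t) \<in> A" if "x \<in> A" "y \<in> A" for x y
    proof -
      obtain F G where "x = mat ?I F" "y = mat ?I G" "AlgR n F" "AlgR n G" using \<open>x \<in> A\<close> \<open>y \<in> A\<close> unfolding A_def by blast
      then show ?thesis unfolding A_def
        by (intro CollectI exI[of _ "\<lambda>x u. F x u + G x u"]) (auto simp: mat_def AlgR_add fun_eq_iff)
    qed
    show sc: "(\<lambda>t. c * x t) \<in> A" if "x \<in> A" for x c
    proof -
      obtain F where "x = mat ?I F" "AlgR n F" using \<open>x \<in> A\<close> unfolding A_def by blast
      then show ?thesis unfolding A_def
        by (intro CollectI exI[of _ "\<lambda>x u. c * F x u"]) (auto simp: mat_def AlgR_scale fun_eq_iff)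
    qed
    show "(\<lambda>t. 0) \<in> A" unfolding A_def
      by (intro CollectI exI[of _ "\<lambda>x u. 0"]) (auto simp: mat_def AlgR_zero fun_eq_iff)
    interpret kalg "endo ?I :: (Cq, tens \<Rightarrow> tens) module" by (rule endo_kalg)
    show "(\<lambda>t. x t + y t) \<in> B" if "x \<in> B" "y \<in> B" for x y
    proof -
      obtain f g where fg: "x = mat ?I f" "y = mat ?I g" "f \<in> carrier (EndUqS d N n)" "g \<in> carrier (EndUqS d N n)"
        using \<open>x \<in> B\<close> \<open>y \<in> B\<close> unfolding B_def by blast
      have e: "f \<in> carrier (endo ?I)" "g \<in> carrier (endo ?I)" using fg(3,4) unfolding EndUqS_iff by blast+
      have v: "f z \<in> vec ?I" "g z \<in> vec ?I" if "z \<in> vec ?I" for z using endo_vec[OF e(1) that] endo_vec[OF e(2) that] .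
      have vv: "Top k z \<in> vec ?I" if "k \<in> ugens d N" "z \<in> vec ?I" for k z
        using Top_preserves[OF that(1)] that(2) by (simp add: preserves_def)
      have vp: "PT \<tau> z \<in> vec ?I" if "\<tau> permutes {1..d}" "z \<in> vec ?I" for \<tau> and z :: tens
        by (rule bspec[OF PT_preserves[OF that(1), unfolded preserves_def] that(2)])
      have "f \<oplus>\<^bsub>endo ?I\<^esub> g \<in> carrier (EndUqS d N n)"
        unfolding EndUqS_iff
      proof (intro conjI a_closed[OF e] ballI allI impI)
        fix k and z :: tens assume k: "k \<in> ugens d N" "z \<in> vec ?I"
        then have fgk: "f (Top k z) = Top k (f z)" "g (Top k z) = Top k (g z)" using fg(3,4) unfolding EndUqS_iff by blast+
        then show "(f \<oplus>\<^bsub>endo ?I\<^esub> g) (Top k z) = Top k ((f \<oplus>\<^bsub>endo ?I\<^esub> g) z)"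
        proof -
          have "(f \<oplus>\<^bsub>endo ?I\<^esub> g) (Top k z) = (\<lambda>u. f (Top k z) u + g (Top k z) u)" using vv[OF k] by simp
          also have "\<dots> = (\<lambda>u. Top k (f z) u + Top k (g z) u)" by (simp only: fgk)
          also have "\<dots> = Top k (\<lambda>u. f z u + g z u)"
            by (simp only: Top_linear[unfolded total_linear_def, THEN conjunct1, rule_format])
          also have "(\<lambda>u. f z u + g z u) = (f \<oplus>\<^bsub>endo ?I\<^esub> g) z" using k by simp
          finally show ?thesis .
        qed
      next
        fix \<tau> and z :: tens assume k: "\<tau> permutes {1..d}" "z \<in> vec ?I"
        then have fgk: "f (PT \<tau> z) = PT \<tau> (f z)" "g (PT \<tau> z) = PT \<tau> (g z)" using fg(3,4) unfolding EndUqS_iff by blast+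
        then show "(f \<oplus>\<^bsub>endo ?I\<^esub> g) (PT \<tau> z) = PT \<tau> ((f \<oplus>\<^bsub>endo ?I\<^esub> g) z)"
        proof -
          have "(f \<oplus>\<^bsub>endo ?I\<^esub> g) (PT \<tau> z) = (\<lambda>u. f (PT \<tau> z) u + g (PT \<tau> z) u)" using vp[OF k] by simp
          also have "\<dots> = PT \<tau> (\<lambda>u. f z u + g z u)" unfolding fgk by (simp add: PT_def fun_eq_iff)
          also have "(\<lambda>u. f z u + g z u) = (f \<oplus>\<^bsub>endo ?I\<^esub> g) z" using k by simp
          finally show ?thesis .
        qed
      qed
      moreover have "(\<lambda>t. x t + y t) = mat ?I (f \<oplus>\<^bsub>endo ?I\<^esub> g)"
        by (auto simp: fg mat_def fun_eq_iff)
      ultimately show ?thesis unfolding B_def by blast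
    qed
    show "(\<lambda>t. c * x t) \<in> B" if "x \<in> B" for x c
    proof -
      obtain f where fg: "x = mat ?I f" "f \<in> carrier (EndUqS d N n)"
        using \<open>x \<in> B\<close> unfolding B_def by blast
      have e: "f \<in> carrier (endo ?I)" using fg(2) unfolding EndUqS_iff by blast
      have vv: "Top k z \<in> vec ?I" if "k \<in> ugens d N" "z \<in> vec ?I" for k z
        using Top_preserves[OF that(1)] that(2) by (simp add: preserves_def)
      have vp: "PT \<tau> z \<in> vec ?I" if "\<tau> permutes {1..d}" "z \<in> vec ?I" for \<tau> and z :: tens
        by (rule bspec[OF PT_preserves[OF that(1), unfolded preserves_def] that(2)])
      have "c \<odot>\<^bsub>endo ?I\<^esub> f \<in> carrier (EndUqS d N n)"
        unfolding EndUqS_iff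
      proof (intro conjI smult_closed[OF e] ballI allI impI)
        fix k and z :: tens assume k: "k \<in> ugens d N" "z \<in> vec ?I"
        then have fk: "f (Top k z) = Top k (f z)" using fg(2) unfolding EndUqS_iff by blast
        then show "(c \<odot>\<^bsub>endo ?I\<^esub> f) (Top k z) = Top k ((c \<odot>\<^bsub>endo ?I\<^esub> f) z)"
        proof -
          have "(c \<odot>\<^bsub>endo ?I\<^esub> f) (Top k z) = (\<lambda>u. c * f (Top k z) u)" using vv[OF k] by simp
          also have "\<dots> = (\<lambda>u. c * Top k (f z) u)" by (simp only: fk)
          also have "\<dots> = Top k (\<lambda>u. c * f z u)"
            by (simp only: Top_linear[unfolded total_linear_def, THEN conjunct2, rule_format])
          also have "(\<lambda>u. c * f z u) = (c \<odot>\<^bsub>endo ?I\<^esub> f) z" using k by simp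
          finally show ?thesis .
        qed
      next
        fix \<tau> and z :: tens assume k: "\<tau> permutes {1..d}" "z \<in> vec ?I"
        then have fk: "f (PT \<tau> z) = PT \<tau> (f z)" using fg(2) unfolding EndUqS_iff by blast
        then show "(c \<odot>\<^bsub>endo ?I\<^esub> f) (PT \<tau> z) = PT \<tau> ((c \<odot>\<^bsub>endo ?I\<^esub> f) z)"
        proof -
          have "(c \<odot>\<^bsub>endo ?I\<^esub> f) (PT \<tau> z) = (\<lambda>u. c * f (PT \<tau> z) u)" using vp[OF k] by simp
          also have "\<dots> = PT \<tau> (\<lambda>u. c * f z u)" unfolding fk by (simp add: PT_def fun_eq_iff)
          also have "(\<lambda>u. c * f z u) = (c \<odot>\<^bsub>endo ?I\<^esub> f) z" using k by simp
          finally show ?thesis .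
        qed
      qed
      moreover have "(\<lambda>t. c * x t) = mat ?I (c \<odot>\<^bsub>endo ?I\<^esub> f)"
        by (auto simp: fg mat_def fun_eq_iff)
      ultimately show ?thesis unfolding B_def by blast
    qed
    show "A \<subseteq> B"
    proof
      fix x assume "x \<in> A"
      then obtain F where F: "AlgR n F" "x = mat ?I F" unfolding A_def by blast
      have "mat ?I F = mat ?I (res ?I F)" by (auto simp: mat_def fun_eq_iff)
      then show "x \<in> B" using AlgR_EndUqS[OF F(1)] unfolding B_def F(2) by blast
    qed
    show "x t = 0" if "x \<in> B" "t \<notin> ?I \<times> ?I" for x t
      using that unfolding B_def by (cases t) (auto simp: mat_def)
    show "\<exists>y\<in>A. \<forall>t\<in>?I \<times> ?I. spec (y t) (x' t)"
      if xB: "x \<in> B" and sp: "\<And>t. t \<in> ?I \<times> ?I \<Longrightarrow> spec (x t) (x' t)" for x x'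
    proof -
      obtain f where f: "x = mat ?I f" "f \<in> carrier (EndUqS d N n)" using xB unfolding B_def by blast
      have "Abar d N n x'" by (rule EndUqS_residue[OF f(2)]) (use sp f(1) in simp)
      then obtain F where F: "AlgR n F" "\<forall>u\<in>?I. \<forall>v\<in>?I. spec (F (bv v) u) (x' (u, v))"
        unfolding Abar_def by blast
      show ?thesis
        by (rule bexI[of _ "mat ?I F"]) (use F in \<open>auto simp: A_def mat_def\<close>)
    qed
    show "\<exists>c x'. (\<forall>t\<in>?I \<times> ?I. spec (c * x t) (x' t)) \<and> (\<exists>t\<in>?I \<times> ?I. x' t \<noteq> 0)"
      if "\<exists>t\<in>?I \<times> ?I. x t \<noteq> 0" for x
      by (rule spec_normalise[OF _ that]) simp
  qed
  then have "mat ?I f \<in> A" using f unfolding B_def by blast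
  then obtain F where F: "AlgR n F" "mat ?I f = mat ?I F" unfolding A_def by auto
  have fe: "f \<in> carrier (endo ?I)" using f unfolding EndUqS_iff by blast
  note Fe = AlgR_closed[OF F(1), of d N]
  have "f = res ?I F"
  proof (rule endo_eqI[OF fe Fe])
    fix x :: tens assume x: "x \<in> vec ?I"
    have "f (bv v) u = res ?I F (bv v) u" if v: "v \<in> ?I" for u v
    proof (cases "u \<in> ?I")
      case True
      then show ?thesis using fun_cong[OF F(2), of "(u, v)"] v by (simp add: mat_def)
    next
      case False
      then show ?thesis using endo_vec[OF fe bv_in_vec[OF v]] endo_vec[OF Fe bv_in_vec[OF v]] by (simp add: vec_def)
    qed
    then show "f x = res ?I F x"
      unfolding endo_expand[OF fe finite_tidx x] endo_expand[OF Fe finite_tidx x] by simp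
  qed
  then show thesis using that F(1) by blast
qed


section \<open>Injectivity\<close>

text \<open>Uniqueness in the universal property of the free algebra. It shows that cosets in the
  presented algebra are evaluated from its own generators.\<close>

lemma alg_hom_free_ev:
  fixes X :: "'g set" and B :: "('k::field, 'b) module" (structure)
  assumes B: "kalg B" and h: "h \<in> alg_hom (free_alg X) B" and x: "x \<in> carrier (free_alg X)"
  shows "h x = free_ev B (\<lambda>g. h (bv [g])) x"
proof -
  interpret F: kalg "free_alg X :: ('k, _) module" by (rule free_alg_kalg)
  interpret B: kalg B by (rule B)
  interpret h: ring_hom_ring "free_alg X" B h by (rule F.alg_hom_ring_hom_ring[OF B h])
  let ?r = "\<lambda>g. h (bv [g])"
  have r: "?r g \<in> carrier B" if "g \<in> X" for g using that by (intro h.hom_closed bv_free_alg) simp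
  have w: "h (bv w) = word_ev B ?r w" if "set w \<subseteq> X" for w
    using that
  proof (induction w)
    case Nil
    show ?case using h.hom_one by simp
  next
    case (Cons g w)
    have "h (bv (g # w)) = h (bv [g] \<otimes>\<^bsub>free_alg X\<^esub> bv w)" by (simp add: free_alg_bv_mult)
    also have "\<dots> = h (bv [g]) \<otimes> h (bv w)" using Cons.prems by (intro h.hom_mult) auto
    finally show ?case using Cons by simp
  qed
  show ?thesis using x
  proof (induction rule: free_alg_induct)
    case zero
    show ?case using h.hom_zero B.free_ev_zero[of X ?r] r by simp
  next
    case (add x c w)
    have s: "(\<lambda>u. c * bv w u) \<in> carrier (free_alg X)"
      using F.smult_closed[OF bv_free_alg[OF add(2)], of c] by simp
    have "h (\<lambda>u. x u + c * bv w u) = h x \<oplus> h (\<lambda>u. c * bv w u)"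
      using h.hom_add[OF add(1) s] by simp
    also have "h (\<lambda>u. c * bv w u) = c \<odot> h (bv w)"
      using alg_hom_smult[OF h bv_free_alg[OF add(2)], of c] by simp
    also have "h (bv w) = free_ev B ?r (bv w)" using w[OF add(2)] B.free_ev_bv[of X ?r w] r add(2) by simp
    also have "c \<odot> free_ev B ?r (bv w) = free_ev B ?r (\<lambda>u. c * bv w u)"
      by (rule B.free_ev_smult[of X ?r, symmetric]) (use r add(2) in auto)
    also have "h x \<oplus> \<dots> = free_ev B ?r (\<lambda>u. x u + c * bv w u)"
      using B.free_ev_add[of X ?r x "\<lambda>u. c * bv w u"] r add(1,3) s by simp
    finally show ?case .
  qed
qed

abbreviation bgen :: "nat \<Rightarrow> btgen \<Rightarrow> (btgen list \<Rightarrow> Cq) set" where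
  "bgen n \<equiv> pres_gen (btgens n) (bth_rels n)"

lemma BTH_coset_hom: "(+>\<^bsub>free_alg (btgens n)\<^esub>) (rel_ideal (btgens n) (bth_rels n)) \<in> alg_hom (free_alg (btgens n)) (BTH n)"
  unfolding BTH_def by (rule kalg.coset_hom_pres[OF endo_kalg bt_rho_closed wf_bth_rels])

lemma BTH_coset:
  assumes "x \<in> carrier (free_alg (btgens n))"
  shows "rel_ideal (btgens n) (bth_rels n) +>\<^bsub>free_alg (btgens n)\<^esub> x = free_ev (BTH n) (bgen n) x"
  using alg_hom_free_ev[OF BTH_kalg BTH_coset_hom assms] by (simp add: pres_gen_def[abs_def])

lemma BTH_coset_closed:
  "x \<in> carrier (free_alg (btgens n)) \<Longrightarrow> rel_ideal (btgens n) (bth_rels n) +>\<^bsub>free_alg (btgens n)\<^esub> x \<in> carrier (BTH n)"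
  unfolding BTH_def by (rule kalg.coset_in_pres_alg[OF endo_kalg bt_rho_closed wf_bth_rels])

lemma bgen_closed: "g \<in> btgens n \<Longrightarrow> bgen n g \<in> carrier (BTH n)"
  unfolding pres_gen_def by (rule BTH_coset_closed) simp

lemma BTH_rels:
  assumes lr: "(l, r) \<in> bth_rels n"
  shows "lc_ev (BTH n) (bgen n) l = lc_ev (BTH n) (bgen n) r"
proof -
  interpret F: kalg "free_alg (btgens n) :: (Cq, _) module" by (rule free_alg_kalg)
  interpret B: kalg "BTH n" by (rule BTH_kalg)
  let ?I = "rel_ideal (btgens n) (bth_rels n)"
  have w: "\<forall>(c, u)\<in>set l. set u \<subseteq> btgens n" "\<forall>(c, u)\<in>set r. set u \<subseteq> btgens n"
    using wf_bth_rels[of n] lr unfolding wf_rels_def by fast+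
  note c = lc_free_alg[OF w(1)] lc_free_alg[OF w(2)]
  have "lc l \<ominus>\<^bsub>free_alg (btgens n)\<^esub> lc r = (\<lambda>w. lc l w - lc r w)"
    using F.smult_minus_one[OF c(2)] by (simp add: a_minus_def) (metis (no_types, lifting) add.inverse_inverse diff_minus_eq_add)
  moreover have "(\<lambda>w. lc l w - lc r w) \<in> ?I"
    unfolding rel_ideal_def
    by (rule subsetD[OF F.genideal_self[OF kalg.rel_elems[OF endo_kalg bt_rho_closed wf_bth_rels]]]) (use lr in blast)
  ultimately have "?I +>\<^bsub>free_alg (btgens n)\<^esub> lc l = ?I +>\<^bsub>free_alg (btgens n)\<^esub> lc r"
    using F.coset_eq_iff[OF kalg.rel_ideal_ideal[OF endo_kalg bt_rho_closed wf_bth_rels] c] by simp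
  then show ?thesis
    unfolding BTH_coset[OF c(1)] BTH_coset[OF c(2)]
    using B.free_ev_lc[of "btgens n" "bgen n"] bgen_closed w by simp
qed

lemma BTH_word_rel:
  assumes "weq u v \<in> bth_rels n" "set u \<subseteq> btgens n" "set v \<subseteq> btgens n"
  shows "word_ev (BTH n) (bgen n) u = word_ev (BTH n) (bgen n) v"
proof -
  interpret B: kalg "BTH n" by (rule BTH_kalg)
  have c: "word_ev (BTH n) (bgen n) u \<in> carrier (BTH n)" "word_ev (BTH n) (bgen n) v \<in> carrier (BTH n)"
    using B.word_ev_closed[of "btgens n" "bgen n"] bgen_closed assms(2,3) by blast+
  show ?thesis using BTH_rels[of "[(1, u)]" "[(1, v)]" n] assms(1) c by (simp add: weq_def)
qed

lemma BTH_ties: "ties (BTH n) n (bth_s n) (\<lambda>i. bgen n (BS' i)) (bth_E n) (q - inverse q)"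
proof -
  interpret B: kalg "BTH n" by (rule BTH_kalg)
  have c: "bgen n (BS i) \<in> carrier (BTH n)" "bgen n (BS' i) \<in> carrier (BTH n)" "bgen n (BE i) \<in> carrier (BTH n)"
    if "i \<in> {1..<n}" for i using bgen_closed that by simp_all
  note R = bth_rels_def tb_rels_def
  show ?thesis
    unfolding bth_s_def bth_E_def
  proof (unfold_locales, goal_cases)
    case (1 i) then show ?case by (rule c)
  next
    case (2 i) then show ?case by (rule c)
  next
    case (3 i) then show ?case by (rule c)
  next
    case (4 i)
    have "weq [BS i, BS' i] [] \<in> bth_rels n" unfolding R using 4 by blast
    from BTH_word_rel[OF this] show ?case using 4 c[OF 4] by simp
  next
    case (5 i)
    have "weq [BS' i, BS i] [] \<in> bth_rels n" unfolding R using 5 by blast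
    from BTH_word_rel[OF this] show ?case using 5 c[OF 5] by simp
  next
    case (6 i)
    have "weq [BE i, BE i] [BE i] \<in> bth_rels n" unfolding R using 6 by blast
    from BTH_word_rel[OF this] show ?case using 6 c[OF 6] by simp
  next
    case (7 i)
    have "weq [BS i, BE i] [BE i, BS i] \<in> bth_rels n" unfolding R using 7 by blast
    from BTH_word_rel[OF this] show ?case using 7 c[OF 7] by simp
  next
    case (8 i j)
    have "weq [BE i, BE j] [BE j, BE i] \<in> bth_rels n" unfolding R using 8 by blast
    from BTH_word_rel[OF this] show ?case using 8 c[OF 8(1)] c[OF 8(2)] by simp
  next
    case (9 i j)
    have "weq [BS i, BS j] [BS j, BS i] \<in> bth_rels n" unfolding R using 9 by blast
    from BTH_word_rel[OF this] show ?case using 9 c[OF 9(1)] c[OF 9(2)] by simp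
  next
    case (10 i j)
    have "weq [BS i, BE j] [BE j, BS i] \<in> bth_rels n" unfolding R using 10 by blast
    from BTH_word_rel[OF this] show ?case using 10 c[OF 10(1)] c[OF 10(2)] by simp
  next
    case (11 i j)
    have "weq [BS i, BS j, BS i] [BS j, BS i, BS j] \<in> bth_rels n" unfolding R using 11 by blast
    from BTH_word_rel[OF this] show ?case using 11 c[OF 11(1)] c[OF 11(2)] by simp
  next
    case (12 i j)
    have "weq [BE i, BS j, BS i] [BS j, BS i, BE j] \<in> bth_rels n" unfolding R using 12 by blast
    from BTH_word_rel[OF this] show ?case using 12 c[OF 12(1)] c[OF 12(2)] by simp
  next
    case (13 i j)
    have "weq [BE i, BS j, BS' i] [BS j, BS' i, BE j] \<in> bth_rels n" unfolding R using 13 by blast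
    from BTH_word_rel[OF this] show ?case using 13 c[OF 13(1)] c[OF 13(2)] by simp
  next
    case (14 i j)
    have "weq [BE i, BE j, BS i] [BE j, BS i, BE j] \<in> bth_rels n" unfolding R using 14 by blast
    from BTH_word_rel[OF this] show ?case using 14 c[OF 14(1)] c[OF 14(2)] by simp
  next
    case (15 i)
    have "([(1, [BS i, BS i])], [(q - inverse q, [BS i, BE i]), (1, [])]) \<in> bth_rels n" unfolding R using 15 by blast
    from BTH_rels[OF this] show ?case using c[OF 15] by simp
  qed
qed

lemma alg_hom_comb:
  assumes A: "kalg A" and h: "h \<in> alg_hom A (endo I)" and P: "finite P" and f: "\<And>p. p \<in> P \<Longrightarrow> f p \<in> carrier A"
    and x: "x \<in> vec I"
  shows "h (\<Oplus>\<^bsub>A\<^esub>p\<in>P. a p \<odot>\<^bsub>A\<^esub> f p) x u = (\<Sum>p\<in>P. a p * h (f p) x u)"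
proof -
  interpret A: kalg A by (rule A)
  interpret h: ring_hom_ring A "endo I" h by (rule A.alg_hom_ring_hom_ring[OF endo_kalg h])
  show ?thesis using P f
  proof induction
    case empty
    show ?case using h.hom_zero x by simp
  next
    case (insert p P)
    have cl: "a p \<odot>\<^bsub>A\<^esub> f p \<in> carrier A" "(\<Oplus>\<^bsub>A\<^esub>p\<in>P. a p \<odot>\<^bsub>A\<^esub> f p) \<in> carrier A"
      using insert.prems by (auto intro!: A.finsum_closed)
    have "(\<Oplus>\<^bsub>A\<^esub>p\<in>insert p P. a p \<odot>\<^bsub>A\<^esub> f p) = a p \<odot>\<^bsub>A\<^esub> f p \<oplus>\<^bsub>A\<^esub> (\<Oplus>\<^bsub>A\<^esub>p\<in>P. a p \<odot>\<^bsub>A\<^esub> f p)"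
      using insert by (intro A.finsum_insert) auto
    then have "h (\<Oplus>\<^bsub>A\<^esub>p\<in>insert p P. a p \<odot>\<^bsub>A\<^esub> f p) x u
        = h (a p \<odot>\<^bsub>A\<^esub> f p) x u + h (\<Oplus>\<^bsub>A\<^esub>p\<in>P. a p \<odot>\<^bsub>A\<^esub> f p) x u"
      using h.hom_add[OF cl] x by simp
    then show ?case using insert alg_hom_smult[OF h, of "f p" "a p"] x by simp
  qed
qed

lemma res_compose: "preserves I g \<Longrightarrow> res I f \<otimes>\<^bsub>endo I\<^esub> res I g = res I (\<lambda>x. f (g x))"
  by (auto simp: compose_def fun_eq_iff preserves_def)

lemma Diag_preserves: "preserves I (Diag P)"
  by (auto simp: preserves_def vec_def Diag_def)

section \<open>Normal words acting on increasing words\<close>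

abbreviation SgW :: "nat list \<Rightarrow> tens \<Rightarrow> tens" where
  "SgW \<equiv> wop (\<lambda>i. Sg q (i - 1))"

lemma SgW_preserves: "preserves (tidx d N n) (SgW w)"
  by (rule wop_preserves) (rule Sg_preserves)

lemma SgW_linear: "total_linear (SgW w)"
  by (rule wop_linear) (rule Sg_linear)

text \<open>The word obtained by letting each generator swap two places; the last letter of
  \<open>w\<close> acts first, as for operators.\<close>

definition arr :: "nat list \<Rightarrow> 'a list \<Rightarrow> 'a list" where
  "arr w v = foldr (\<lambda>i. swp (i - 1)) w v"

lemma arr_simps [simp]: "arr [] v = v" "arr (i # w) v = swp (i - 1) (arr w v)"
  by (simp_all add: arr_def)

lemma length_arr [simp]: "length (arr w v) = length v"
  by (induction w) auto

lemma arr_append: "arr (u @ w) v = arr u (arr w v)"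
  by (induction u) auto

lemma arr_ge:
  assumes "set w \<subseteq> {1..<m}" "m \<le> length v" "m \<le> k" "k < length v"
  shows "arr w v ! k = v ! k"
  using assms(1)
proof (induction w)
  case (Cons i w)
  then have i: "1 \<le> i" "i < m" by auto
  have "swp (i - 1) (arr w v) ! k = arr w v ! k"
    using swp_nth[of "i - 1" "arr w v" k] i assms by auto
  then show ?case using Cons by simp
qed simp

text \<open>The block carries the entry at position \<open>p\<close> to position \<open>m\<close>
  and shifts the entries between by one to the left, so the first \<open>m\<close> entries keep
  their order.\<close>

lemma arr_block:
  assumes "p \<le> m" "m < length v" "k < length v"
  shows "arr (rev [Suc p..<Suc m]) v ! k
    = (if k < p then v ! k else if k < m then v ! Suc k else if k = m then v ! p else v ! k)"
  using assms
proof (induction m arbitrary: k)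
  case (Suc m)
  show ?case
  proof (cases "p = Suc m")
    case False
    then have pm: "p \<le> m" using Suc.prems by simp
    then have "rev [Suc p..<Suc (Suc m)] = Suc m # rev [Suc p..<Suc m]" by simp
    then have "arr (rev [Suc p..<Suc (Suc m)]) v ! k = swp m (arr (rev [Suc p..<Suc m]) v) ! k" by (simp del: upt_Suc)
    also have "\<dots> = (if k = m then arr (rev [Suc p..<Suc m]) v ! Suc m
        else if k = Suc m then arr (rev [Suc p..<Suc m]) v ! m else arr (rev [Suc p..<Suc m]) v ! k)"
      using Suc.prems by (intro swp_nth) simp_all
    also have "\<dots> = (if k < p then v ! k else if k < Suc m then v ! Suc k else if k = Suc m then v ! p else v ! k)"
      using Suc.IH[OF pm, of "Suc m"] Suc.IH[OF pm, of m] Suc.IH[OF pm, of k] Suc.prems pm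
      by (auto simp del: upt_Suc)
    finally show ?thesis .
  qed (use Suc.prems in auto)
qed simp

definition inc :: "nat \<Rightarrow> (nat \<times> nat) list \<Rightarrow> bool" where
  "inc m v \<longleftrightarrow> (\<forall>i k. i < k \<longrightarrow> k < m \<longrightarrow> snd (v ! i) < snd (v ! k))"

text \<open>For letters in ascending order the R-matrix is the flip without correction term, whether
  or not the colours agree.\<close>

lemma Sg_bv:
  assumes k: "Suc k < length v" and lt: "snd (v ! k) < snd (v ! Suc k)"
  shows "Sg q k (bv v) = bv (swp k v)"
proof
  fix u show "Sg q k (bv v) u = bv (swp k v) u"
  proof (cases "length u = length v")
    case True
    then have l: "Suc k < length u" using k by simp
    have e: "bv v (swp k u) = (bv (swp k v) u :: Cq)"
      using swp_swp[OF l] swp_swp[OF k] by (auto simp: bv_def)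
    have "u \<noteq> v" "u \<noteq> swp k v" if "u ! k = u ! Suc k"
      using that lt k by (auto simp: swp_nth)
    moreover have "u \<noteq> v" if "snd (u ! Suc k) < snd (u ! k)" using that lt by auto
    ultimately show ?thesis using e by (auto simp: Sg_nth[OF l] bv_def)
  next
    case False
    then have "bv (swp k v) u = (0 :: Cq)" "bv v u = (0 :: Cq)" "bv v (swp k u) = (0 :: Cq)"
      by (auto simp: bv_def)
    then show ?thesis using Sg_nth[of k u q "bv v"] Sg_short[of u k q "bv v"] by (cases "Suc k < length u") auto
  qed
qed

lemma SgW_block:
  assumes "p \<le> m" "m < length v" "inc (Suc m) v"
  shows "SgW (rev [Suc p..<Suc m]) (bv v) = bv (arr (rev [Suc p..<Suc m]) v)"
  using assms
proof (induction m)
  case (Suc m)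
  show ?case
  proof (cases "p = Suc m")
    case False
    then have pm: "p \<le> m" using Suc.prems by simp
    let ?v = "arr (rev [Suc p..<Suc m]) v"
    have d: "rev [Suc p..<Suc (Suc m)] = Suc m # rev [Suc p..<Suc m]" using pm by simp
    have i: "inc (Suc m) v" using Suc.prems(3) by (simp add: inc_def)
    have "?v ! m = v ! p" "?v ! Suc m = v ! Suc m"
      using arr_block[OF pm, of v m] arr_block[OF pm, of v "Suc m"] pm Suc.prems(2) by auto
    moreover have "snd (v ! p) < snd (v ! Suc m)" using Suc.prems(3) pm by (simp add: inc_def)
    ultimately have "Sg q m (bv ?v) = bv (swp m ?v)" using Suc.prems(2) by (intro Sg_bv) (simp_all del: upt_Suc)
    then show ?thesis using Suc.IH[OF pm _ i] Suc.prems(2) unfolding d by (simp del: upt_Suc)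
  qed simp
qed simp

lemma inc_block:
  assumes "p \<le> m" "m < length v" "inc (Suc m) v"
  shows "inc m (arr (rev [Suc p..<Suc m]) v)"
  unfolding inc_def
proof (intro allI impI)
  fix i k assume "i < k" "k < m"
  then show "snd (arr (rev [Suc p..<Suc m]) v ! i) < snd (arr (rev [Suc p..<Suc m]) v ! k)"
    using assms arr_block[OF assms(1,2), of i] arr_block[OF assms(1,2), of k]
    by (auto simp: inc_def simp del: upt_Suc)
qed

lemma NW_SucE:
  assumes "u \<in> NW (Suc m)"
  obtains w p where "u = w @ rev [Suc p..<Suc m]" "w \<in> NW m" "p \<le> m"
proof -
  obtain w j where "u = w @ rev [j..<Suc m]" "w \<in> NW m" "1 \<le> j" "j \<le> Suc m"
    using assms by (auto simp: NW.simps(2))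
  then show thesis using that[of w "j - 1"] by (cases j) (auto simp del: upt_Suc)
qed

text \<open>Each block acts while the entries it passes are still ascending, and it leaves the first
  \<open>m\<close> entries ascending for the shorter normal word.\<close>

lemma SgW_NW:
  assumes "u \<in> NW m" "m \<le> length v" "inc m v"
  shows "SgW u (bv v) = bv (arr u v)"
  using assms
proof (induction m arbitrary: u v)
  case (Suc m)
  obtain w p where u: "u = w @ rev [Suc p..<Suc m]" "w \<in> NW m" "p \<le> m" by (rule NW_SucE[OF Suc.prems(1)])
  have m: "m < length v" using Suc.prems by simp
  show ?case
    unfolding u(1) wop_append arr_append SgW_block[OF u(3) m Suc.prems(3)]
    by (rule Suc.IH[OF u(2) _ inc_block[OF u(3) m Suc.prems(3)]]) (use m in simp)
qed simp

text \<open>The entry at the last position reveals where the last block started; the rest follows by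
  induction.\<close>

lemma arr_NW_inj:
  assumes "u \<in> NW m" "u' \<in> NW m" "m \<le> length v" "inc m v" "arr u v = arr u' v"
  shows "u = u'"
  using assms
proof (induction m arbitrary: u u' v)
  case (Suc m)
  obtain w p where u: "u = w @ rev [Suc p..<Suc m]" "w \<in> NW m" "p \<le> m" by (rule NW_SucE[OF Suc.prems(1)])
  obtain w' p' where u': "u' = w' @ rev [Suc p'..<Suc m]" "w' \<in> NW m" "p' \<le> m" by (rule NW_SucE[OF Suc.prems(2)])
  have m: "m < length v" using Suc.prems by simp
  have "arr u v ! m = v ! p"
    unfolding u(1) arr_append using arr_ge[OF NW_set[OF u(2)], of "arr (rev [Suc p..<Suc m]) v" m] arr_block[OF u(3) m m] m u(3) by (simp del: upt_Suc)
  moreover have "arr u' v ! m = v ! p'"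
    unfolding u'(1) arr_append using arr_ge[OF NW_set[OF u'(2)], of "arr (rev [Suc p'..<Suc m]) v" m] arr_block[OF u'(3) m m] m u'(3) by (simp del: upt_Suc)
  ultimately have "v ! p = v ! p'" using Suc.prems(5) by simp
  then have p: "p = p'"
    using Suc.prems(4) u(3) u'(3) unfolding inc_def
    by (metis le_imp_less_Suc less_irrefl linorder_neqE_nat)
  have "w = w'"
    by (rule Suc.IH[OF u(2) u'(2) _ inc_block[OF u(3) m Suc.prems(4)]])
      (use m Suc.prems(5) in \<open>simp_all add: u(1) u'(1) p arr_append del: upt_Suc\<close>)
  then show ?case by (simp add: u(1) u'(1) p)
qed simp

lemma BTev_mult:
  "x \<in> carrier (BTH n) \<Longrightarrow> y \<in> carrier (BTH n) \<Longrightarrow>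
    BTev d N n (x \<otimes>\<^bsub>BTH n\<^esub> y) = BTev d N n x \<otimes>\<^bsub>endo (tidx d N n)\<^esub> BTev d N n y"
  using ring_hom_mult[OF alg_hom_ring_hom[OF BTev_hom]] .

lemma BTev_one: "BTev d N n \<one>\<^bsub>BTH n\<^esub> = res (tidx d N n) (\<lambda>x. x)"
  using ring_hom_one[OF alg_hom_ring_hom[OF BTev_hom]] by simp

lemma BTev_zero: "BTev d N n \<zero>\<^bsub>BTH n\<^esub> = res (tidx d N n) (\<lambda>x u. 0)"
proof -
  interpret ring_hom_ring "BTH n" "endo (tidx d N n)" "BTev d N n"
    by (rule kalg.alg_hom_ring_hom_ring[OF BTH_kalg endo_kalg BTev_hom])
  show ?thesis using hom_zero by simp
qed

lemma BTev_bgen: "g \<in> btgens n \<Longrightarrow> BTev d N n (bgen n g) = bt_rho d N n g"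
  unfolding BTev_def by (rule kalg.pres_ev_gen[OF endo_kalg bt_rho_closed wf_bth_rels sat_bth_rels])

context
  fixes n :: nat
begin

interpretation B: ties "BTH n" n "bth_s n" "\<lambda>i. bgen n (BS' i)" "bth_E n" "q - inverse q"
  by (rule BTH_ties)

lemma BTev_T:
  "set w \<subseteq> {1..<n} \<Longrightarrow> BTev d N n (B.T w) = res (tidx d N n) (SgW w)"
proof (induction w)
  case Nil
  have "SgW [] = (\<lambda>x. x)" by (simp add: fun_eq_iff)
  then show ?case by (simp only: B.T_simps BTev_one)
next
  case (Cons i w)
  then have i: "i \<in> {1..<n}" and w: "set w \<subseteq> {1..<n}" by auto
  have "BTev d N n (B.T (i # w)) = BTev d N n (bth_s n i) \<otimes>\<^bsub>endo (tidx d N n)\<^esub> BTev d N n (B.T w)"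
    using BTev_mult[OF B.s_closed[OF i] B.T_closed[OF w]] by (simp del: endo_simps)
  also have "\<dots> = res (tidx d N n) (SgW (i # w))"
    unfolding Cons.IH[OF w] BTev_gens(1)[OF i] sigma_op_eq[OF i] res_compose[OF SgW_preserves]
    by (rule restrict_ext) simp
  finally show ?case .
qed

text \<open>Strands are numbered from 1 and positions of a word from 0. The induction mirrors the
  recursion of \<open>B.e\<close>: conjugation by the next generator moves the second position by
  one.\<close>

lemma BTev_e:
  assumes "1 \<le> i" "i < j" "j \<le> n"
  shows "BTev d N n (B.e i j) = res (tidx d N n) (Diag (\<lambda>c. c ! (i - 1) = c ! (j - 1)))"
  using assms(2,3)
proof (induction j)
  case (Suc j)
  let ?I = "tidx d N n"
  show ?case
  proof (cases "j = i")
    case True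
    have i: "i \<in> {1..<n}" using Suc.prems True assms by auto
    have "BTev d N n (B.e i (Suc j)) = res ?I (Ep (i - 1))"
      using BTev_gens(2)[OF i] eps_op_eq[OF i] True by simp
    also have "\<dots> = res ?I (Diag (\<lambda>c. c ! (i - 1) = c ! (Suc j - 1)))"
      using Ep_Diag[of _ d N n "i - 1"] i True by (auto simp: fun_eq_iff)
    finally show ?thesis .
  next
    case False
    define k where "k = j - 1"
    have k: "j = Suc k" "Suc k < n" "i \<le> k" using False Suc.prems assms by (auto simp: k_def)
    have j: "j \<in> {1..<n}" using k by simp
    let ?P = "\<lambda>c. c ! (i - 1) = c ! (j - 1)"
    have IH: "BTev d N n (B.e i j) = res ?I (Diag ?P)" by (rule Suc.IH) (use False Suc.prems in auto)
    have c: "B.e i j \<in> carrier (BTH n)" using B.e_closed[of i j] assms k by simp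
    have s': "bgen n (BS' j) \<in> carrier (BTH n)" by (rule B.s'_closed[OF j])
    have e: "B.e i (Suc j) = bth_s n j \<otimes>\<^bsub>BTH n\<^esub> (B.e i j \<otimes>\<^bsub>BTH n\<^esub> bgen n (BS' j))"
      using B.e_step[of i j] False Suc.prems by (simp add: B.cj_def)
    have b: "BTev d N n (bth_s n j) = res ?I (Sg q k)"
      using BTev_gens(1)[OF j] sigma_op_eq[OF j] k by simp
    have b': "BTev d N n (bgen n (BS' j)) = res ?I (btop (BS' j))"
      using BTev_bgen[of "BS' j" n] j by (simp add: bt_rho_def del: btop.simps)
    have "BTev d N n (B.e i (Suc j)) = res ?I (Sg q k) \<otimes>\<^bsub>endo ?I\<^esub> (res ?I (Diag ?P) \<otimes>\<^bsub>endo ?I\<^esub> res ?I (btop (BS' j)))"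
      unfolding e BTev_mult[OF B.s_closed[OF j] B.m_closed[OF c s']] BTev_mult[OF c s'] IH b b' by (rule refl)
    also have "\<dots> = res ?I (\<lambda>x. Sg q k (Diag ?P (btop (BS' j) x)))"
    proof -
      have "preserves ?I (\<lambda>x. Diag ?P (btop (BS' j) x))"
        using btop_preserves Diag_preserves unfolding preserves_def by blast
      then show ?thesis by (simp only: res_compose[OF btop_preserves] res_compose)
    qed
    also have "\<dots> = res ?I (Diag (\<lambda>c. c ! (i - 1) = c ! (Suc j - 1)))"
    proof (rule restrict_ext)
      fix x :: tens assume x: "x \<in> vec ?I"
      have "Sg q k (Diag ?P (btop (BS' j) x)) = Diag (\<lambda>c. ?P (swp k c)) x"
        unfolding k(1) by (rule Sg_Diag_conj[OF x k(2)])
      also have "\<dots> = Diag (\<lambda>c. c ! (i - 1) = c ! (Suc j - 1)) x"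
        by (rule Diag_cong_vec[OF x]) (use k assms in \<open>auto simp: swp_nth\<close>)
      finally show "Sg q k (Diag ?P (btop (BS' j) x)) = Diag (\<lambda>c. c ! (i - 1) = c ! (Suc j - 1)) x" .
    qed
    finally show ?thesis .
  qed
qed simp

lemma BTev_et:
  assumes "i \<in> {1..n}" "j \<in> {1..n}"
  shows "BTev d N n (B.et i j) = res (tidx d N n) (Diag (\<lambda>c. c ! (i - 1) = c ! (j - 1)))"
proof -
  consider "i < j" | "i = j" | "j < i" by linarith
  then show ?thesis
  proof cases
    case 1
    then show ?thesis using BTev_e[of i j d N] assms by (simp add: B.et_def B.ee_def)
  next
    case 2
    have "Diag (\<lambda>c. True) = (\<lambda>x. x)" by (auto simp: Diag_def fun_eq_iff)
    then show ?thesis using 2 by (simp add: BTev_one)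
  next
    case 3
    have "(\<lambda>c :: nat list. c ! (i - 1) = c ! (j - 1)) = (\<lambda>c. c ! (j - 1) = c ! (i - 1))"
      by (auto simp: fun_eq_iff)
    then show ?thesis using BTev_e[of j i d N] 3 assms by (simp add: B.et_def B.ee_def)
  qed
qed

lemma BTev_EC:
  "BTev d N n (B.EC c) = res (tidx d N n) (Diag (\<lambda>w. \<forall>(i, j)\<in>set (B.EL c). w ! (i - 1) = w ! (j - 1)))"
proof -
  have "BTev d N n (B.TE L) = res (tidx d N n) (Diag (\<lambda>w. \<forall>(i, j)\<in>set L. w ! (i - 1) = w ! (j - 1)))"
    if "set L \<subseteq> {1..n} \<times> {1..n}" for L
    using that
  proof (induction L)
    case Nil
    have "Diag (\<lambda>c. True) = (\<lambda>x. x)" by (auto simp: Diag_def fun_eq_iff)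
    then show ?case by (simp add: BTev_one)
  next
    case (Cons p L)
    have p: "fst p \<in> {1..n}" "snd p \<in> {1..n}" and L: "set L \<subseteq> {1..n} \<times> {1..n}" using Cons.prems by auto
    have "BTev d N n (B.TE (p # L)) = BTev d N n (B.et (fst p) (snd p)) \<otimes>\<^bsub>endo (tidx d N n)\<^esub> BTev d N n (B.TE L)"
      using BTev_mult[OF B.et_closed[OF p] B.TE_closed[OF L]] by (simp del: endo_simps)
    also have "\<dots> = res (tidx d N n) (Diag (\<lambda>w. \<forall>(i, j)\<in>set (p # L). w ! (i - 1) = w ! (j - 1)))"
      unfolding Cons.IH[OF L] BTev_et[OF p] res_compose[OF Diag_preserves]
      by (rule restrict_ext, rule ext) (simp add: Diag_def case_prod_beta)
    finally show ?case .
  qed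
  from this[OF B.EL_range] show ?thesis unfolding B.EC_def .
qed

text \<open>For each partition label \<open>c0\<close> the test word has the colours of
  \<open>c0\<close> and letters 1, ..., n. Normal words send it to distinct words, and
  \<open>EC c\<close> keeps it exactly when \<open>c\<close> refines \<open>c0\<close>, so the
  coefficients satisfy a triangular system.\<close>

theorem BTev_injective:
  assumes nd: "n \<le> d" and nN: "n \<le> N" and X: "X \<in> carrier (BTH n)"
    and 0: "BTev d N n X = res (tidx d N n) (\<lambda>x u. 0)"
  shows "X = \<zero>\<^bsub>BTH n\<^esub>"
proof -
  let ?I = "tidx d N n"
  obtain x where x: "x \<in> carrier (free_alg (btgens n))"
    "X = rel_ideal (btgens n) (bth_rels n) +>\<^bsub>free_alg (btgens n)\<^esub> x"
    by (rule BTH_cases[OF X])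
  have "bgen n = B.gen"
    by (auto simp: fun_eq_iff B.gen_def bth_s_def bth_E_def split: btgen.split)
  then have "X \<in> B.sp n" using B.sp_free_ev[OF x(1)] unfolding x(2) BTH_coset[OF x(1)] by simp
  from B.normal_form[OF this] obtain a where a: "X = (\<Oplus>\<^bsub>BTH n\<^esub>p\<in>NW n \<times> B.CC. a p \<odot>\<^bsub>BTH n\<^esub> (B.T (fst p) \<otimes>\<^bsub>BTH n\<^esub> B.EC (snd p)))"
    by (rule exE)
  \<comment> \<open>The refinement order: strands tied by \<open>c\<close> must have equal colour
    under \<open>c0\<close>.\<close>
  define le where "le c c' \<longleftrightarrow> (\<forall>i\<in>{1..n}. \<forall>j\<in>{1..n}. c i = c j \<longrightarrow> c' i = c' j)" for c c' :: "nat \<Rightarrow> nat"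
  have eq: "(\<Sum>c\<in>B.CC. if le c c0 then a (u0, c) else 0) = 0" if c0: "c0 \<in> B.CC" and u0: "u0 \<in> NW n" for c0 u0
  proof -
    \<comment> \<open>Colours up to \<open>n\<close> require \<open>n \<le> d\<close>, and the
      increasing letters 1, ..., n require \<open>n \<le> N\<close>.\<close>
    define v where "v = map (\<lambda>i. (c0 i, i)) [1..<Suc n]"
    have v: "length v = n" "\<And>k. k < n \<Longrightarrow> v ! k = (c0 (Suc k), Suc k)" by (simp_all add: v_def del: upt_Suc)
    have cr: "c0 i \<in> {1..n}" if "i \<in> {1..n}" for i using c0 that unfolding B.CC_def by blast
    have "set v \<subseteq> vidx d N"
    proof
      fix p assume "p \<in> set v"
      then obtain i where i: "i \<in> {1..n}" "p = (c0 i, i)" by (auto simp: v_def simp del: upt_Suc)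
      then show "p \<in> vidx d N" using cr[OF i(1)] nd nN by (simp add: vidx_def)
    qed
    then have vI: "v \<in> ?I" using v(1) by (simp add: tidx_def)
    have iv: "inc n v" by (simp add: inc_def v)
    have fe: "(\<forall>(i, j)\<in>set (B.EL c). map fst v ! (i - 1) = map fst v ! (j - 1)) \<longleftrightarrow> le c c0" for c
    proof -
      have m: "map fst v ! (i - 1) = c0 i" if i: "i \<in> {1..n}" for i
      proof -
        obtain k where "i = Suc k" "k < n" using i by (cases i) auto
        then show ?thesis using v by simp
      qed
      have "(\<forall>(i, j)\<in>set (B.EL c). map fst v ! (i - 1) = map fst v ! (j - 1)) \<longleftrightarrow>
          (\<forall>i\<in>{1..n}. \<forall>j\<in>{1..n}. c i = c j \<longrightarrow> map fst v ! (i - 1) = map fst v ! (j - 1))"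
        unfolding B.set_EL by blast
      also have "\<dots> \<longleftrightarrow> le c c0"
        unfolding le_def by (intro ball_cong refl) (simp only: m)
      finally show ?thesis .
    qed
    have T: "BTev d N n (B.T u \<otimes>\<^bsub>BTH n\<^esub> B.EC c) (bv v) = (\<lambda>w. if le c c0 then bv (arr u v) w else 0)" if u: "u \<in> NW n" for u c
    proof -
      have us: "set u \<subseteq> {1..<n}" by (rule NW_set[OF u])
      let ?D = "Diag (\<lambda>w. \<forall>(i, j)\<in>set (B.EL c). w ! (i - 1) = w ! (j - 1))"
      have "BTev d N n (B.T u \<otimes>\<^bsub>BTH n\<^esub> B.EC c) = res ?I (\<lambda>x. SgW u (?D x))"
        unfolding BTev_mult[OF B.T_closed[OF us] B.EC_closed] BTev_T[OF us] BTev_EC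
        by (rule res_compose[OF Diag_preserves])
      then have 1: "BTev d N n (B.T u \<otimes>\<^bsub>BTH n\<^esub> B.EC c) (bv v) = SgW u (?D (bv v))" using vI by simp
      have 2: "?D (bv v) = (\<lambda>w. (if le c c0 then 1 else 0) * bv v w)"
      proof
        fix w show "?D (bv v) w = (if le c c0 then 1 else 0) * bv v w"
        proof (cases "w = v")
          case True
          show ?thesis unfolding True Diag_def fe by simp
        qed (simp add: Diag_def bv_def)
      qed
      have 3: "SgW u (\<lambda>w. k * bv v w) = (\<lambda>w. k * SgW u (bv v) w)" for k
        using SgW_linear[of u] unfolding total_linear_def by blast
      show ?thesis unfolding 1 2 3 using SgW_NW[OF u _ iv] v(1) by auto
    qed
    have fin: "finite (NW n \<times> B.CC)" using finite_NW B.finite_CC by simp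
    have bvv: "(bv v :: tens) \<in> vec ?I" using vI by simp
    have "0 = BTev d N n X (bv v) (arr u0 v)" unfolding 0 using bvv by simp
    also have "\<dots> = (\<Sum>p\<in>NW n \<times> B.CC. a p * BTev d N n (B.T (fst p) \<otimes>\<^bsub>BTH n\<^esub> B.EC (snd p)) (bv v) (arr u0 v))"
      unfolding a by (rule alg_hom_comb[OF BTH_kalg BTev_hom fin _ bvv]) (auto simp: B.NW_T)
    also have "\<dots> = (\<Sum>p\<in>NW n \<times> B.CC. if fst p = u0 then if le (snd p) c0 then a (u0, snd p) else 0 else 0)"
    proof (rule sum.cong[OF refl])
      fix p assume p: "p \<in> NW n \<times> B.CC"
      then have pu: "fst p \<in> NW n" by auto
      have "bv (arr (fst p) v) (arr u0 v) = (if fst p = u0 then 1 else 0 :: Cq)"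
        using arr_NW_inj[OF pu u0 _ iv] v(1) by (auto simp: bv_def)
      then show "a p * BTev d N n (B.T (fst p) \<otimes>\<^bsub>BTH n\<^esub> B.EC (snd p)) (bv v) (arr u0 v)
          = (if fst p = u0 then if le (snd p) c0 then a (u0, snd p) else 0 else 0)"
        unfolding T[OF pu] by (cases p) auto
    qed
    also have "\<dots> = (\<Sum>u\<in>NW n. \<Sum>c\<in>B.CC. if u = u0 then if le c c0 then a (u0, c) else 0 else 0)"
      by (subst sum.cartesian_product) (simp add: case_prod_beta)
    also have "\<dots> = (\<Sum>u\<in>NW n. if u = u0 then \<Sum>c\<in>B.CC. if le c c0 then a (u0, c) else 0 else 0)"
      by (rule sum.cong) auto
    also have "\<dots> = (\<Sum>c\<in>B.CC. if le c c0 then a (u0, c) else 0)" using u0 finite_NW by simp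
    finally show ?thesis by simp
  qed
  define kr where "kr c = {(i, j). i \<in> {1..n} \<and> j \<in> {1..n} \<and> c i = c j}" for c :: "nat \<Rightarrow> nat"
  have fk: "finite (kr c)" for c by (rule finite_subset[of _ "{1..n} \<times> {1..n}"]) (auto simp: kr_def)
  have a0: "a (u0, c0) = 0" if "c0 \<in> B.CC" "u0 \<in> NW n" for c0 u0
    using that
  \<comment> \<open>Inverts the sum over refinements: a proper refinement has fewer equal pairs, so
    its coefficient is already known to vanish.\<close>
  proof (induction "card (kr c0)" arbitrary: c0 rule: less_induct)
    case less
    have "(\<Sum>c\<in>B.CC. if le c c0 then a (u0, c) else 0) = (\<Sum>c\<in>B.CC. if c = c0 then a (u0, c0) else 0)"
    proof (rule sum.cong[OF refl])
      fix c assume c: "c \<in> B.CC"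
      show "(if le c c0 then a (u0, c) else 0) = (if c = c0 then a (u0, c0) else 0)"
      proof (cases "c = c0 \<or> \<not> le c c0")
        case True
        then show ?thesis by (auto simp: le_def)
      next
        case False
        have "kr c \<subseteq> kr c0" using False unfolding kr_def le_def by blast
        moreover have "kr c \<noteq> kr c0"
        proof
          assume "kr c = kr c0"
          then have k: "(i, j) \<in> kr c \<longleftrightarrow> (i, j) \<in> kr c0" for i j by simp
          have "c i = c j \<longleftrightarrow> c0 i = c0 j" if "i \<in> {1..n}" "j \<in> {1..n}" for i j
            using k[of i j] that by (simp add: kr_def)
          from B.CC_inj[OF c less.prems(1) this] show False using False by simp
        qed
        ultimately have "card (kr c) < card (kr c0)" using psubset_card_mono[OF fk, of "kr c" c0] by blast
        from less.hyps[OF this c less.prems(2)] show ?thesis using False by simp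
      qed
    qed
    also have "\<dots> = a (u0, c0)" using less.prems(1) B.finite_CC by simp
    finally show ?case using eq[OF less.prems] by simp
  qed
  have "X = (\<Oplus>\<^bsub>BTH n\<^esub>p\<in>NW n \<times> B.CC. \<zero>\<^bsub>BTH n\<^esub>)"
    unfolding a by (rule B.finsum_cong') (auto simp: a0 B.NW_T)
  then show ?thesis by simp
qed

end


section \<open>Elements of the kernel\<close>

text \<open>A coset acts for all \<open>d\<close> and \<open>N\<close> through one element of the
  free algebra, so a nonzero value for some other pair \<open>d'\<close>, \<open>N'\<close> shows
  that the coset is nonzero.\<close>

lemma kernel_element:
  assumes F: "AlgR n F" and zero: "\<And>x. x \<in> vec (tidx d N n) \<Longrightarrow> F x = (\<lambda>u. 0)"
    and nz: "v \<in> tidx d' N' n" "F (bv v) u \<noteq> 0"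
  obtains X where "X \<in> carrier (BTH n)" "X \<noteq> \<zero>\<^bsub>BTH n\<^esub>" "BTev d N n X = BTev d N n \<zero>\<^bsub>BTH n\<^esub>"
proof -
  obtain x where x: "x \<in> carrier (free_alg (btgens n))"
    "\<And>d N. free_ev (endo (tidx d N n)) (bt_rho d N n) x = res (tidx d N n) F"
    using F unfolding AlgR_def by blast
  let ?X = "rel_ideal (btgens n) (bth_rels n) +>\<^bsub>free_alg (btgens n)\<^esub> x"
  have ev: "BTev d N n ?X = res (tidx d N n) F" for d N using BTev_coset[OF x(1)] x(2) by simp
  have "?X \<noteq> \<zero>\<^bsub>BTH n\<^esub>"
  proof
    assume "?X = \<zero>\<^bsub>BTH n\<^esub>"
    then have "res (tidx d' N' n) F = res (tidx d' N' n) (\<lambda>x u. 0)" using ev[of d' N'] BTev_zero[of d' N' n] by simp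
    from fun_cong[OF this, of "bv v"] have "F (bv v) = (\<lambda>u. 0)" using nz(1) by simp
    then show False using nz(2) by simp
  qed
  moreover have "BTev d N n ?X = BTev d N n \<zero>\<^bsub>BTH n\<^esub>"
    unfolding ev BTev_zero by (rule restrict_ext) (rule zero)
  ultimately show thesis using that BTH_coset_closed[OF x(1)] by blast
qed

text \<open>With fewer than \<open>n\<close> colours no word has all colours distinct, so the
  projection onto such words vanishes; with \<open>n\<close> colours and a single letter it fixes a
  basis vector.\<close>

lemma kernel_colours:
  assumes "n > d"
  obtains X where "X \<in> carrier (BTH n)" "X \<noteq> \<zero>\<^bsub>BTH n\<^esub>" "BTev d N n X = BTev d N n \<zero>\<^bsub>BTH n\<^esub>"
proof (rule kernel_element[OF AlgR_Diag_ker[of n "[0..<n]"]])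
  let ?v = "map (\<lambda>i. (i, 1)) [1..<Suc n]"
  show "Diag (same_ker n [0..<n]) x = (\<lambda>u. 0)" if x: "x \<in> vec (tidx d N n)" for x
  proof
    fix u show "Diag (same_ker n [0..<n]) x u = 0"
    proof (cases "u \<in> tidx d N n")
      case True
      then have u: "length (map fst u) = n" "set (map fst u) \<subseteq> {1..d}" by (auto simp: tidx_def vidx_def)
      have "\<not> same_ker n [0..<n] (map fst u)"
      proof
        assume "same_ker n [0..<n] (map fst u)"
        then have "distinct (map fst u)" using u(1) by (auto simp: same_ker_def distinct_conv_nth)
        then have "card (set (map fst u)) = n" using distinct_card u(1) by metis
        then show False using card_mono[OF _ u(2)] assms by simp
      qed
      then show ?thesis by (simp add: Diag_def)
    next
      case False
      then show ?thesis using x by (simp add: vec_def Diag_def)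
    qed
  qed
  show "?v \<in> tidx n 1 n" by (auto simp: tidx_def vidx_def)
  have s: "same_ker n [0..<n] (map fst ?v)" by (simp add: same_ker_def del: upt_Suc)
  show "Diag (same_ker n [0..<n]) (bv ?v) ?v \<noteq> 0" unfolding Diag_def if_P[OF s] by (simp add: bv_def del: upt_Suc)
qed

section \<open>The antisymmetriser on words of one colour\<close>

definition onecol :: "nat \<Rightarrow> (nat \<times> nat) list set" where
  "onecol n = {u. length u = n \<and> (\<forall>p\<in>set u. \<forall>p'\<in>set u. fst p = fst p')}"

lemma mono_swp: "Suc k < length u \<Longrightarrow> swp k u \<in> onecol n \<longleftrightarrow> u \<in> onecol n"
  by (simp add: onecol_def mset_eq_setD[OF mset_swp])

lemma Sg_mono:
  assumes "y \<in> vec (onecol n)" shows "Sg q k y \<in> vec (onecol n)"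
  unfolding vec_def
proof (intro CollectI allI impI)
  fix u assume u: "u \<notin> onecol n"
  show "Sg q k y u = 0"
  proof (cases "Suc k < length u")
    case True
    then have "y (swp k u) = 0" "y u = 0" using assms u mono_swp[OF True, of n] by (simp_all add: vec_def)
    then show ?thesis by (simp add: Sg_nth[OF True])
  next
    case False
    then show ?thesis by (simp add: Sg_short)
  qed
qed

lemma mono_eqI:
  assumes "y \<in> vec (onecol n)" "z \<in> vec (onecol n)" "\<And>u. length u = n \<Longrightarrow> y u = z u"
  shows "y = z"
proof
  fix u show "y u = z u"
  proof (cases "length u = n")
    case False
    then have "u \<notin> onecol n" by (simp add: onecol_def)
    then show ?thesis using assms(1,2) by (simp add: vec_def)
  qed (rule assms(3))
qed

lemma mono_lin:
  "y \<in> vec I \<Longrightarrow> (\<lambda>u. a * y u) \<in> vec I"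
  "y \<in> vec I \<Longrightarrow> z \<in> vec I \<Longrightarrow> (\<lambda>u. y u + z u) \<in> vec I"
  "(\<And>l. l \<in> S \<Longrightarrow> f l \<in> vec I) \<Longrightarrow> (\<lambda>u. \<Sum>l\<in>S. c l * f l u) \<in> vec I"
  by (auto simp: vec_def)

text \<open>On words of one colour \<open>Ep\<close> is the identity, so the quadratic relation
  becomes that of the Hecke algebra; this is why the antisymmetriser starts from the projection onto
  such words.\<close>

lemma Sg_square_mono:
  assumes y: "y \<in> vec (onecol n)" and k: "Suc k < n"
  shows "Sg q k (Sg q k y) = (\<lambda>u. (q - inverse q) * Sg q k y u + y u)"
proof (rule mono_eqI[of _ n])
  have Ep: "Ep k y = y"
  proof
    fix u show "Ep k y u = y u"
    proof (cases "u \<in> onecol n")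
      case True
      then have "Suc k < length u" using k by (simp add: onecol_def)
      moreover from this have "fst (u ! k) = fst (u ! Suc k)"
        using True by (simp add: onecol_def)
      ultimately show ?thesis by (simp add: Ep_nth)
    next
      case False
      then have "y u = 0" using y by (simp add: vec_def)
      then show ?thesis using Ep_nth[of k u y] Ep_short[of u k y] by (cases "Suc k < length u") auto
    qed
  qed
  show "Sg q k (Sg q k y) u = (q - inverse q) * Sg q k y u + y u" if "length u = n" for u
    using Sg_square[of q k u y] k that by (simp add: Ep)
  show "Sg q k (Sg q k y) \<in> vec (onecol n)" by (intro Sg_mono y)
  show "(\<lambda>u. (q - inverse q) * Sg q k y u + y u) \<in> vec (onecol n)" by (intro mono_lin Sg_mono y)
qed

lemma far_mono: "Suc k < l \<Longrightarrow> Sg q k (Sg q l x) = Sg q l (Sg q k x)"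
proof -
  assume "Suc k < l"
  then have "k + 2 \<le> l" by simp
  then obtain i where "l = k + 2 + i" using le_Suc_ex by blast
  then show ?thesis using far_commute(1)[of q k i x] by (simp only: fun_eq_iff) blast
qed

lemma braid_mono:
  assumes y: "y \<in> vec (onecol n)" and k: "Suc (Suc k) < n"
  shows "Sg q (Suc k) (Sg q k (Sg q (Suc k) y)) = Sg q k (Sg q (Suc k) (Sg q k y))"
  by (rule mono_eqI[of _ n]) (use braid[of q k] k in \<open>auto intro!: Sg_mono y\<close>)

lemma Sg_sum: "Sg t k (\<lambda>u. \<Sum>l\<in>S. c l * f l u) = (\<lambda>u. \<Sum>l\<in>S. c l * Sg t k (f l) u)"
proof (induction S rule: infinite_finite_induct)
  case (insert l S)
  then have "Sg t k (\<lambda>u. \<Sum>l\<in>insert l S. c l * f l u) = Sg t k (\<lambda>u. c l * f l u + (\<Sum>l\<in>S. c l * f l u))" by simp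
  also have "\<dots> = (\<lambda>u. c l * Sg t k (f l) u + (\<Sum>l\<in>S. c l * Sg t k (f l) u))"
    by (simp only: Sg_lin insert.IH)
  finally show ?case using insert by simp
qed (simp_all add: Sg_lin)

abbreviation r :: Cq where "r \<equiv> - inverse q"

text \<open>
  The \<open>q\<close>-antisymmetriser on \<open>m + 1\<close> factors is built from the one on \<open>m\<close> factors and the coset
  representatives \<open>s\<^sub>j \<dots> s\<^sub>m\<close>, so that \<open>s\<^sub>i\<close> acts on its image by \<open>- q\<^sup>-\<^sup>1\<close>.
\<close>

primrec bo :: "nat \<Rightarrow> nat \<Rightarrow> tens \<Rightarrow> tens" where
  "bo m 0 x = x"
| "bo m (Suc l) x = Sg q (m - 1 - l) (bo m l x)"

primrec Zo :: "nat \<Rightarrow> nat \<Rightarrow> tens \<Rightarrow> tens" where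
  "Zo n 0 x = Diag (same_ker n (replicate n (0 :: nat))) x"
| "Zo n (Suc m) x = (\<lambda>u. \<Sum>l\<le>m. r ^ l * bo m l (Zo n m x) u)"

lemma AlgR_Zo: "m \<le> n \<Longrightarrow> AlgR n (Zo n m)"
proof (induction m)
  case 0
  have "Zo n 0 = Diag (same_ker n (replicate n (0 :: nat)))" by (simp add: fun_eq_iff)
  then show ?case using AlgR_Diag_ker by metis
next
  case (Suc m)
  have b: "AlgR n (\<lambda>x. bo m l (Zo n m x))" if "l \<le> m" for l
    using that
  proof (induction l)
    case 0
    then show ?case using Suc by simp
  next
    case (Suc l)
    have "AlgR n (Sg q (m - 1 - l))" by (rule AlgR_Sg) (use Suc.prems \<open>Suc m \<le> n\<close> in simp)
    from AlgR_comp[OF this Suc.IH] show ?case using Suc.prems by simp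
  qed
  have "AlgR n (\<lambda>x u. \<Sum>l\<in>{..m}. r ^ l * bo m l (Zo n m x) u)"
    by (intro AlgR_sum AlgR_scale b) simp
  moreover have "Zo n (Suc m) = (\<lambda>x u. \<Sum>l\<in>{..m}. r ^ l * bo m l (Zo n m x) u)" by (simp add: fun_eq_iff)
  ultimately show ?case by simp
qed

definition alt :: "nat \<Rightarrow> tens \<Rightarrow> bool" where
  "alt m y \<longleftrightarrow> (\<forall>k. Suc k < m \<longrightarrow> Sg q k y = (\<lambda>u. r * y u))"

lemma bo_mono: "y \<in> vec (onecol n) \<Longrightarrow> bo m l y \<in> vec (onecol n)"
  by (induction l) (auto intro: Sg_mono)

text \<open>Applied to the sum over coset representatives, a generator passes through most of them
  and reaches \<open>y\<close>, where it acts by \<open>r\<close>. Two consecutive terms are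
  exchanged instead, and their sum has the same eigenvalue because 1 + r q = 0.\<close>

lemma alt_step:
  assumes y: "y \<in> vec (onecol n)" and m: "m < n" and alt: "alt m y"
  shows "alt (Suc m) (\<lambda>u. \<Sum>l\<le>m. r ^ l * bo m l y u)"
  unfolding alt_def
proof (intro allI impI)
  let ?b = "\<lambda>l. bo m l y"
  have low: "Sg q k (?b l) = (\<lambda>u. r * ?b l u)" if "Suc k + l < m" for k l
    using that
  proof (induction l)
    case 0
    then show ?case using alt by (simp add: alt_def)
  next
    case (Suc l)
    then have "Suc k < m - 1 - l" by simp
    then have "Sg q k (?b (Suc l)) = Sg q (m - 1 - l) (Sg q k (?b l))" unfolding bo.simps by (rule far_mono)
    also have "Sg q k (?b l) = (\<lambda>u. r * ?b l u)" by (rule Suc.IH) (use Suc.prems in simp)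
    also have "Sg q (m - 1 - l) (\<lambda>u. r * ?b l u) = (\<lambda>u. r * ?b (Suc l) u)" by (simp only: bo.simps Sg_lin)
    finally show ?case .
  qed
  fix k assume k: "Suc k < Suc m"
  \<comment> \<open>The index at which the generator at position \<open>k\<close> extends one
    representative to the next.\<close>
  define l0 where "l0 = m - 1 - k"
  have l0: "m - 1 - l0 = k" "Suc l0 \<le> m" "k + l0 = m - 1" using k by (auto simp: l0_def)
  have e1: "Sg q k (?b l0) = ?b (Suc l0)" by (simp only: bo.simps l0(1))
  have e2: "Sg q k (?b (Suc l0)) = (\<lambda>u. (q - inverse q) * ?b (Suc l0) u + ?b l0 u)"
    using Sg_square_mono[OF bo_mono[OF y], of k m l0] k m by (simp only: bo.simps l0(1))
  \<comment> \<open>For longer representatives one braid relation turns the generator into the one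
    just below, for which \<open>low\<close> applies; further factors are far away and
    commute.\<close>
  have high: "Sg q k (?b (l0 + 2 + l)) = (\<lambda>u. r * ?b (l0 + 2 + l) u)" if "l0 + 2 + l \<le> m" for l
    using that
  proof (induction l)
    case 0
    define j where "j = k - 1"
    have j: "k = Suc j" "m - 1 - Suc l0 = j" using 0 l0 by (auto simp: j_def)
    have two: "l0 + 2 = Suc (Suc l0)" by simp
    have b: "?b (l0 + 2) = Sg q j (Sg q k (?b l0))" by (simp only: two bo.simps j(2) l0(1))
    have "Sg q k (Sg q j (Sg q k (?b l0))) = Sg q j (Sg q k (Sg q j (?b l0)))"
      unfolding j(1) by (rule braid_mono[OF bo_mono[OF y]]) (use j k m in simp)
    also have "Sg q j (?b l0) = (\<lambda>u. r * ?b l0 u)" by (rule low) (use j l0 k in linarith)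
    finally show ?case by (simp only: b add_0_right Sg_lin)
  next
    case (Suc l)
    let ?i = "m - 1 - (l0 + 2 + l)"
    have i: "Suc ?i < k" using Suc.prems l0 by linarith
    have "?b (l0 + 2 + Suc l) = Sg q ?i (?b (l0 + 2 + l))" by (simp only: add_Suc_right bo.simps)
    moreover have "Sg q k (Sg q ?i (?b (l0 + 2 + l))) = Sg q ?i (Sg q k (?b (l0 + 2 + l)))"
      using far_mono[OF i] by simp
    moreover have "Sg q k (?b (l0 + 2 + l)) = (\<lambda>u. r * ?b (l0 + 2 + l) u)" by (rule Suc.IH) (use Suc.prems in simp)
    ultimately show ?case by (simp only: Sg_lin)
  qed
  show "Sg q k (\<lambda>u. \<Sum>l\<le>m. r ^ l * ?b l u) = (\<lambda>u. r * (\<Sum>l\<le>m. r ^ l * ?b l u))"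
  proof
    fix u
    \<comment> \<open>The contribution of each term to the failure of the eigenvalue equation; only
      the exchanged pair needs computation.\<close>
    define D where "D l = r ^ l * (Sg q k (?b l) u - r * ?b l u)" for l
    have "D l = 0" if l: "l \<le> m" "l \<notin> {l0, Suc l0}" for l
    proof -
      have "l < l0 \<or> l0 + 2 \<le> l" using l(2) by auto
      then have "Sg q k (?b l) = (\<lambda>u. r * ?b l u)"
      proof
        assume "l < l0"
        then show ?thesis using l0 k by (intro low) linarith
      next
        assume "l0 + 2 \<le> l"
        then have "l0 + 2 + (l - (l0 + 2)) = l" by simp
        then show ?thesis using high[of "l - (l0 + 2)"] l(1) by (simp only:)
      qed
      then show ?thesis by (simp add: D_def)
    qed
    then have "(\<Sum>l\<le>m. D l) = (\<Sum>l\<in>{l0, Suc l0}. D l)"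
      using l0(2) by (intro sum.mono_neutral_right) auto
    also have "\<dots> = r ^ l0 * ((1 + r * q) * ?b (Suc l0) u)"
      by (simp add: D_def e1 e2 del: bo.simps) (simp add: algebra_simps del: bo.simps)
    also have "\<dots> = 0" by simp
    finally have 0: "(\<Sum>l\<le>m. D l) = 0" .
    have "(\<Sum>l\<le>m. r ^ l * Sg q k (?b l) u) - (\<Sum>l\<le>m. r ^ l * (r * ?b l u)) = (\<Sum>l\<le>m. D l)"
      by (simp only: D_def right_diff_distrib sum_subtractf)
    then have e: "(\<Sum>l\<le>m. r ^ l * Sg q k (?b l) u) = (\<Sum>l\<le>m. r ^ l * (r * ?b l u))"
      unfolding 0 by (rule eq_iff_diff_eq_0[THEN iffD2])
    show "Sg q k (\<lambda>u. \<Sum>l\<le>m. r ^ l * ?b l u) u = r * (\<Sum>l\<le>m. r ^ l * ?b l u)"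
      unfolding Sg_sum e sum_distrib_left by (rule sum.cong[OF refl]) (rule mult.left_commute)
  qed
qed

lemma Zo_mono:
  assumes "\<And>u. length u \<noteq> n \<Longrightarrow> x u = 0" shows "Zo n m x \<in> vec (onecol n)"
proof (induction m)
  case 0
  show ?case unfolding vec_def
  proof (intro CollectI allI impI)
    fix u assume u: "u \<notin> onecol n"
    show "Zo n 0 x u = 0"
    proof (cases "length u = n")
      case True
      then have "\<not> same_ker n (replicate n (0 :: nat)) (map fst u)"
      proof -
        have "u \<in> onecol n" if s: "same_ker n (replicate n (0 :: nat)) (map fst u)"
          unfolding onecol_def
        proof (rule CollectI, rule conjI[OF True], rule ballI, rule ballI)
          have e: "fst (u ! i) = fst (u ! j)" if ij: "i < n" "j < n" for i j
            using s[unfolded same_ker_def, rule_format, OF ij] ij True by simp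
          fix p p' assume p: "p \<in> set u" "p' \<in> set u"
          obtain i where i: "i < n" "u ! i = p" using p(1) True unfolding in_set_conv_nth by blast
          obtain j where j: "j < n" "u ! j = p'" using p(2) True unfolding in_set_conv_nth by blast
          show "fst p = fst p'" using e[OF i(1) j(1)] unfolding i(2) j(2) .
        qed
        then show ?thesis using u by blast
      qed
      then show ?thesis by (simp add: Diag_def)
    next
      case False
      then show ?thesis using assms by (simp add: Diag_def)
    qed
  qed
next
  case (Suc m)
  show ?case using mono_lin(3)[of "{..m}" "\<lambda>l. bo m l (Zo n m x)" "onecol n" "\<lambda>l. r ^ l"] bo_mono[OF Suc] by simp
qed

lemma Zo_alt:
  assumes "\<And>u. length u \<noteq> n \<Longrightarrow> x u = 0" "m \<le> n" shows "alt m (Zo n m x)"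
  using assms(2)
proof (induction m)
  case (Suc m)
  have "alt m (Zo n m x)" using Suc by simp
  from alt_step[OF Zo_mono[OF assms(1)] _ this] Suc.prems show ?case by simp
qed (simp add: alt_def)

text \<open>At equal neighbouring letters a generator has eigenvalue q, which differs from - q^-1. A
  swap preserves nonvanishing of the coefficient, so two equal letters could be brought next to each
  other.\<close>

lemma alt_distinct:
  assumes y: "alt n y" and u: "length u = n" "y u \<noteq> 0" and ij: "i < j" "j < n"
  shows "u ! i \<noteq> u ! j"
proof -
  \<comment> \<open>From q^4 \<noteq> 1 one gets q^2 \<noteq> - 1, that is, q + q^-1 \<noteq>
    0.\<close>
  have "q ^ 4 \<noteq> 1" using q_power_eq_1[of 4] by auto
  then have q2: "q * q \<noteq> - 1" by (auto simp: power4_eq_xxxx)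
  have qq: "q + inverse q \<noteq> 0"
  proof
    assume "q + inverse q = 0"
    then have "q * (q + inverse q) = 0" by simp
    then show False using q2 by (simp add: algebra_simps add_eq_0_iff)
  qed
  have step: "u ! k \<noteq> u ! Suc k \<and> y (swp k u) \<noteq> 0" if "length u = n" "y u \<noteq> 0" "Suc k < n" for u k
  proof -
    have e: "Sg q k y u = r * y u" using y that(3) by (simp add: alt_def)
    have l: "Suc k < length u" using that by simp
    have ne: "u ! k \<noteq> u ! Suc k"
    proof
      assume "u ! k = u ! Suc k"
      then have "q * y u = r * y u" using e by (simp add: Sg_nth[OF l])
      then have "(q + inverse q) * y u = 0" by (simp add: algebra_simps)
      then show False using qq that(2) by simp
    qed
    moreover have "y (swp k u) \<noteq> 0"
    proof
      assume "y (swp k u) = 0"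
      then have "(if fst (u ! k) = fst (u ! Suc k) \<and> snd (u ! Suc k) < snd (u ! k) then (q - inverse q) * y u else 0) = r * y u"
        using e ne by (simp add: Sg_nth[OF l])
      then have "q * y u = 0 \<or> inverse q * y u = 0" by (auto simp: algebra_simps split: if_splits)
      then show False using that(2) by simp
    qed
    ultimately show ?thesis by simp
  qed
  show ?thesis using ij u
  proof (induction j arbitrary: u)
    case (Suc j)
    show ?case
    proof (cases "i = j")
      case True
      then show ?thesis using step Suc.prems by blast
    next
      case False
      have "swp j u ! i \<noteq> swp j u ! j"
        by (rule Suc.IH) (use False Suc.prems step[of u j] in auto)
      then show ?thesis using False Suc.prems by (simp add: swp_nth)
    qed
  qed simp
qed

text \<open>Nonempty coset representatives move the letter m + 1 away from its place, so they cannot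
  contribute to the coefficient of the increasing word, which stays 1.\<close>

lemma Zo_unit:
  defines "v \<equiv> \<lambda>n. map (\<lambda>i. (1 :: nat, i)) [1..<Suc n]"
  assumes "m \<le> n" shows "Zo n m (bv (v n)) (v n) = 1"
proof -
  \<comment> \<open>At stage \<open>m\<close> the places from \<open>m\<close> on are untouched and
    the earlier letters are at most \<open>m\<close>; this contains every word reached so
    far.\<close>
  define W where "W m = {u :: (nat \<times> nat) list. length u = n \<and> (\<forall>k<n. m \<le> k \<longrightarrow> u ! k = (1, Suc k)) \<and> (\<forall>k<m. snd (u ! k) \<le> m)}" for m
  have v: "length (v n) = n" "\<And>k. k < n \<Longrightarrow> v n ! k = (1, Suc k)" by (simp_all add: v_def del: upt_Suc)
  have "Zo n m (bv (v n)) \<in> vec (W m) \<and> Zo n m (bv (v n)) (v n) = 1"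
    using assms(2)
  proof (induction m)
    case 0
    have "same_ker n (replicate n (0 :: nat)) (map fst (v n))" by (simp add: same_ker_def v)
    then have "Zo n 0 (bv (v n)) = bv (v n)" by (auto simp: Diag_def bv_def fun_eq_iff)
    then show ?case using v by (auto simp: vec_def bv_def W_def)
  next
    case (Suc m)
    define y where "y = Zo n m (bv (v n))"
    have y: "y \<in> vec (W m)" "y (v n) = 1" using Suc by (simp_all add: y_def)
    have yW: "u \<in> W m" if "y u \<noteq> 0" for u using y(1) that by (auto simp: vec_def)
    \<comment> \<open>Words in which the largest letter has left position \<open>m\<close>, which
      excludes the increasing word.\<close>
    define Y where "Y = {u \<in> W (Suc m). snd (u ! m) \<le> m}"
    have b: "u \<in> Y" if "bo m (Suc l) y u \<noteq> 0" "Suc l \<le> m" for l u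
      using that
    proof (induction l arbitrary: u)
      case 0
      define k where "k = m - 1"
      have k: "m = Suc k" "Suc k < n" using 0 Suc.prems by (auto simp: k_def)
      have nz: "Sg q k y u \<noteq> 0" using 0 by (simp add: k_def)
      have l: "Suc k < length u" using nz Sg_short[of u k q y] by (cases "Suc k < length u") auto
      \<comment> \<open>In \<open>W m\<close> the letter at position m exceeds all earlier ones, so
        neither equal letters nor a descent occur and \<open>Sg\<close> can only swap.\<close>
      have no: "\<not> (u \<in> W m \<and> snd (u ! Suc k) \<le> snd (u ! k))"
      proof
        assume a: "u \<in> W m \<and> snd (u ! Suc k) \<le> snd (u ! k)"
        then have "u ! Suc k = (1, Suc (Suc k))" "snd (u ! k) \<le> Suc k" using k by (auto simp: W_def)
        then show False using a by simp
      qed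
      have "y (swp k u) \<noteq> 0"
      proof
        assume "y (swp k u) = 0"
        then have "y u \<noteq> 0 \<and> snd (u ! Suc k) \<le> snd (u ! k)" using nz by (auto simp: Sg_nth[OF l] split: if_splits)
        then show False using no yW by blast
      qed
      then have w: "swp k u \<in> W m" by (rule yW)
      then have lu: "length u = n" by (simp add: W_def)
      have "u ! k' = (1, Suc k')" if "k' < n" "Suc m \<le> k'" for k'
        using w that k swp_nth[OF l, of k'] lu by (auto simp: W_def)
      moreover have "snd (u ! k') \<le> Suc m" if "k' < Suc m" for k'
      proof -
        consider "k' < k" | "k' = k" | "k' = Suc k" using \<open>k' < Suc m\<close> k by linarith
        then show ?thesis
        proof cases
          case 1
          have "snd (swp k u ! k') \<le> m" using w 1 k by (simp add: W_def)
          then show ?thesis using swp_nth[OF l, of k'] 1 l by simp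
        next
          case 2
          have "swp k u ! Suc k = (1, Suc (Suc k))" using w k by (simp add: W_def)
          then show ?thesis using swp_nth[OF l, of "Suc k"] 2 l k by simp
        next
          case 3
          have "snd (swp k u ! k) \<le> m" using w k by (simp add: W_def)
          then show ?thesis using swp_nth[OF l, of k] 3 l by simp
        qed
      qed
      moreover have "snd (u ! m) \<le> m"
      proof -
        have "snd (swp k u ! k) \<le> m" using w k by (simp add: W_def)
        then show ?thesis using swp_nth[OF l, of k] l k by simp
      qed
      ultimately show ?case using lu by (simp add: Y_def W_def)
    next
      case (Suc l)
      define k where "k = m - 1 - Suc l"
      have k: "Suc k < m" "m < n" using Suc.prems \<open>Suc m \<le> n\<close> by (auto simp: k_def)
      have nz: "Sg q k (bo m (Suc l) y) u \<noteq> 0" using Suc.prems by (simp add: k_def)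
      have ls: "Suc k < length u" using nz Sg_short[of u k q] by (cases "Suc k < length u") auto
      have "bo m (Suc l) y u \<noteq> 0 \<or> bo m (Suc l) y (swp k u) \<noteq> 0"
        using nz by (auto simp: Sg_nth[OF ls] split: if_splits)
      then show ?case
      proof
        assume "bo m (Suc l) y u \<noteq> 0"
        then show ?thesis using Suc by simp
      next
        assume "bo m (Suc l) y (swp k u) \<noteq> 0"
        then have w: "swp k u \<in> Y" using Suc by simp
        then have lu: "length u = n" by (simp add: Y_def W_def)
        have s: "swp k u ! k' = u ! k'" if "k' < n" "k' \<noteq> k" "k' \<noteq> Suc k" for k'
          using swp_nth[OF ls, of k'] that lu by simp
        have "u ! k' = (1, Suc k')" if "k' < n" "Suc m \<le> k'" for k'
          using w that k s[of k'] by (simp add: Y_def W_def)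
        moreover have "snd (u ! k') \<le> Suc m" if "k' < Suc m" for k'
        proof -
          have a: "snd (swp k u ! i) \<le> Suc m" if "i < Suc m" for i using w that by (simp add: Y_def W_def)
          have "swp k u ! (if k' = k then Suc k else if k' = Suc k then k else k') = u ! k'"
            using swp_nth[OF ls] lu k that s by auto
          then show ?thesis using a[of "if k' = k then Suc k else if k' = Suc k then k else k'"] that k by (auto split: if_splits)
        qed
        moreover have "snd (u ! m) \<le> m" using w s[of m] k by (simp add: Y_def)
        ultimately show ?thesis using lu by (simp add: Y_def W_def)
      qed
    qed
    have vY: "v n \<notin> Y" using v(2)[of m] Suc.prems by (simp add: Y_def)
    have b': "bo m l y u = 0" if "l \<noteq> 0" "l \<le> m" "u \<notin> Y" for l u
      using b[of "l - 1" u] that by (cases l) (auto simp del: bo.simps)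
    have Wm: "u \<in> W (Suc m)" if "u \<in> W m" for u
      using that Suc.prems by (auto simp: W_def less_Suc_eq le_Suc_eq)
    have S: "Zo n (Suc m) (bv (v n)) u = y u" if "u \<notin> Y" for u
    proof -
      have "Zo n (Suc m) (bv (v n)) u = (\<Sum>l\<le>m. r ^ l * bo m l y u)" by (simp add: y_def)
      also have "\<dots> = (\<Sum>l\<in>{0}. r ^ l * bo m l y u)"
        by (rule sum.mono_neutral_right) (use b' that in auto)
      finally show ?thesis by simp
    qed
    have "Zo n (Suc m) (bv (v n)) \<in> vec (W (Suc m))"
      unfolding vec_def
    proof (intro CollectI allI impI)
      fix u assume u: "u \<notin> W (Suc m)"
      then have "u \<notin> Y" "y u = 0" using Wm yW by (auto simp: Y_def)
      then show "Zo n (Suc m) (bv (v n)) u = 0" using S by simp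
    qed
    then show ?case using S[OF vY] y(2) by simp
  qed
  then show ?thesis by simp
qed

text \<open>Values of the antisymmetriser are supported on words of one colour with distinct
  letters, of which there are none for \<open>n > N\<close>. With one colour and \<open>n\<close>
  letters its coefficient at the increasing word is 1.\<close>

lemma kernel_letters:
  assumes "n > N"
  obtains X where "X \<in> carrier (BTH n)" "X \<noteq> \<zero>\<^bsub>BTH n\<^esub>" "BTev d N n X = BTev d N n \<zero>\<^bsub>BTH n\<^esub>"
proof (rule kernel_element[OF AlgR_Zo[OF order_refl]])
  let ?v = "map (\<lambda>i. (1 :: nat, i)) [1..<Suc n]"
  show "Zo n n x = (\<lambda>u. 0)" if x: "x \<in> vec (tidx d N n)" for x
  proof (rule ext, rule ccontr)
    fix u assume nz: "Zo n n x u \<noteq> 0"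
    have l: "x u = 0" if "length u \<noteq> n" for u using vec_length[OF x that] .
    have y: "Zo n n x \<in> vec (tidx d N n)" by (rule AlgR_vec[OF AlgR_Zo[OF order_refl] x])
    have u: "u \<in> tidx d N n" "u \<in> onecol n"
      using nz y Zo_mono[of n x n] l by (auto simp: vec_def)
    then have len: "length u = n" by (simp add: tidx_def)
    have "distinct u"
      unfolding distinct_conv_nth
    proof (intro allI impI)
      fix i j assume ij: "i < length u" "j < length u" "i \<noteq> j"
      then show "u ! i \<noteq> u ! j"
        using alt_distinct[OF Zo_alt[of n x n] len nz, of i j] alt_distinct[OF Zo_alt[of n x n] len nz, of j i] l len
        by (cases "i < j") auto
    qed
    then have "card (set u) = n" using distinct_card len by metis
    moreover have "inj_on snd (set u)"
    proof (rule inj_onI)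
      fix p p' assume p: "p \<in> set u" "p' \<in> set u" "snd p = snd p'"
      have "fst p = fst p'" using u(2) p(1,2) unfolding onecol_def by blast
      then show "p = p'" using p(3) by (simp add: prod_eq_iff)
    qed
    moreover have "snd ` set u \<subseteq> {1..N}" using u(1) by (auto simp: tidx_def vidx_def)
    ultimately have "n \<le> card {1..N}" using card_image[of snd "set u"] card_mono[of "{1..N}" "snd ` set u"] by simp
    then show False using assms by simp
  qed
  show "?v \<in> tidx 1 n n" by (auto simp: tidx_def vidx_def)
  show "Zo n n (bv ?v) ?v \<noteq> 0" using Zo_unit[of n n] by (simp del: upt_Suc)
qed


section \<open>The isomorphism theorem\<close>

theorem theorem7p2:
  fixes d n N :: nat
  assumes "d \<ge> 1" and "n \<ge> 1" and "N > 1"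
  shows "\<exists>\<Psi> \<in> alg_hom (BTH n) (EndUqS d N n).
    (\<forall>i\<in>{1..<n}. \<Psi> (bth_s n i) = sigma_op d N n i \<and> \<Psi> (bth_E n i) = eps_op d N n i) \<and>
    \<Psi> ` carrier (BTH n) = carrier (EndUqS d N n) \<and>
    (\<Psi> \<in> alg_iso (BTH n) (EndUqS d N n) \<longleftrightarrow> n \<le> d \<and> n \<le> N)"
proof (intro bexI conjI ballI)
  let ?\<Psi> = "BTev d N n"
  interpret B: kalg "BTH n" by (rule BTH_kalg)
  interpret h: ring_hom_ring "BTH n" "endo (tidx d N n)" ?\<Psi>
    by (rule B.alg_hom_ring_hom_ring[OF endo_kalg BTev_hom])
  have im: "?\<Psi> X \<in> carrier (EndUqS d N n)" if X: "X \<in> carrier (BTH n)" for X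
  proof -
    obtain x where x: "x \<in> carrier (free_alg (btgens n))"
      "X = rel_ideal (btgens n) (bth_rels n) +>\<^bsub>free_alg (btgens n)\<^esub> x"
      by (rule BTH_cases[OF X])
    \<comment> \<open>Writing the image as a combination of total operators makes the closure
      properties of \<open>AlgR\<close>, and hence \<open>AlgR_EndUqS\<close>, applicable.\<close>
    define F where "F y u = (\<Sum>w | x w \<noteq> 0. x w * wop btop w y u)" for y u
    have W: "AlgR n (wop btop w)" if "set w \<subseteq> btgens n" for w
      using that
    proof (induction w)
      case Nil
      have "wop btop [] = (\<lambda>x. x)" by (simp add: fun_eq_iff)
      then show ?case using AlgR_id by simp
    next
      case (Cons g w)
      have "wop btop (g # w) = (\<lambda>x. btop g (wop btop w x))" by (simp add: fun_eq_iff)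
      then show ?case using Cons AlgR_comp[OF AlgR_gen[of g n]] by simp
    qed
    have Fe: "F = (\<lambda>y u. \<Sum>w\<in>{w. x w \<noteq> 0}. x w * wop btop w y u)" by (simp add: F_def fun_eq_iff)
    have F: "AlgR n F" unfolding Fe
    proof (rule AlgR_sum)
      fix w assume "w \<in> {w. x w \<noteq> 0}"
      then have "set w \<subseteq> btgens n" using x(1) by (simp add: free_alg_carrier)
      then show "AlgR n (\<lambda>y u. x w * wop btop w y u)" by (intro AlgR_scale W)
    qed
    have "?\<Psi> X = res (tidx d N n) F"
    proof -
      let ?I = "tidx d N n"
      interpret K: kalg "endo ?I :: (Cq, tens \<Rightarrow> tens) module" by (rule endo_kalg)
      have fin: "finite {w. x w \<noteq> 0}" and sub: "\<And>w. x w \<noteq> 0 \<Longrightarrow> set w \<subseteq> btgens n" using x(1) by (auto simp: free_alg_carrier)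
      have w: "word_ev (endo ?I) (bt_rho d N n) w = res ?I (wop btop w)" for w
        by (rule word_ev_res) (auto simp: btop_preserves bt_rho_def)
      \<comment> \<open>The identity homomorphism allows \<open>alg_hom_comb\<close> to evaluate the
        sum taken in \<open>endo\<close> coordinate by coordinate.\<close>
      have id: "id \<in> alg_hom (endo ?I) (endo ?I :: (Cq, tens \<Rightarrow> tens) module)"
        by (auto simp: alg_hom_def ring_hom_def)
      have c: "word_ev (endo ?I) (bt_rho d N n) w \<in> carrier (endo ?I)" if "w \<in> {w. x w \<noteq> 0}" for w
        using K.word_ev_closed[of "btgens n" "bt_rho d N n" w] bt_rho_closed sub that by auto
      have fe: "free_ev (endo ?I) (bt_rho d N n) x \<in> carrier (endo ?I)"
        using K.free_ev_closed[of "btgens n" "bt_rho d N n" x] bt_rho_closed x(1) by blast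
      show ?thesis unfolding x(2) BTev_coset[OF x(1)]
      proof (rule endo_eqI[OF fe AlgR_closed[OF F]])
        fix y :: tens assume y: "y \<in> vec ?I"
        show "free_ev (endo ?I) (bt_rho d N n) x y = res ?I F y"
        proof
          fix u
          show "free_ev (endo ?I) (bt_rho d N n) x y u = res ?I F y u"
            using alg_hom_comb[OF endo_kalg id fin c y, where a = x and u = u] y
            by (simp add: free_ev_def w F_def)
        qed
      qed
    qed
    then show ?thesis using AlgR_EndUqS[OF F] by simp
  qed
  show hom: "?\<Psi> \<in> alg_hom (BTH n) (EndUqS d N n)"
  proof -
    have "?\<Psi> \<in> ring_hom (BTH n) (EndUqS d N n)"
      by (rule ring_hom_memI) (simp_all add: im h.hom_mult h.hom_add h.hom_one del: endo_simps)
    then show ?thesis using alg_hom_smult[OF BTev_hom[of d N n]] by (simp add: alg_hom_def del: endo_simps)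
  qed
  show "?\<Psi> (bth_s n i) = sigma_op d N n i" "?\<Psi> (bth_E n i) = eps_op d N n i" if "i \<in> {1..<n}" for i
    using BTev_gens[OF that] .
  show sur: "?\<Psi> ` carrier (BTH n) = carrier (EndUqS d N n)"
  proof (intro subset_antisym subsetI)
    fix f assume "f \<in> carrier (EndUqS d N n)"
    then obtain F where F: "AlgR n F" "f = res (tidx d N n) F" by (rule EndUqS_AlgR)
    obtain x where x: "x \<in> carrier (free_alg (btgens n))"
      "\<And>d N. free_ev (endo (tidx d N n)) (bt_rho d N n) x = res (tidx d N n) F"
      using F(1) unfolding AlgR_def by blast
    show "f \<in> ?\<Psi> ` carrier (BTH n)"
      by (rule image_eqI[OF _ BTH_coset_closed[OF x(1)]]) (simp only: BTev_coset[OF x(1)] x(2) F(2))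
  qed (use im in auto)
  show "?\<Psi> \<in> alg_iso (BTH n) (EndUqS d N n) \<longleftrightarrow> n \<le> d \<and> n \<le> N"
  proof
    assume "?\<Psi> \<in> alg_iso (BTH n) (EndUqS d N n)"
    then have inj: "inj_on ?\<Psi> (carrier (BTH n))" by (simp add: alg_iso_def bij_betw_def)
    have no: "\<not> (X \<in> carrier (BTH n) \<and> X \<noteq> \<zero>\<^bsub>BTH n\<^esub> \<and> ?\<Psi> X = ?\<Psi> \<zero>\<^bsub>BTH n\<^esub>)" for X
      using inj_onD[OF inj, of X "\<zero>\<^bsub>BTH n\<^esub>"] by auto
    show "n \<le> d \<and> n \<le> N"
    proof (rule ccontr)
      assume "\<not> (n \<le> d \<and> n \<le> N)"
      then have "d < n \<or> N < n" by auto
      then show False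
      proof
        assume "d < n"
        show False by (rule kernel_colours[OF \<open>d < n\<close>, of N]) (use no in blast)
      next
        assume "N < n"
        show False by (rule kernel_letters[OF \<open>N < n\<close>, of d]) (use no in blast)
      qed
    qed
  next
    assume nd: "n \<le> d \<and> n \<le> N"
    have "inj_on ?\<Psi> (carrier (BTH n))"
    proof (rule inj_onI)
      fix X Y assume XY: "X \<in> carrier (BTH n)" "Y \<in> carrier (BTH n)" "?\<Psi> X = ?\<Psi> Y"
      have e: "X \<ominus>\<^bsub>BTH n\<^esub> Y = X \<oplus>\<^bsub>BTH n\<^esub> (- 1) \<odot>\<^bsub>BTH n\<^esub> Y"
        by (simp add: a_minus_def B.smult_minus_one XY(2))
      have "?\<Psi> (X \<ominus>\<^bsub>BTH n\<^esub> Y) = ?\<Psi> X \<oplus>\<^bsub>endo (tidx d N n)\<^esub> (- 1) \<odot>\<^bsub>endo (tidx d N n)\<^esub> ?\<Psi> Y"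
        unfolding e by (simp only: h.hom_add[OF XY(1) B.smult_closed[OF XY(2)]] alg_hom_smult[OF BTev_hom XY(2)])
      also have "\<dots> = res (tidx d N n) (\<lambda>x u. 0)"
        unfolding XY(3) by (auto simp: fun_eq_iff)
      finally have "?\<Psi> (X \<ominus>\<^bsub>BTH n\<^esub> Y) = res (tidx d N n) (\<lambda>x u. 0)" .
      then have "X \<ominus>\<^bsub>BTH n\<^esub> Y = \<zero>\<^bsub>BTH n\<^esub>"
        using nd by (intro BTev_injective[OF _ _ B.minus_closed[OF XY(1,2)]]) auto
      then have z: "X \<ominus>\<^bsub>BTH n\<^esub> Y = \<zero>\<^bsub>BTH n\<^esub>" .
      have "X = (X \<ominus>\<^bsub>BTH n\<^esub> Y) \<oplus>\<^bsub>BTH n\<^esub> Y"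
        using XY(1,2) by (simp add: a_minus_def B.a_assoc B.l_neg)
      also have "\<dots> = Y" unfolding z by (rule B.l_zero[OF XY(2)])
      finally show "X = Y" .
    qed
    then show "?\<Psi> \<in> alg_iso (BTH n) (EndUqS d N n)"
      using hom sur by (simp add: alg_iso_def bij_betw_def)
  qed
qed

end
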